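(* Let $f(y_1,y_2,y_3)\in\mathbf{Z}[y_1,y_2,y_3]$ be a polynomial of degree $d\ge 4$ which is absolutely irreducible over $\mathbf{Q}$. Suppose that there are only finitely many lines over $\overline{\mathbf{Q}}$ contained in the surface $Y_{\mathbf{Q}}\subset\mathbf{A}^3_{\mathbf{Q}}$ defined by $f(\mathbf{y})=0$. Let $n(Y;B)$ be the number of triples $\mathbf{y}=(y_1,y_2,y_3)$ of integers with $y_1,y_2,y_3\in[-B,B]$ and $f(\mathbf{y})=0$. Then for every $\varepsilon>0$ there is a constant $C=C(d,\varepsilon)$, depending only on $d$ and $\varepsilon$, such that $n(Y;B)\le C\,B^{1+\varepsilon}$ for all $B\ge1$. *)

theory Defs
  imports Complex_Main "HOL-Computational_Algebra.Polynomial" "HOL-Computational_Algebra.Polynomial_Factorial"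
begin

text \<open>Trivariate polynomials are represented as nested univariate polynomials
  p :: 'a poly poly poly; the outermost variable is y1, the middle one y2, the
  innermost one y3.\<close>

definition coeff3 :: "'a::zero poly poly poly \<Rightarrow> nat \<Rightarrow> nat \<Rightarrow> nat \<Rightarrow> 'a" where
  "coeff3 p i j k = coeff (coeff (coeff p i) j) k"

definition eval3 :: "'a::comm_semiring_0 poly poly poly \<Rightarrow> 'a \<Rightarrow> 'a \<Rightarrow> 'a \<Rightarrow> 'a" where
  "eval3 p y1 y2 y3 = poly (poly (poly p [:[:y1:]:]) [:y2:]) y3"

definition total_degree3 :: "'a::zero poly poly poly \<Rightarrow> nat" where
  "total_degree3 p = Max (insert 0 {i + j + k | i j k. coeff3 p i j k \<noteq> 0})"

definition map_poly3 :: "('a::zero \<Rightarrow> 'b::zero) \<Rightarrow> 'a poly poly poly \<Rightarrow> 'b poly poly poly" where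
  "map_poly3 g p = map_poly (map_poly (map_poly g)) p"

text \<open>Lines over the algebraic closure of Q (algebraic numbers inside C) contained in
  the complex zero set of f; a line is recorded as its set of complex points.\<close>
definition lines_on_surface :: "int poly poly poly \<Rightarrow> (complex \<times> complex \<times> complex) set set" where
  "lines_on_surface f =
     {L. \<exists>a1 a2 a3 b1 b2 b3.
           algebraic a1 \<and> algebraic a2 \<and> algebraic a3 \<and>
           algebraic b1 \<and> algebraic b2 \<and> algebraic b3 \<and>
           (b1, b2, b3) \<noteq> (0, 0, 0) \<and>
           L = {(a1 + t * b1, a2 + t * b2, a3 + t * b3) | t. True} \<and>
           (\<forall>t. algebraic t \<longrightarrow>
              eval3 (map_poly3 of_int f) (a1 + t * b1) (a2 + t * b2) (a3 + t * b3) = (0::complex))}"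

definition count_points :: "int poly poly poly \<Rightarrow> real \<Rightarrow> nat" where
  "count_points f B = card {(y1::int, y2::int, y3::int).
      \<bar>real_of_int y1\<bar> \<le> B \<and> \<bar>real_of_int y2\<bar> \<le> B \<and> \<bar>real_of_int y3\<bar> \<le> B \<and>
      eval3 f y1 y2 y3 = 0}"

end

theory Submission
  imports Defs "HOL-Number_Theory.Cong" "HOL-Library.FuncSet" "HOL-Library.Nat_Bijection"
    "HOL-Computational_Algebra.Fundamental_Theorem_Algebra"
begin

text \<open>Let N be the integer part of B. If the surface contains only finitely many lines, then it contains boundedly
  many, and each of them carries at most 2N + 1 points. Now consider the points through which no line of integer
  direction runs on the surface, and fix a large n. For a product q of n primes, with q about the square root of N,
  the points that are congruent modulo q and at which the derivative is prime to q lie on a second surface of bounded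
  degree: by Hensel's lemma the first coordinate is a polynomial in the other two modulo a power of q, and the
  pigeonhole principle yields a combination of monomials whose values are divisible by that power and smaller than
  it. Elimination projects the class to a plane curve of bounded degree. There are about N classes, and each
  irreducible curve carries about the square root of N of the points, by the same method in the plane. This alone
  gives only the exponent 3/2. To save the square root, label each point with a component of the curve of its class
  and exchange the n primes for random ones, one at a time. A point whose label stops being a component is one of
  boundedly many intersection points in its class. If a label persists, then the points that carry it are hardly
  more numerous than the choices of primes, so few of them share a class modulo a random product. Hence there are
  hardly more points than pairs of a class and a component.\<close>

section \<open>Degrees and elimination\<close>

text \<open>Degree 4 is where the counts balance. In degree m a surface of degree d leaves about
  \<open>d * m\<close> monomials that are not multiples of its leading monomial. Weighed against the
  terms of an expansion in two displacements, they produce the second surface once \<open>q\<close>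
  exceeds N^(1/sqrt d). For d >= 4 a modulus slightly above N^(1/2) will do, and it has about
  \<open>q^2\<close>, hardly more than N, classes. The modulus is cut into many small primes because
  of the price of an exchange. Two tuples that differ in one place are compared on joint classes
  modulo n + 1 primes, of which there are N^(1 + O(1/n)); two unrelated moduli would need about N^2.
  The other obstacle is uniformity in f. A prime is useful at a point only if it does not divide the
  derivative there, so the coefficients of f should be at most a power of N. If they are not, linear
  algebra gives another surface of degree at most d through the same points. The number of lines is
  bounded uniformly because finite fibres of a constructible family over the algebraic numbers have
  bounded size.\<close>

definition lift_deg :: "('a::zero \<Rightarrow> nat \<Rightarrow> bool) \<Rightarrow> 'a poly \<Rightarrow> nat \<Rightarrow> bool" where
  "lift_deg D p n \<longleftrightarrow> (\<forall>i. coeff p i \<noteq> 0 \<longrightarrow> i \<le> n \<and> D (coeff p i) (n - i))"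

text \<open>\<open>D x n\<close> reads: x has degree at most n. As a relation it includes zero for
  every n, and a lifted polynomial can leave the remaining degree \<open>n - i\<close> to its
  coefficient \<open>i\<close>. Three lifts of the trivial relation give the total degree in three
  variables.\<close>

locale degree_filtration =
  fixes D :: "'a::idom \<Rightarrow> nat \<Rightarrow> bool"
  assumes D_0: "D 0 n"
    and D_1: "D 1 0"
    and D_mono: "D x m \<Longrightarrow> m \<le> n \<Longrightarrow> D x n"
    and D_add: "D x n \<Longrightarrow> D y n \<Longrightarrow> D (x + y) n"
    and D_mult: "D x m \<Longrightarrow> D y n \<Longrightarrow> D (x * y) (m + n)"
    and D_uminus: "D x n \<Longrightarrow> D (- x) n"
begin

lemma D_sum: "(\<And>i. i \<in> A \<Longrightarrow> D (g i) n) \<Longrightarrow> D (sum g A) n"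
  by (induction A rule: infinite_finite_induct) (auto intro: D_0 D_add)

lemma lift_deg_coeff: "lift_deg D p n \<Longrightarrow> i \<le> n \<Longrightarrow> D (coeff p i) (n - i)"
  unfolding lift_deg_def by (cases "coeff p i = 0") (auto intro: D_0)

lemma lift_deg_degree: "lift_deg D p n \<Longrightarrow> degree p \<le> n"
  unfolding lift_deg_def by (metis degree_0 le0 leading_coeff_0_iff)

lemma lift_deg_const: "D c n \<Longrightarrow> lift_deg D [:c:] n"
  unfolding lift_deg_def by (auto simp: coeff_pCons split: nat.split)

lemma lift_deg_monom: "D c (n - k) \<Longrightarrow> k \<le> n \<Longrightarrow> lift_deg D (monom c k) n"
  unfolding lift_deg_def by auto

lemma lift_filtration: "degree_filtration (lift_deg D)"
proof
  show "lift_deg D 0 n" for n by (simp add: lift_deg_def)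
  show "lift_deg D 1 0" by (auto simp: lift_deg_def coeff_1 D_1 split: if_splits)
  show "lift_deg D x n" if "lift_deg D x m" "m \<le> n" for x m n
    using that unfolding lift_deg_def by (meson D_mono diff_le_mono le_trans)
  show "lift_deg D (x + y) n" if x: "lift_deg D x n" and y: "lift_deg D y n" for x y n
    unfolding lift_deg_def
  proof (intro allI impI)
    fix i assume "coeff (x + y) i \<noteq> 0"
    then have "coeff x i \<noteq> 0 \<or> coeff y i \<noteq> 0" by auto
    then have "i \<le> n" using x y by (auto simp: lift_deg_def)
    then show "i \<le> n \<and> D (coeff (x + y) i) (n - i)"
      using lift_deg_coeff[OF x] lift_deg_coeff[OF y] by (auto intro: D_add)
  qed
  show "lift_deg D (- x) n" if "lift_deg D x n" for x n
    using that unfolding lift_deg_def by (auto intro: D_uminus)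
  show "lift_deg D (x * y) (m + n)" if x: "lift_deg D x m" and y: "lift_deg D y n" for x y m n
    unfolding lift_deg_def
  proof (intro allI impI conjI)
    fix k assume nz: "coeff (x * y) k \<noteq> 0"
    have "\<exists>i\<le>k. coeff x i * coeff y (k - i) \<noteq> 0"
      using nz unfolding coeff_mult by (metis (no_types, lifting) atMost_iff sum.neutral)
    then obtain i where "i \<le> k" "coeff x i \<noteq> 0" "coeff y (k - i) \<noteq> 0" by auto
    then have "i \<le> m" "k - i \<le> n" using x y unfolding lift_deg_def by blast+
    with \<open>i \<le> k\<close> show "k \<le> m + n" by linarith
    show "D (coeff (x * y) k) (m + n - k)"
      unfolding coeff_mult
    proof (rule D_sum)
      fix i assume i: "i \<in> {..k}"
      show "D (coeff x i * coeff y (k - i)) (m + n - k)"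
      proof (cases "coeff x i = 0 \<or> coeff y (k - i) = 0")
        case False
        then have "D (coeff x i) (m - i)" "i \<le> m" "D (coeff y (k - i)) (n - (k - i))" "k - i \<le> n"
          using x y unfolding lift_deg_def by blast+
        then have "D (coeff x i * coeff y (k - i)) ((m - i) + (n - (k - i)))" by (intro D_mult)
        moreover have "(m - i) + (n - (k - i)) = m + n - k"
          using i \<open>i \<le> m\<close> \<open>k - i \<le> n\<close> by auto
        ultimately show ?thesis by simp
      qed (auto intro: D_0)
    qed
  qed
qed

text \<open>Every division step multiplies by the leading coefficient of \<open>b\<close>, which
  costs \<open>nb\<close>, and at most \<open>degree a + 1\<close> steps occur. The bound for the
  remainder thus depends on degrees alone, never on the particular polynomials.\<close>

lemma pseudo_division:
  assumes "b \<noteq> 0" and b: "lift_deg D b nb"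
  shows "lift_deg D a na \<Longrightarrow> \<exists>c q r. c \<noteq> 0 \<and> [:c:] * a = q * b + r \<and> (r = 0 \<or> degree r < degree b)
    \<and> lift_deg D r (na + (degree a + 1) * nb)"
proof (induction "degree a" arbitrary: a na rule: less_induct)
  case less
  interpret L: degree_filtration "lift_deg D" by (rule lift_filtration)
  show ?case
  proof (cases "a = 0 \<or> degree a < degree b")
    case True
    then show ?thesis
      by - (rule exI[of _ 1], rule exI[of _ 0], rule exI[of _ a],
        auto intro: L.D_mono[OF less.prems] L.D_0)
  next
    case False
    define da db where "da = degree a" and "db = degree b"
    have le: "db \<le> da" using False by (simp add: da_def db_def)
    define a' where "a' = [:lead_coeff b:] * a - monom (lead_coeff a) (da - db) * b"
    have na: "da \<le> na" using lift_deg_degree[OF less.prems] by (simp add: da_def)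
    have nb: "db \<le> nb" using lift_deg_degree[OF b] by (simp add: db_def)
    have 1: "lift_deg D [:lead_coeff b:] nb"
      using lift_deg_coeff[OF b nb] by (intro lift_deg_const) (auto simp: db_def intro: D_mono)
    have 2: "lift_deg D (monom (lead_coeff a) (da - db)) na"
      using lift_deg_coeff[OF less.prems na] na
      by (intro lift_deg_monom) (auto simp: da_def intro: D_mono)
    have a': "lift_deg D a' (na + nb)"
      unfolding a'_def diff_conv_add_uminus
      using L.D_mult[OF 1 less.prems] L.D_mult[OF 2 b]
      by (intro L.D_add L.D_uminus) (simp_all add: add.commute)
    have deg: "coeff a' i = 0" if "i \<ge> da" for i
    proof (cases "i = da")
      case True
      then show ?thesis using le
        by (simp add: a'_def coeff_monom_mult da_def db_def)
    next
      case False
      then have "i > da" using that by simp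
      then have "coeff a i = 0" "coeff b (i - (da - db)) = 0"
        using le by (auto intro!: coeff_eq_0 simp: da_def db_def)
      then show ?thesis by (simp add: a'_def coeff_monom_mult)
    qed
    have fin: "\<exists>c q r. c \<noteq> 0 \<and> [:c:] * a = q * b + r \<and> (r = 0 \<or> degree r < degree b)
        \<and> lift_deg D r (na + (degree a + 1) * nb)"
      if "c \<noteq> 0" "[:c:] * a' = q * b + r" "r = 0 \<or> degree r < degree b"
        "lift_deg D r (na + (degree a + 1) * nb)" for c q r
    proof -
      have "[:c * lead_coeff b:] * a = [:c:] * a' + [:c:] * monom (lead_coeff a) (da - db) * b"
        unfolding a'_def by (simp add: algebra_simps)
      also have "\<dots> = (q + [:c:] * monom (lead_coeff a) (da - db)) * b + r"
        using that(2) by (simp add: algebra_simps)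
      finally show ?thesis using that \<open>b \<noteq> 0\<close>
        by (intro exI[of _ "c * lead_coeff b"] exI[of _ "q + [:c:] * monom (lead_coeff a) (da - db)"]
            exI[of _ r]) auto
    qed
    show ?thesis
    proof (cases "a' = 0")
      case True
      then show ?thesis by (intro fin[of 1 0 0]) (auto intro: L.D_0)
    next
      case a'0: False
      have lt: "degree a' < degree a"
        using deg a'0 unfolding da_def by (meson leading_coeff_0_iff not_le)
      obtain c q r where "c \<noteq> 0" "[:c:] * a' = q * b + r" "r = 0 \<or> degree r < degree b"
        and r: "lift_deg D r (na + nb + (degree a' + 1) * nb)"
        using less.hyps[OF lt a'] by blast
      moreover have "lift_deg D r (na + (degree a + 1) * nb)"
      proof (rule L.D_mono[OF r])
        have "(degree a' + 1 + 1) * nb \<le> (degree a + 1) * nb" using lt by (intro mult_le_mono1) simp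
        then show "na + nb + (degree a' + 1) * nb \<le> na + (degree a + 1) * nb"
          by (simp add: algebra_simps)
      qed
      ultimately show ?thesis by (intro fin)
    qed
  qed
qed

text \<open>A resultant without determinants: the remainder of \<open>f\<close> by \<open>g\<close>
  lies in the ideal of both and has smaller degree than \<open>g\<close>, so it takes the place of
  \<open>g\<close> until a constant is left. \<open>f\<close> stays fixed during the descent.
  \<open>E\<close> is chosen before \<open>f\<close> and \<open>g\<close>, which makes all later
  constants uniform.\<close>

lemma elimination_low_degree:
  "\<exists>E. \<forall>f g. prime_elem f \<longrightarrow> lift_deg D f n \<longrightarrow> lift_deg D g m \<longrightarrow> g \<noteq> 0 \<longrightarrow> degree g \<le> k \<longrightarrow>
     degree g < degree f \<longrightarrow> (\<exists>r u v. r \<noteq> 0 \<and> D r E \<and> [:r:] = u * f + v * g)"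
proof (induction k arbitrary: m)
  case 0
  show ?case
  proof (rule exI[of _ m], intro allI impI)
    fix f g :: "'a poly"
    assume "lift_deg D g m" "g \<noteq> 0" "degree g \<le> 0"
    moreover then obtain r where "g = [:r:]" by (meson degree_eq_zeroE le_zero_eq)
    ultimately show "\<exists>r u v. r \<noteq> 0 \<and> D r m \<and> [:r:] = u * f + v * g"
      using lift_deg_coeff[of g m 0] by (intro exI[of _ r] exI[of _ 0] exI[of _ 1]) auto
  qed
next
  case (Suc k)
  define m' where "m' = n + (n + 1) * m"
  interpret L: degree_filtration "lift_deg D" by (rule lift_filtration)
  obtain E where E: "\<And>f g. prime_elem f \<Longrightarrow> lift_deg D f n \<Longrightarrow> lift_deg D g m' \<Longrightarrow> g \<noteq> 0 \<Longrightarrow>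
     degree g \<le> k \<Longrightarrow> degree g < degree f \<Longrightarrow> (\<exists>r u v. r \<noteq> 0 \<and> D r E \<and> [:r:] = u * f + v * g)"
    using Suc.IH[of m'] by blast
  show ?case
  proof (rule exI[of _ "max m E"], intro allI impI)
    fix f g :: "'a poly"
    assume f: "prime_elem f" "lift_deg D f n" and g: "lift_deg D g m" "g \<noteq> 0" "degree g \<le> Suc k"
      "degree g < degree f"
    show "\<exists>r u v. r \<noteq> 0 \<and> D r (max m E) \<and> [:r:] = u * f + v * g"
    proof (cases "degree g = 0")
      case True
      then obtain r where "g = [:r:]" by (meson degree_eq_zeroE)
      then show ?thesis using lift_deg_coeff[OF g(1), of 0] g(2)
        by (intro exI[of _ r] exI[of _ 0] exI[of _ 1]) (auto intro: D_mono)
    next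
      case False
      obtain c q r where c: "c \<noteq> 0" and eq: "[:c:] * f = q * g + r" and r: "r = 0 \<or> degree r < degree g"
        and dr: "lift_deg D r (n + (degree f + 1) * m)"
        using pseudo_division[OF g(2,1) f(2)] by blast
      \<comment> \<open>Otherwise \<open>f\<close> divides \<open>q * g\<close> and hence
        \<open>q\<close>, as \<open>g\<close> has smaller degree; cancelling \<open>f\<close> leaves
        \<open>g\<close> as a divisor of the constant \<open>c\<close>.\<close>
      have r0: "r \<noteq> 0"
      proof
        assume "r = 0"
        then have "f dvd q * g" using eq by (metis add_0_right dvd_triv_right)
        then have "f dvd q \<or> f dvd g" using f(1) by (simp add: prime_elem_dvd_mult_iff)
        moreover have "\<not> f dvd g" using g by (metis dvd_imp_degree_le not_le)
        ultimately obtain s where "q = f * s" by (auto elim: dvdE)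
        then have "f * [:c:] = f * (s * g)" using eq \<open>r = 0\<close> by (simp add: algebra_simps)
        then have "[:c:] = s * g" using f(1) by (metis mult_cancel_left prime_elem_not_zeroI)
        then have "g dvd [:c:]" by simp
        then have "degree g \<le> degree [:c:]" using c by (intro dvd_imp_degree_le) auto
        then show False using False by simp
      qed
      have "lift_deg D r m'"
        using lift_deg_degree[OF f(2)] unfolding m'_def by (intro L.D_mono[OF dr] add_left_mono mult_le_mono1) simp
      then obtain \<rho> u v where \<rho>: "\<rho> \<noteq> 0" "D \<rho> E" "[:\<rho>:] = u * f + v * r"
        using E[OF f \<open>lift_deg D r m'\<close> r0] r r0 g(3,4) by (metis less_Suc_eq_le less_le_trans less_trans)
      have "r = [:c:] * f - q * g" using eq by simp
      then have "v * r = (v * [:c:]) * f - (v * q) * g"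
        by (simp only: right_diff_distrib mult.assoc)
      then have "[:\<rho>:] = (u + v * [:c:]) * f + (- (v * q)) * g"
        unfolding \<rho>(3) by (simp only: distrib_right mult_minus_left) simp
      then show ?thesis using \<rho> D_mono by (meson max.cobounded2)
    qed
  qed
qed

text \<open>One pseudo-division by \<open>f\<close> brings the degree of \<open>g\<close> below that
  of \<open>f\<close>. The multiplier \<open>c\<close> is harmless: a nonzero constant is not
  divisible by \<open>f\<close>, so the remainder does not vanish.\<close>

lemma elimination:
  "\<exists>E. \<forall>f g. prime_elem f \<longrightarrow> degree f > 0 \<longrightarrow> lift_deg D f n \<longrightarrow> lift_deg D g m \<longrightarrow> \<not> f dvd g \<longrightarrow>
     (\<exists>r u v. r \<noteq> 0 \<and> D r E \<and> [:r:] = u * f + v * g)"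
proof -
  interpret L: degree_filtration "lift_deg D" by (rule lift_filtration)
  define m' where "m' = m + (m + 1) * n"
  obtain E where E: "\<And>f g. prime_elem f \<Longrightarrow> lift_deg D f n \<Longrightarrow> lift_deg D g m' \<Longrightarrow> g \<noteq> 0 \<Longrightarrow>
     degree g \<le> n \<Longrightarrow> degree g < degree f \<Longrightarrow> (\<exists>r u v. r \<noteq> 0 \<and> D r E \<and> [:r:] = u * f + v * g)"
    using elimination_low_degree[of n m' n] by blast
  show ?thesis
  proof (rule exI[of _ E], intro allI impI)
    fix f g :: "'a poly"
    assume f: "prime_elem f" "degree f > 0" "lift_deg D f n" and g: "lift_deg D g m" "\<not> f dvd g"
    have "f \<noteq> 0" using f by auto
    obtain c q r where c: "c \<noteq> 0" and eq: "[:c:] * g = q * f + r" and r: "r = 0 \<or> degree r < degree f"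
      and dr: "lift_deg D r (m + (degree g + 1) * n)"
      using pseudo_division[OF \<open>f \<noteq> 0\<close> f(3) g(1)] by blast
    have "\<not> f dvd [:c:]" using f c by (metis degree_pCons_0 dvd_imp_degree_le not_le pCons_eq_0_iff)
    then have "\<not> f dvd [:c:] * g" using f(1) g(2) prime_elem_dvd_mult_iff by blast
    then have r0: "r \<noteq> 0" using eq by auto
    have "lift_deg D r m'"
      using lift_deg_degree[OF g(1)] unfolding m'_def by (intro L.D_mono[OF dr] add_left_mono mult_le_mono1) simp
    then obtain \<rho> u v where \<rho>: "\<rho> \<noteq> 0" "D \<rho> E" "[:\<rho>:] = u * f + v * r"
      using E[OF f(1,3) \<open>lift_deg D r m'\<close> r0] r r0 lift_deg_degree[OF f(3)] by (meson le_trans less_imp_le_nat)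
    have "r = [:c:] * g - q * f" using eq by simp
    then have "v * r = (v * [:c:]) * g - (v * q) * f"
      by (simp only: right_diff_distrib mult.assoc)
    then have "[:\<rho>:] = (u - v * q) * f + (v * [:c:]) * g"
      unfolding \<rho>(3) by (simp only: left_diff_distrib) simp
    then show "\<exists>r u v. r \<noteq> 0 \<and> D r E \<and> [:r:] = u * f + v * g" using \<rho> by blast
  qed
qed

end

section \<open>Total degree in up to three variables, and intersections of plane curves\<close>

abbreviation "deg1 \<equiv> lift_deg (\<lambda>_ _. True)"
abbreviation "deg2 \<equiv> lift_deg deg1"
abbreviation "deg3 \<equiv> lift_deg deg2"

interpretation F0: degree_filtration "\<lambda>(_::'a::idom) _. True" by unfold_locales auto
interpretation F1: degree_filtration "deg1 :: 'a::idom poly \<Rightarrow> _" by (rule F0.lift_filtration)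
interpretation F2: degree_filtration "deg2 :: 'a::idom poly poly \<Rightarrow> _" by (rule F1.lift_filtration)
interpretation F3: degree_filtration "deg3 :: 'a::idom poly poly poly \<Rightarrow> _" by (rule F2.lift_filtration)

lemma deg1_iff: "deg1 p n \<longleftrightarrow> degree p \<le> n"
  unfolding lift_deg_def by (metis degree_le le_degree not_le order.trans)

definition eval2 :: "'a::comm_semiring_0 poly poly \<Rightarrow> 'a \<Rightarrow> 'a \<Rightarrow> 'a" where
  "eval2 p a b = poly (poly p [:a:]) b"

lemma eval2_simps [simp]:
  fixes p q :: "'a::comm_ring_1 poly poly"
  shows "eval2 (p + q) a b = eval2 p a b + eval2 q a b" "eval2 (p * q) a b = eval2 p a b * eval2 q a b"
    "eval2 (- p) a b = - eval2 p a b" "eval2 (p - q) a b = eval2 p a b - eval2 q a b"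
    "eval2 [:c:] a b = poly c b" "eval2 0 a b = 0" "eval2 1 a b = 1"
  by (simp_all add: eval2_def)

lemma eval3_simps [simp]:
  fixes p q :: "'a::comm_ring_1 poly poly poly"
  shows "eval3 (p + q) a b c = eval3 p a b c + eval3 q a b c" "eval3 (p * q) a b c = eval3 p a b c * eval3 q a b c"
    "eval3 (- p) a b c = - eval3 p a b c" "eval3 (p - q) a b c = eval3 p a b c - eval3 q a b c"
    "eval3 [:r:] a b c = eval2 r b c" "eval3 0 a b c = 0" "eval3 1 a b c = 1"
  by (simp_all add: eval3_def eval2_def)

lemma eval2_pCons: "eval2 (pCons c p) a b = poly c b + a * eval2 p a b" for p :: "'a::comm_ring_1 poly poly"
  by (simp add: eval2_def)

lemma eval3_pCons: "eval3 (pCons r p) a b c = eval2 r b c + a * eval3 p a b c" for p :: "'a::comm_ring_1 poly poly poly"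
  by (simp add: eval3_def eval2_def)

lemma eval2_map: "eval2 p a b = poly (map_poly (\<lambda>c. poly c b) p) a" for p :: "'a::comm_ring_1 poly poly"
  by (induction p) (simp_all add: eval2_pCons map_poly_pCons)

lemma eval3_map: "eval3 p a b c = poly (map_poly (\<lambda>r. eval2 r b c) p) a" for p :: "'a::comm_ring_1 poly poly poly"
  by (induction p) (simp_all add: eval3_pCons map_poly_pCons)

lemma card_roots_le:
  fixes p :: "'a::idom poly"
  assumes "p \<noteq> 0" "degree p \<le> n"
  shows "finite {x. poly p x = 0}" "card {x. poly p x = 0} \<le> n"
  using assms poly_roots_finite card_poly_roots_bound[of p] by (auto intro: le_trans)

lemma card_fibration_le:
  assumes "finite B" "card B \<le> n" "\<And>a b. (a, b) \<in> S \<Longrightarrow> b \<in> B"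
    and "\<And>b. b \<in> B \<Longrightarrow> finite {a. (a, b) \<in> S} \<and> card {a. (a, b) \<in> S} \<le> m"
  shows "finite S \<and> card S \<le> n * m"
proof -
  let ?T = "SIGMA b:B. {a. (a, b) \<in> S}"
  have fin: "finite ?T" using assms(1,4) by (intro finite_SigmaI) auto
  have sub: "S \<subseteq> prod.swap ` ?T"
  proof
    fix s assume "s \<in> S"
    then have "(snd s, fst s) \<in> ?T" using assms(3)[of "fst s" "snd s"] by auto
    then show "s \<in> prod.swap ` ?T" by (metis image_eqI prod.collapse swap_simp)
  qed
  then have "finite S" using fin by (meson finite_imageI finite_subset)
  have "card S \<le> card ?T" using sub fin by (meson card_image_le card_mono finite_imageI le_trans)
  also have "\<dots> = (\<Sum>b\<in>B. card {a. (a, b) \<in> S})" using assms(1,4) by (intro card_SigmaI) auto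
  also have "\<dots> \<le> card B * m" using assms(4) sum_bounded_above[of B "\<lambda>b. card {a. (a, b) \<in> S}" m] by auto
  also have "\<dots> \<le> n * m" using assms(2) by simp
  finally show ?thesis using \<open>finite S\<close> by simp
qed

lemma vertical_factor:
  fixes h :: "int poly poly"
  assumes "map_poly (\<lambda>c. poly c b) h = 0"
  shows "[:[:-b, 1:]:] dvd h"
proof -
  have "[:-b, 1:] dvd coeff h i" for i
    using arg_cong[OF assms, of "\<lambda>p. coeff p i"] by (simp add: coeff_map_poly poly_eq_0_iff_dvd)
  then show ?thesis by (simp add: const_poly_dvd_iff)
qed

text \<open>Elimination leaves at most \<open>E\<close> values of the second coordinate, and over
  each of them \<open>h\<close> has at most \<open>n\<close> zeros unless it contains the whole
  line. If \<open>h\<close> does not involve the first variable, its roots give the second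
  coordinates and \<open>R\<close> bounds the fibres instead. The constant is cruder than Bezout's,
  but it depends only on the degrees.\<close>

theorem plane_bezout:
  "\<exists>C. \<forall>h R. prime_elem h \<longrightarrow> deg2 h n \<longrightarrow> deg2 R m \<longrightarrow> \<not> h dvd R \<longrightarrow>
     finite {(a::int, b). eval2 h a b = 0 \<and> eval2 R a b = 0} \<and>
     card {(a, b). eval2 h a b = 0 \<and> eval2 R a b = 0} \<le> C"
proof -
  obtain E where E: "\<And>f g :: int poly poly. prime_elem f \<Longrightarrow> degree f > 0 \<Longrightarrow> deg2 f n \<Longrightarrow> deg2 g m \<Longrightarrow> \<not> f dvd g \<Longrightarrow>
     (\<exists>r u v. r \<noteq> 0 \<and> deg1 r E \<and> [:r:] = u * f + v * g)"
    using F1.elimination[of n m] by blast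
  have lin: "\<not> is_unit [:[:-b, 1::int:]:]" for b by (simp add: is_unit_poly_iff)
  show ?thesis
  proof (rule exI[of _ "E * n + n * m"], intro allI impI)
    fix h R :: "int poly poly"
    assume h: "prime_elem h" "deg2 h n" and R: "deg2 R m" "\<not> h dvd R"
    let ?S = "{(a, b). eval2 h a b = 0 \<and> eval2 R a b = 0}"
    have irr: "irreducible h" using h(1) by (rule prime_elem_imp_irreducible)
    have "finite ?S \<and> card ?S \<le> E * n \<or> finite ?S \<and> card ?S \<le> n * m"
    proof (cases "degree h > 0")
      case True
      obtain r u v where r: "r \<noteq> 0" "deg1 r E" "[:r:] = u * h + v * R"
        using E[OF h(1) True h(2) R] by blast
      have "finite ?S \<and> card ?S \<le> E * n"
      proof (rule card_fibration_le[of "{b. poly r b = 0}"])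
        show "finite {b. poly r b = 0}" "card {b. poly r b = 0} \<le> E"
          using card_roots_le[OF r(1)] r(2) deg1_iff by auto
        show "b \<in> {b. poly r b = 0}" if "(a, b) \<in> ?S" for a b
          using that arg_cong[OF r(3), of "\<lambda>p. eval2 p a b"] by simp
        show "finite {a. (a, b) \<in> ?S} \<and> card {a. (a, b) \<in> ?S} \<le> n" for b
        proof -
          \<comment> \<open>A prime \<open>h\<close> that contains the whole line equals its
            equation up to a unit, against \<open>degree h > 0\<close>.\<close>
          have ne: "map_poly (\<lambda>c. poly c b) h \<noteq> 0"
          proof
            assume "map_poly (\<lambda>c. poly c b) h = 0"
            then obtain k where k: "h = [:[:-b, 1:]:] * k" using vertical_factor by (metis dvdE)
            then have "is_unit k" using irr lin irreducibleD by blast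
            then have "degree k = 0" by (auto simp: is_unit_poly_iff)
            then show False using True k by simp
          qed
          have "{a. (a, b) \<in> ?S} \<subseteq> {a. poly (map_poly (\<lambda>c. poly c b) h) a = 0}"
            by (auto simp: eval2_map)
          moreover have "degree (map_poly (\<lambda>c. poly c b) h) \<le> n"
            using map_poly_degree_leq[of "\<lambda>c. poly c b" h] F1.lift_deg_degree[OF h(2)] by linarith
          ultimately show ?thesis using card_roots_le[OF ne] by (meson card_mono finite_subset le_trans)
        qed
      qed
      then show ?thesis ..
    next
      case False
      then obtain h0 where h0: "h = [:h0:]" by (meson degree_eq_zeroE gr0I)
      have "h0 \<noteq> 0" using h0 h by auto
      have "finite ?S \<and> card ?S \<le> n * m"
      proof (rule card_fibration_le[of "{b. poly h0 b = 0}"])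
        have "deg1 h0 n" using F1.lift_deg_coeff[OF h(2), of 0] h0 by simp
        then show "finite {b. poly h0 b = 0}" "card {b. poly h0 b = 0} \<le> n"
          using card_roots_le[OF \<open>h0 \<noteq> 0\<close>] deg1_iff by auto
        show "b \<in> {b. poly h0 b = 0}" if "(a, b) \<in> ?S" for a b
          using that h0 by simp
        show "finite {a. (a, b) \<in> ?S} \<and> card {a. (a, b) \<in> ?S} \<le> m" if "b \<in> {b. poly h0 b = 0}" for b
        proof -
          \<comment> \<open>Here the line would be \<open>h\<close> itself up to a unit, and
            \<open>h\<close> does not divide \<open>R\<close>.\<close>
          have ne: "map_poly (\<lambda>c. poly c b) R \<noteq> 0"
          proof
            assume "map_poly (\<lambda>c. poly c b) R = 0"
            then have dR: "[:[:-b, 1:]:] dvd R" by (rule vertical_factor)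
            have "[:-b, 1:] dvd h0" using that by (simp add: poly_eq_0_iff_dvd)
            then obtain k where "h0 = [:-b, 1:] * k" by (rule dvdE)
            then have k: "h = [:[:-b, 1:]:] * [:k:]" using h0 by simp
            then have "is_unit [:k:]" using irr lin irreducibleD by blast
            then have "h dvd [:[:-b, 1:]:]" unfolding k by (simp only: mult_unit_dvd_iff dvd_refl)
            then show False using dR R(2) dvd_trans by blast
          qed
          have "{a. (a, b) \<in> ?S} \<subseteq> {a. poly (map_poly (\<lambda>c. poly c b) R) a = 0}"
            by (auto simp: eval2_map)
          moreover have "degree (map_poly (\<lambda>c. poly c b) R) \<le> m"
            using map_poly_degree_leq[of "\<lambda>c. poly c b" R] F1.lift_deg_degree[OF R(1)] by linarith
          ultimately show ?thesis using card_roots_le[OF ne] by (meson card_mono finite_subset le_trans)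
        qed
      qed
      then show ?thesis ..
    qed
    then show "finite ?S \<and> card ?S \<le> E * n + n * m" by linarith
  qed
qed

section \<open>Factors of integer polynomials\<close>

definition is_hom :: "('a::comm_ring_1 \<Rightarrow> 'b::comm_ring_1) \<Rightarrow> bool" where
  "is_hom \<phi> \<longleftrightarrow> \<phi> 0 = 0 \<and> \<phi> 1 = 1 \<and> (\<forall>x y. \<phi> (x + y) = \<phi> x + \<phi> y) \<and> (\<forall>x y. \<phi> (x * y) = \<phi> x * \<phi> y)"

lemma is_hom_prod: "is_hom \<phi> \<Longrightarrow> \<phi> (prod g A) = (\<Prod>x\<in>A. \<phi> (g x))"
  by (induction A rule: infinite_finite_induct) (auto simp: is_hom_def)

lemma is_hom_eval:
  assumes "is_hom \<phi>"
  shows "is_hom (\<lambda>p. poly (map_poly \<phi> p) s)"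
proof -
  have 0: "\<phi> 0 = 0" and 1: "\<phi> 1 = 1" and add: "\<phi> (x + y) = \<phi> x + \<phi> y" and mult: "\<phi> (x * y) = \<phi> x * \<phi> y" for x y
    using assms by (auto simp: is_hom_def)
  have padd: "map_poly \<phi> (p + q) = map_poly \<phi> p + map_poly \<phi> q" for p q
    by (rule poly_eqI) (simp add: coeff_map_poly 0 add)
  have psmult: "map_poly \<phi> (smult c q) = smult (\<phi> c) (map_poly \<phi> q)" for c q
    by (rule poly_eqI) (simp add: coeff_map_poly 0 mult)
  have pmult: "poly (map_poly \<phi> (p * q)) s = poly (map_poly \<phi> p) s * poly (map_poly \<phi> q) s" for p q
    by (induction p) (simp_all add: padd psmult map_poly_pCons 0 algebra_simps)
  show ?thesis unfolding is_hom_def by (simp add: padd pmult 0 1 map_poly_1)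
qed

lemma is_hom_const: "is_hom \<phi> \<Longrightarrow> is_hom (\<lambda>c. [:\<phi> c:])"
  by (auto simp: is_hom_def one_pCons)

text \<open>Mapping coefficients is evaluation at the variable, with constant polynomials as
  coefficients; in this way \<open>is_hom_eval\<close> also covers
  \<open>map_poly \<phi>\<close>.\<close>

lemma map_poly_eval: "\<phi> 0 = 0 \<Longrightarrow> map_poly \<phi> p = poly (map_poly (\<lambda>c. [:\<phi> c:]) p) [:0, 1:]"
  for \<phi> :: "'a::zero \<Rightarrow> 'b::comm_ring_1"
  by (induction p) (simp_all add: map_poly_pCons)

lemma is_hom_map_poly: assumes "is_hom \<phi>" shows "is_hom (map_poly \<phi>)"
proof -
  have "\<phi> 0 = 0" using assms by (simp add: is_hom_def)
  then have "map_poly \<phi> = (\<lambda>p. poly (map_poly (\<lambda>c. [:\<phi> c:]) p) [:0, 1:])"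
    using map_poly_eval by blast
  then show ?thesis using is_hom_eval[OF is_hom_const[OF assms]] by simp
qed

lemma is_hom_of_int: "is_hom (of_int :: int \<Rightarrow> 'a::comm_ring_1)"
  by (simp add: is_hom_def)

lemma is_hom_map_poly3: "is_hom \<phi> \<Longrightarrow> is_hom (map_poly3 \<phi>)"
  unfolding map_poly3_def by (intro is_hom_map_poly)

lemma poly_map_sum:
  fixes \<phi> :: "'a::zero \<Rightarrow> 'b::comm_ring_1"
  assumes "\<phi> 0 = 0" "degree p < n"
  shows "poly (map_poly \<phi> p) s = (\<Sum>i<n. \<phi> (coeff p i) * s ^ i)"
proof -
  have "poly (map_poly \<phi> p) s = (\<Sum>i\<le>degree (map_poly \<phi> p). coeff (map_poly \<phi> p) i * s ^ i)"
    by (rule poly_altdef)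
  also have "\<dots> = (\<Sum>i<n. coeff (map_poly \<phi> p) i * s ^ i)"
    using assms(2) map_poly_degree_leq[of \<phi> p] by (intro sum.mono_neutral_left) (auto intro!: le_degree)
  finally show ?thesis using assms(1) by (simp add: coeff_map_poly)
qed

text \<open>Kronecker substitution. For exponents below W the weight is injective and orders the monomials
  by total degree first, so that the degree of the image singles out a leading monomial.\<close>

definition weight :: "nat \<Rightarrow> nat \<Rightarrow> nat \<Rightarrow> nat \<Rightarrow> nat" where
  "weight W i j k = (i + j + k) * W^2 + i * W + j"

definition kron :: "nat \<Rightarrow> int poly poly poly \<Rightarrow> int poly" where
  "kron W f = poly (map_poly (\<lambda>c. poly (map_poly (\<lambda>e. poly (map_poly (\<lambda>x. [:x:]) e)
     (monom 1 (weight W 0 0 1))) c) (monom 1 (weight W 0 1 0))) f) (monom 1 (weight W 1 0 0))"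

lemma is_hom_kron: "is_hom (kron W)"
  unfolding kron_def by (intro is_hom_eval) (simp add: is_hom_def one_pCons)

lemma kron_mult: "kron W (f * g) = kron W f * kron W g"
  using is_hom_kron by (simp add: is_hom_def)

lemma euclidean_unique:
  assumes "a * m + b = a' * m + (b'::nat)" "b < m" "b' < m"
  shows "a = a' \<and> b = b'"
proof -
  have "a = (a * m + b) div m" "a' = (a' * m + b') div m" using assms(2,3) by simp_all
  then have "a = a'" using assms(1) by simp
  then show ?thesis using assms(1) by simp
qed

text \<open>The weight is an expansion in base \<open>W\<close>: the part \<open>i * W + j\<close>
  stays below \<open>W^2\<close>, so the total degree, \<open>i\<close> and \<open>j\<close> can be
  read off as digits.\<close>

lemma weight_inj:
  assumes "weight W i j k = weight W i' j' k'" "i < W" "j < W" "i' < W" "j' < W"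
  shows "i = i' \<and> j = j' \<and> k = k'"
proof -
  have lt: "a * W + b < W^2" if "a < W" "b < W" for a b
  proof -
    have "a * W + b < (a + 1) * W" using that by simp
    also have "\<dots> \<le> W * W" using that by (intro mult_le_mono1) simp
    finally show ?thesis by (simp add: power2_eq_square)
  qed
  have "(i + j + k) * W^2 + (i * W + j) = (i' + j' + k') * W^2 + (i' * W + j')"
    using assms(1) by (simp add: weight_def)
  then have 1: "i + j + k = i' + j' + k'" and 2: "i * W + j = i' * W + j'"
    using euclidean_unique lt[OF assms(2,3)] lt[OF assms(4,5)] by blast+
  from euclidean_unique[OF 2 assms(3,5)] have "i = i'" "j = j'" by simp_all
  with 1 show ?thesis by simp
qed

lemma weight_add: "weight W i j k + weight W i' j' k' = weight W (i + i') (j + j') (k + k')"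
  by (simp add: weight_def algebra_simps)

lemma monom_weight: "monom c 0 * monom 1 (weight W 0 0 1) ^ k * monom 1 (weight W 0 1 0) ^ j * monom 1 (weight W 1 0 0) ^ i
   = monom c (weight W i j k)"
  by (simp add: monom_power mult_monom weight_def algebra_simps)

lemma deg2_coeff_bound: "deg2 f n \<Longrightarrow> degree f \<le> n \<and> degree (coeff f i) \<le> n" for f :: "'a::idom poly poly"
proof (intro conjI)
  assume f: "deg2 f n"
  then show "degree f \<le> n" by (rule F1.lift_deg_degree)
  show "degree (coeff f i) \<le> n"
  proof (cases "coeff f i = 0")
    case False
    then have "deg1 (coeff f i) (n - i)" using f unfolding lift_deg_def[of deg1] by blast
    then show ?thesis by (simp add: deg1_iff)
  qed simp
qed

lemma deg3_coeff_bound: "deg3 f n \<Longrightarrow> degree f \<le> n \<and> deg2 (coeff f i) n" for f :: "'a::idom poly poly poly"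
proof (intro conjI)
  assume f: "deg3 f n"
  then show "degree f \<le> n" by (rule F2.lift_deg_degree)
  show "deg2 (coeff f i) n"
  proof (cases "coeff f i = 0")
    case False
    then have "deg2 (coeff f i) (n - i)" using f unfolding lift_deg_def[of deg2] by blast
    then show ?thesis by (rule F2.D_mono) simp
  qed (simp add: F2.D_0)
qed

lemma deg2_iff: "deg2 f n \<longleftrightarrow> (\<forall>i j. coeff (coeff f i) j \<noteq> 0 \<longrightarrow> i + j \<le> n)"
proof
  assume "deg2 f n"
  then show "\<forall>i j. coeff (coeff f i) j \<noteq> 0 \<longrightarrow> i + j \<le> n"
    unfolding lift_deg_def by (metis coeff_0 add_le_cancel_left le_add_diff_inverse)
next
  assume *: "\<forall>i j. coeff (coeff f i) j \<noteq> 0 \<longrightarrow> i + j \<le> n"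
  show "deg2 f n" unfolding lift_deg_def[of deg1]
  proof (intro allI impI)
    fix i assume "coeff f i \<noteq> 0"
    then obtain j where "coeff (coeff f i) j \<noteq> 0" by (auto simp: poly_eq_iff)
    then have "i \<le> n" using * by fastforce
    then show "i \<le> n \<and> deg1 (coeff f i) (n - i)"
      using * by (auto simp: lift_deg_def le_diff_conv2 add.commute[of _ i])
  qed
qed

lemma deg3_iff: "deg3 f n \<longleftrightarrow> (\<forall>i j k. coeff3 f i j k \<noteq> 0 \<longrightarrow> i + j + k \<le> n)"
proof
  assume "deg3 f n"
  then have "i \<le> n \<and> j + k \<le> n - i" if "coeff3 f i j k \<noteq> 0" for i j k
    using that unfolding lift_deg_def[of deg2] coeff3_def deg2_iff by (metis coeff_0)
  then show "\<forall>i j k. coeff3 f i j k \<noteq> 0 \<longrightarrow> i + j + k \<le> n" by fastforce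
next
  assume *: "\<forall>i j k. coeff3 f i j k \<noteq> 0 \<longrightarrow> i + j + k \<le> n"
  show "deg3 f n" unfolding lift_deg_def[of deg2]
  proof (intro allI impI)
    fix i assume "coeff f i \<noteq> 0"
    then obtain j k where "coeff3 f i j k \<noteq> 0" by (auto simp: poly_eq_iff coeff3_def)
    then have "i \<le> n" using * by fastforce
    then show "i \<le> n \<and> deg2 (coeff f i) (n - i)"
      using * by (fastforce simp: deg2_iff coeff3_def)
  qed
qed

lemma deg3_exists: "\<exists>n. deg3 f n" for f :: "'a::idom poly poly poly"
proof -
  have "\<exists>n. \<forall>i\<le>m. deg2 (coeff f i) n" if "\<And>i. \<exists>n. deg2 (coeff f i) n" for f :: "'a poly poly poly" and m
  proof (induction m)
    case (Suc m)
    then obtain n where n: "\<forall>i\<le>m. deg2 (coeff f i) n" by blast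
    have "\<exists>n'. deg2 (coeff f (Suc m)) n'" by (rule that)
    then obtain n' where "deg2 (coeff f (Suc m)) n'" ..
    with n show ?case by (intro exI[of _ "max n n'"]) (auto simp: le_Suc_eq intro: F2.D_mono)
  qed (use that in auto)
  moreover have "\<exists>n. deg2 c n" for c :: "'a poly poly"
  proof -
    define n where "n = degree c + (\<Sum>i\<le>degree c. degree (coeff c i))"
    have "i + j \<le> n" if "coeff (coeff c i) j \<noteq> 0" for i j
    proof -
      have "coeff c i \<noteq> 0" using that by auto
      then have i: "i \<le> degree c" by (rule le_degree)
      have "j \<le> degree (coeff c i)" using that by (rule le_degree)
      also have "\<dots> \<le> (\<Sum>i\<le>degree c. degree (coeff c i))" using i by (intro member_le_sum) auto
      finally show ?thesis using i by (simp add: n_def)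
    qed
    then show ?thesis by (auto simp: deg2_iff)
  qed
  ultimately obtain n where n: "\<forall>i\<le>degree f. deg2 (coeff f i) n" by metis
  have "deg3 f (degree f + n)"
    unfolding deg3_iff
  proof (intro allI impI)
    fix i j k assume c: "coeff3 f i j k \<noteq> 0"
    then have "coeff f i \<noteq> 0" by (auto simp: coeff3_def)
    then have "i \<le> degree f" by (rule le_degree)
    then have "j + k \<le> n" using n c by (auto simp: coeff3_def deg2_iff)
    with \<open>i \<le> degree f\<close> show "i + j + k \<le> degree f + n" by simp
  qed
  then show ?thesis ..
qed

lemma kron_sum:
  assumes "deg3 f n" "n < W"
  shows "kron W f = (\<Sum>(i, j, k)\<in>{..<W} \<times> {..<W} \<times> {..<W}. monom (coeff3 f i j k) (weight W i j k))"
proof -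
  have f: "degree f < W" using deg3_coeff_bound[OF assms(1)] assms(2) by (meson le_less_trans)
  have fi: "degree (coeff f i) < W" for i
    using deg3_coeff_bound[OF assms(1), of i] deg2_coeff_bound[of "coeff f i" n] assms(2) by (meson le_less_trans)
  have fij: "degree (coeff (coeff f i) j) < W" for i j
    using deg3_coeff_bound[OF assms(1), of i] deg2_coeff_bound[of "coeff f i" n j] assms(2) by (meson le_less_trans)
  let ?m = "\<lambda>i j k. monom 1 (weight W i j k) :: int poly"
  have "kron W f = (\<Sum>i<W. (\<Sum>j<W. (\<Sum>k<W. [:coeff3 f i j k:] * ?m 0 0 1 ^ k) * ?m 0 1 0 ^ j) * ?m 1 0 0 ^ i)"
    unfolding kron_def coeff3_def
    by (subst poly_map_sum[OF _ f], simp, subst poly_map_sum[OF _ fi], simp, subst poly_map_sum[OF _ fij]) simp_all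
  also have "\<dots> = (\<Sum>i<W. \<Sum>j<W. \<Sum>k<W. [:coeff3 f i j k:] * ?m 0 0 1 ^ k * ?m 0 1 0 ^ j * ?m 1 0 0 ^ i)"
    by (simp only: sum_distrib_right)
  also have "\<dots> = (\<Sum>i<W. \<Sum>j<W. \<Sum>k<W. monom (coeff3 f i j k) (weight W i j k))"
    by (intro sum.cong refl) (simp only: monom_weight flip: monom_0)
  finally show ?thesis by (simp only: sum.cartesian_product)
qed

lemma coeff_kron:
  assumes "deg3 f n" "n < W" "i < W" "j < W" "k < W"
  shows "coeff (kron W f) (weight W i j k) = coeff3 f i j k"
proof -
  have "coeff (kron W f) (weight W i j k)
      = (\<Sum>t\<in>{..<W} \<times> {..<W} \<times> {..<W}. if t = (i, j, k) then coeff3 f i j k else 0)"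
    unfolding kron_sum[OF assms(1,2)] coeff_sum
  proof (rule sum.cong)
    fix t assume "t \<in> {..<W} \<times> {..<W} \<times> {..<W}"
    then show "coeff (case t of (i, j, k) \<Rightarrow> monom (coeff3 f i j k) (weight W i j k)) (weight W i j k)
       = (if t = (i, j, k) then coeff3 f i j k else 0)"
      using weight_inj[of W "fst t" "fst (snd t)" "snd (snd t)" i j k] assms by (auto split: prod.splits)
  qed simp
  also have "\<dots> = coeff3 f i j k" using assms by (subst sum.delta) auto
  finally show ?thesis .
qed

lemma kron_support:
  assumes "deg3 f n" "n < W" "coeff (kron W f) e \<noteq> 0"
  shows "\<exists>i j k. e = weight W i j k \<and> coeff3 f i j k \<noteq> 0 \<and> i + j + k \<le> n"
proof -
  have "\<exists>t\<in>{..<W} \<times> {..<W} \<times> {..<W}. coeff (case t of (i, j, k) \<Rightarrow> monom (coeff3 f i j k) (weight W i j k)) e \<noteq> 0"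
    using assms(3) unfolding kron_sum[OF assms(1,2)] coeff_sum by (metis (no_types, lifting) sum.neutral)
  then obtain i j k where "coeff (monom (coeff3 f i j k) (weight W i j k)) e \<noteq> 0" by auto
  then have "e = weight W i j k" "coeff3 f i j k \<noteq> 0" by (auto split: if_splits)
  then show ?thesis using assms(1) unfolding deg3_iff by blast
qed

lemma kron_nonzero:
  assumes "deg3 f n" "n < W" "f \<noteq> 0"
  shows "kron W f \<noteq> 0"
proof -
  obtain i j k where c: "coeff3 f i j k \<noteq> 0" using assms(3) by (auto simp: poly_eq_iff coeff3_def)
  then have "i + j + k \<le> n" using assms(1) by (simp add: deg3_iff)
  then show ?thesis using coeff_kron[OF assms(1,2), of i j k] c assms(2) by auto
qed

lemma kron_degree:
  assumes "deg3 f n" "n < W" "f \<noteq> 0"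
  obtains i j k where "degree (kron W f) = weight W i j k" "coeff3 f i j k \<noteq> 0" "i + j + k \<le> n"
  using kron_support[OF assms(1,2), of "degree (kron W f)"] kron_nonzero[OF assms] that by auto

lemma le_kron_degree:
  assumes "deg3 f n" "n < W" "coeff3 f i j k \<noteq> 0"
  shows "weight W i j k \<le> degree (kron W f)"
proof -
  have "i + j + k \<le> n" using assms by (simp add: deg3_iff)
  then show ?thesis using coeff_kron[OF assms(1,2), of i j k] assms by (intro le_degree) auto
qed

lemma weight_less:
  assumes "weight W i j k \<le> weight W i' j' k'" "i' < W" "j' < W"
  shows "i + j + k \<le> i' + j' + k'"
proof -
  have "i' * W + j' < W^2"
  proof -
    have "i' * W + j' < (i' + 1) * W" using assms by simp
    also have "\<dots> \<le> W * W" using assms by (intro mult_le_mono1) simp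
    finally show ?thesis by (simp add: power2_eq_square)
  qed
  then have "(i + j + k) * W^2 < (i' + j' + k' + 1) * W^2"
    using assms(1) by (simp add: weight_def algebra_simps)
  then have "i + j + k < i' + j' + k' + 1" by (simp only: mult_less_cancel2)
  then show ?thesis by simp
qed

text \<open>Degrees add under multiplication in the Kronecker image, and the total degree is the top
  digit of the weight. \<open>W\<close> exceeds the degree bounds of all three polynomials.\<close>

lemma deg3_dvd:
  fixes f h :: "int poly poly poly"
  assumes "f dvd h" "h \<noteq> 0" "deg3 h n"
  shows "deg3 f n"
proof -
  obtain a where h: "h = f * a" using assms(1) by auto
  obtain nf na where nf: "deg3 f nf" and na: "deg3 a na" using deg3_exists by metis
  define W where "W = n + nf + na + 1"
  have nW: "n < W" by (simp add: W_def)
  have nz: "f \<noteq> 0" "a \<noteq> 0" using h assms by auto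
  have "kron W f \<noteq> 0" "kron W a \<noteq> 0"
    using kron_nonzero[OF nf _ nz(1)] kron_nonzero[OF na _ nz(2)] by (simp_all add: W_def)
  then have deg: "degree (kron W h) = degree (kron W f) + degree (kron W a)"
    unfolding h kron_mult by (rule degree_mult_eq)
  obtain i' j' k' where h': "degree (kron W h) = weight W i' j' k'" "i' + j' + k' \<le> n"
    using kron_degree[OF assms(3) nW assms(2)] by metis
  show ?thesis unfolding deg3_iff
  proof (intro allI impI)
    fix i j k assume "coeff3 f i j k \<noteq> 0"
    then have "weight W i j k \<le> weight W i' j' k'"
      using le_kron_degree[OF nf, of W i j k] deg h'(1) by (simp add: W_def)
    then have "i + j + k \<le> i' + j' + k'"
      by (rule weight_less) (use h'(2) in \<open>simp_all add: W_def\<close>)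
    then show "i + j + k \<le> n" using h'(2) by simp
  qed
qed

text \<open>The triple is the leading monomial of \<open>f\<close> in the order given by the weight,
  and leading monomials multiply. It has full degree \<open>d\<close> because this order compares
  total degrees first.\<close>

theorem leading_monomial:
  fixes f :: "int poly poly poly"
  assumes f: "deg3 f d" "coeff3 f i0 j0 k0 \<noteq> 0" "i0 + j0 + k0 = d"
  obtains a b c where "a + b + c = d"
    "\<And>h. f dvd h \<Longrightarrow> h \<noteq> 0 \<Longrightarrow> deg3 h D \<Longrightarrow> \<exists>i j k. a \<le> i \<and> b \<le> j \<and> c \<le> k \<and> coeff3 h i j k \<noteq> 0"
proof -
  \<comment> \<open>The exponents in a product of two leading monomials, up to \<open>D + d\<close>,
    must still be digits.\<close>
  define W where "W = 2 * (D + d) + 1"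
  have "d < W" by (simp add: W_def)
  have f0: "f \<noteq> 0" using f(2) by (auto simp: coeff3_def)
  obtain a b c where abc: "degree (kron W f) = weight W a b c" "a + b + c \<le> d"
    using kron_degree[OF f(1) \<open>d < W\<close> f0] by metis
  have "weight W i0 j0 k0 \<le> weight W a b c"
    using le_kron_degree[OF f(1) \<open>d < W\<close> f(2)] abc(1) by simp
  then have "i0 + j0 + k0 \<le> a + b + c"
    by (rule weight_less) (use abc(2) in \<open>simp_all add: W_def\<close>)
  then have eq: "a + b + c = d" using abc(2) f(3) by simp
  have "\<exists>i j k. a \<le> i \<and> b \<le> j \<and> c \<le> k \<and> coeff3 h i j k \<noteq> 0" if h: "f dvd h" "h \<noteq> 0" "deg3 h D" for h
  proof -
    obtain q where q: "h = f * q" using h(1) by auto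
    then have qd: "deg3 q D" using deg3_dvd[of q h D] h by simp
    have q0: "q \<noteq> 0" using q h by auto
    have DW: "D < W" by (simp add: W_def)
    have deg: "degree (kron W h) = degree (kron W f) + degree (kron W q)"
      unfolding q kron_mult using kron_nonzero[OF f(1) \<open>d < W\<close> f0] kron_nonzero[OF qd DW q0] by (rule degree_mult_eq)
    obtain i j k where ijk: "degree (kron W h) = weight W i j k" "coeff3 h i j k \<noteq> 0" "i + j + k \<le> D"
      using kron_degree[OF h(3) DW h(2)] by metis
    obtain i' j' k' where q': "degree (kron W q) = weight W i' j' k'" "i' + j' + k' \<le> D"
      using kron_degree[OF qd DW q0] by metis
    have "weight W i j k = weight W (a + i') (b + j') (c + k')"
      using deg by (simp add: abc(1) q'(1) ijk(1) weight_add)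
    then have "i = a + i' \<and> j = b + j' \<and> k = c + k'"
      by (rule weight_inj) (use ijk(3) q'(2) abc(2) in \<open>simp_all add: W_def\<close>)
    then show ?thesis using ijk(2) by (intro exI[of _ i] exI[of _ j] exI[of _ k]) simp
  qed
  with eq show ?thesis using that by blast
qed

lemma deg3_const: "deg3 [:h:] n \<longleftrightarrow> deg2 h n"
  unfolding deg3_iff deg2_iff coeff3_def by (auto simp: coeff_pCons split: nat.splits)

lemma const_dvd_const: "h dvd g \<Longrightarrow> [:h:] dvd [:g:]" for h g :: "'a::comm_ring_1"
proof -
  assume "h dvd g"
  then obtain k where "g = h * k" by (rule dvdE)
  then have "[:g:] = [:h:] * [:k:]" by simp
  then show "[:h:] dvd [:g:]" by (metis dvd_triv_left)
qed

lemma deg2_dvd: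
  assumes "f dvd h" "h \<noteq> 0" "deg2 h n"
  shows "deg2 (f :: int poly poly) n"
  using deg3_dvd[of "[:f:]" "[:h:]" n] assms by (simp add: deg3_const const_dvd_const)

text \<open>The components of the curve \<open>R = 0\<close>; constant primes, which vanish nowhere,
  are left out.\<close>

definition plane_factors :: "int poly poly \<Rightarrow> int poly poly set" where
  "plane_factors R = {h \<in> prime_factors R. \<not> deg2 h 0}"

lemma plane_factors_finite: "finite (plane_factors R)"
  by (simp add: plane_factors_def)

text \<open>Each non-constant factor adds at least 1 to the degree of a Kronecker image. The product
  of the distinct factors divides \<open>R\<close>, so the degree of its image is bounded through
  \<open>n\<close>.\<close>

lemma card_plane_factors:
  assumes "R \<noteq> 0" "deg2 R n"
  shows "card (plane_factors R) \<le> (n + 1) * (n + 1)^2"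
proof -
  define A where "A = plane_factors R"
  define W where "W = n + 1"
  have A: "finite A" "h \<in> A \<Longrightarrow> h dvd R" "h \<in> A \<Longrightarrow> h \<noteq> 0" "h \<in> A \<Longrightarrow> \<not> deg2 h 0" for h
    by (auto simp: A_def plane_factors_def)
  have sub: "A \<subseteq> set_mset (prime_factorization R)" by (auto simp: A_def plane_factors_def)
  have "mset_set A \<subseteq># mset_set (set_mset (prime_factorization R))"
    using sub A(1) by simp
  then have "mset_set A \<subseteq># prime_factorization R"
    using mset_set_set_mset_msubset subset_mset.order_trans by blast
  then have "prod_mset (mset_set A) dvd prod_mset (prime_factorization R)"
    by (rule prod_mset_subset_imp_dvd)
  also have "\<dots> dvd R"
    using prod_mset_prime_factorization_weak[OF assms(1)] by (metis dvd_refl normalize_dvd_iff)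
  finally have dvd: "\<Prod>A dvd R" by (simp add: prod_unfold_prod_mset)
  then have nz: "\<Prod>A \<noteq> 0" using assms(1) by auto
  have hom: "is_hom (\<lambda>h. kron W [:h:])"
    using is_hom_kron[of W] unfolding is_hom_def
    by (metis (no_types, lifting) add_0 add_pCons mult_pCons_left mult_zero_left add.right_neutral pCons_0_0 pCons_one smult_pCons smult_0_right)
  have P: "deg3 [:\<Prod>A:] n" using deg2_dvd[OF dvd assms] by (simp add: deg3_const)
  have nW: "n < W" by (simp add: W_def)
  have hd: "deg3 [:h:] n" if "h \<in> A" for h
    using deg2_dvd[OF A(2)[OF that] assms] by (simp add: deg3_const)
  have h1: "kron W [:h:] \<noteq> 0 \<and> 1 \<le> degree (kron W [:h:])" if h: "h \<in> A" for h
  proof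
    show "kron W [:h:] \<noteq> 0" using kron_nonzero[OF hd[OF h] nW] A(3)[OF h] by simp
    obtain i j where ij: "coeff (coeff h i) j \<noteq> 0" "i + j > 0"
      using A(4)[OF h] by (auto simp: deg2_iff)
    have "1 * 1 \<le> (i + j) * W^2" using ij(2) by (intro mult_le_mono) (auto simp: W_def)
    also have "\<dots> \<le> weight W 0 i j" by (simp add: weight_def)
    also have "\<dots> \<le> degree (kron W [:h:])"
      using le_kron_degree[OF hd[OF h] nW, of 0 i j] ij(1) by (simp add: coeff3_def)
    finally show "1 \<le> degree (kron W [:h:])" by simp
  qed
  have "card A = (\<Sum>h\<in>A. 1)" by simp
  also have "\<dots> \<le> (\<Sum>h\<in>A. degree (kron W [:h:]))" using h1 by (intro sum_mono) auto
  also have "\<dots> = degree (\<Prod>h\<in>A. kron W [:h:])"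
    using h1 by (subst degree_prod_eq_sum_degree) auto
  also have "(\<Prod>h\<in>A. kron W [:h:]) = kron W [:\<Prod>A:]"
    using is_hom_prod[OF hom, of "\<lambda>h. h" A] by simp
  also have "degree (kron W [:\<Prod>A:]) \<le> (n + 1) * W^2"
  proof -
    obtain i j k where d: "degree (kron W [:\<Prod>A:]) = weight W i j k" "i + j + k \<le> n"
      using kron_degree[OF P nW] nz by (metis pCons_eq_0_iff)
    have "i * W + j \<le> n * W + n" using d(2) by (intro add_mono mult_le_mono1) auto
    also have "\<dots> \<le> W^2" by (simp add: W_def power2_eq_square)
    finally have "weight W i j k \<le> n * W^2 + W^2"
      using d(2) unfolding weight_def add.assoc[of "_ * W^2"] by (intro add_mono mult_le_mono1)
    then show ?thesis by (simp add: d(1))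
  qed
  finally show ?thesis by (simp add: A_def W_def)
qed

lemma plane_factor_vanishes:
  assumes "R \<noteq> 0" "eval2 R a b = 0"
  shows "\<exists>h\<in>plane_factors R. eval2 h a b = 0"
proof -
  have hom: "is_hom (\<lambda>h. eval2 h a b)" by (simp add: is_hom_def)
  have prodm: "eval2 (prod_mset F) a b = (\<Prod>h\<in>#F. eval2 h a b)" for F :: "int poly poly multiset"
    by (induction F) simp_all
  have "R dvd prod_mset (prime_factorization R)"
    using prod_mset_prime_factorization_weak[OF assms(1)] by (metis dvd_refl dvd_normalize_iff normalize_dvd_iff)
  then have "eval2 (prod_mset (prime_factorization R)) a b = 0" using assms(2) by (auto elim!: dvdE)
  then have "\<exists>h\<in>prime_factors R. eval2 h a b = 0" by (auto simp: prodm prod_mset_zero_iff)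
  then obtain h where h: "h \<in> prime_factors R" "eval2 h a b = 0" by blast
  have "\<not> deg2 h 0"
  proof
    assume "deg2 h 0"
    then have "degree h = 0" "degree (coeff h 0) = 0"
      using deg2_coeff_bound[of h 0 0] by auto
    then obtain x where "h = [:[:x:]:]" by (metis coeff_pCons_0 degree_eq_zeroE)
    then have "h = 0" using h(2) by simp
    then show False using h(1) by auto
  qed
  then show ?thesis using h by (auto simp: plane_factors_def)
qed

lemma plane_factor_prime: "h \<in> plane_factors R \<Longrightarrow> prime_elem h \<and> h dvd R"
  by (auto simp: plane_factors_def in_prime_factors_iff)

lemma deg3_0_iff: "deg3 f 0 \<longleftrightarrow> (\<exists>c. f = [:[:[:c:]:]:])" for f :: "'a::idom poly poly poly"
proof
  assume f: "deg3 f 0"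
  then have "degree f = 0" "deg2 (coeff f 0) 0" using deg3_coeff_bound[of f 0 0] by auto
  moreover then have "degree (coeff f 0) = 0" "degree (coeff (coeff f 0) 0) = 0"
    using deg2_coeff_bound[of "coeff f 0" 0 0] by auto
  ultimately show "\<exists>c. f = [:[:[:c:]:]:]" by (metis coeff_pCons_0 degree_eq_zeroE)
qed (auto simp: deg3_const deg2_iff coeff_pCons split: nat.splits)

lemma map_poly3_const: "\<phi> 0 = 0 \<Longrightarrow> map_poly3 \<phi> [:[:[:c:]:]:] = [:[:[:\<phi> c:]:]:]"
  by (simp add: map_poly3_def map_poly_pCons)

lemma coeff3_map_poly3: "\<phi> 0 = 0 \<Longrightarrow> coeff3 (map_poly3 \<phi> f) i j k = \<phi> (coeff3 f i j k)"
  by (simp add: map_poly3_def coeff3_def coeff_map_poly)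

lemma is_unit_const3: "is_unit f \<Longrightarrow> \<exists>c. f = [:[:[:c:]:]:]" for f :: "'a::field poly poly poly"
  by (auto simp: is_unit_poly_iff)

lemma constant_if_no_prime_factor:
  fixes f :: "int poly poly poly"
  assumes "f \<noteq> 0" "\<And>p. prime p \<Longrightarrow> p dvd f \<Longrightarrow> deg3 p 0"
  shows "deg3 f 0"
  using assms
proof (induction f rule: prime_divisors_induct)
  case (unit x)
  then have "x dvd 1" by simp
  then show ?case using deg3_dvd[of x 1 0] F3.D_1 by simp
next
  case (factor p x)
  then have "deg3 p 0" "deg3 x 0" by (auto intro: dvd_mult)
  then show ?case using F3.D_mult[of p 0 x 0] by simp
qed simp

text \<open>Over the complex numbers one of any two factors is constant, so over the integers a
  single non-constant prime remains. \<open>f\<close> itself may fail to be prime because of an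
  integer factor, which \<open>c\<close> collects.\<close>

lemma irreducible_over_int:
  fixes f :: "int poly poly poly"
  assumes "irreducible (map_poly3 (of_int :: int \<Rightarrow> complex) f)"
  obtains c p where "f = [:[:[:c:]:]:] * p" "c \<noteq> 0" "prime_elem p"
proof -
  let ?\<mu> = "map_poly3 (of_int :: int \<Rightarrow> complex)"
  have hom: "is_hom ?\<mu>" by (intro is_hom_map_poly3 is_hom_of_int)
  have const: "deg3 g 0" if unit: "is_unit (?\<mu> g)" for g
  proof -
    obtain c where "?\<mu> g = [:[:[:c:]:]:]" using is_unit_const3[OF unit] by blast
    then have "deg3 (?\<mu> g) 0" by (auto simp: deg3_0_iff)
    then show ?thesis by (auto simp: deg3_iff coeff3_map_poly3)
  qed
  have f0: "f \<noteq> 0" using assms hom by (auto simp: is_hom_def)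
  have "\<not> deg3 f 0"
  proof
    assume "deg3 f 0"
    then obtain c where c: "f = [:[:[:c:]:]:]" by (auto simp: deg3_0_iff)
    then have "is_unit (?\<mu> f)" using f0 by (auto simp: map_poly3_const is_unit_poly_iff dvd_field_iff)
    then show False using assms irreducible_not_unit by blast
  qed
  then obtain p where p: "prime p" "p dvd f" "\<not> deg3 p 0"
    using constant_if_no_prime_factor[OF f0] by blast
  then obtain g where g: "f = p * g" by auto
  then have "?\<mu> f = ?\<mu> p * ?\<mu> g" using hom by (simp add: is_hom_def)
  then have "is_unit (?\<mu> p) \<or> is_unit (?\<mu> g)" using assms irreducibleD by blast
  then have "deg3 g 0" using const p(3) by blast
  then obtain c where "g = [:[:[:c:]:]:]" by (auto simp: deg3_0_iff)
  then show ?thesis using that[of c p] g f0 p(1) by (auto simp: mult.commute)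
qed

section \<open>Auxiliary polynomials for a residue class\<close>

text \<open>The factor \<open>q ^ s j\<close> is already present, so the coefficient belonging to
  \<open>j\<close> matters only modulo \<open>q ^ (k - s j)\<close>; this keeps the number of
  residue vectors small. Two coefficient vectors from the box with equal residues differ by a
  combination that is divisible by \<open>q ^ k\<close> and smaller than it at every point, hence
  zero. It is the determinant method with the pigeonhole principle in place of the
  determinant.\<close>

lemma small_vanishing_combination:
  fixes m :: "'i \<Rightarrow> 'p \<Rightarrow> int" and a :: "'i \<Rightarrow> 'j \<Rightarrow> int" and W :: "'i \<Rightarrow> nat" and q k :: nat
  assumes fin: "finite I" "finite J" and q: "q > 0"
    and expand: "\<And>i y. i \<in> I \<Longrightarrow> y \<in> S \<Longrightarrow> [m i y = (\<Sum>j\<in>J. a i j * int q ^ s j * \<theta> j y)] (mod int q ^ k)"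
    and s: "\<And>j. j \<in> J \<Longrightarrow> s j \<le> k"
    and count: "(\<Prod>j\<in>J. q ^ (k - s j)) < (\<Prod>i\<in>I. W i + 1)"
    and size: "\<And>y. y \<in> S \<Longrightarrow> (\<Sum>i\<in>I. int (W i) * \<bar>m i y\<bar>) < int q ^ k"
  shows "\<exists>c. (\<exists>i\<in>I. c i \<noteq> 0) \<and> (\<forall>y\<in>S. (\<Sum>i\<in>I. c i * m i y) = 0)"
proof -
  define C where "C = PiE I (\<lambda>i. {0..int (W i)})"
  define R where "R = PiE J (\<lambda>j. {0..<int (q ^ (k - s j))})"
  define \<Phi> where "\<Phi> c = restrict (\<lambda>j. (\<Sum>i\<in>I. c i * a i j) mod int (q ^ (k - s j))) J" for c
  have "card C = (\<Prod>i\<in>I. W i + 1)" using fin by (simp add: C_def card_PiE nat_add_distrib)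
  moreover have "card R = (\<Prod>j\<in>J. q ^ (k - s j))" using fin by (simp add: R_def card_PiE nat_power_eq)
  ultimately have "card R < card C" using count by simp
  moreover have "\<Phi> ` C \<subseteq> R" using q by (auto simp: \<Phi>_def R_def)
  moreover have "finite R" using fin by (auto simp: R_def intro: finite_PiE)
  ultimately have "\<not> inj_on \<Phi> C" using card_inj_on_le by (metis not_le)
  then obtain c c' where c: "c \<in> C" "c' \<in> C" "c \<noteq> c'" "\<Phi> c = \<Phi> c'" by (auto simp: inj_on_def)
  define e where "e i = c i - c' i" for i
  have "\<exists>i\<in>I. e i \<noteq> 0"
  proof (rule ccontr)
    assume "\<not> ?thesis"
    then have "c = c'" using c(1,2) unfolding C_def e_def by (intro PiE_ext) auto
    then show False using c(3) by simp
  qed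
  moreover have "(\<Sum>i\<in>I. e i * m i y) = 0" if y: "y \<in> S" for y
  proof -
    have bound: "\<bar>e i\<bar> \<le> int (W i)" if "i \<in> I" for i
    proof -
      have "c i \<in> {0..int (W i)}" "c' i \<in> {0..int (W i)}" using c(1,2) that unfolding C_def by auto
      then show ?thesis unfolding e_def by auto
    qed
    have dvd: "int q ^ (k - s j) dvd (\<Sum>i\<in>I. e i * a i j)" if "j \<in> J" for j
    proof -
      have "(\<Sum>i\<in>I. c i * a i j) mod int (q ^ (k - s j)) = (\<Sum>i\<in>I. c' i * a i j) mod int (q ^ (k - s j))"
        using fun_cong[OF c(4), of j] that by (simp add: \<Phi>_def)
      then show ?thesis
        by (simp add: mod_eq_dvd_iff e_def left_diff_distrib sum_subtractf)
    qed
    have "[(\<Sum>i\<in>I. e i * m i y) = (\<Sum>i\<in>I. e i * (\<Sum>j\<in>J. a i j * int q ^ s j * \<theta> j y))] (mod int q ^ k)"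
      using expand[OF _ y] by (intro cong_sum cong_mult cong_refl)
    also have "(\<Sum>i\<in>I. e i * (\<Sum>j\<in>J. a i j * int q ^ s j * \<theta> j y))
        = (\<Sum>j\<in>J. (\<Sum>i\<in>I. e i * a i j) * int q ^ s j * \<theta> j y)"
      by (simp add: sum_distrib_left sum_distrib_right mult.assoc sum.swap[of _ J])
    also have "[\<dots> = 0] (mod int q ^ k)"
      unfolding cong_0_iff
    proof (rule dvd_sum)
      fix j assume j: "j \<in> J"
      have "int q ^ k = int q ^ (k - s j) * int q ^ s j" using s[OF j] by (simp flip: power_add)
      also have "\<dots> dvd (\<Sum>i\<in>I. e i * a i j) * int q ^ s j" using dvd[OF j] by (rule mult_dvd_mono) simp
      finally show "int q ^ k dvd (\<Sum>i\<in>I. e i * a i j) * int q ^ s j * \<theta> j y" by (rule dvd_mult2)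
    qed
    finally have "int q ^ k dvd (\<Sum>i\<in>I. e i * m i y)" by (simp add: cong_0_iff)
    moreover have "\<bar>\<Sum>i\<in>I. e i * m i y\<bar> < int q ^ k"
    proof -
      have "\<bar>\<Sum>i\<in>I. e i * m i y\<bar> \<le> (\<Sum>i\<in>I. \<bar>e i * m i y\<bar>)" by (rule sum_abs)
      also have "\<dots> \<le> (\<Sum>i\<in>I. int (W i) * \<bar>m i y\<bar>)"
        using bound by (intro sum_mono) (auto simp: abs_mult intro: mult_right_mono)
      finally show ?thesis using size[OF y] by simp
    qed
    ultimately show ?thesis by (metis zdvd_not_zless abs_eq_0 abs_ge_zero dvd_abs_iff order_le_less)
  qed
  ultimately show ?thesis by blast
qed

text \<open>The ranges \<open>N ^ (D - \<delta> i)\<close> give every monomial the same share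
  \<open>N ^ D\<close> in the size of the combination. With fewer than \<open>N\<close> monomials
  the total stays below N^(D + 1), and \<open>D + 1 = (n + 1) * l\<close> and
  \<open>k = 2 * n * l\<close> are chosen so that the lower bound for \<open>q\<close> turns this
  into a bound by \<open>q ^ k\<close>. The hypothesis \<open>count\<close> is the pigeonhole
  inequality in exponents of \<open>N\<close>, by the upper bound for \<open>q\<close>.\<close>

lemma weighted_vanishing_combination:
  fixes m :: "'i \<Rightarrow> 'p \<Rightarrow> int" and N q n l D :: nat
  defines "k \<equiv> 2 * n * l"
  assumes fin: "finite I" "finite J" "I \<noteq> {}" and n: "n \<ge> 1"
    and q: "N ^ (n + 1) \<le> q ^ (2 * n)" "q ^ (2 * n) \<le> N ^ (n + 2)"
    and D: "D + 1 = (n + 1) * l"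
    and N: "card I < N"
    and \<delta>: "\<And>i. i \<in> I \<Longrightarrow> \<delta> i \<le> D" "\<And>i y. i \<in> I \<Longrightarrow> y \<in> S \<Longrightarrow> \<bar>m i y\<bar> \<le> int N ^ \<delta> i"
    and expand: "\<And>i y. i \<in> I \<Longrightarrow> y \<in> S \<Longrightarrow> [m i y = (\<Sum>j\<in>J. a i j * int q ^ s j * \<theta> j y)] (mod int q ^ k)"
    and s: "\<And>j. j \<in> J \<Longrightarrow> s j \<le> k"
    and count: "(n + 2) * (\<Sum>j\<in>J. k - s j) \<le> 2 * n * (\<Sum>i\<in>I. D - \<delta> i)"
  shows "\<exists>c. (\<exists>i\<in>I. c i \<noteq> 0) \<and> (\<forall>y\<in>S. (\<Sum>i\<in>I. c i * m i y) = 0)"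
proof (rule small_vanishing_combination[where W = "\<lambda>i. N ^ (D - \<delta> i)" and q = q and k = k, OF fin(1,2) _ expand s])
  have N0: "N > 0" using N by simp
  have "0 < q ^ (2 * n)" using q(1) N0 by (meson less_le_trans zero_less_power)
  then show q0: "q > 0" using n by (cases "q = 0") auto
  show "(\<Prod>j\<in>J. q ^ (k - s j)) < (\<Prod>i\<in>I. N ^ (D - \<delta> i) + 1)"
  proof -
    let ?K = "\<Sum>j\<in>J. k - s j" and ?W = "\<Sum>i\<in>I. D - \<delta> i"
    \<comment> \<open>Compared after raising to the power \<open>2 * n\<close>, as the exponent of
      \<open>q\<close> in terms of \<open>N\<close> is a fraction with this denominator.\<close>
    have "(q ^ ?K) ^ (2 * n) = (q ^ (2 * n)) ^ ?K" by (simp add: mult.commute flip: power_mult)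
    also have "\<dots> \<le> (N ^ (n + 2)) ^ ?K" using q(2) by (rule power_mono) simp
    also have "\<dots> = N ^ ((n + 2) * ?K)" by (rule power_mult[symmetric])
    also have "\<dots> \<le> N ^ (2 * n * ?W)" using count N0 by (intro power_increasing) auto
    also have "\<dots> = (N ^ ?W) ^ (2 * n)" by (simp only: power_mult[symmetric] mult.commute)
    finally have "q ^ ?K \<le> N ^ ?W" using n by (simp add: power_mono_iff)
    then have "(\<Prod>j\<in>J. q ^ (k - s j)) \<le> (\<Prod>i\<in>I. N ^ (D - \<delta> i))" by (simp add: power_sum)
    also have "\<dots> < (\<Prod>i\<in>I. N ^ (D - \<delta> i) + 1)"
    proof -
      obtain i where "i \<in> I" using fin(3) by auto
      then show ?thesis using fin N0 by (intro prod_mono_strict[of i]) auto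
    qed
    finally show ?thesis .
  qed
  show "(\<Sum>i\<in>I. int (N ^ (D - \<delta> i)) * \<bar>m i y\<bar>) < int q ^ k" if y: "y \<in> S" for y
  proof -
    have "(\<Sum>i\<in>I. int (N ^ (D - \<delta> i)) * \<bar>m i y\<bar>) \<le> (\<Sum>i\<in>I. int N ^ D)"
    proof (rule sum_mono)
      fix i assume i: "i \<in> I"
      have "int (N ^ (D - \<delta> i)) * \<bar>m i y\<bar> \<le> int (N ^ (D - \<delta> i)) * int N ^ \<delta> i"
        using \<delta>(2)[OF i y] by (intro mult_left_mono) auto
      also have "\<dots> = int N ^ D" using \<delta>(1)[OF i] by (simp flip: power_add)
      finally show "int (N ^ (D - \<delta> i)) * \<bar>m i y\<bar> \<le> int N ^ D" .
    qed
    also have "\<dots> = int (card I) * int N ^ D" by simp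
    also have "\<dots> < int N * int N ^ D" using N N0 by (intro mult_strict_right_mono) auto
    also have "\<dots> = int ((N ^ (n + 1)) ^ l)" using D by (simp flip: power_mult power_Suc)
    also have "\<dots> \<le> int ((q ^ (2 * n)) ^ l)" using q(1) by (intro of_nat_mono power_mono) auto
    also have "\<dots> = int q ^ k" by (simp add: k_def flip: power_mult)
    finally show ?thesis .
  qed
qed

section \<open>Hensel's lemma with polynomial dependence on parameters\<close>

lemma poly_taylor2: "\<exists>r. poly F (x + h) = poly F x + h * poly (pderiv F) x + h^2 * r" for F :: "int poly"
proof (induction F)
  case (pCons a F)
  then obtain r where "poly F (x + h) = poly F x + h * poly (pderiv F) x + h^2 * r" by blast
  then have "poly (pCons a F) (x + h) = poly (pCons a F) x + h * poly (pderiv (pCons a F)) x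
      + h^2 * (poly (pderiv F) x + x * r + h * r)"
    by (simp add: pderiv_pCons algebra_simps power2_eq_square)
  then show ?case ..
qed simp

text \<open>Newton's iteration with a fixed approximate inverse \<open>w\<close> of the derivative
  gains one power of \<open>q\<close> per step. It uses ring operations only, so the approximations
  stay in the function ring \<open>A\<close>; and as all points share \<open>e\<close> and
  \<open>w\<close>, one function serves the whole class.\<close>

lemma hensel_parametrization:
  fixes A :: "('p \<Rightarrow> int) set" and F :: "'p \<Rightarrow> int poly" and q :: int
  assumes const: "\<And>c. (\<lambda>_. c) \<in> A"
    and add: "\<And>x y. x \<in> A \<Longrightarrow> y \<in> A \<Longrightarrow> (\<lambda>p. x p + y p) \<in> A"
    and mult: "\<And>x y. x \<in> A \<Longrightarrow> y \<in> A \<Longrightarrow> (\<lambda>p. x p * y p) \<in> A"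
    and F: "\<And>j. (\<lambda>p. coeff (F p) j) \<in> A" "\<And>p. degree (F p) < n"
    and root: "\<And>p. p \<in> S \<Longrightarrow> poly (F p) (\<eta> p) = 0"
    and simple: "\<And>p. p \<in> S \<Longrightarrow> [w * poly (pderiv (F p)) (\<eta> p) = 1] (mod q)"
    and base: "\<And>p. p \<in> S \<Longrightarrow> [\<eta> p = e] (mod q)"
  shows "\<exists>\<phi>\<in>A. \<forall>p\<in>S. [\<eta> p = \<phi> p] (mod q ^ k)"
proof (cases k)
  case 0
  then show ?thesis using const by (intro bexI[of _ "\<lambda>_. 0"]) auto
next
  case (Suc k')
  have sum: "(\<lambda>p. \<Sum>j<n. g j p) \<in> A" if "\<And>j. g j \<in> A" for g :: "nat \<Rightarrow> 'p \<Rightarrow> int" and n :: nat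
    by (induction n) (auto intro: const add that)
  have pow: "(\<lambda>p. x p ^ j) \<in> A" if "x \<in> A" for x and j :: nat
    by (induction j) (auto intro: const mult that)
  have ev: "(\<lambda>p. poly (F p) (\<phi> p)) \<in> A" if "\<phi> \<in> A" for \<phi>
  proof -
    have "poly (F p) (\<phi> p) = (\<Sum>j<n. coeff (F p) j * \<phi> p ^ j)" for p
      unfolding poly_altdef using F(2)[of p] by (intro sum.mono_neutral_left) (auto simp: coeff_eq_0)
    then show ?thesis using sum[of "\<lambda>j p. coeff (F p) j * \<phi> p ^ j"] mult F(1) pow[OF that] by simp
  qed
  have "\<exists>\<phi>\<in>A. \<forall>p\<in>S. [\<eta> p = \<phi> p] (mod q ^ Suc k')" for k'
  proof (induction k')
    case 0
    then show ?case using const base by (intro bexI[of _ "\<lambda>_. e"]) auto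
  next
    case (Suc k)
    then obtain \<phi> where \<phi>: "\<phi> \<in> A" "\<And>p. p \<in> S \<Longrightarrow> [\<eta> p = \<phi> p] (mod q ^ Suc k)" by blast
    \<comment> \<open>Since \<open>w\<close> inverts the derivative only modulo \<open>q\<close>,
      the error \<open>h\<close> is replaced by a combination of \<open>q * h\<close> and
      \<open>h * h\<close>; both are divisible by the next power of \<open>q\<close>.\<close>
    define \<phi>' where "\<phi>' p = \<phi> p + (- w) * poly (F p) (\<phi> p)" for p
    have "\<phi>' \<in> A" unfolding \<phi>'_def by (intro add mult const ev \<phi>(1))
    moreover have "[\<eta> p = \<phi>' p] (mod q ^ Suc (Suc k))" if p: "p \<in> S" for p
    proof -
      obtain t where t: "\<eta> p - \<phi> p = q ^ Suc k * t"
        using \<phi>(2)[OF p] by (auto simp: cong_iff_dvd_diff)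
      define h where "h = q ^ Suc k * t"
      obtain r where r: "poly (F p) (\<eta> p + - h) = poly (F p) (\<eta> p) + - h * poly (pderiv (F p)) (\<eta> p) + (- h)^2 * r"
        using poly_taylor2 by blast
      have "\<phi> p = \<eta> p + - h" using t by (simp add: h_def)
      then have F\<phi>: "poly (F p) (\<phi> p) = - h * poly (pderiv (F p)) (\<eta> p) + h^2 * r"
        using r root[OF p] by simp
      obtain v where v: "w * poly (pderiv (F p)) (\<eta> p) = 1 + q * v"
        using simple[OF p] by (metis cong_iff_lin cong_sym)
      have "\<eta> p - \<phi>' p = h + w * poly (F p) (\<phi> p)" using t by (simp add: \<phi>'_def h_def)
      also have "\<dots> = h - h * (w * poly (pderiv (F p)) (\<eta> p)) + w * h^2 * r"
        unfolding F\<phi> by (simp add: algebra_simps)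
      also have "\<dots> = q * h * (- v) + h * h * (w * r)"
        unfolding v by (simp add: algebra_simps power2_eq_square)
      finally have eq: "\<eta> p - \<phi>' p = q * h * (- v) + h * h * (w * r)" .
      have 1: "q ^ Suc (Suc k) dvd q * h" by (simp add: h_def mult.assoc[symmetric])
      have 2: "q ^ Suc (Suc k) dvd h * h"
      proof -
        have "q ^ Suc (Suc k) dvd q ^ (Suc k + Suc k)" by (rule le_imp_power_dvd) simp
        also have "\<dots> dvd h * h" by (simp add: h_def power_add mult_dvd_mono)
        finally show ?thesis .
      qed
      show ?thesis unfolding cong_iff_dvd_diff eq by (rule dvd_add[OF dvd_mult2[OF 1] dvd_mult2[OF 2]])
    qed
    ultimately show ?case by blast
  qed
  then show ?thesis using Suc by blast
qed

definition triples :: "nat \<Rightarrow> (nat \<times> nat \<times> nat) set" where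
  "triples n = {(i, j, k). i + j + k \<le> n}"

definition pairs :: "nat \<Rightarrow> (nat \<times> nat) set" where
  "pairs n = {(i, j). i + j \<le> n}"

lemma finite_triples [simp]: "finite (triples n)"
  by (rule finite_subset[of _ "{..n} \<times> {..n} \<times> {..n}"]) (auto simp: triples_def)

lemma finite_pairs [simp]: "finite (pairs n)"
  by (rule finite_subset[of _ "{..n} \<times> {..n}"]) (auto simp: pairs_def)

lemma poly_sum_le: "degree p \<le> n \<Longrightarrow> poly p x = (\<Sum>i\<le>n. coeff p i * x ^ i)" for p :: "'a::comm_ring_1 poly"
  unfolding poly_altdef by (intro sum.mono_neutral_left) (auto simp: coeff_eq_0)

lemma eval2_sum:
  fixes p :: "'a::idom poly poly"
  assumes "deg2 p n"
  shows "eval2 p a b = (\<Sum>(i, j)\<in>pairs n. coeff (coeff p i) j * (a ^ i * b ^ j))"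
proof -
  have d: "degree (map_poly (\<lambda>c. poly c b) p) \<le> n" "degree (coeff p i) \<le> n" for i
    using deg2_coeff_bound[OF assms] map_poly_degree_leq[of "\<lambda>c. poly c b" p] by (auto intro: le_trans)
  have "eval2 p a b = (\<Sum>i\<le>n. (\<Sum>j\<le>n. coeff (coeff p i) j * b ^ j) * a ^ i)"
    unfolding eval2_map poly_sum_le[OF d(1)] by (simp add: coeff_map_poly poly_sum_le[OF d(2)])
  also have "\<dots> = (\<Sum>i\<le>n. \<Sum>j\<le>n. coeff (coeff p i) j * (a ^ i * b ^ j))"
    by (simp add: sum_distrib_right sum_distrib_left mult_ac)
  also have "\<dots> = (\<Sum>(i, j)\<in>{..n} \<times> {..n}. coeff (coeff p i) j * (a ^ i * b ^ j))"
    by (rule sum.cartesian_product)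
  also have "\<dots> = (\<Sum>(i, j)\<in>pairs n. coeff (coeff p i) j * (a ^ i * b ^ j))"
    using assms by (intro sum.mono_neutral_right) (auto simp: pairs_def deg2_iff)
  finally show ?thesis .
qed

lemma eval3_sum:
  fixes p :: "'a::idom poly poly poly"
  assumes "deg3 p n"
  shows "eval3 p a b c = (\<Sum>(i, j, k)\<in>triples n. coeff3 p i j k * (a ^ i * b ^ j * c ^ k))"
proof -
  have d: "degree (map_poly (\<lambda>r. eval2 r b c) p) \<le> n" "deg2 (coeff p i) n" for i
    using deg3_coeff_bound[OF assms] map_poly_degree_leq[of "\<lambda>r. eval2 r b c" p] by (auto intro: le_trans)
  have "eval3 p a b c = (\<Sum>i\<le>n. (\<Sum>(j, k)\<in>pairs n. coeff3 p i j k * (b ^ j * c ^ k)) * a ^ i)"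
    unfolding eval3_map poly_sum_le[OF d(1)] by (simp add: coeff_map_poly eval2_sum[OF d(2)] coeff3_def)
  also have "\<dots> = (\<Sum>i\<le>n. \<Sum>t\<in>pairs n. coeff3 p i (fst t) (snd t) * (a ^ i * b ^ fst t * c ^ snd t))"
    by (simp add: sum_distrib_right sum_distrib_left mult_ac case_prod_unfold)
  also have "\<dots> = (\<Sum>(i, t)\<in>{..n} \<times> pairs n. coeff3 p i (fst t) (snd t) * (a ^ i * b ^ fst t * c ^ snd t))"
    by (rule sum.cartesian_product)
  also have "\<dots> = (\<Sum>(i, t)\<in>triples n. coeff3 p i (fst t) (snd t) * (a ^ i * b ^ fst t * c ^ snd t))"
    using assms by (intro sum.mono_neutral_right finite_cartesian_product finite_pairs finite_atMost)
      (auto simp: pairs_def triples_def deg3_iff)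
  finally show ?thesis by (simp add: case_prod_unfold)
qed

definition poly3_of :: "(nat \<times> nat \<times> nat) set \<Rightarrow> (nat \<times> nat \<times> nat \<Rightarrow> int) \<Rightarrow> int poly poly poly" where
  "poly3_of M c = (\<Sum>(i, j, k)\<in>M. monom (monom (monom (c (i, j, k)) k) j) i)"

definition poly2_of :: "(nat \<times> nat) set \<Rightarrow> (nat \<times> nat \<Rightarrow> int) \<Rightarrow> int poly poly" where
  "poly2_of M c = (\<Sum>(i, j)\<in>M. monom (monom (c (i, j)) j) i)"

lemma coeff3_poly3_of:
  assumes "finite M"
  shows "coeff3 (poly3_of M c) i j k = (if (i, j, k) \<in> M then c (i, j, k) else 0)"
proof -
  have "coeff3 (poly3_of M c) i j k = (\<Sum>t\<in>M. if t = (i, j, k) then c (i, j, k) else 0)"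
    unfolding poly3_of_def coeff3_def coeff_sum by (intro sum.cong) (auto split: prod.splits)
  then show ?thesis using assms by simp
qed

lemma coeff2_poly2_of:
  assumes "finite M"
  shows "coeff (coeff (poly2_of M c) i) j = (if (i, j) \<in> M then c (i, j) else 0)"
proof -
  have "coeff (coeff (poly2_of M c) i) j = (\<Sum>t\<in>M. if t = (i, j) then c (i, j) else 0)"
    unfolding poly2_of_def coeff_sum by (intro sum.cong) (auto split: prod.splits)
  then show ?thesis using assms by simp
qed

lemma deg3_poly3_of: "M \<subseteq> triples n \<Longrightarrow> deg3 (poly3_of M c) n"
  using finite_subset[OF _ finite_triples, of M n] by (auto simp: deg3_iff coeff3_poly3_of triples_def)

lemma deg2_poly2_of: "M \<subseteq> pairs n \<Longrightarrow> deg2 (poly2_of M c) n"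
  using finite_subset[OF _ finite_pairs, of M n] by (auto simp: deg2_iff coeff2_poly2_of pairs_def)

lemma eval3_poly3_of:
  assumes "M \<subseteq> triples n"
  shows "eval3 (poly3_of M c) x y z = (\<Sum>(i, j, k)\<in>M. c (i, j, k) * (x ^ i * y ^ j * z ^ k))"
proof -
  have fin: "finite M" using assms by (rule finite_subset) simp
  show ?thesis unfolding eval3_sum[OF deg3_poly3_of[OF assms]]
    using assms by (intro sum.mono_neutral_cong_right) (auto simp: coeff3_poly3_of[OF fin])
qed

lemma eval2_poly2_of:
  assumes "M \<subseteq> pairs n"
  shows "eval2 (poly2_of M c) x y = (\<Sum>(i, j)\<in>M. c (i, j) * (x ^ i * y ^ j))"
proof -
  have fin: "finite M" using assms by (rule finite_subset) simp
  show ?thesis unfolding eval2_sum[OF deg2_poly2_of[OF assms]]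
    using assms by (intro sum.mono_neutral_cong_right) (auto simp: coeff2_poly2_of[OF fin])
qed

section \<open>Polynomial functions of the displacement from a base point of a class\<close>

definition funs2 :: "('p \<Rightarrow> int) \<Rightarrow> ('p \<Rightarrow> int) \<Rightarrow> ('p \<Rightarrow> int) set" where
  "funs2 U V = {\<lambda>p. eval2 G (U p) (V p) | G. True}"

lemma funs2_const: "(\<lambda>_. c) \<in> funs2 U V"
  unfolding funs2_def by (auto intro!: exI[of _ "[:[:c:]:]"])

lemma funs2_add: "x \<in> funs2 U V \<Longrightarrow> y \<in> funs2 U V \<Longrightarrow> (\<lambda>p. x p + y p) \<in> funs2 U V"
  unfolding funs2_def by (auto simp flip: eval2_simps)

lemma funs2_mult: "x \<in> funs2 U V \<Longrightarrow> y \<in> funs2 U V \<Longrightarrow> (\<lambda>p. x p * y p) \<in> funs2 U V"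
  unfolding funs2_def by (auto simp flip: eval2_simps)

lemma funs2_fst: "U \<in> funs2 U V"
  unfolding funs2_def by (auto intro!: exI[of _ "[:0, 1:]"] simp: eval2_pCons)

lemma funs2_snd: "V \<in> funs2 U V"
  unfolding funs2_def by (auto intro!: exI[of _ "[:[:0, 1:]:]"])

lemma closed_power:
  assumes "\<And>x y. x \<in> A \<Longrightarrow> y \<in> A \<Longrightarrow> (\<lambda>p. x p * y p :: int) \<in> A" "(\<lambda>_. 1) \<in> A" "x \<in> A"
  shows "(\<lambda>p. x p ^ j) \<in> A"
  by (induction j) (auto intro: assms)

text \<open>On a class \<open>U\<close> and \<open>V\<close> are multiples of \<open>q\<close>: a
  term of degree s carries \<open>q ^ s\<close>, and terms of degree \<open>k\<close> or more vanish
  modulo \<open>q ^ k\<close>. The coefficients \<open>a\<close> do not depend on the point, as the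
  pigeonhole argument requires.\<close>

lemma funs2_expansion:
  fixes k :: nat
  assumes "x \<in> funs2 U V"
  obtains a where "\<And>p u v. U p = q * u \<Longrightarrow> V p = q * v \<Longrightarrow>
    [x p = (\<Sum>t\<in>{(i, j). i + j < k}. a t * q ^ (fst t + snd t) * (u ^ fst t * v ^ snd t))] (mod q ^ k)"
proof -
  obtain G where x: "x = (\<lambda>p. eval2 G (U p) (V p))" using assms by (auto simp: funs2_def)
  obtain n0 where "deg3 [:G:] n0" using deg3_exists by blast
  then have G: "deg2 G (max n0 k)" by (auto simp: deg3_const intro: F2.D_mono)
  define n where "n = max n0 k"
  define a where "a t = coeff (coeff G (fst t)) (snd t)" for t
  have "[x p = (\<Sum>t\<in>{(i, j). i + j < k}. a t * q ^ (fst t + snd t) * (u ^ fst t * v ^ snd t))] (mod q ^ k)"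
    if U: "U p = q * u" and V: "V p = q * v" for p u v
  proof -
    let ?g = "\<lambda>t. a t * q ^ (fst t + snd t) * (u ^ fst t * v ^ snd t)"
    have "x p = (\<Sum>t\<in>pairs n. ?g t)"
      unfolding x U V eval2_sum[OF G] n_def[symmetric]
      by (intro sum.cong) (auto simp: a_def power_mult_distrib power_add)
    also have "pairs n = {(i, j). i + j < k} \<union> (pairs n - {(i, j). i + j < k})"
      by (auto simp: pairs_def n_def)
    also have "sum ?g \<dots> = sum ?g {(i, j). i + j < k} + sum ?g (pairs n - {(i, j). i + j < k})"
    proof (rule sum.union_disjoint)
      show "finite {(i, j). i + j < k}"
        by (rule finite_subset[OF _ finite_pairs[of k]]) (auto simp: pairs_def)
    qed auto
    finally have "x p - sum ?g {(i, j). i + j < k} = sum ?g (pairs n - {(i, j). i + j < k})" by simp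
    moreover have "q ^ k dvd \<dots>"
    proof (rule dvd_sum)
      fix t assume "t \<in> pairs n - {(i, j). i + j < k}"
      then have "q ^ k dvd q ^ (fst t + snd t)" by (intro le_imp_power_dvd) auto
      then show "q ^ k dvd ?g t" by (intro dvd_mult2 dvd_mult)
    qed
    ultimately show ?thesis by (simp add: cong_iff_dvd_diff)
  qed
  then show ?thesis by (rule that)
qed

definition funs1 :: "('p \<Rightarrow> int) \<Rightarrow> ('p \<Rightarrow> int) set" where
  "funs1 U = {\<lambda>p. poly G (U p) | G. True}"

lemma funs1_const: "(\<lambda>_. c) \<in> funs1 U"
  unfolding funs1_def by (auto intro!: exI[of _ "[:c:]"])

lemma funs1_add: "x \<in> funs1 U \<Longrightarrow> y \<in> funs1 U \<Longrightarrow> (\<lambda>p. x p + y p) \<in> funs1 U"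
  unfolding funs1_def by (auto simp flip: poly_add)

lemma funs1_mult: "x \<in> funs1 U \<Longrightarrow> y \<in> funs1 U \<Longrightarrow> (\<lambda>p. x p * y p) \<in> funs1 U"
  unfolding funs1_def by (auto simp flip: poly_mult)

lemma funs1_id: "U \<in> funs1 U"
  unfolding funs1_def by (auto intro!: exI[of _ "[:0, 1:]"])

lemma funs1_expansion:
  fixes k :: nat
  assumes "x \<in> funs1 U"
  obtains a where "\<And>p u. U p = q * u \<Longrightarrow> [x p = (\<Sum>t<k. a t * q ^ t * u ^ t)] (mod q ^ k)"
proof -
  obtain G where x: "x = (\<lambda>p. poly G (U p))" using assms by (auto simp: funs1_def)
  define n where "n = max (degree G) k"
  have "[x p = (\<Sum>t<k. coeff G t * q ^ t * u ^ t)] (mod q ^ k)" if U: "U p = q * u" for p u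
  proof -
    let ?g = "\<lambda>t. coeff G t * q ^ t * u ^ t"
    have "x p = (\<Sum>t\<le>n. ?g t)"
      unfolding x U by (subst poly_sum_le[of _ n]) (auto simp: n_def power_mult_distrib mult_ac)
    also have "{..n} = {..<k} \<union> {k..n}" by (auto simp: n_def)
    also have "sum ?g \<dots> = sum ?g {..<k} + sum ?g {k..n}" by (rule sum.union_disjoint) auto
    finally have "x p - sum ?g {..<k} = sum ?g {k..n}" by simp
    moreover have "q ^ k dvd \<dots>"
    proof (rule dvd_sum)
      fix t assume "t \<in> {k..n}"
      then have "q ^ k dvd q ^ t" by (intro le_imp_power_dvd) auto
      then show "q ^ k dvd ?g t" by (intro dvd_mult2[OF dvd_mult])
    qed
    ultimately show ?thesis by (simp add: cong_iff_dvd_diff)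
  qed
  then show ?thesis by (rule that)
qed

text \<open>The sizes of the monomial sets: in degree m at least 4m - 2 monomials in three variables are not
  divisible by a given monomial of degree at least 4.\<close>

definition level :: "nat \<Rightarrow> (nat \<times> nat \<times> nat) set" where
  "level m = {(i, j, k). i + j + k = m}"

lemma card_level: "2 * card (level m) = (m + 1) * (m + 2)" and finite_level: "finite (level m)"
proof -
  have eq: "level m = (\<lambda>(i, j). (i, j, m - i - j)) ` (SIGMA i:{..m}. {..m - i})"
    by (force simp: level_def image_iff)
  show "finite (level m)" unfolding eq by (intro finite_imageI finite_SigmaI) auto
  have "card (level m) = card (SIGMA i:{..m}. {..m - i})"
    unfolding eq by (rule card_image) (auto simp: inj_on_def)
  also have "\<dots> = (\<Sum>i\<le>m. m - i + 1)" by simp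
  also have "\<dots> = (\<Sum>i\<le>m. i + 1)"
    by (rule sum.reindex_bij_witness[of _ "\<lambda>i. m - i" "\<lambda>i. m - i"]) auto
  finally have "card (level m) = (\<Sum>i\<le>m. i + 1)" .
  moreover have "2 * (\<Sum>i\<le>m. i + 1) = (m + 1) * (m + 2)" by (induction m) auto
  ultimately show "2 * card (level m) = (m + 1) * (m + 2)" by simp
qed

lemma card_level_not_divisible:
  assumes "a + b + c = d" "d \<ge> 4" "m \<ge> 1"
  shows "4 * m - 2 \<le> card {(i, j, k) \<in> level m. \<not> (a \<le> i \<and> b \<le> j \<and> c \<le> k)}"
proof -
  let ?B = "{(i, j, k) \<in> level m. a \<le> i \<and> b \<le> j \<and> c \<le> k}"
  have "{(i, j, k) \<in> level m. \<not> (a \<le> i \<and> b \<le> j \<and> c \<le> k)} = level m - ?B" by auto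
  then have eq: "card {(i, j, k) \<in> level m. \<not> (a \<le> i \<and> b \<le> j \<and> c \<le> k)} = card (level m) - card ?B"
    using card_Diff_subset[of ?B "level m"] finite_subset[OF _ finite_level, of ?B m] by auto
  show ?thesis
  proof (cases "m < d")
    case True
    then have "?B = {}" using assms by (auto simp: level_def)
    then have "card ?B = 0" by (simp only: card.empty)
    moreover have "4 * m - 2 \<le> card (level m)"
    proof -
      \<comment> \<open>No multiples occur in this degree, and (m+1)(m+2)/2 - (4m-2) = (m-2)(m-3)/2
        is never negative for integers m.\<close>
      consider "m = 1" | "m = 2" | "m \<ge> 3" using assms(3) by linarith
      then show ?thesis
      proof cases
        case 3
        then obtain r where "m = r + 3" using le_Suc_ex by (metis add.commute)
        then show ?thesis using card_level[of m] by (simp add: algebra_simps)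
      qed (use card_level[of m] in auto)
    qed
    ultimately show ?thesis using eq by linarith
  next
    case False
    have "?B \<subseteq> (\<lambda>(i, j, k). (i + a, j + b, k + c)) ` level (m - d)"
    proof
      fix t assume "t \<in> ?B"
      then obtain i j k where t: "t = (i, j, k)" "i + j + k = m" "a \<le> i" "b \<le> j" "c \<le> k"
        by (auto simp: level_def)
      then have "t = (\<lambda>(i, j, k). (i + a, j + b, k + c)) (i - a, j - b, k - c)"
          "(i - a, j - b, k - c) \<in> level (m - d)"
        using assms(1) by (auto simp: level_def)
      then show "t \<in> (\<lambda>(i, j, k). (i + a, j + b, k + c)) ` level (m - d)" by blast
    qed
    then have "card ?B \<le> card (level (m - d))"
      using card_image_le[OF finite_level] card_mono[OF finite_imageI[OF finite_level]] le_trans by blast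
    then have "2 * card ?B \<le> (m - d + 1) * (m - d + 2)" using card_level[of "m - d"] by simp
    \<comment> \<open>For d = 4 the difference (m+1)(m+2)/2 - (m-3)(m-2)/2 is exactly 4m - 2; a
      larger d leaves fewer multiples.\<close>
    also have "\<dots> \<le> (m - 4 + 1) * (m - 4 + 2)" using assms(2) by (intro mult_le_mono) auto
    finally have B: "2 * card ?B \<le> (m - 4 + 1) * (m - 4 + 2)" .
    obtain r where "m = r + 4" using False assms(2) by (metis add.commute le_Suc_ex le_trans not_less)
    then show ?thesis using B card_level[of m] eq by (simp add: algebra_simps)
  qed
qed

text \<open>The sum is the exponent of \<open>N\<close> in the number of coefficient vectors. With
  \<open>4 * m - 2\<close> monomials in each degree \<open>m\<close> it amounts to about 2 D^3 / 3
  or more.\<close>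

lemma sum_level_weights:
  assumes "a + b + c = d" "d \<ge> 4"
  shows "D * (D - 1) * (2 * D - 1) \<le> 3 * (\<Sum>(i, j, k)\<in>{(i, j, k) \<in> triples D. \<not> (a \<le> i \<and> b \<le> j \<and> c \<le> k)}. D - (i + j + k))"
proof -
  let ?M = "{(i, j, k) \<in> triples D. \<not> (a \<le> i \<and> b \<le> j \<and> c \<le> k)}"
  let ?L = "\<lambda>m. {(i, j, k) \<in> level m. \<not> (a \<le> i \<and> b \<le> j \<and> c \<le> k)}"
  have "(\<Sum>m\<in>{1..D}. (4 * m - 2) * (D - m)) \<le> (\<Sum>m\<in>{1..D}. \<Sum>(i, j, k)\<in>?L m. D - (i + j + k))"
  proof (rule sum_mono)
    fix m assume m: "m \<in> {1..D}"
    have "(\<Sum>(i, j, k)\<in>?L m. D - (i + j + k)) = (\<Sum>t\<in>?L m. D - m)"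
      by (intro sum.cong) (auto simp: level_def)
    then show "(4 * m - 2) * (D - m) \<le> (\<Sum>(i, j, k)\<in>?L m. D - (i + j + k))"
      using card_level_not_divisible[OF assms, of m] m by simp
  qed
  also have "\<dots> = (\<Sum>(i, j, k)\<in>(\<Union>m\<in>{1..D}. ?L m). D - (i + j + k))"
    by (intro sum.UNION_disjoint[symmetric]) (auto simp: level_def intro: finite_subset[OF _ finite_level])
  also have "\<dots> \<le> (\<Sum>(i, j, k)\<in>?M. D - (i + j + k))"
    by (intro sum_mono2) (auto simp: level_def triples_def intro: finite_subset[OF _ finite_triples[of D]])
  finally have "3 * (\<Sum>m\<in>{1..D}. (4 * m - 2) * (D - m)) \<le> 3 * (\<Sum>(i, j, k)\<in>?M. D - (i + j + k))" by simp
  moreover have "D * (D - 1) * (2 * D - 1) = 3 * (\<Sum>m\<in>{1..D}. (4 * m - 2) * (D - m))"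
  proof -
    have *: "(\<Sum>m\<in>{1..n}. (4 * int m - 2) * (int D - int m))
       = 2 * int n ^ 2 * int D - 2 * (\<Sum>m\<in>{1..n}. 2 * int m ^ 2 - int m)" for n
      by (induction n) (auto simp: algebra_simps power2_eq_square)
    have **: "3 * (\<Sum>m\<in>{1..n}. 2 * int m ^ 2 - int m) = 2 * int n ^ 3 + 3 * int n ^ 2 + int n - 3 * (\<Sum>m\<in>{1..n}. int m)" for n
      by (induction n) (auto simp: algebra_simps power2_eq_square power3_eq_cube)
    have ***: "2 * (\<Sum>m\<in>{1..n}. int m) = int n ^ 2 + int n" for n
      by (induction n) (auto simp: algebra_simps power2_eq_square)
    have "int (3 * (\<Sum>m\<in>{1..D}. (4 * m - 2) * (D - m))) = 3 * (\<Sum>m\<in>{1..D}. (4 * int m - 2) * (int D - int m))"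
      by (simp add: of_nat_diff)
    also have "\<dots> = 2 * int D ^ 3 - 3 * int D ^ 2 + int D"
      unfolding * using **[of D] ***[of D] by (simp add: algebra_simps power2_eq_square power3_eq_cube)
    also have "\<dots> = int (D * (D - 1) * (2 * D - 1))"
      by (cases D) (auto simp: algebra_simps power2_eq_square power3_eq_cube)
    finally show ?thesis by linarith
  qed
  ultimately show ?thesis by simp
qed

lemma closed_poly:
  fixes A :: "('p \<Rightarrow> int) set"
  assumes "\<And>c. (\<lambda>_. c) \<in> A" "\<And>x y. x \<in> A \<Longrightarrow> y \<in> A \<Longrightarrow> (\<lambda>p. x p + y p) \<in> A"
    "\<And>x y. x \<in> A \<Longrightarrow> y \<in> A \<Longrightarrow> (\<lambda>p. x p * y p) \<in> A" "x \<in> A"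
  shows "(\<lambda>p. poly r (x p)) \<in> A"
proof (induction r)
  case (pCons a r)
  then show ?case using assms(2)[OF assms(1) assms(3)[OF assms(4) pCons.IH]] by simp
qed (simp add: assms(1))

lemma closed_eval2:
  fixes A :: "('p \<Rightarrow> int) set"
  assumes "\<And>c. (\<lambda>_. c) \<in> A" "\<And>x y. x \<in> A \<Longrightarrow> y \<in> A \<Longrightarrow> (\<lambda>p. x p + y p) \<in> A"
    "\<And>x y. x \<in> A \<Longrightarrow> y \<in> A \<Longrightarrow> (\<lambda>p. x p * y p) \<in> A" "x \<in> A" "y \<in> A"
  shows "(\<lambda>p. eval2 r (x p) (y p)) \<in> A"
proof (induction r)
  case (pCons c r)
  have "(\<lambda>p. poly c (y p)) \<in> A" by (intro closed_poly assms(1-3,5))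
  then show ?case using assms(2)[OF _ assms(3)[OF assms(4) pCons.IH]] by (simp add: eval2_pCons)
qed (simp add: assms(1))

lemma eval2_of_nat: "eval2 (of_nat n) a b = (of_nat n :: 'a::comm_ring_1)"
  by (induction n) auto

lemma eval2_pderiv: "eval2 (pderiv h) a b = poly (pderiv (map_poly (\<lambda>c. poly c b) h)) a" for h :: "int poly poly"
proof -
  have "pderiv (map_poly (\<lambda>c. poly c b) h) = map_poly (\<lambda>c. poly c b) (pderiv h)"
    by (rule poly_eqI) (simp add: coeff_pderiv coeff_map_poly)
  then show ?thesis by (simp add: eval2_map)
qed

lemma eval3_pderiv: "eval3 (pderiv f) a b c = poly (pderiv (map_poly (\<lambda>r. eval2 r b c) f)) a" for f :: "int poly poly poly"
proof -
  have "pderiv (map_poly (\<lambda>r. eval2 r b c) f) = map_poly (\<lambda>r. eval2 r b c) (pderiv f)"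
    by (rule poly_eqI) (simp add: coeff_pderiv coeff_map_poly eval2_of_nat del: of_nat_Suc)
  then show ?thesis by (simp add: eval3_map)
qed

lemma cong_eval2:
  fixes r :: "int poly poly"
  assumes "[a = a'] (mod q)" "[b = b'] (mod q)"
  shows "[eval2 r a b = eval2 r a' b'] (mod q)"
proof -
  have 1: "[poly c b = poly c b'] (mod q)" for c
    by (induction c) (auto intro!: cong_add cong_mult assms)
  show ?thesis by (induction r) (auto simp: eval2_pCons intro!: cong_add cong_mult assms 1)
qed

lemma cong_eval3:
  fixes r :: "int poly poly poly"
  assumes "[a = a'] (mod q)" "[b = b'] (mod q)" "[c = c'] (mod q)"
  shows "[eval3 r a b c = eval3 r a' b' c'] (mod q)"
  by (induction r) (auto simp: eval3_pCons intro!: cong_add cong_mult assms cong_eval2)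

text \<open>A tetrahedral number. It is the exponent of \<open>q\<close> in the number of residue
  vectors, with one residue for every term of degree below \<open>k\<close> in the two
  displacements.\<close>

lemma sum_pairs_weights:
  fixes k :: nat
  shows "6 * (\<Sum>t\<in>{(i, j). i + j < k}. k - (fst t + snd t)) = k * (k + 1) * (k + 2)"
proof -
  have inner: "2 * (\<Sum>j<m. m - j) = m * (m + 1)" for m :: nat
  proof -
    have "(\<Sum>j<m. m - j) = (\<Sum>j<m. Suc (m - Suc j))" by (intro sum.cong) auto
    also have "\<dots> = (\<Sum>j<m. Suc j)" by (rule sum.nat_diff_reindex)
    finally have *: "(\<Sum>j<m. m - j) = (\<Sum>j<m. Suc j)" .
    have "2 * (\<Sum>j<m. Suc j) = m * (m + 1)" by (induction m) auto
    then show ?thesis using * by simp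
  qed
  have eq: "{(i, j). i + j < k} = (SIGMA i:{..<k}. {..<k - i})" by auto
  have "(\<Sum>t\<in>{(i, j). i + j < k}. k - (fst t + snd t)) = (\<Sum>i<k. \<Sum>j<k - i. (k - i) - j)"
    unfolding eq by (subst sum.Sigma) (auto simp: case_prod_unfold)
  then have "2 * (\<Sum>t\<in>{(i, j). i + j < k}. k - (fst t + snd t)) = (\<Sum>i<k. 2 * (\<Sum>j<k - i. (k - i) - j))"
    by (simp only: sum_distrib_left)
  also have "\<dots> = (\<Sum>i<k. (k - i) * (k - i + 1))" by (simp only: inner)
  also have "\<dots> = (\<Sum>i<k. Suc (k - Suc i) * (Suc (k - Suc i) + 1))"
    by (intro sum.cong) (simp_all only: lessThan_iff Suc_diff_Suc)
  also have "\<dots> = (\<Sum>i<k. Suc i * (Suc i + 1))" by (rule sum.nat_diff_reindex)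
  finally have *: "2 * (\<Sum>t\<in>{(i, j). i + j < k}. k - (fst t + snd t)) = (\<Sum>i<k. Suc i * (Suc i + 1))" .
  have "3 * (\<Sum>i<k. Suc i * (Suc i + 1)) = k * (k + 1) * (k + 2)"
    by (induction k) (auto simp: algebra_simps)
  then show ?thesis using * by linarith
qed

text \<open>Only monomials outside the multiples of the leading monomial of \<open>f\<close> enter,
  so a nonzero combination of them cannot be divisible by \<open>f\<close>. \<open>N0\<close> and
  \<open>D\<close> depend on \<open>n\<close> alone.\<close>

theorem surface_class_auxiliary:
  fixes n :: nat
  assumes n: "n \<ge> 1"
  obtains N0 D where "\<And>N q f d i0 j0 k0 S. N \<ge> N0 \<Longrightarrow> N ^ (n + 1) \<le> q ^ (2 * n) \<Longrightarrow> q ^ (2 * n) \<le> N ^ (n + 2) \<Longrightarrow>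
    deg3 f d \<Longrightarrow> i0 + j0 + k0 = d \<Longrightarrow> coeff3 f i0 j0 k0 \<noteq> 0 \<Longrightarrow> d \<ge> 4 \<Longrightarrow>
    (\<And>x y z. (x, y, z) \<in> S \<Longrightarrow> \<bar>x\<bar> \<le> int N \<and> \<bar>y\<bar> \<le> int N \<and> \<bar>z\<bar> \<le> int N \<and> eval3 f x y z = 0
      \<and> coprime (eval3 (pderiv f) x y z) (int q)) \<Longrightarrow>
    (\<And>x y z x' y' z'. (x, y, z) \<in> S \<Longrightarrow> (x', y', z') \<in> S \<Longrightarrow>
      [x = x'] (mod int q) \<and> [y = y'] (mod int q) \<and> [z = z'] (mod int q)) \<Longrightarrow>
    \<exists>g. g \<noteq> 0 \<and> deg3 g D \<and> \<not> f dvd g \<and> (\<forall>(x, y, z)\<in>S. eval3 g x y z = 0)"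
proof -
  \<comment> \<open>Here \<open>D + 1 = 20 * (n + 1)\<close> and \<open>k = 40 * n\<close>, the case
    \<open>l = 20\<close>. The leading terms of the two sides of the counting inequality are in the
    ratio of n^2 (n + 2) to (n + 1)^3; the factor 20 makes the lower terms harmless.\<close>
  define D where "D = 20 * n + 19"
  define k where "k = 2 * n * 20"
  define N0 where "N0 = card (triples D) + 1"
  have main: "\<exists>g. g \<noteq> 0 \<and> deg3 g D \<and> \<not> f dvd g \<and> (\<forall>(x, y, z)\<in>S. eval3 g x y z = 0)"
    if N: "N \<ge> N0" and q: "N ^ (n + 1) \<le> q ^ (2 * n)" "q ^ (2 * n) \<le> N ^ (n + 2)"
      and f: "deg3 f d" and ex: "i0 + j0 + k0 = d" "coeff3 f i0 j0 k0 \<noteq> 0" and d: "d \<ge> 4"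
      and S: "\<And>x y z. (x, y, z) \<in> S \<Longrightarrow> \<bar>x\<bar> \<le> int N \<and> \<bar>y\<bar> \<le> int N \<and> \<bar>z\<bar> \<le> int N \<and> eval3 f x y z = 0
          \<and> coprime (eval3 (pderiv f) x y z) (int q)"
      and cls: "\<And>x y z x' y' z'. (x, y, z) \<in> S \<Longrightarrow> (x', y', z') \<in> S \<Longrightarrow>
          [x = x'] (mod int q) \<and> [y = y'] (mod int q) \<and> [z = z'] (mod int q)"
    for N q f d i0 j0 k0 and S :: "(int \<times> int \<times> int) set"
  proof -
    obtain a b c where abc: "a + b + c = d"
      and lead: "\<And>h. f dvd h \<Longrightarrow> h \<noteq> 0 \<Longrightarrow> deg3 h D \<Longrightarrow> \<exists>i j k. a \<le> i \<and> b \<le> j \<and> c \<le> k \<and> coeff3 h i j k \<noteq> 0"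
      using leading_monomial[OF f ex(2,1), of D] by blast
    define M where "M = {(i, j, k) \<in> triples D. \<not> (a \<le> i \<and> b \<le> j \<and> c \<le> k)}"
    have Msub: "M \<subseteq> triples D" by (auto simp: M_def)
    have finM: "finite M" using Msub by (rule finite_subset) simp
    have M0: "(0, 0, 0) \<in> M" using abc d by (auto simp: M_def triples_def)
    define m where "m t p = (case t of (i, j, k) \<Rightarrow> case p of (x, y, z) \<Rightarrow> x ^ i * y ^ j * z ^ k)"
      for t :: "nat \<times> nat \<times> nat" and p :: "int \<times> int \<times> int"
    have "\<exists>c. (\<exists>t\<in>M. c t \<noteq> 0) \<and> (\<forall>p\<in>S. (\<Sum>t\<in>M. c t * m t p) = 0)"
    proof (cases "S = {}")
      case True
      then show ?thesis using M0 by (intro exI[of _ "\<lambda>_. 1"]) auto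
    next
      case False
      then obtain x0 y0 z0 where p0: "(x0, y0, z0) \<in> S" by auto
      define U V where "U p = fst (snd p) - y0" and "V p = snd (snd p) - z0" for p :: "int \<times> int \<times> int"
      have UV: "U p = int q * (U p div int q)" "V p = int q * (V p div int q)" if "p \<in> S" for p
        using cls[OF _ p0, of "fst p" "fst (snd p)" "snd (snd p)"] that
        by (auto simp: U_def V_def cong_iff_dvd_diff)
      define A where "A = funs2 U V"
      note closed = funs2_const[of _ U V, folded A_def] funs2_add[of _ U V, folded A_def] funs2_mult[of _ U V, folded A_def]
      have Y: "(\<lambda>p. fst (snd p)) \<in> A" and Z: "(\<lambda>p. snd (snd p)) \<in> A"
        using closed(2)[OF closed(1)[of y0] funs2_fst[of U V, folded A_def]]
          closed(2)[OF closed(1)[of z0] funs2_snd[of V U, folded A_def]] by (simp_all add: U_def V_def)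
      define F where "F p = map_poly (\<lambda>r. eval2 r (fst (snd p)) (snd (snd p))) f" for p :: "int \<times> int \<times> int"
      obtain w where w: "[eval3 (pderiv f) x0 y0 z0 * w = 1] (mod int q)"
        using S[OF p0] cong_solve_coprime_int by blast
      \<comment> \<open>One function of the displacements gives the first coordinate modulo
        \<open>q ^ k\<close> at all points of the class; every monomial then has an expansion of the
        kind that the pigeonhole lemma takes.\<close>
      have "\<exists>\<phi>\<in>A. \<forall>p\<in>S. [fst p = \<phi> p] (mod int q ^ k)"
      proof (rule hensel_parametrization[where F = F and n = "degree f + 1" and w = w and e = x0])
        show "(\<lambda>p. coeff (F p) j) \<in> A" for j
          unfolding F_def by (simp add: coeff_map_poly closed_eval2[OF closed Y Z])
        show "degree (F p) < degree f + 1" for p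
          unfolding F_def using map_poly_degree_leq[of _ f] by (simp add: less_Suc_eq_le)
        show "poly (F p) (fst p) = 0" if "p \<in> S" for p
          using S[of "fst p" "fst (snd p)" "snd (snd p)"] that by (simp add: F_def eval3_map)
        show "[w * poly (pderiv (F p)) (fst p) = 1] (mod int q)" if "p \<in> S" for p
        proof -
          have "[eval3 (pderiv f) (fst p) (fst (snd p)) (snd (snd p)) = eval3 (pderiv f) x0 y0 z0] (mod int q)"
            using cls[OF _ p0, of "fst p" "fst (snd p)" "snd (snd p)"] that by (intro cong_eval3) auto
          then have "[eval3 (pderiv f) (fst p) (fst (snd p)) (snd (snd p)) * w = 1] (mod int q)"
            using w by (meson cong_scalar_right cong_trans)
          then show ?thesis by (simp add: F_def eval3_pderiv mult.commute)
        qed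
        show "[fst p = x0] (mod int q)" if "p \<in> S" for p
          using cls[OF _ p0, of "fst p" "fst (snd p)" "snd (snd p)"] that by auto
      qed (fact closed)+
      then obtain \<phi> where \<phi>: "\<phi> \<in> A" "\<And>p. p \<in> S \<Longrightarrow> [fst p = \<phi> p] (mod int q ^ k)" by blast
      define expansion where "expansion t \<alpha> \<longleftrightarrow> (\<forall>p\<in>S. [m t p = (\<Sum>s\<in>{(i, j). i + j < k}. \<alpha> s * int q ^ (fst s + snd s)
          * ((U p div int q) ^ fst s * (V p div int q) ^ snd s))] (mod int q ^ k))" for t \<alpha>
      have "\<exists>\<alpha>. expansion t \<alpha>" for t
      proof -
        obtain i j l where t: "t = (i, j, l)" by (cases t)
        have "(\<lambda>p. \<phi> p ^ i * fst (snd p) ^ j * snd (snd p) ^ l) \<in> funs2 U V"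
          unfolding A_def[symmetric] by (intro closed(3) closed_power closed(1) \<phi>(1) Y Z)
        from funs2_expansion[OF this, where q = "int q" and k = k]
        obtain \<alpha> where \<alpha>: "\<And>p u v. U p = int q * u \<Longrightarrow> V p = int q * v \<Longrightarrow>
          [\<phi> p ^ i * fst (snd p) ^ j * snd (snd p) ^ l = (\<Sum>s\<in>{(i, j). i + j < k}. \<alpha> s * int q ^ (fst s + snd s)
            * (u ^ fst s * v ^ snd s))] (mod int q ^ k)"
          by blast
        have "[m t p = \<phi> p ^ i * fst (snd p) ^ j * snd (snd p) ^ l] (mod int q ^ k)" if "p \<in> S" for p
          unfolding m_def t case_prod_unfold fst_conv snd_conv using \<phi>(2)[OF that] by (intro cong_mult cong_pow cong_refl)
        then have "expansion t \<alpha>"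
          unfolding expansion_def using \<alpha>[OF UV] by (blast intro: cong_trans)
        then show ?thesis by (rule exI[of _ \<alpha>])
      qed
      then obtain \<alpha> where "\<And>t. expansion t (\<alpha> t)" by metis
      then have \<alpha>: "\<And>t p. p \<in> S \<Longrightarrow> [m t p = (\<Sum>s\<in>{(i, j). i + j < k}. \<alpha> t s * int q ^ (fst s + snd s)
          * ((U p div int q) ^ fst s * (V p div int q) ^ snd s))] (mod int q ^ k)"
        by (simp add: expansion_def)
      show ?thesis
      proof (rule weighted_vanishing_combination[where N = N and q = q and n = n and l = 20 and D = D
            and \<delta> = "\<lambda>(i, j, k). i + j + k" and a = \<alpha> and s = "\<lambda>s. fst s + snd s" and J = "{(i, j). i + j < k}"
            and \<theta> = "\<lambda>s p. (U p div int q) ^ fst s * (V p div int q) ^ snd s"])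
        show "finite {(i, j). i + j < k}"
          by (rule finite_subset[OF _ finite_pairs[of k]]) (auto simp: pairs_def)
        show "card M < N" using N card_mono[OF finite_triples Msub] by (simp add: N0_def)
        show "(case t of (i, j, k) \<Rightarrow> i + j + k) \<le> D" if "t \<in> M" for t
          using that Msub by (auto simp: triples_def)
        show "\<bar>m t p\<bar> \<le> int N ^ (case t of (i, j, k) \<Rightarrow> i + j + k)" if "p \<in> S" for t p
        proof -
          obtain i j l where t: "t = (i, j, l)" by (cases t)
          obtain x y z where p: "p = (x, y, z)" by (cases p)
          have "\<bar>x\<bar> ^ i * \<bar>y\<bar> ^ j * \<bar>z\<bar> ^ l \<le> int N ^ i * int N ^ j * int N ^ l"
            using S[of x y z] that p by (intro mult_mono power_mono) auto
          then show ?thesis by (simp add: m_def t p abs_mult power_abs power_add)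
        qed
        show "[m t p = (\<Sum>s\<in>{(i, j). i + j < k}. \<alpha> t s * int q ^ (fst s + snd s)
          * ((U p div int q) ^ fst s * (V p div int q) ^ snd s))] (mod int q ^ (2 * n * 20))" if "p \<in> S" for t p
          using \<alpha>[OF that] by (simp add: k_def)
        show "(n + 2) * (\<Sum>j\<in>{(i, j). i + j < k}. 2 * n * 20 - (fst j + snd j)) \<le> 2 * n * (\<Sum>t\<in>M. D - (case t of (i, j, k) \<Rightarrow> i + j + k))"
        proof -
          let ?K = "\<Sum>j\<in>{(i, j). i + j < k}. k - (fst j + snd j)" and ?W = "\<Sum>t\<in>M. D - (case t of (i, j, k) \<Rightarrow> i + j + k)"
          have "(n + 2) * 10 * (40 * n + 1) * (40 * n + 2) \<le> (20 * n + 19) * (20 * n + 18) * (40 * n + 37)"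
            by (simp add: algebra_simps)
          then have "4 * n * ((n + 2) * 10 * (40 * n + 1) * (40 * n + 2)) \<le> 4 * n * ((20 * n + 19) * (20 * n + 18) * (40 * n + 37))"
            by (rule mult_le_mono2)
          also have "(20 * n + 19) * (20 * n + 18) * (40 * n + 37) = D * (D - 1) * (2 * D - 1)"
          proof -
            have "D = 20 * n + 19" "D - 1 = 20 * n + 18" "2 * D - 1 = 40 * n + 37" by (simp_all add: D_def)
            then show ?thesis by (simp only:)
          qed
          also have "4 * n * (D * (D - 1) * (2 * D - 1)) \<le> 4 * n * (3 * ?W)"
            using sum_level_weights[OF abc d, of D] unfolding M_def
            by (intro mult_le_mono2) (simp add: case_prod_unfold)
          finally have "4 * n * ((n + 2) * 10 * (40 * n + 1) * (40 * n + 2)) \<le> 12 * n * ?W" by simp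
          moreover have "4 * n * ((n + 2) * 10 * (40 * n + 1) * (40 * n + 2)) = (n + 2) * (6 * ?K)"
            unfolding sum_pairs_weights k_def by (simp add: algebra_simps)
          ultimately have "6 * ((n + 2) * ?K) \<le> 6 * (2 * n * ?W)" by linarith
          then show ?thesis by (simp add: k_def)
        qed
      qed (use finM M0 n q in \<open>auto simp: D_def k_def\<close>)
    qed
    then obtain c where c: "\<exists>t\<in>M. c t \<noteq> 0" "\<forall>p\<in>S. (\<Sum>t\<in>M. c t * m t p) = 0" by blast
    define g where "g = poly3_of M c"
    have coef: "coeff3 g i j k = (if (i, j, k) \<in> M then c (i, j, k) else 0)" for i j k
      unfolding g_def by (rule coeff3_poly3_of[OF finM])
    have g0: "g \<noteq> 0"
    proof
      assume "g = 0"
      then have "coeff3 g i j k = 0" for i j k by (simp add: coeff3_def)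
      then show False using c(1) coef by (metis prod_cases3)
    qed
    have gD: "deg3 g D" unfolding g_def using Msub by (rule deg3_poly3_of)
    have "\<not> f dvd g"
    proof
      assume "f dvd g"
      from lead[OF this g0 gD] obtain i j k where "coeff3 g i j k \<noteq> 0" "(i, j, k) \<notin> M"
        by (auto simp: M_def)
      then show False using coef[of i j k] by auto
    qed
    moreover have "eval3 g x y z = 0" if "(x, y, z) \<in> S" for x y z
      using c(2) that unfolding g_def eval3_poly3_of[OF Msub] by (auto simp: m_def case_prod_unfold)
    ultimately show ?thesis using g0 gD by (intro exI[of _ g]) auto
  qed
  show ?thesis by (rule that[of N0 D], rule main)
qed

text \<open>Every positive degree contains two monomials that are not multiples of the given one,
  since that has degree at least 2: the two pure powers in general, and a pure power with its
  neighbour if \<open>b\<close> or \<open>c\<close> is zero. The function \<open>\<mu>\<close> names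
  them.\<close>

lemma sum_pair_monomial_weights:
  assumes "b + c \<ge> (2::nat)"
  shows "D * (D - 1) \<le> (\<Sum>(i, j)\<in>{(i, j) \<in> pairs D. \<not> (b \<le> i \<and> c \<le> j)}. D - (i + j))"
proof -
  let ?M = "{(i, j) \<in> pairs D. \<not> (b \<le> i \<and> c \<le> j)}"
  define \<mu> where "\<mu> m s = (if s then if c = 0 then (0, m) else (m, 0)
      else if b = 0 then (m - 1, 1) else if c = 0 then (1, m - 1) else (0, m))" for m :: nat and s :: bool
  have tot: "fst (\<mu> m s) + snd (\<mu> m s) = m" if "m \<ge> 1" for m s
    using that by (auto simp: \<mu>_def)
  have M: "\<mu> m s \<in> ?M" if "m \<in> {1..D}" for m s
    using that assms by (auto simp: \<mu>_def pairs_def)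
  have inj: "inj_on (case_prod \<mu>) ({1..D} \<times> UNIV)"
  proof (rule inj_onI)
    fix p p' assume p: "p \<in> {1..D} \<times> (UNIV :: bool set)" "p' \<in> {1..D} \<times> UNIV" and eq: "case_prod \<mu> p = case_prod \<mu> p'"
    obtain m s where ms: "p = (m, s)" by (cases p)
    obtain m' s' where ms': "p' = (m', s')" by (cases p')
    have m1: "m \<ge> 1" "m' \<ge> 1" using p ms ms' by auto
    have mm: "m = m'" using tot[OF m1(1), of s] tot[OF m1(2), of s'] eq ms ms' by simp
    have "s = s'"
    proof (rule ccontr)
      assume "s \<noteq> s'"
      then have "\<mu> m True = \<mu> m False" using eq ms ms' mm by (cases s; cases s') auto
      then show False using m1 assms by (auto simp: \<mu>_def split: if_splits)
    qed
    then show "p = p'" using mm ms ms' by simp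
  qed
  have fin: "finite ?M" by (rule finite_subset[OF _ finite_pairs[of D]]) auto
  have sum: "(\<Sum>m\<in>{1..D}. D - m) * 2 = D * (D - 1)"
  proof -
    have "(\<Sum>m\<in>{1..D}. D - m) = (\<Sum>m\<in>{..<D}. m)"
      by (rule sum.reindex_bij_witness[of _ "\<lambda>m. D - m" "\<lambda>m. D - m"]) auto
    moreover have "2 * (\<Sum>m\<in>{..<D}. m) = D * (D - 1)"
    proof (induction D)
      case (Suc D)
      then show ?case by (cases D) auto
    qed simp
    ultimately show ?thesis by simp
  qed
  have "(\<Sum>m\<in>{1..D}. D - m) * 2 = (\<Sum>m\<in>{1..D}. \<Sum>s\<in>(UNIV :: bool set). D - m)"
  proof -
    have "(\<Sum>s\<in>(UNIV :: bool set). D - m) = (D - m) * 2" for m by (simp add: UNIV_bool)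
    then show ?thesis by (simp only: sum_distrib_right)
  qed
  also have "\<dots> = (\<Sum>(m, s)\<in>{1..D} \<times> (UNIV :: bool set). D - (fst (\<mu> m s) + snd (\<mu> m s)))"
    unfolding sum.cartesian_product by (intro sum.cong) (auto simp: tot)
  also have "\<dots> = (\<Sum>t\<in>case_prod \<mu> ` ({1..D} \<times> UNIV). D - (fst t + snd t))"
    by (subst sum.reindex[OF inj]) (simp add: case_prod_unfold)
  also have "\<dots> \<le> (\<Sum>t\<in>?M. D - (fst t + snd t))"
  proof (rule sum_mono2[OF fin])
    show "case_prod \<mu> ` ({1..D} \<times> UNIV) \<subseteq> ?M"
    proof (rule image_subsetI)
      fix p assume "p \<in> {1..D} \<times> (UNIV :: bool set)"
      then show "case_prod \<mu> p \<in> ?M" using M[of "fst p" "snd p"] by (simp only: case_prod_unfold mem_Times_iff)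
    qed
  qed simp
  finally show ?thesis using sum by (simp add: case_prod_unfold)
qed

text \<open>The surface argument with one variable less: a single displacement remains, and degree 2
  takes the role of degree 4.\<close>

theorem curve_class_auxiliary:
  fixes n :: nat
  assumes n: "n \<ge> 1"
  obtains N0 D where "\<And>N q h e i0 j0 S. N \<ge> N0 \<Longrightarrow> N ^ (n + 1) \<le> q ^ (2 * n) \<Longrightarrow> q ^ (2 * n) \<le> N ^ (n + 2) \<Longrightarrow>
    deg2 h e \<Longrightarrow> i0 + j0 = e \<Longrightarrow> coeff (coeff h i0) j0 \<noteq> 0 \<Longrightarrow> e \<ge> 2 \<Longrightarrow>
    (\<And>x y. (x, y) \<in> S \<Longrightarrow> \<bar>x\<bar> \<le> int N \<and> \<bar>y\<bar> \<le> int N \<and> eval2 h x y = 0 \<and> coprime (eval2 (pderiv h) x y) (int q)) \<Longrightarrow>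
    (\<And>x y x' y'. (x, y) \<in> S \<Longrightarrow> (x', y') \<in> S \<Longrightarrow> [x = x'] (mod int q) \<and> [y = y'] (mod int q)) \<Longrightarrow>
    \<exists>g. g \<noteq> 0 \<and> deg2 g D \<and> \<not> h dvd g \<and> (\<forall>(x, y)\<in>S. eval2 g x y = 0)"
proof -
  \<comment> \<open>The leading terms of the counting inequality are now in the ratio of n (n + 2)
    to (n + 1)^2. These differ by 1 only, so \<open>l\<close> has to grow with \<open>n\<close> to
    outweigh the lower terms.\<close>
  define l where "l = 4 * n + 8"
  define D where "D = 4 * n^2 + 12 * n + 7"
  define k where "k = 2 * n * l"
  define N0 where "N0 = card (pairs D) + 1"
  have Dl: "D + 1 = (n + 1) * l" by (simp add: D_def l_def algebra_simps power2_eq_square)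
  have main: "\<exists>g. g \<noteq> 0 \<and> deg2 g D \<and> \<not> h dvd g \<and> (\<forall>(x, y)\<in>S. eval2 g x y = 0)"
    if N: "N \<ge> N0" and q: "N ^ (n + 1) \<le> q ^ (2 * n)" "q ^ (2 * n) \<le> N ^ (n + 2)"
      and h: "deg2 h e" and ex: "i0 + j0 = e" "coeff (coeff h i0) j0 \<noteq> 0" and e: "e \<ge> 2"
      and S: "\<And>x y. (x, y) \<in> S \<Longrightarrow> \<bar>x\<bar> \<le> int N \<and> \<bar>y\<bar> \<le> int N \<and> eval2 h x y = 0
          \<and> coprime (eval2 (pderiv h) x y) (int q)"
      and cls: "\<And>x y x' y'. (x, y) \<in> S \<Longrightarrow> (x', y') \<in> S \<Longrightarrow> [x = x'] (mod int q) \<and> [y = y'] (mod int q)"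
    for N q h e i0 j0 and S :: "(int \<times> int) set"
  proof -
    have h3: "deg3 [:h:] e" "coeff3 [:h:] 0 i0 j0 \<noteq> 0" "0 + i0 + j0 = e"
      using h ex by (simp_all add: deg3_const coeff3_def)
    obtain a b c where abc: "a + b + c = e"
      and lead: "\<And>g. [:h:] dvd g \<Longrightarrow> g \<noteq> 0 \<Longrightarrow> deg3 g (D + e) \<Longrightarrow> \<exists>i j k. a \<le> i \<and> b \<le> j \<and> c \<le> k \<and> coeff3 g i j k \<noteq> 0"
      using leading_monomial[OF h3, of "D + e"] by blast
    have h0: "h \<noteq> 0" using ex(2) by auto
    have lead2: "\<exists>j k. a = 0 \<and> b \<le> j \<and> c \<le> k \<and> coeff (coeff g j) k \<noteq> 0" if g: "h dvd g" "g \<noteq> 0" "deg2 g (D + e)" for g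
    proof -
      obtain i j k where "a \<le> i" "b \<le> j" "c \<le> k" "coeff3 [:g:] i j k \<noteq> 0"
        using lead[OF const_dvd_const[OF g(1)]] g(2,3) by (auto simp: deg3_const)
      then show ?thesis by (auto simp: coeff3_def coeff_pCons split: nat.splits)
    qed
    have "deg2 h (D + e)" using h by (rule F2.D_mono) simp
    \<comment> \<open>\<open>h\<close> is regarded as a polynomial in three variables that does not
      involve the first one. Being a multiple of itself, it contains a multiple of its leading
      monomial, which therefore does not involve it either.\<close>
    then have "a = 0" using lead2[OF dvd_refl h0] by blast
    then have bc: "b + c \<ge> 2" using abc e by simp
    define M where "M = {(i, j) \<in> pairs D. \<not> (b \<le> i \<and> c \<le> j)}"
    have Msub: "M \<subseteq> pairs D" by (auto simp: M_def)
    have finM: "finite M" using Msub by (rule finite_subset) simp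
    have M0: "(0, 0) \<in> M" using bc by (auto simp: M_def pairs_def)
    define m where "m t p = (case t of (i, j) \<Rightarrow> case p of (x, y) \<Rightarrow> x ^ i * y ^ j)"
      for t :: "nat \<times> nat" and p :: "int \<times> int"
    have "\<exists>c. (\<exists>t\<in>M. c t \<noteq> 0) \<and> (\<forall>p\<in>S. (\<Sum>t\<in>M. c t * m t p) = 0)"
    proof (cases "S = {}")
      case True
      then show ?thesis using M0 by (intro exI[of _ "\<lambda>_. 1"]) auto
    next
      case False
      then obtain x0 y0 where p0: "(x0, y0) \<in> S" by auto
      define U where "U p = snd p - y0" for p :: "int \<times> int"
      have U: "U p = int q * (U p div int q)" if "p \<in> S" for p
        using cls[OF _ p0, of "fst p" "snd p"] that by (auto simp: U_def cong_iff_dvd_diff)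
      define A where "A = funs1 U"
      note closed = funs1_const[of _ U, folded A_def] funs1_add[of _ U, folded A_def] funs1_mult[of _ U, folded A_def]
      have Y: "snd \<in> A"
        using closed(2)[OF closed(1)[of y0] funs1_id[of U, folded A_def]] by (simp add: U_def)
      define F where "F p = map_poly (\<lambda>r. poly r (snd p)) h" for p :: "int \<times> int"
      obtain w where w: "[eval2 (pderiv h) x0 y0 * w = 1] (mod int q)"
        using S[OF p0] cong_solve_coprime_int by blast
      have "\<exists>\<phi>\<in>A. \<forall>p\<in>S. [fst p = \<phi> p] (mod int q ^ k)"
      proof (rule hensel_parametrization[where F = F and n = "degree h + 1" and w = w and e = x0])
        show "(\<lambda>p. coeff (F p) j) \<in> A" for j
          unfolding F_def by (simp add: coeff_map_poly closed_poly[OF closed Y])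
        show "degree (F p) < degree h + 1" for p
          unfolding F_def using map_poly_degree_leq[of _ h] by (simp add: less_Suc_eq_le)
        show "poly (F p) (fst p) = 0" if "p \<in> S" for p
          using S[of "fst p" "snd p"] that by (simp add: F_def eval2_map)
        show "[w * poly (pderiv (F p)) (fst p) = 1] (mod int q)" if "p \<in> S" for p
        proof -
          have "[eval2 (pderiv h) (fst p) (snd p) = eval2 (pderiv h) x0 y0] (mod int q)"
            using cls[OF _ p0, of "fst p" "snd p"] that by (intro cong_eval2) auto
          then have "[eval2 (pderiv h) (fst p) (snd p) * w = 1] (mod int q)"
            using w by (meson cong_scalar_right cong_trans)
          then show ?thesis by (simp add: F_def eval2_pderiv mult.commute)
        qed
        show "[fst p = x0] (mod int q)" if "p \<in> S" for p
          using cls[OF _ p0, of "fst p" "snd p"] that by auto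
      qed (fact closed)+
      then obtain \<phi> where \<phi>: "\<phi> \<in> A" "\<And>p. p \<in> S \<Longrightarrow> [fst p = \<phi> p] (mod int q ^ k)" by blast
      define expansion where "expansion t \<alpha> \<longleftrightarrow> (\<forall>p\<in>S. [m t p = (\<Sum>s<k. \<alpha> s * int q ^ s * (U p div int q) ^ s)] (mod int q ^ k))" for t \<alpha>
      have "\<exists>\<alpha>. expansion t \<alpha>" for t
      proof -
        obtain i j where t: "t = (i, j)" by (cases t)
        have "(\<lambda>p. \<phi> p ^ i * snd p ^ j) \<in> funs1 U"
          unfolding A_def[symmetric] by (intro closed(3) closed_power closed(1) \<phi>(1) Y)
        from funs1_expansion[OF this, where q = "int q" and k = k]
        obtain \<alpha> where \<alpha>: "\<And>p u. U p = int q * u \<Longrightarrow>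
            [\<phi> p ^ i * snd p ^ j = (\<Sum>s<k. \<alpha> s * int q ^ s * u ^ s)] (mod int q ^ k)"
          by blast
        have "[m t p = \<phi> p ^ i * snd p ^ j] (mod int q ^ k)" if "p \<in> S" for p
          unfolding m_def t case_prod_unfold fst_conv snd_conv using \<phi>(2)[OF that] by (intro cong_mult cong_pow cong_refl)
        then have "expansion t \<alpha>"
          unfolding expansion_def using \<alpha>[OF U] by (blast intro: cong_trans)
        then show ?thesis by (rule exI[of _ \<alpha>])
      qed
      then obtain \<alpha> where "\<And>t. expansion t (\<alpha> t)" by metis
      then have \<alpha>: "\<And>t p. p \<in> S \<Longrightarrow> [m t p = (\<Sum>s<k. \<alpha> t s * int q ^ s * (U p div int q) ^ s)] (mod int q ^ k)"
        by (simp add: expansion_def)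
      show ?thesis
      proof (rule weighted_vanishing_combination[where N = N and q = q and n = n and l = l and D = D
            and \<delta> = "\<lambda>(i, j). i + j" and a = \<alpha> and s = "\<lambda>s. s" and J = "{..<k}"
            and \<theta> = "\<lambda>s p. (U p div int q) ^ s"])
        show "card M < N" using N card_mono[OF finite_pairs Msub] by (simp add: N0_def)
        show "(case t of (i, j) \<Rightarrow> i + j) \<le> D" if "t \<in> M" for t
          using that Msub by (auto simp: pairs_def)
        show "\<bar>m t p\<bar> \<le> int N ^ (case t of (i, j) \<Rightarrow> i + j)" if "p \<in> S" for t p
        proof -
          obtain i j where t: "t = (i, j)" by (cases t)
          obtain x y where p: "p = (x, y)" by (cases p)
          have "\<bar>x\<bar> ^ i * \<bar>y\<bar> ^ j \<le> int N ^ i * int N ^ j"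
            using S[of x y] that p by (intro mult_mono power_mono) auto
          then show ?thesis by (simp add: m_def t p abs_mult power_abs power_add)
        qed
        show "[m t p = (\<Sum>s<k. \<alpha> t s * int q ^ s * (U p div int q) ^ s)] (mod int q ^ (2 * n * l))" if "p \<in> S" for t p
          using \<alpha>[OF that] by (simp add: k_def)
        show "(n + 2) * (\<Sum>j<k. 2 * n * l - j) \<le> 2 * n * (\<Sum>t\<in>M. D - (case t of (i, j) \<Rightarrow> i + j))"
        proof -
          let ?K = "\<Sum>j<k. k - j" and ?W = "\<Sum>t\<in>M. D - (case t of (i, j) \<Rightarrow> i + j)"
          have K: "2 * ?K = k * (k + 1)"
          proof -
            have "(\<Sum>j<k. k - j) = (\<Sum>j<k. Suc (k - Suc j))"
              by (intro sum.cong) (simp_all only: lessThan_iff Suc_diff_Suc minus_nat.diff_0)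
            also have "\<dots> = (\<Sum>j<k. Suc j)" by (rule sum.nat_diff_reindex)
            finally have *: "(\<Sum>j<k. k - j) = (\<Sum>j<k. Suc j)" .
            have "2 * (\<Sum>j<k. Suc j) = k * (k + 1)" by (induction k) auto
            then show ?thesis using * by simp
          qed
          have "(n + 2) * l * (2 * n * l + 1) \<le> 2 * ((4 * n^2 + 12 * n + 7) * (4 * n^2 + 12 * n + 6))"
            by (simp add: l_def algebra_simps power2_eq_square)
          then have "2 * n * ((n + 2) * l * (2 * n * l + 1)) \<le> 2 * n * (2 * ((4 * n^2 + 12 * n + 7) * (4 * n^2 + 12 * n + 6)))"
            by (rule mult_le_mono2)
          also have "(4 * n^2 + 12 * n + 7) * (4 * n^2 + 12 * n + 6) = D * (D - 1)" by (simp add: D_def)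
          also have "2 * n * (2 * (D * (D - 1))) \<le> 2 * n * (2 * ?W)"
            using sum_pair_monomial_weights[OF bc, of D] unfolding M_def
            by (intro mult_le_mono2) (simp add: case_prod_unfold)
          finally have "2 * n * ((n + 2) * l * (2 * n * l + 1)) \<le> 2 * n * (2 * ?W)" .
          moreover have "(n + 2) * (k * (k + 1)) = 2 * n * ((n + 2) * l * (2 * n * l + 1))"
            by (simp add: k_def algebra_simps)
          ultimately have "(n + 2) * (k * (k + 1)) \<le> 2 * (2 * n * ?W)" by linarith
          then have "2 * ((n + 2) * ?K) \<le> 2 * (2 * n * ?W)" unfolding K[symmetric] by (simp only: mult_ac)
          then show ?thesis by (simp add: k_def)
        qed
      qed (use finM M0 n q Dl in \<open>auto simp: k_def\<close>)
    qed
    then obtain c where c: "\<exists>t\<in>M. c t \<noteq> 0" "\<forall>p\<in>S. (\<Sum>t\<in>M. c t * m t p) = 0" by blast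
    define g where "g = poly2_of M c"
    have coef: "coeff (coeff g i) j = (if (i, j) \<in> M then c (i, j) else 0)" for i j
      unfolding g_def by (rule coeff2_poly2_of[OF finM])
    have g0: "g \<noteq> 0"
    proof
      assume "g = 0"
      then have "coeff (coeff g i) j = 0" for i j by simp
      then show False using c(1) coef by (metis surj_pair)
    qed
    have gD: "deg2 g D" unfolding g_def using Msub by (rule deg2_poly2_of)
    have "\<not> h dvd g"
    proof
      assume "h dvd g"
      moreover have "deg2 g (D + e)" using gD by (rule F2.D_mono) simp
      ultimately obtain i j where "coeff (coeff g i) j \<noteq> 0" "(i, j) \<notin> M"
        using lead2[OF _ g0] by (auto simp: M_def)
      then show False using coef[of i j] by auto
    qed
    moreover have "eval2 g x y = 0" if "(x, y) \<in> S" for x y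
      using c(2) that unfolding g_def eval2_poly2_of[OF Msub] by (auto simp: m_def case_prod_unfold)
    ultimately show ?thesis using g0 gD by (intro exI[of _ g]) auto
  qed
  show ?thesis by (rule that[of N0 D], rule main)
qed

text \<open>Leading monomials multiply, so total degrees subtract; the given monomial bounds the
  degree of \<open>f\<close> from below.\<close>

lemma deg3_quotient:
  fixes f a :: "int poly poly poly"
  assumes "deg3 (f * a) D" "coeff3 f i0 j0 k0 \<noteq> 0" "a \<noteq> 0"
  shows "deg3 a (D - (i0 + j0 + k0))"
proof -
  obtain nf na where nf: "deg3 f nf" and na: "deg3 a na" using deg3_exists by metis
  define W where "W = D + nf + na + 1"
  have W: "D < W" "nf < W" "na < W" by (simp_all add: W_def)
  have f0: "f \<noteq> 0" using assms(2) by (auto simp: coeff3_def)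
  obtain i j k where h: "degree (kron W (f * a)) = weight W i j k" "i + j + k \<le> D"
    using kron_degree[OF assms(1) W(1)] f0 assms(3) by (metis mult_eq_0_iff)
  obtain i1 j1 k1 where f: "degree (kron W f) = weight W i1 j1 k1" "i1 + j1 + k1 \<le> nf"
    using kron_degree[OF nf W(2) f0] by metis
  obtain i2 j2 k2 where a: "degree (kron W a) = weight W i2 j2 k2" "i2 + j2 + k2 \<le> na"
    using kron_degree[OF na W(3) assms(3)] by metis
  have "degree (kron W (f * a)) = degree (kron W f) + degree (kron W a)"
    unfolding kron_mult using kron_nonzero[OF nf W(2) f0] kron_nonzero[OF na W(3) assms(3)] by (rule degree_mult_eq)
  then have "weight W i j k = weight W (i1 + i2) (j1 + j2) (k1 + k2)" by (simp add: h f a weight_add)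
  then have eq: "i = i1 + i2 \<and> j = j1 + j2 \<and> k = k1 + k2"
    by (rule weight_inj) (use h(2) f(2) a(2) in \<open>simp_all add: W_def\<close>)
  have "weight W i0 j0 k0 \<le> weight W i1 j1 k1" using le_kron_degree[OF nf W(2) assms(2)] f(1) by simp
  then have 1: "i0 + j0 + k0 \<le> i1 + j1 + k1"
    by (rule weight_less) (use f(2) in \<open>simp_all add: W_def\<close>)
  show ?thesis unfolding deg3_iff
  proof (intro allI impI)
    fix i' j' k' assume "coeff3 a i' j' k' \<noteq> 0"
    then have "weight W i' j' k' \<le> weight W i2 j2 k2" using le_kron_degree[OF na W(3)] a(1) by metis
    then have "i' + j' + k' \<le> i2 + j2 + k2"
      by (rule weight_less) (use a(2) in \<open>simp_all add: W_def\<close>)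
    then show "i' + j' + k' \<le> D - (i0 + j0 + k0)" using 1 eq h(2) by linarith
  qed
qed

text \<open>Elimination of one unknown: a vector \<open>v0\<close> with
  \<open>v0 i0 \<noteq> 0\<close> removes \<open>i0\<close> from all other equations, whose entries
  grow to \<open>2 * X^2\<close>, and then determines this unknown after scaling by
  \<open>v0 i0\<close>. \<open>V\<close> may be infinite, since the exponent depends on the number
  of unknowns only.\<close>

lemma small_solution:
  assumes "finite I"
  shows "\<exists>E. \<forall>X\<ge>(1::int). \<forall>V. (\<forall>v\<in>V. \<forall>i\<in>I. \<bar>v i\<bar> \<le> X) \<longrightarrow>
     (\<exists>c::'i \<Rightarrow> int. (\<exists>i\<in>I. c i \<noteq> 0) \<and> (\<forall>v\<in>V. (\<Sum>i\<in>I. c i * v i) = 0)) \<longrightarrow>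
     (\<exists>c. (\<exists>i\<in>I. c i \<noteq> 0) \<and> (\<forall>v\<in>V. (\<Sum>i\<in>I. c i * v i) = 0) \<and> (\<forall>i\<in>I. \<bar>c i\<bar> \<le> (2 * X) ^ E))"
    (is "\<exists>E. ?P I E")
  using assms
proof (induction I rule: finite_induct)
  case empty
  then show ?case by auto
next
  case (insert i0 F)
  then obtain E where E: "?P F E" by blast
  \<comment> \<open>The recursion gives (4 X^2)^E = (2 X)^(2 E), the pivot one more factor, and
    \<open>card F\<close> comes from adding up the terms of the pivot equation.\<close>
  define E' where "E' = 2 * E + 1 + card F"
  show ?case
  proof (rule exI[of _ E'], intro allI impI)
    fix X :: int and V :: "('i \<Rightarrow> int) set"
    assume X: "X \<ge> 1" and V: "\<forall>v\<in>V. \<forall>i\<in>insert i0 F. \<bar>v i\<bar> \<le> X"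
      and "\<exists>c. (\<exists>i\<in>insert i0 F. c i \<noteq> 0) \<and> (\<forall>v\<in>V. (\<Sum>i\<in>insert i0 F. c i * v i) = 0)"
    then obtain c where c: "\<exists>i\<in>insert i0 F. c i \<noteq> 0" "\<And>v. v \<in> V \<Longrightarrow> (\<Sum>i\<in>insert i0 F. c i * v i) = 0"
      by blast
    have c': "c i0 * v i0 + (\<Sum>i\<in>F. c i * v i) = 0" if "v \<in> V" for v
      using c(2)[OF that] insert.hyps by simp
    show "\<exists>c. (\<exists>i\<in>insert i0 F. c i \<noteq> 0) \<and> (\<forall>v\<in>V. (\<Sum>i\<in>insert i0 F. c i * v i) = 0) \<and>
         (\<forall>i\<in>insert i0 F. \<bar>c i\<bar> \<le> (2 * X) ^ E')"
    proof (cases "\<exists>v\<in>V. v i0 \<noteq> 0")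
      case False
      have "(\<Sum>i\<in>F. (if i = i0 then 1 else 0) * v i) = 0" for v :: "'i \<Rightarrow> int"
        using insert.hyps by (intro sum.neutral) auto
      moreover have "1 \<le> (2 * X) ^ E'" using X by (intro one_le_power) simp
      ultimately show ?thesis using False X insert.hyps
        by (intro exI[of _ "\<lambda>i. if i = i0 then 1 else 0"]) (auto simp del: power_mult_distrib)
    next
      case True
      then obtain v0 where v0: "v0 \<in> V" "v0 i0 \<noteq> 0" by blast
      define V' where "V' = (\<lambda>v i. v0 i0 * v i - v i0 * v0 i) ` V"
      have X2: "\<forall>v\<in>V'. \<forall>i\<in>F. \<bar>v i\<bar> \<le> 2 * X^2"
      proof (intro ballI)
        fix u i assume "u \<in> V'" and i: "i \<in> F"
        then obtain v where v: "v \<in> V" "u = (\<lambda>i. v0 i0 * v i - v i0 * v0 i)" by (auto simp: V'_def)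
        have "\<bar>v0 i0\<bar> * \<bar>v i\<bar> \<le> X * X" "\<bar>v i0\<bar> * \<bar>v0 i\<bar> \<le> X * X"
          using V v0 v i X by (auto intro!: mult_mono)
        then show "\<bar>u i\<bar> \<le> 2 * X^2" unfolding v(2) power2_eq_square
          by (simp flip: abs_mult)
      qed
      have ex: "\<exists>c. (\<exists>i\<in>F. c i \<noteq> 0) \<and> (\<forall>v\<in>V'. (\<Sum>i\<in>F. c i * v i) = 0)"
      proof (intro exI[of _ c] conjI ballI)
        show "\<exists>i\<in>F. c i \<noteq> 0"
        proof (rule ccontr)
          assume "\<not> ?thesis"
          then have "c i0 * v0 i0 = 0" "c i0 \<noteq> 0" using c'[OF v0(1)] c(1) by auto
          then show False using v0 by simp
        qed
        fix u assume "u \<in> V'"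
        then obtain v where v: "v \<in> V" "u = (\<lambda>i. v0 i0 * v i - v i0 * v0 i)" by (auto simp: V'_def)
        have "(\<Sum>i\<in>F. c i * u i) = v0 i0 * (\<Sum>i\<in>F. c i * v i) - v i0 * (\<Sum>i\<in>F. c i * v0 i)"
          unfolding v(2) by (simp add: right_diff_distrib sum_subtractf sum_distrib_left mult_ac)
        also have "(\<Sum>i\<in>F. c i * v i) = - (c i0 * v i0)" using c'[OF v(1)] by simp
        also have "(\<Sum>i\<in>F. c i * v0 i) = - (c i0 * v0 i0)" using c'[OF v0(1)] by simp
        finally show "(\<Sum>i\<in>F. c i * u i) = 0" by simp
      qed
      have "2 * X^2 \<ge> 1" using one_le_power[OF X, of 2] by linarith
      from E[THEN spec, THEN mp, OF this, THEN spec, THEN mp, OF X2, THEN mp, OF ex]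
      obtain e where e: "\<exists>i\<in>F. e i \<noteq> 0" "\<And>v. v \<in> V' \<Longrightarrow> (\<Sum>i\<in>F. e i * v i) = 0"
          "\<And>i. i \<in> F \<Longrightarrow> \<bar>e i\<bar> \<le> (2 * (2 * X^2)) ^ E"
        by blast
      have eb: "\<bar>e i\<bar> \<le> (2 * X) ^ (2 * E)" if "i \<in> F" for i
      proof -
        have "2 * (2 * X^2) = (2 * X)^2" by (simp add: power2_eq_square)
        then show ?thesis using e(3)[OF that] by (simp only: power_mult)
      qed
      define d where "d i = (if i = i0 then - (\<Sum>i\<in>F. v0 i * e i) else v0 i0 * e i)" for i
      have dF: "d i = v0 i0 * e i" if "i \<in> F" for i using that insert.hyps by (auto simp: d_def)
      have "\<exists>i\<in>insert i0 F. d i \<noteq> 0" using e(1) dF v0 by auto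
      moreover have "(\<Sum>i\<in>insert i0 F. d i * v i) = 0" if v: "v \<in> V" for v
      proof -
        have "(\<Sum>i\<in>insert i0 F. d i * v i) = - (\<Sum>i\<in>F. v0 i * e i) * v i0 + (\<Sum>i\<in>F. v0 i0 * e i * v i)"
          using insert.hyps dF by (simp add: d_def)
        also have "\<dots> = (\<Sum>i\<in>F. e i * (v0 i0 * v i - v i0 * v0 i))"
          by (simp add: right_diff_distrib sum_subtractf sum_distrib_left mult_ac)
        also have "\<dots> = 0" using e(2)[of "\<lambda>i. v0 i0 * v i - v i0 * v0 i"] v by (simp add: V'_def)
        finally show ?thesis .
      qed
      moreover have "\<bar>d i\<bar> \<le> (2 * X) ^ E'" if "i \<in> insert i0 F" for i
      proof (cases "i = i0")
        case False
        then have i: "i \<in> F" using that by simp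
        have "\<bar>d i\<bar> \<le> X * (2 * X) ^ (2 * E)"
          unfolding dF[OF i] abs_mult using V v0 eb[OF i] X by (intro mult_mono) auto
        also have "\<dots> \<le> (2 * X) ^ 1 * (2 * X) ^ (2 * E)" using X by (intro mult_right_mono) auto
        also have "\<dots> \<le> (2 * X) ^ E'" unfolding power_add[symmetric] using X
          by (intro power_increasing) (auto simp: E'_def)
        finally show ?thesis .
      next
        case True
        have "\<bar>d i\<bar> \<le> (\<Sum>i\<in>F. \<bar>v0 i * e i\<bar>)" using True by (simp add: d_def sum_abs)
        also have "\<dots> \<le> (\<Sum>i\<in>F. X * (2 * X) ^ (2 * E))"
          unfolding abs_mult using V v0 eb X by (intro sum_mono mult_mono) auto
        also have "\<dots> = int (card F) * (X * (2 * X) ^ (2 * E))" by simp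
        also have "\<dots> \<le> (2 * X) ^ card F * ((2 * X) ^ 1 * (2 * X) ^ (2 * E))"
        proof (intro mult_mono)
          have "int (card F) \<le> 2 ^ card F" by (metis less_exp of_nat_le_iff of_nat_numeral of_nat_power less_imp_le)
          also have "\<dots> \<le> (2 * X) ^ card F" using X by (intro power_mono) auto
          finally show "int (card F) \<le> (2 * X) ^ card F" .
        qed (use X in auto)
        also have "\<dots> = (2 * X) ^ E'" by (simp add: E'_def power_add mult_ac)
        finally show ?thesis .
      qed
      ultimately show ?thesis by blast
    qed
  qed
qed

section \<open>Heights and primes\<close>

text \<open>Passing through the points of \<open>S\<close> is a linear system for the coefficients,
  with \<open>f\<close> as a solution; hence there is a small solution \<open>g\<close>. If
  \<open>f\<close> divides \<open>g\<close>, the quotient is a constant because \<open>f\<close> has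
  full degree \<open>d\<close>, so \<open>f\<close> is small as well. The support \<open>M\<close>
  is a parameter so that plane curves can be treated as cylinders.\<close>

lemma height_dichotomy:
  assumes M: "M \<subseteq> triples d"
  shows "\<exists>c. \<forall>f N S. N \<ge> 2 \<longrightarrow> (\<forall>i j k. coeff3 f i j k \<noteq> 0 \<longrightarrow> (i, j, k) \<in> M) \<longrightarrow>
    (\<exists>i j k. i + j + k = d \<and> coeff3 f i j k \<noteq> 0) \<longrightarrow>
    (\<forall>(x, y, z)\<in>S. \<bar>x\<bar> \<le> int N \<and> \<bar>y\<bar> \<le> int N \<and> \<bar>z\<bar> \<le> int N \<and> eval3 f x y z = 0) \<longrightarrow>
    (\<exists>g. g \<noteq> 0 \<and> (\<forall>i j k. coeff3 g i j k \<noteq> 0 \<longrightarrow> (i, j, k) \<in> M) \<and> \<not> f dvd g \<and> (\<forall>(x, y, z)\<in>S. eval3 g x y z = 0)) \<or>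
    (\<forall>i j k. \<bar>coeff3 f i j k\<bar> \<le> int N ^ c)"
proof -
  have finM: "finite M" using M by (rule finite_subset) simp
  from small_solution[OF finM] obtain E where
    E: "\<forall>X\<ge>(1::int). \<forall>V. (\<forall>v\<in>V. \<forall>i\<in>M. \<bar>v i\<bar> \<le> X) \<longrightarrow>
     (\<exists>c::nat \<times> nat \<times> nat \<Rightarrow> int. (\<exists>i\<in>M. c i \<noteq> 0) \<and> (\<forall>v\<in>V. (\<Sum>i\<in>M. c i * v i) = 0)) \<longrightarrow>
     (\<exists>c. (\<exists>i\<in>M. c i \<noteq> 0) \<and> (\<forall>v\<in>V. (\<Sum>i\<in>M. c i * v i) = 0) \<and> (\<forall>i\<in>M. \<bar>c i\<bar> \<le> (2 * X) ^ E))" ..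
  have main: "(\<exists>g. g \<noteq> 0 \<and> (\<forall>i j k. coeff3 g i j k \<noteq> 0 \<longrightarrow> (i, j, k) \<in> M) \<and> \<not> f dvd g \<and> (\<forall>(x, y, z)\<in>S. eval3 g x y z = 0)) \<or>
    (\<forall>i j k. \<bar>coeff3 f i j k\<bar> \<le> int N ^ ((d + 1) * E))"
    if N: "N \<ge> 2" and f: "\<And>i j k. coeff3 f i j k \<noteq> 0 \<Longrightarrow> (i, j, k) \<in> M"
      and lead: "i0 + j0 + k0 = d" "coeff3 f i0 j0 k0 \<noteq> 0"
      and S: "\<And>x y z. (x, y, z) \<in> S \<Longrightarrow> \<bar>x\<bar> \<le> int N \<and> \<bar>y\<bar> \<le> int N \<and> \<bar>z\<bar> \<le> int N \<and> eval3 f x y z = 0"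
    for f N S i0 j0 k0
  proof -
    define mon where "mon p t = (case p of (x, y, z) \<Rightarrow> case t of (i, j, k) \<Rightarrow> x ^ i * y ^ j * z ^ k)"
      for p :: "int \<times> int \<times> int" and t :: "nat \<times> nat \<times> nat"
    have eval: "eval3 g x y z = (\<Sum>t\<in>M. (case t of (i, j, k) \<Rightarrow> coeff3 g i j k) * mon (x, y, z) t)"
      if "\<And>i j k. coeff3 g i j k \<noteq> 0 \<Longrightarrow> (i, j, k) \<in> M" for g x y z
    proof -
      have g: "deg3 g d" using that M by (auto simp: deg3_iff triples_def)
      show ?thesis unfolding eval3_sum[OF g] using that M
        by (intro sum.mono_neutral_cong_right) (auto simp: mon_def)
    qed
    have X: "int N ^ d \<ge> 1" using N by (intro one_le_power) simp
    have V: "\<forall>v\<in>mon ` S. \<forall>i\<in>M. \<bar>v i\<bar> \<le> int N ^ d"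
    proof (intro ballI)
      fix v t assume "v \<in> mon ` S" and t: "t \<in> M"
      then obtain x y z where v: "(x, y, z) \<in> S" "v = mon (x, y, z)" by auto
      obtain i j k where ijk: "t = (i, j, k)" by (cases t)
      have "\<bar>x\<bar> ^ i * \<bar>y\<bar> ^ j * \<bar>z\<bar> ^ k \<le> int N ^ i * int N ^ j * int N ^ k"
        using S[OF v(1)] by (intro mult_mono power_mono) auto
      also have "\<dots> = int N ^ (i + j + k)" by (simp add: power_add)
      also have "\<dots> \<le> int N ^ d" using t M ijk N by (intro power_increasing) (auto simp: triples_def)
      finally show "\<bar>v t\<bar> \<le> int N ^ d" by (simp add: v(2) mon_def ijk abs_mult power_abs)
    qed
    have ex: "\<exists>c. (\<exists>i\<in>M. c i \<noteq> 0) \<and> (\<forall>v\<in>mon ` S. (\<Sum>i\<in>M. c i * v i) = 0)"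
    proof (intro exI[of _ "\<lambda>(i, j, k). coeff3 f i j k"] conjI ballI)
      show "\<exists>t\<in>M. (case t of (i, j, k) \<Rightarrow> coeff3 f i j k) \<noteq> 0"
        using f[OF lead(2)] lead(2) by (intro bexI[of _ "(i0, j0, k0)"]) auto
      fix v assume "v \<in> mon ` S"
      then obtain x y z where v: "(x, y, z) \<in> S" "v = mon (x, y, z)" by auto
      show "(\<Sum>t\<in>M. (case t of (i, j, k) \<Rightarrow> coeff3 f i j k) * v t) = 0"
        using eval[OF f, THEN sym] S[OF v(1)] v(2) by simp
    qed
    from E[THEN spec, THEN mp, OF X, THEN spec, THEN mp, OF V, THEN mp, OF ex]
    obtain c where c: "\<exists>i\<in>M. c i \<noteq> 0" "\<And>v. v \<in> mon ` S \<Longrightarrow> (\<Sum>i\<in>M. c i * v i) = 0"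
      "\<And>i. i \<in> M \<Longrightarrow> \<bar>c i\<bar> \<le> (2 * int N ^ d) ^ E" by blast
    define g where "g = poly3_of M c"
    have coef: "coeff3 g i j k = (if (i, j, k) \<in> M then c (i, j, k) else 0)" for i j k
      unfolding g_def by (rule coeff3_poly3_of[OF finM])
    have gM: "\<And>i j k. coeff3 g i j k \<noteq> 0 \<Longrightarrow> (i, j, k) \<in> M" by (auto simp: coef split: if_splits)
    have g0: "g \<noteq> 0"
    proof
      assume "g = 0"
      then have "coeff3 g i j k = 0" for i j k by (simp add: coeff3_def)
      then show False using c(1) coef by (metis prod_cases3)
    qed
    have "eval3 g x y z = 0" if "(x, y, z) \<in> S" for x y z
    proof -
      have "eval3 g x y z = (\<Sum>t\<in>M. (case t of (i, j, k) \<Rightarrow> coeff3 g i j k) * mon (x, y, z) t)"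
        by (rule eval) (rule gM)
      also have "\<dots> = (\<Sum>t\<in>M. c t * mon (x, y, z) t)" by (intro sum.cong) (auto simp: coef)
      finally show ?thesis using c(2)[of "mon (x, y, z)"] that by simp
    qed
    moreover have "\<bar>coeff3 f i j k\<bar> \<le> int N ^ ((d + 1) * E)" if "f dvd g" for i j k
    proof -
      obtain a where a: "g = f * a" using \<open>f dvd g\<close> by (rule dvdE)
      have "deg3 g d" using gM M by (auto simp: deg3_iff triples_def)
      then have "deg3 a 0" using deg3_quotient[of f a d i0 j0 k0] a lead g0 by auto
      then obtain e where e: "a = [:[:[:e:]:]:]" by (auto simp: deg3_0_iff)
      then have "e \<noteq> 0" using a g0 by auto
      have "coeff3 g i j k = coeff3 f i j k * e" by (simp add: a e coeff3_def mult.commute)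
      moreover have "\<bar>coeff3 g i j k\<bar> \<le> int N ^ ((d + 1) * E)"
      proof -
        have "2 * int N ^ d \<le> int N * int N ^ d" using N by (intro mult_right_mono) auto
        then have "(2 * int N ^ d) ^ E \<le> (int N ^ (d + 1)) ^ E" by (intro power_mono) auto
        then have "(2 * int N ^ d) ^ E \<le> int N ^ ((d + 1) * E)" by (simp only: power_mult)
        then have "\<bar>coeff3 g i j k\<bar> \<le> int N ^ ((d + 1) * E)" if "(i, j, k) \<in> M"
          using c(3)[OF that] that by (simp only: coef if_True)
        then show ?thesis by (cases "(i, j, k) \<in> M") (auto simp: coef)
      qed
      ultimately have "\<bar>coeff3 f i j k\<bar> * \<bar>e\<bar> \<le> int N ^ ((d + 1) * E)" by (simp add: abs_mult)
      moreover have "\<bar>coeff3 f i j k\<bar> * 1 \<le> \<bar>coeff3 f i j k\<bar> * \<bar>e\<bar>"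
        using \<open>e \<noteq> 0\<close> by (intro mult_left_mono) auto
      ultimately show ?thesis by simp
    qed
    ultimately show ?thesis using g0 gM by blast
  qed
  show ?thesis
    by (rule exI[of _ "(d + 1) * E"], intro allI impI, elim exE conjE, rule main) (assumption | fastforce)+
qed

text \<open>The product of the primes divides \<open>z\<close>. Their size is expressed by
  \<open>N \<le> p ^ s\<close>, which avoids roots of \<open>N\<close>.\<close>

lemma card_prime_divisors:
  fixes P :: "nat set" and z :: int
  assumes "finite P" "\<And>p. p \<in> P \<Longrightarrow> prime p \<and> int p dvd z \<and> N \<le> p ^ s" "z \<noteq> 0" "\<bar>z\<bar> \<le> int N ^ c" "N \<ge> 2"
  shows "card P \<le> s * c"
proof -
  have "int (\<Prod>P) dvd z" using assms(1,2)
  proof (induction P rule: finite_induct)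
    case (insert p F)
    have "coprime p (\<Prod>F)" using insert by (intro prod_coprime_right primes_coprime) auto
    then have "coprime (int p) (int (\<Prod>F))" by (simp only: coprime_int_iff)
    then have "int p * int (\<Prod>F) dvd z" using insert by (intro divides_mult) auto
    then show ?case using insert by simp
  qed simp
  then have "int (\<Prod>P) \<le> \<bar>z\<bar>" using dvd_imp_le_int[OF assms(3)] by (meson abs_ge_self order_trans)
  then have le: "int (\<Prod>P) \<le> int N ^ c" using assms(4) by linarith
  have "N ^ card P = (\<Prod>p\<in>P. N)" by simp
  also have "\<dots> \<le> (\<Prod>p\<in>P. p ^ s)" using assms(2) by (intro prod_mono) auto
  also have "\<dots> = (\<Prod>P) ^ s" by (simp add: prod_power_distrib)
  also have "\<dots> \<le> (N ^ c) ^ s" using le by (intro power_mono) (simp_all only: of_nat_le_iff flip: of_nat_power)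
  also have "\<dots> = N ^ (s * c)" by (simp add: mult.commute flip: power_mult)
  finally have "N ^ card P \<le> N ^ (s * c)" .
  then show ?thesis by (rule power_le_imp_le_exp[rotated]) (use assms(5) in simp)
qed

text \<open>Lagrange's theorem modulo a prime; synthetic division splits off one root at a
  time.\<close>

lemma card_roots_mod_prime:
  fixes p :: int
  assumes "prime p"
  shows "degree F \<le> n \<Longrightarrow> \<exists>i. \<not> p dvd coeff F i \<Longrightarrow> card {x \<in> {0..<p}. p dvd poly F x} \<le> n"
proof (induction n arbitrary: F)
  case 0
  then obtain c where c: "F = [:c:]" by (metis degree_eq_zeroE le_zero_eq)
  have "\<not> p dvd c"
  proof
    assume "p dvd c"
    then have "p dvd coeff F i" for i by (simp add: c coeff_pCons split: nat.split)
    then show False using 0 by blast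
  qed
  then show ?case using c by simp
next
  case (Suc n)
  have fin: "finite {x \<in> {0..<p}. p dvd poly G x}" for G
    by (rule finite_subset[of _ "{0..<p}"]) auto
  show ?case
  proof (cases "\<exists>r\<in>{0..<p}. p dvd poly F r")
    case True
    then obtain r where r: "r \<in> {0..<p}" "p dvd poly F r" by blast
    define Q where "Q = synthetic_div F r"
    have FQ: "F = [:-r, 1:] * Q + [:poly F r:]" unfolding Q_def by (rule synthetic_div_correct'[symmetric])
    have "degree Q \<le> n" using Suc.prems by (simp add: Q_def degree_synthetic_div)
    moreover have "\<exists>i. \<not> p dvd coeff Q i"
    proof (rule ccontr)
      assume "\<not> ?thesis"
      then have "p dvd coeff F i" for i
        by (subst FQ) (auto simp: coeff_pCons r(2) split: nat.splits)
      then show False using Suc.prems by blast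
    qed
    ultimately have IH: "card {x \<in> {0..<p}. p dvd poly Q x} \<le> n" by (rule Suc.IH)
    have "{x \<in> {0..<p}. p dvd poly F x} \<subseteq> insert r {x \<in> {0..<p}. p dvd poly Q x}"
    proof
      fix x assume x: "x \<in> {x \<in> {0..<p}. p dvd poly F x}"
      have "poly F x = (x - r) * poly Q x + poly F r" by (subst FQ) (simp add: algebra_simps)
      then have "p dvd (x - r) * poly Q x" using x r(2) by (simp add: dvd_add_left_iff)
      then have "p dvd x - r \<or> p dvd poly Q x" using assms by (simp add: prime_dvd_mult_iff)
      moreover have "x = r" if "p dvd x - r"
      proof -
        have "x mod p = r mod p" using that by (simp add: mod_eq_dvd_iff)
        then show ?thesis using x r(1) by simp
      qed
      ultimately show "x \<in> insert r {x \<in> {0..<p}. p dvd poly Q x}" using x by auto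
    qed
    then have "card {x \<in> {0..<p}. p dvd poly F x} \<le> card (insert r {x \<in> {0..<p}. p dvd poly Q x})"
      by (intro card_mono finite.insertI fin)
    also have "\<dots> \<le> Suc n" using IH card_insert_le_m1[of "Suc n"] by simp
    finally show ?thesis .
  next
    case False
    then have "{x \<in> {0..<p}. p dvd poly F x} = {}" by auto
    then show ?thesis by (simp only: card.empty)
  qed
qed

text \<open>The polynomial may vanish modulo \<open>p\<close>: then so does its derivative, and
  there is no simple root.\<close>

lemma card_simple_roots_mod_prime:
  fixes p :: int
  assumes "prime p" "degree F \<le> n"
  shows "card {x \<in> {0..<p}. p dvd poly F x \<and> \<not> p dvd poly (pderiv F) x} \<le> n"
proof (cases "\<exists>i. \<not> p dvd coeff F i")
  case True
  have "card {x \<in> {0..<p}. p dvd poly F x \<and> \<not> p dvd poly (pderiv F) x} \<le> card {x \<in> {0..<p}. p dvd poly F x}"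
    by (intro card_mono finite_subset[of "{x \<in> {0..<p}. p dvd poly F x}" "{0..<p}"]) auto
  then show ?thesis using card_roots_mod_prime[OF assms True] by simp
next
  case False
  then have "p dvd poly (pderiv F) x" for x
    unfolding poly_altdef by (intro dvd_sum dvd_mult2) (simp add: coeff_pderiv)
  then show ?thesis by simp
qed

section \<open>Chebyshev's lower bound, and primes between two powers of N\<close>

lemma binomial_dvd_common_multiple:
  fixes L :: int
  assumes "\<And>i. 1 \<le> i \<Longrightarrow> i \<le> N \<Longrightarrow> int i dvd L"
  shows "1 \<le> k \<Longrightarrow> k \<le> n \<Longrightarrow> n \<le> N \<Longrightarrow> int (k * (n choose k)) dvd L"
proof (induction k arbitrary: n rule: nat_induct_at_least)
  case base
  then show ?case using assms[of n] by simp
next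
  case (Suc k)
  then obtain n' where n: "n = Suc n'" by (cases n) auto
  \<comment> \<open>Leibniz's harmonic triangle: \<open>t * k\<close> equals both
    \<open>n * a\<close> and \<open>(n - k) * b\<close>, that is 1/t = 1/a - 1/b, so the quotients
    of \<open>L\<close> satisfy \<open>L = t * (u - v)\<close>.\<close>
  define a b t where "a = int (k * (n' choose k))" and "b = int (k * (n choose k))" and "t = int (Suc k * (n choose Suc k))"
  have "a dvd L" "b dvd L" unfolding a_def b_def using Suc n by (auto intro: Suc.IH)
  obtain u where u: "L = a * u" using \<open>a dvd L\<close> by (rule dvdE)
  obtain v where v: "L = b * v" using \<open>b dvd L\<close> by (rule dvdE)
  have 1: "Suc k * (n choose Suc k) = n * (n' choose k)" unfolding n by (simp only: Suc_times_binomial_eq mult.commute[of "Suc k"])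
  have 2: "Suc k * (n choose Suc k) = (n - k) * (n choose k)"
    using binomial_absorption[of k n'] binomial_absorb_comp[of n k] 1 n by (simp add: mult.commute)
  have A: "t * int k = int n * a" unfolding t_def a_def 1 by simp
  have B: "t * int k = (int n - int k) * b"
    unfolding t_def b_def 2 using Suc n by (simp add: of_nat_diff)
  have "int k * (t * (u - v)) = (t * int k) * u - (t * int k) * v" by (simp add: algebra_simps)
  also have "(t * int k) * u = int n * (a * u)" by (simp add: A)
  also have "(t * int k) * v = (int n - int k) * (b * v)" by (simp add: B)
  also have "int n * (a * u) - (int n - int k) * (b * v) = int k * L" unfolding u[symmetric] v[symmetric] by (simp add: algebra_simps)
  finally have "L = t * (u - v)" using Suc by simp
  then show ?case unfolding t_def by (metis dvd_triv_left)
qed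

text \<open>The least common multiple of 1, ..., 2m is a product of prime powers not exceeding 2m,
  one for each prime up to 2m. It is a multiple of \<open>m * (2 * m choose m)\<close>, and the
  central binomial coefficient is at least 4^m / (2m).\<close>

lemma chebyshev_lower_bound:
  assumes m: "m \<ge> (1::nat)"
  shows "4 ^ m \<le> (2 * m) ^ Suc (card {p. prime p \<and> p \<le> 2 * m})"
proof -
  define N where "N = 2 * m"
  define P where "P = {p. prime p \<and> p \<le> N}"
  have finP: "finite P" unfolding P_def by (rule finite_subset[of _ "{..N}"]) auto
  define e where "e p = Max {e. p ^ e \<le> N}" for p :: nat
  have fin: "finite {e. p ^ e \<le> N}" if "prime p" for p
  proof (rule finite_subset)
    show "{e. p ^ e \<le> N} \<subseteq> {..N}"
    proof
      fix e assume "e \<in> {e. p ^ e \<le> N}"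
      then have "p ^ e \<le> N" by simp
      moreover have "e < 2 ^ e" by (rule less_exp)
      moreover have "2 ^ e \<le> p ^ e" using that by (intro power_mono) (auto dest: prime_ge_2_nat)
      ultimately have "e \<le> N" by linarith
      then show "e \<in> {..N}" by simp
    qed
  qed simp
  have e: "p ^ e p \<le> N" if "prime p" for p
  proof -
    have "{e. p ^ e \<le> N} \<noteq> {}" using m by (auto simp: N_def intro!: exI[of _ 0])
    then show ?thesis unfolding e_def using Max_in[OF fin[OF that]] by auto
  qed
  define L where "L = (\<Prod>p\<in>P. p ^ e p)"
  have L0: "L \<noteq> 0" unfolding L_def using finP by (auto simp: P_def)
  have dvdL: "i dvd L" if i: "1 \<le> i" "i \<le> N" for i
  proof (rule multiplicity_le_imp_dvd)
    show "i \<noteq> 0" using i by simp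
    fix p :: nat assume p: "prime p"
    show "multiplicity p i \<le> multiplicity p L"
    proof (cases "p dvd i")
      case True
      have le: "p ^ multiplicity p i \<le> N"
        using multiplicity_dvd[of p i] i by (meson dvd_imp_le le_trans less_le_trans zero_less_one)
      then have "multiplicity p i \<le> e p" unfolding e_def using fin[OF p] by (intro Max_ge) auto
      moreover have "p \<in> P" using True i p dvd_imp_le[of p i] by (auto simp: P_def)
      then have "p ^ e p dvd L" unfolding L_def by (intro dvd_prodI finP)
      then have "e p \<le> multiplicity p L" using p L0 by (intro multiplicity_geI) auto
      ultimately show ?thesis by simp
    qed (simp add: not_dvd_imp_multiplicity_0)
  qed
  have "int (m * (N choose m)) dvd int L"
    using dvdL m by (intro binomial_dvd_common_multiple[of N]) (auto simp: N_def)
  then have "m * (N choose m) dvd L" by (simp only: int_dvd_int_iff)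
  then have "m * (N choose m) \<le> L" using L0 by (simp add: dvd_imp_le)
  moreover have "1 * (N choose m) \<le> m * (N choose m)" using m by (rule mult_le_mono1)
  ultimately have "N choose m \<le> L" by linarith
  also have "L \<le> (\<Prod>p\<in>P. N)" unfolding L_def by (intro prod_mono) (auto simp: P_def e)
  also have "\<dots> = N ^ card P" by simp
  finally have C: "N choose m \<le> N ^ card P" .
  have "4 ^ m / (2 * real m) \<le> real (N choose m)"
    unfolding N_def using m by (intro central_binomial_lower_bound) simp
  then have "real (4 ^ m) \<le> real ((N choose m) * N)" using m by (simp add: N_def field_simps)
  then have "4 ^ m \<le> (N choose m) * N" by (simp only: of_nat_le_iff)
  also have "\<dots> \<le> N ^ card P * N" using C by (rule mult_le_mono1)
  finally show ?thesis by (simp add: N_def P_def mult.commute)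
qed

text \<open>The logarithm is at most \<open>x powr \<gamma> / \<gamma>\<close> with
  \<open>2 * \<gamma> = b - a\<close>; the second factor \<open>x powr \<gamma>\<close> exceeds
  \<open>K\<close> and so absorbs all constants.\<close>

lemma prime_bound_for_large:
  fixes a b m :: real
  assumes "0 < a" "a < b" "m \<ge> 0"
  shows "\<exists>x0. \<forall>x\<ge>x0. (m + 1) * x powr a + 2 \<le> (x powr b / 2 - 1) / (b * ln x) \<and> x powr b \<ge> 4 \<and> x > 1"
proof -
  define \<delta> where "\<delta> = b - a"
  define \<gamma> where "\<gamma> = \<delta> / 2"
  have "\<gamma> > 0" using assms by (simp add: \<gamma>_def \<delta>_def)
  moreover have "b = a + 2 * \<gamma>" by (simp add: \<gamma>_def \<delta>_def field_simps)
  ultimately have \<gamma>: "\<gamma> > 0" "b = a + 2 * \<gamma>" by blast+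
  define K where "K = 4 * b * (m + 3) / \<gamma>"
  have b: "b > 0" using assms by simp
  have K: "K > 0" using assms \<gamma> by (simp add: K_def)
  define x0 where "x0 = max 2 (max (K powr (1 / \<gamma>)) (4 powr (1 / b)))"
  show ?thesis
  proof (rule exI[of _ x0], intro allI impI)
    fix x assume "x \<ge> x0"
    then have x: "x \<ge> 2" "K powr (1 / \<gamma>) \<le> x" "4 powr (1 / b) \<le> x" by (auto simp: x0_def)
    have "(4 powr (1 / b)) powr b \<le> x powr b" using x b by (intro powr_mono2) auto
    then have x4: "x powr b \<ge> 4" using b by (simp add: powr_powr)
    have "(K powr (1 / \<gamma>)) powr \<gamma> \<le> x powr \<gamma>" using x \<gamma> by (intro powr_mono2) auto
    then have xK: "x powr \<gamma> \<ge> K" using \<gamma> K by (simp add: powr_powr)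
    have xa: "x powr a \<ge> 1" using x assms by (intro ge_one_powr_ge_zero) auto
    have ln: "ln x \<le> x powr \<gamma> / \<gamma>" using x \<gamma> by (intro ln_powr_bound) auto
    have lnpos: "ln x > 0" using x by simp
    have "((m + 1) * x powr a + 2) * (b * ln x) \<le> ((m + 3) * x powr a) * (b * (x powr \<gamma> / \<gamma>))"
      using xa assms b ln lnpos by (intro mult_mono mult_left_mono) (auto simp: algebra_simps)
    also have "\<dots> = (K / 4) * (x powr a * x powr \<gamma>)" using \<gamma> by (simp add: K_def field_simps)
    also have "\<dots> \<le> (x powr \<gamma> / 4) * (x powr a * x powr \<gamma>)" using xK by (intro mult_right_mono) auto
    also have "\<dots> = x powr b / 4" unfolding \<gamma>(2) by (simp add: powr_add mult_ac flip: powr_add) (simp add: algebra_simps)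
    also have "\<dots> \<le> x powr b / 2 - 1" using x4 by simp
    finally have "(m + 1) * x powr a + 2 \<le> (x powr b / 2 - 1) / (b * ln x)"
      using b lnpos by (simp add: pos_le_divide_eq)
    then show "(m + 1) * x powr a + 2 \<le> (x powr b / 2 - 1) / (b * ln x) \<and> x powr b \<ge> 4 \<and> x > 1"
      using x x4 by simp
  qed
qed

text \<open>Chebyshev's bound up to about N^b, less the at most N^a + 1 numbers below N^a.\<close>

lemma primes_between:
  fixes a b :: real and m :: nat
  assumes "0 < a" "a < b"
  shows "\<exists>N0. \<forall>N::nat\<ge>N0. real m * real N powr a \<le> card {p::nat. prime p \<and> real N powr a \<le> p \<and> p \<le> real N powr b}"
proof -
  obtain x0 where x0: "\<And>x. x \<ge> x0 \<Longrightarrow> (real m + 1) * x powr a + 2 \<le> (x powr b / 2 - 1) / (b * ln x) \<and> x powr b \<ge> 4 \<and> x > 1"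
    using prime_bound_for_large[OF assms, of "real m"] by auto
  show ?thesis
  proof (rule exI[of _ "nat \<lceil>x0\<rceil>"], intro allI impI)
    fix N :: nat assume N: "N \<ge> nat \<lceil>x0\<rceil>"
    define x y where "x = real N powr b" and "y = real N powr a"
    have bound: "(real m + 1) * y + 2 \<le> (x / 2 - 1) / (b * ln (real N))" and x4: "x \<ge> 4" and N1: "real N > 1"
      using x0[of "real N"] N by (auto simp: x_def y_def)
    define M where "M = nat \<lfloor>x / 2\<rfloor>"
    have M: "real M \<le> x / 2" "x / 2 - 1 \<le> real M" using x4 unfolding M_def by linarith+
    have "M \<ge> 1" using x4 by (simp add: M_def le_nat_floor)
    define P where "P = {p::nat. prime p \<and> p \<le> 2 * M}"
    define Q where "Q = {p::nat. prime p \<and> y \<le> p \<and> p \<le> x}"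
    have "real M * ln 4 = ln (real (4 ^ M))" by (simp add: ln_realpow)
    also have "\<dots> \<le> ln (real ((2 * M) ^ Suc (card P)))"
    proof (rule ln_mono)
      show "real (4 ^ M) \<le> real ((2 * M) ^ Suc (card P))"
        using chebyshev_lower_bound[OF \<open>M \<ge> 1\<close>] by (simp only: of_nat_le_iff P_def)
    qed (use \<open>M \<ge> 1\<close> in auto)
    also have "\<dots> = real (Suc (card P)) * ln (2 * real M)" using \<open>M \<ge> 1\<close> by (subst of_nat_power, subst ln_realpow) auto
    also have "\<dots> \<le> real (Suc (card P)) * ln x"
      using M \<open>M \<ge> 1\<close> by (intro mult_left_mono) auto
    also have "ln x = b * ln (real N)" using N1 by (simp add: x_def ln_powr)
    finally have 1: "real M * ln 4 \<le> real (Suc (card P)) * (b * ln (real N))" .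
    have pos: "b * ln (real N) > 0" using assms N1 by simp
    have "ln (4::real) \<ge> 1" by (subst ln_ge_iff) (use exp_le in auto)
    then have "real M * 1 \<le> real M * ln 4" by (intro mult_left_mono) auto
    then have "x / 2 - 1 \<le> real (Suc (card P)) * (b * ln (real N))" using 1 M by linarith
    then have "(x / 2 - 1) / (b * ln (real N)) \<le> real (Suc (card P))" using pos by (simp add: field_simps)
    then have P: "(real m + 1) * y + 1 \<le> card P" using bound by simp
    have sub: "P \<subseteq> {..<nat \<lceil>y\<rceil>} \<union> Q"
    proof
      fix p assume p: "p \<in> P"
      show "p \<in> {..<nat \<lceil>y\<rceil>} \<union> Q"
      proof (cases "real p < y")
        case True
        then show ?thesis by (simp add: less_ceiling_iff zless_nat_eq_int_zless)
      next
        case False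
        then show ?thesis using p M by (auto simp: P_def Q_def)
      qed
    qed
    have finQ: "finite Q" unfolding Q_def
      by (rule finite_subset[of _ "{..nat \<lfloor>x\<rfloor>}"]) (auto simp: le_nat_floor)
    have "card P \<le> card ({..<nat \<lceil>y\<rceil>} \<union> Q)" using sub finQ by (intro card_mono) auto
    also have "\<dots> \<le> nat \<lceil>y\<rceil> + card Q" using card_Un_le[of "{..<nat \<lceil>y\<rceil>}" Q] by simp
    finally have "real (card P) \<le> real (nat \<lceil>y\<rceil>) + real (card Q)" by linarith
    moreover have "real (nat \<lceil>y\<rceil>) \<le> y + 1" by (simp add: y_def)
    ultimately have "real m * y \<le> card Q" using P by (simp add: algebra_simps)
    then show "real m * real N powr a \<le> card {p::nat. prime p \<and> real N powr a \<le> p \<and> p \<le> real N powr b}"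
      by (simp add: Q_def x_def y_def)
  qed
qed

section \<open>Points on plane curves\<close>

lemma card_le_fibres:
  assumes "finite A" "f ` A \<subseteq> T" "finite T" "card T \<le> t" "\<And>y. y \<in> f ` A \<Longrightarrow> card {x \<in> A. f x = y} \<le> c"
  shows "card A \<le> t * c"
proof -
  have "A = (\<Union>y\<in>f ` A. {x \<in> A. f x = y})" by auto
  then have "card A \<le> (\<Sum>y\<in>f ` A. card {x \<in> A. f x = y})"
    using card_UN_le[OF finite_imageI[OF assms(1)], of "\<lambda>y. {x \<in> A. f x = y}" f] by simp
  also have "\<dots> \<le> card (f ` A) * c" using sum_bounded_above[of "f ` A" "\<lambda>y. card {x \<in> A. f x = y}" c] assms(5) by simp
  also have "\<dots> \<le> t * c" using card_mono[OF assms(3,2)] assms(4) by (intro mult_le_mono1) simp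
  finally show ?thesis .
qed

lemma exact_degree2:
  fixes h :: "'a::idom poly poly"
  assumes "h \<noteq> 0" "deg2 h n"
  obtains e i j where "e \<le> n" "deg2 h e" "i + j = e" "coeff (coeff h i) j \<noteq> 0"
proof -
  define e where "e = (LEAST e. deg2 h e)"
  have e: "deg2 h e" "e \<le> n" unfolding e_def using assms(2) by (auto intro: LeastI Least_le)
  have "\<exists>i j. i + j = e \<and> coeff (coeff h i) j \<noteq> 0"
  proof (rule ccontr)
    assume *: "\<not> ?thesis"
    obtain i j where ij: "coeff (coeff h i) j \<noteq> 0" using assms(1) by (auto simp: poly_eq_iff)
    then have "i + j \<noteq> e" "i + j \<le> e" using * e(1) by (auto simp: deg2_iff)
    then have "e > 0" by simp
    have "deg2 h (e - 1)" unfolding deg2_iff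
    proof (intro allI impI)
      fix i j assume "coeff (coeff h i) j \<noteq> 0"
      then have "i + j \<noteq> e" "i + j \<le> e" using * e(1) by (auto simp: deg2_iff)
      then show "i + j \<le> e - 1" by simp
    qed
    then have "e \<le> e - 1" unfolding e_def by (rule Least_le)
    then show False using \<open>e > 0\<close> by simp
  qed
  then show ?thesis using that e by blast
qed

lemma coeff_of_nat_mult: "coeff (of_nat n * p) i = of_nat n * coeff p i" for p :: "'a::comm_ring_1 poly"
  by (simp add: of_nat_poly)

text \<open>The window for the modulus is stated in integer powers where exponents are compared and
  in real powers where primes are counted.\<close>

lemma admissible_powr:
  fixes N p n :: nat
  assumes "n \<ge> 1" "N \<ge> 1"
  shows "real N powr ((n + 1) / (2 * n)) \<le> p \<Longrightarrow> N ^ (n + 1) \<le> p ^ (2 * n)"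
    and "p \<le> real N powr ((n + 2) / (2 * n)) \<Longrightarrow> p ^ (2 * n) \<le> N ^ (n + 2)"
proof -
  have *: "(real N powr (real k / (2 * n))) ^ (2 * n) = real N ^ k" for k
  proof -
    have "(real N powr (real k / (2 * n))) ^ (2 * n) = (real N powr (real k / (2 * n))) powr real (2 * n)"
      using assms by (subst powr_realpow) auto
    also have "\<dots> = real N powr real k" using assms by (simp add: powr_powr)
    also have "\<dots> = real N ^ k" using assms by (subst powr_realpow) auto
    finally show ?thesis .
  qed
  show "N ^ (n + 1) \<le> p ^ (2 * n)" if "real N powr ((n + 1) / (2 * n)) \<le> p"
  proof -
    have "(real N powr (real (n + 1) / (2 * n))) ^ (2 * n) \<le> real p ^ (2 * n)"
      using that by (intro power_mono) auto
    then have "real (N ^ (n + 1)) \<le> real (p ^ (2 * n))" unfolding * by simp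
    then show ?thesis by (simp only: of_nat_le_iff)
  qed
  show "p ^ (2 * n) \<le> N ^ (n + 2)" if "p \<le> real N powr ((n + 2) / (2 * n))"
  proof -
    have "real p ^ (2 * n) \<le> (real N powr (real (n + 2) / (2 * n))) ^ (2 * n)"
      using that by (intro power_mono) auto
    then have "real (p ^ (2 * n)) \<le> real (N ^ (n + 2))" unfolding * by simp
    then show ?thesis by (simp only: of_nat_le_iff)
  qed
qed

lemma admissible_square:
  fixes N p n :: nat
  assumes "n \<ge> 1" "N ^ (n + 1) \<le> p ^ (2 * n)"
  shows "N \<le> p ^ 2"
proof -
  have "N ^ n \<le> (p ^ 2) ^ n"
  proof (cases "N = 0")
    case False
    then have "N ^ n \<le> N ^ (n + 1)" by (intro power_increasing) auto
    also note assms(2)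
    also have "p ^ (2 * n) = (p ^ 2) ^ n" by (rule power_mult)
    finally show ?thesis .
  qed (use assms in auto)
  then show ?thesis using assms(1) by (simp add: power_mono_iff)
qed

lemma finite_box2: "finite {(x::int, y::int). \<bar>x\<bar> \<le> int N \<and> \<bar>y\<bar> \<le> int N \<and> P x y}"
  by (rule finite_subset[of _ "{-int N..int N} \<times> {-int N..int N}"]) auto

lemma card_box2: "card {(x::int, y::int). \<bar>x\<bar> \<le> int N \<and> \<bar>y\<bar> \<le> int N \<and> P x y} \<le> (2 * N + 1)^2"
proof -
  have "card {(x::int, y::int). \<bar>x\<bar> \<le> int N \<and> \<bar>y\<bar> \<le> int N \<and> P x y} \<le> card ({-int N..int N} \<times> {-int N..int N})"
    by (intro card_mono) auto
  moreover have "card {-int N..int N} = 2 * N + 1" by (subst card_atLeastAtMost_int) arith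
  ultimately show ?thesis by (simp only: card_cartesian_product power2_eq_square)
qed

text \<open>For each residue of the second coordinate there are at most \<open>E\<close> simple
  roots modulo \<open>p\<close>; where \<open>h\<close> vanishes modulo \<open>p\<close> on the
  whole line, none of the roots is simple.\<close>

lemma card_simple_zeros_mod_prime:
  fixes h :: "int poly poly" and p :: nat
  assumes "prime p" "deg2 h E" "finite A"
    and "\<And>x y. (x, y) \<in> A \<Longrightarrow> int p dvd eval2 h x y \<and> \<not> int p dvd eval2 (pderiv h) x y"
  shows "\<exists>T. (\<lambda>(x, y). (x mod int p, y mod int p)) ` A \<subseteq> T \<and> finite T \<and> card T \<le> p * E"
proof -
  define F where "F b = map_poly (\<lambda>c. poly c b) h" for b
  define R where "R b = {a \<in> {0..<int p}. int p dvd poly (F b) a \<and> \<not> int p dvd poly (pderiv (F b)) a}" for b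
  have R: "finite (R b)" "card (R b) \<le> E" for b
  proof -
    show "finite (R b)" unfolding R_def by (rule finite_subset[of _ "{0..<int p}"]) auto
    have "degree (F b) \<le> E"
      unfolding F_def using map_poly_degree_leq F1.lift_deg_degree[OF assms(2)] by (rule le_trans)
    then show "card (R b) \<le> E" unfolding R_def using assms(1) by (intro card_simple_roots_mod_prime) auto
  qed
  define T where "T = prod.swap ` (SIGMA b:{0..<int p}. R b)"
  have fin: "finite T" unfolding T_def using R by (intro finite_imageI finite_SigmaI) auto
  have "card T \<le> card (SIGMA b:{0..<int p}. R b)" unfolding T_def using R by (intro card_image_le finite_SigmaI) auto
  also have "\<dots> = (\<Sum>b\<in>{0..<int p}. card (R b))" using R by (intro card_SigmaI) auto
  also have "\<dots> \<le> (\<Sum>b\<in>{0..<int p}. E)" using R by (intro sum_mono)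
  also have "\<dots> = p * E" by simp
  finally have cardT: "card T \<le> p * E" .
  have "(x mod int p, y mod int p) \<in> T" if xy: "(x, y) \<in> A" for x y
  proof -
    let ?x = "x mod int p" and ?y = "y mod int p"
    have p: "int p > 0" using assms(1) by (simp add: prime_gt_0_nat)
    have "[eval2 g ?x ?y = eval2 g x y] (mod int p)" for g by (intro cong_eval2) (auto simp: cong_def)
    then have "int p dvd eval2 g ?x ?y \<longleftrightarrow> int p dvd eval2 g x y" for g by (simp add: cong_dvd_iff)
    then have "int p dvd eval2 h ?x ?y" "\<not> int p dvd eval2 (pderiv h) ?x ?y" using assms(4)[OF xy] by auto
    then have "?x \<in> R ?y" using p by (simp add: R_def F_def flip: eval2_map eval2_pderiv)
    then have "(?y, ?x) \<in> (SIGMA b:{0..<int p}. R b)" using p by simp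
    then show ?thesis unfolding T_def by (metis image_eqI swap_simp)
  qed
  then have "(\<lambda>(x, y). (x mod int p, y mod int p)) ` A \<subseteq> T" by auto
  then show ?thesis using fin cardT by blast
qed

text \<open>One additional power of \<open>N\<close> swallows the number of monomials and the
  factors from differentiation.\<close>

lemma derivative_bound2:
  fixes h :: "int poly poly"
  assumes h: "deg2 h E" "\<And>i j. \<bar>coeff (coeff h i) j\<bar> \<le> int N ^ c" and N: "N \<ge> card (pairs E) * (E + 1)" "N \<ge> 1"
    and xy: "\<bar>x\<bar> \<le> int N" "\<bar>y\<bar> \<le> int N"
  shows "\<bar>eval2 (pderiv h) x y\<bar> \<le> int N ^ (c + E + 1)"
proof -
  have coef: "coeff (coeff (pderiv h) i) j = of_nat (Suc i) * coeff (coeff h (Suc i)) j" for i j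
    by (simp add: coeff_pderiv coeff_of_nat_mult del: of_nat_Suc)
  have deg: "deg2 (pderiv h) E" unfolding deg2_iff
  proof (intro allI impI)
    fix i j assume "coeff (coeff (pderiv h) i) j \<noteq> 0"
    then have "coeff (coeff h (Suc i)) j \<noteq> 0" by (simp add: coef)
    then have "Suc i + j \<le> E" using h(1) unfolding deg2_iff by blast
    then show "i + j \<le> E" by simp
  qed
  have "\<bar>eval2 (pderiv h) x y\<bar> \<le> (\<Sum>(i, j)\<in>pairs E. \<bar>coeff (coeff (pderiv h) i) j * (x ^ i * y ^ j)\<bar>)"
    unfolding eval2_sum[OF deg] case_prod_unfold by (rule sum_abs)
  also have "\<dots> \<le> (\<Sum>(i, j)\<in>pairs E. (int E + 1) * int N ^ c * int N ^ E)"
  proof (rule sum_mono, clarify)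
    fix i j assume ij: "(i, j) \<in> pairs E"
    have 1: "\<bar>coeff (coeff (pderiv h) i) j\<bar> \<le> (int E + 1) * int N ^ c"
      unfolding coef abs_mult using h(2) ij by (intro mult_mono) (auto simp: pairs_def)
    have "\<bar>x\<bar> ^ i * \<bar>y\<bar> ^ j \<le> int N ^ i * int N ^ j" using xy by (intro mult_mono power_mono) auto
    also have "\<dots> \<le> int N ^ E" unfolding power_add[symmetric] using ij N by (intro power_increasing) (auto simp: pairs_def)
    finally have 2: "\<bar>x ^ i * y ^ j\<bar> \<le> int N ^ E" by (simp add: abs_mult power_abs)
    show "\<bar>coeff (coeff (pderiv h) i) j * (x ^ i * y ^ j)\<bar> \<le> (int E + 1) * int N ^ c * int N ^ E"
      unfolding abs_mult[of "coeff _ _"] using 1 2 by (intro mult_mono) auto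
  qed
  also have "\<dots> = int (card (pairs E) * (E + 1)) * (int N ^ c * int N ^ E)" by (simp add: algebra_simps)
  also have "\<dots> \<le> int N * (int N ^ c * int N ^ E)" using N by (intro mult_right_mono) (auto simp only: of_nat_le_iff, auto)
  also have "\<dots> = int N ^ (c + E + 1)" by (simp add: power_add)
  finally show ?thesis .
qed

text \<open>A weak form of the theorem of Bombieri and Pila, uniform in the curve.\<close>

theorem plane_curve_points:
  fixes n E :: nat
  assumes n: "n \<ge> 1"
  shows "\<exists>C\<ge>0. \<forall>h N. prime_elem h \<longrightarrow> deg2 h E \<longrightarrow> \<not> deg2 h 1 \<longrightarrow> N \<ge> 1 \<longrightarrow>
    real (card {(x::int, y). \<bar>x\<bar> \<le> int N \<and> \<bar>y\<bar> \<le> int N \<and> eval2 h x y = 0}) \<le> C * real N powr ((n + 2) / (2 * n))"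
proof -
  define \<beta> where "\<beta> = (real n + 2) / (2 * n)"
  have \<beta>: "\<beta> > 0" using n by (simp add: \<beta>_def)
  obtain N1 D where aux: "\<And>N q h e i0 j0 S. N \<ge> N1 \<Longrightarrow> N ^ (n + 1) \<le> q ^ (2 * n) \<Longrightarrow> q ^ (2 * n) \<le> N ^ (n + 2) \<Longrightarrow>
    deg2 h e \<Longrightarrow> i0 + j0 = e \<Longrightarrow> coeff (coeff h i0) j0 \<noteq> 0 \<Longrightarrow> e \<ge> 2 \<Longrightarrow>
    (\<And>x y. (x, y) \<in> S \<Longrightarrow> \<bar>x\<bar> \<le> int N \<and> \<bar>y\<bar> \<le> int N \<and> eval2 h x y = 0 \<and> coprime (eval2 (pderiv h) x y) (int q)) \<Longrightarrow>
    (\<And>x y x' y'. (x, y) \<in> S \<Longrightarrow> (x', y') \<in> S \<Longrightarrow> [x = x'] (mod int q) \<and> [y = y'] (mod int q)) \<Longrightarrow>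
    \<exists>g. g \<noteq> 0 \<and> deg2 g D \<and> \<not> h dvd g \<and> (\<forall>(x, y)\<in>S. eval2 g x y = 0)"
  proof (rule curve_class_auxiliary[OF n], goal_cases)
    case (1 N0 D)
    show ?case by (rule 1(1), rule 1(2))
  qed
  obtain C1 where C1: "\<And>h R. prime_elem h \<Longrightarrow> deg2 h E \<Longrightarrow> deg2 R E \<Longrightarrow> \<not> h dvd R \<Longrightarrow>
     finite {(a::int, b). eval2 h a b = 0 \<and> eval2 R a b = 0} \<and> card {(a, b). eval2 h a b = 0 \<and> eval2 R a b = 0} \<le> C1"
    using plane_bezout[of E E] by blast
  obtain C2 where C2: "\<And>h R. prime_elem h \<Longrightarrow> deg2 h E \<Longrightarrow> deg2 R D \<Longrightarrow> \<not> h dvd R \<Longrightarrow>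
     finite {(a::int, b). eval2 h a b = 0 \<and> eval2 R a b = 0} \<and> card {(a, b). eval2 h a b = 0 \<and> eval2 R a b = 0} \<le> C2"
    using plane_bezout[of E D] by blast
  \<comment> \<open>Plane curves become cylinders in three variables, with support in
    \<open>i = 0\<close>, so that \<open>height_dichotomy\<close> applies to them.\<close>
  define M where "M e = {(i, j, k) \<in> triples e. i = 0}" for e
  define dich where "dich e c \<longleftrightarrow> (\<forall>f N S. N \<ge> 2 \<longrightarrow> (\<forall>i j k. coeff3 f i j k \<noteq> 0 \<longrightarrow> (i, j, k) \<in> M e) \<longrightarrow>
    (\<exists>i j k. i + j + k = e \<and> coeff3 f i j k \<noteq> 0) \<longrightarrow>
    (\<forall>(x, y, z)\<in>S. \<bar>x\<bar> \<le> int N \<and> \<bar>y\<bar> \<le> int N \<and> \<bar>z\<bar> \<le> int N \<and> eval3 f x y z = 0) \<longrightarrow>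
    (\<exists>g. g \<noteq> 0 \<and> (\<forall>i j k. coeff3 g i j k \<noteq> 0 \<longrightarrow> (i, j, k) \<in> M e) \<and> \<not> f dvd g \<and> (\<forall>(x, y, z)\<in>S. eval3 g x y z = 0)) \<or>
    (\<forall>i j k. \<bar>coeff3 f i j k\<bar> \<le> int N ^ c))" for e c
  have "\<exists>c. dich e c" for e unfolding dich_def M_def by (rule height_dichotomy) auto
  then obtain cf where cf: "\<And>e. dich e (cf e)" by metis
  \<comment> \<open>The exact degree \<open>e\<close> of the curve can be anything up to
    \<open>E\<close>; this exponent serves all of them.\<close>
  define c where "c = (\<Sum>e\<le>E. cf e)"
  have cfc: "cf e \<le> c" if "e \<le> E" for e unfolding c_def using that by (intro member_le_sum) auto
  \<comment> \<open>One more than the number of primes \<open>p\<close> with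
    \<open>N \<le> p ^ 2\<close> that can divide a nonzero derivative value of size at most
    \<open>N ^ (c + E + 1)\<close>.\<close>
  define K where "K = 2 * (c + E + 1) + 1"
  have "0 < (real n + 1) / (2 * n)" "(real n + 1) / (2 * n) < \<beta>" using n by (auto simp: \<beta>_def divide_strict_right_mono)
  from primes_between[OF this, of K] obtain N2 where N2: "\<And>N::nat. N \<ge> N2 \<Longrightarrow>
    real K * real N powr ((real n + 1) / (2 * n)) \<le> card {p::nat. prime p \<and> real N powr ((real n + 1) / (2 * n)) \<le> p \<and> p \<le> real N powr \<beta>}"
    by blast
  define N0 where "N0 = N1 + N2 + 2 + card (pairs E) * (E + 1)"
  define C where "C = real ((2 * N0 + 1)^2 + 2 * C1 + K * (E * C2))"
  have "real (card {(x::int, y). \<bar>x\<bar> \<le> int N \<and> \<bar>y\<bar> \<le> int N \<and> eval2 h x y = 0}) \<le> C * real N powr \<beta>"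
    if h: "prime_elem h" "deg2 h E" "\<not> deg2 h 1" and N: "N \<ge> 1" for h N
  proof -
    define Z where "Z = {(x::int, y). \<bar>x\<bar> \<le> int N \<and> \<bar>y\<bar> \<le> int N \<and> eval2 h x y = 0}"
    have finZ: "finite Z" unfolding Z_def by (rule finite_box2)
    have P1: "real N powr \<beta> \<ge> 1" using N \<beta> by (intro ge_one_powr_ge_zero) auto
    have small: ?thesis if "card Z \<le> (2 * N0 + 1)^2 + 2 * C1"
    proof -
      have "real (card Z) \<le> C" using that unfolding C_def by (simp only: of_nat_le_iff)
      also have "\<dots> \<le> C * real N powr \<beta>" using mult_left_mono[OF P1, of C] by (simp add: C_def)
      finally show ?thesis by (simp add: Z_def)
    qed
    have h0: "h \<noteq> 0" using h by auto
    have irr: "irreducible h" using h(1) by (rule prime_elem_imp_irreducible)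
    show ?thesis
    proof (cases "N < N0")
      case True
      have "card Z \<le> (2 * N + 1)^2" unfolding Z_def by (rule card_box2)
      also have "\<dots> \<le> (2 * N0 + 1)^2" using True by (intro power_mono) auto
      finally show ?thesis by (intro small) simp
    next
      case False
      then have N: "N \<ge> N1" "N \<ge> N2" "N \<ge> 2" "N \<ge> card (pairs E) * (E + 1)" by (simp_all add: N0_def)
      show ?thesis
      proof (cases "degree h = 0")
        case True
        then obtain h1 where h1: "h = [:h1:]" by (meson degree_eq_zeroE)
        \<comment> \<open>A zero would make \<open>h\<close> the equation of a line up to a unit,
          against \<open>\<not> deg2 h 1\<close>.\<close>
        have "Z = {}"
        proof (rule ccontr)
          assume "Z \<noteq> {}"
          then obtain x y where "eval2 h x y = 0" by (auto simp: Z_def)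
          then have "[:-y, 1:] dvd h1" by (simp add: h1 poly_eq_0_iff_dvd)
          then have "[:[:-y, 1:]:] dvd h" unfolding h1 by (rule const_dvd_const)
          then obtain k where k: "h = [:[:-y, 1:]:] * k" by (rule dvdE)
          have "\<not> is_unit [:[:-y, 1::int:]:]" by (simp add: is_unit_poly_iff)
          then have "is_unit k" using irreducibleD[OF irr k] by blast
          then have "h dvd [:[:-y, 1:]:]" unfolding k by (simp only: mult_unit_dvd_iff dvd_refl)
          moreover have "deg2 [:[:-y, 1::int:]:] 1" by (auto simp: deg2_iff coeff_pCons split: nat.splits)
          ultimately have "deg2 h 1" by (intro deg2_dvd[of h "[:[:-y, 1:]:]"]) auto
          then show False using h(3) by simp
        qed
        then show ?thesis by (intro small) simp
      next
        case False
        obtain e i0 j0 where e: "e \<le> E" "deg2 h e" "i0 + j0 = e" "coeff (coeff h i0) j0 \<noteq> 0"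
          using exact_degree2[OF h0 h(2)] by metis
        have e2: "e \<ge> 2"
        proof (rule ccontr)
          assume "\<not> e \<ge> 2"
          then have "deg2 h 1" using F2.D_mono[OF e(2), of 1] by simp
          then show False using h(3) by simp
        qed
        have h3: "\<forall>i j k. coeff3 [:h:] i j k \<noteq> 0 \<longrightarrow> (i, j, k) \<in> M e"
          using e(2) by (auto simp: M_def triples_def deg2_iff coeff3_def coeff_pCons split: nat.splits)
        have h3': "\<exists>i j k. i + j + k = e \<and> coeff3 [:h:] i j k \<noteq> 0"
          using e(3,4) by (intro exI[of _ 0] exI[of _ i0] exI[of _ j0]) (simp add: coeff3_def)
        have S3: "\<forall>(x, y, z)\<in>{0} \<times> Z. \<bar>x\<bar> \<le> int N \<and> \<bar>y\<bar> \<le> int N \<and> \<bar>z\<bar> \<le> int N \<and> eval3 [:h:] x y z = 0"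
          by (auto simp: Z_def)
        from cf[of e, unfolded dich_def, THEN spec, THEN spec, THEN spec, THEN mp, OF N(3), THEN mp, OF h3, THEN mp, OF h3', THEN mp, OF S3]
        consider (other) g where "g \<noteq> 0" "\<forall>i j k. coeff3 g i j k \<noteq> 0 \<longrightarrow> (i, j, k) \<in> M e" "\<not> [:h:] dvd g"
            "\<forall>(x, y, z)\<in>{0} \<times> Z. eval3 g x y z = 0"
          | (bounded) "\<forall>i j k. \<bar>coeff3 [:h:] i j k\<bar> \<le> int N ^ cf e"
          by blast
        then show ?thesis
        proof cases
          case other
          have "coeff g i = 0" if "i > 0" for i
          proof (rule ccontr)
            assume "coeff g i \<noteq> 0"
            then obtain j k where "coeff3 g i j k \<noteq> 0" by (auto simp: poly_eq_iff coeff3_def)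
            then have "(i, j, k) \<in> M e" using other(2) by blast
            then show False using that by (simp add: M_def)
          qed
          then have "degree g = 0" by (metis gr0I leading_coeff_0_iff other(1))
          then obtain g0 where g0: "g = [:g0:]" by (meson degree_eq_zeroE)
          have "deg2 g0 E" unfolding deg2_iff
          proof (intro allI impI)
            fix j k assume "coeff (coeff g0 j) k \<noteq> 0"
            then have "(0, j, k) \<in> M e" using other(2)[THEN spec, of 0] by (simp add: g0 coeff3_def)
            then show "j + k \<le> E" using e(1) by (simp add: M_def triples_def)
          qed
          moreover have "\<not> h dvd g0" using other(3) g0 const_dvd_const by blast
          ultimately have C: "finite {(a::int, b). eval2 h a b = 0 \<and> eval2 g0 a b = 0}"
              "card {(a, b). eval2 h a b = 0 \<and> eval2 g0 a b = 0} \<le> C1" using C1[OF h(1,2)] by auto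
          have "Z \<subseteq> {(a, b). eval2 h a b = 0 \<and> eval2 g0 a b = 0}" using other(4) by (auto simp: Z_def g0)
          then have "card Z \<le> C1" using C card_mono le_trans by blast
          then show ?thesis by (intro small) simp
        next
          case bounded
          have hb: "\<bar>coeff (coeff h i) j\<bar> \<le> int N ^ c" for i j
          proof -
            have "\<bar>coeff (coeff h i) j\<bar> \<le> int N ^ cf e" using bounded[THEN spec, of 0] by (simp add: coeff3_def)
            also have "\<dots> \<le> int N ^ c" using N cfc[OF e(1)] by (intro power_increasing) auto
            finally show ?thesis .
          qed
          define h' where "h' = pderiv h"
          have h'0: "h' \<noteq> 0" using False by (simp add: h'_def pderiv_eq_0_iff)
          have "degree h' < degree h" using False by (simp add: h'_def degree_pderiv)
          then have ndvd: "\<not> h dvd h'" using h'0 dvd_imp_degree_le not_le by blast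
          have degh': "deg2 h' E" unfolding deg2_iff
          proof (intro allI impI)
            fix i j assume "coeff (coeff h' i) j \<noteq> 0"
            then have "coeff (coeff h (Suc i)) j \<noteq> 0"
              by (auto simp: h'_def coeff_pderiv coeff_of_nat_mult simp del: of_nat_Suc)
            then have "Suc i + j \<le> E" using h(2) unfolding deg2_iff by blast
            then show "i + j \<le> E" by simp
          qed
          have K1: "real K \<le> real (card {p::nat. prime p \<and> real N powr ((real n + 1) / (2 * n)) \<le> p \<and> p \<le> real N powr \<beta>})"
          proof -
            have "real N powr ((real n + 1) / (2 * n)) \<ge> 1" using N by (intro ge_one_powr_ge_zero) auto
            then have "real K * 1 \<le> real K * real N powr ((real n + 1) / (2 * n))" by (intro mult_left_mono) auto
            then show ?thesis using N2[OF N(2)] by linarith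
          qed
          then obtain P where P: "P \<subseteq> {p::nat. prime p \<and> real N powr ((real n + 1) / (2 * n)) \<le> p \<and> p \<le> real N powr \<beta>}"
              "card P = K" "finite P"
            using obtain_subset_with_card_n[of K] by (metis of_nat_le_iff)
          have Pp: "prime p" "N ^ (n + 1) \<le> p ^ (2 * n)" "p ^ (2 * n) \<le> N ^ (n + 2)" "real p \<le> real N powr \<beta>" if "p \<in> P" for p
            using that P(1) admissible_powr[OF n, of N p] N(3) by (auto simp: \<beta>_def add.commute)
          define Y where "Y = {(a, b). eval2 h a b = 0 \<and> eval2 h' a b = 0}"
          have Y: "finite Y" "card Y \<le> C1" using C1[OF h(1,2) degh' ndvd] by (auto simp: Y_def)
          define W where "W p = {(x, y) \<in> Z. \<not> int p dvd eval2 h' x y}" for p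
          \<comment> \<open>Bezout disposes of the points with vanishing derivative. At any other
            point one of the \<open>K\<close> primes does not divide the derivative; in the plane a
            single prime serves as the modulus.\<close>
          have cover: "Z \<subseteq> Y \<union> (\<Union>p\<in>P. W p)"
          proof
            fix t assume t: "t \<in> Z"
            obtain x y where xy: "t = (x, y)" by (cases t)
            have "\<exists>p\<in>P. \<not> int p dvd eval2 h' x y" if nz: "eval2 h' x y \<noteq> 0"
            proof (rule ccontr)
              assume *: "\<not> ?thesis"
              have "card P \<le> 2 * (c + E + 1)"
              proof (rule card_prime_divisors[OF P(3) _ nz _ N(3)])
                show "prime p \<and> int p dvd eval2 h' x y \<and> N \<le> p ^ 2" if "p \<in> P" for p
                  using * Pp[OF that] admissible_square[OF n] that by blast
                show "\<bar>eval2 h' x y\<bar> \<le> int N ^ (c + E + 1)" unfolding h'_def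
                  using t N xy by (intro derivative_bound2[OF h(2) hb]) (auto simp: Z_def)
              qed
              then show False using P(2) by (simp add: K_def)
            qed
            then show "t \<in> Y \<union> (\<Union>p\<in>P. W p)" using t xy by (auto simp: Y_def W_def Z_def)
          qed
          have Wp: "card (W p) \<le> p * E * C2" if p: "p \<in> P" for p
          proof -
            have finW: "finite (W p)" unfolding W_def by (rule finite_subset[OF _ finZ]) auto
            obtain T where T: "(\<lambda>(x, y). (x mod int p, y mod int p)) ` W p \<subseteq> T" "finite T" "card T \<le> p * E"
              using card_simple_zeros_mod_prime[OF Pp(1)[OF p] h(2) finW] by (auto simp: W_def Z_def h'_def)
            show ?thesis
            proof (rule card_le_fibres[OF finW T])
              fix t
              define S where "S = {s \<in> W p. (\<lambda>(x, y). (x mod int p, y mod int p)) s = t}"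
              have SZ: "S \<subseteq> Z" by (auto simp: S_def W_def)
              have "\<exists>g. g \<noteq> 0 \<and> deg2 g D \<and> \<not> h dvd g \<and> (\<forall>(x, y)\<in>S. eval2 g x y = 0)"
              proof (rule aux[OF N(1) Pp(2)[OF p] Pp(3)[OF p] e(2,3,4) e2])
                have cop: "coprime (eval2 h' x y) (int p)" if "\<not> int p dvd eval2 h' x y" for x y
                  using Pp(1)[OF p] that by (metis coprime_commute prime_imp_coprime prime_nat_int_transfer)
                show "\<bar>x\<bar> \<le> int N \<and> \<bar>y\<bar> \<le> int N \<and> eval2 h x y = 0 \<and> coprime (eval2 (pderiv h) x y) (int p)"
                  if "(x, y) \<in> S" for x y
                  using that cop[of x y] by (auto simp: S_def W_def Z_def h'_def)
                show "[x = x'] (mod int p) \<and> [y = y'] (mod int p)" if "(x, y) \<in> S" "(x', y') \<in> S" for x y x' y'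
                  using that by (auto simp: S_def cong_def)
              qed
              then obtain g where g: "deg2 g D" "\<not> h dvd g" "\<forall>(x, y)\<in>S. eval2 g x y = 0" by blast
              then have "S \<subseteq> {(a, b). eval2 h a b = 0 \<and> eval2 g a b = 0}" using SZ by (auto simp: Z_def)
              then show "card {s \<in> W p. (\<lambda>(x, y). (x mod int p, y mod int p)) s = t} \<le> C2"
                unfolding S_def[symmetric] using C2[OF h(1,2) g(1,2)] by (meson card_mono le_trans)
            qed
          qed
          have finU: "finite (Y \<union> (\<Union>p\<in>P. W p))"
            using Y P(3) by (auto simp: W_def intro: finite_subset[OF _ finZ])
          have "card Z \<le> card (Y \<union> (\<Union>p\<in>P. W p))" using cover finU by (intro card_mono)
          also have "\<dots> \<le> card Y + card (\<Union>p\<in>P. W p)" by (rule card_Un_le)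
          also have "\<dots> \<le> C1 + (\<Sum>p\<in>P. card (W p))" using Y card_UN_le[OF P(3)] by (intro add_mono)
          also have "\<dots> \<le> C1 + (\<Sum>p\<in>P. p * E * C2)" using Wp by (intro add_left_mono sum_mono)
          finally have "real (card Z) \<le> real (C1 + (\<Sum>p\<in>P. p * E * C2))" by (simp only: of_nat_le_iff)
          also have "\<dots> = real C1 + (\<Sum>p\<in>P. real p * (E * C2))" by (simp add: mult_ac)
          also have "\<dots> \<le> real C1 * real N powr \<beta> + (\<Sum>p\<in>P. real N powr \<beta> * (E * C2))"
            using Pp(4) mult_left_mono[OF P1, of "real C1"] by (intro add_mono sum_mono mult_right_mono) auto
          also have "\<dots> = real (C1 + K * (E * C2)) * real N powr \<beta>" by (simp add: P(2) algebra_simps)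
          also have "\<dots> \<le> C * real N powr \<beta>"
            unfolding C_def by (intro mult_right_mono) (simp_all only: of_nat_le_iff, simp_all)
          finally show ?thesis by (simp add: Z_def)
        qed
      qed
    qed
  qed
  then show ?thesis unfolding \<beta>_def by (intro exI[of _ C]) (auto simp: C_def add.commute)
qed

section \<open>Points on no line of integer direction\<close>

text \<open>Only rational directions count, so a point that is not on such a line may still lie on
  another line of the surface. The arguments below produce lines of rational direction only.\<close>

definition on_integer_line :: "int poly poly poly \<Rightarrow> int \<Rightarrow> int \<Rightarrow> int \<Rightarrow> bool" where
  "on_integer_line f x y z \<longleftrightarrow> (\<exists>a b c. (a, b, c) \<noteq> (0, 0, 0) \<and> (\<forall>t. eval3 f (x + t * a) (y + t * b) (z + t * c) = 0))"

definition free_points :: "int poly poly poly \<Rightarrow> nat \<Rightarrow> (int \<times> int \<times> int) set" where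
  "free_points f N = {(x, y, z). \<bar>x\<bar> \<le> int N \<and> \<bar>y\<bar> \<le> int N \<and> \<bar>z\<bar> \<le> int N \<and> eval3 f x y z = 0 \<and> \<not> on_integer_line f x y z}"

lemma finite_free_points: "finite (free_points f N)"
  by (rule finite_subset[of _ "{-int N..int N} \<times> {-int N..int N} \<times> {-int N..int N}"]) (auto simp: free_points_def)

text \<open>A fibre with more points would force the line of direction (1, 0, 0) through them into
  the surface.\<close>

lemma card_vertical_fibre:
  assumes "deg3 f d"
  shows "card {s \<in> free_points f N. snd s = (y, z)} \<le> d"
proof (cases "{s \<in> free_points f N. snd s = (y, z)} = {}")
  case True
  then show ?thesis by (simp only: card.empty)
next
  case False
  then obtain x where x: "(x, y, z) \<in> free_points f N" by auto
  define F where "F = map_poly (\<lambda>r. eval2 r y z) f"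
  have F0: "F \<noteq> 0"
  proof
    assume "F = 0"
    then have "eval3 f x' y z = 0" for x' by (simp add: eval3_map F_def)
    then have "on_integer_line f x y z" unfolding on_integer_line_def
      by (intro exI[of _ 1] exI[of _ 0]) auto
    then show False using x by (simp add: free_points_def)
  qed
  have "degree F \<le> d"
    unfolding F_def using map_poly_degree_leq F2.lift_deg_degree[OF assms] by (rule le_trans)
  then have r: "finite {x. poly F x = 0}" "card {x. poly F x = 0} \<le> d" using card_roots_le[OF F0] by auto
  have "{s \<in> free_points f N. snd s = (y, z)} \<subseteq> (\<lambda>x. (x, y, z)) ` {x. poly F x = 0}"
    by (auto simp: free_points_def F_def eval3_map)
  then have "card {s \<in> free_points f N. snd s = (y, z)} \<le> card ((\<lambda>x. (x, y, z)) ` {x. poly F x = 0})"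
    using r by (intro card_mono) auto
  also have "\<dots> \<le> d" using r card_image_le[OF r(1)] le_trans by blast
  finally show ?thesis .
qed

lemma eval2_linear:
  fixes h :: "int poly poly"
  assumes "deg2 h 1"
  shows "eval2 h a b = coeff (coeff h 0) 0 + coeff (coeff h 1) 0 * a + coeff (coeff h 0) 1 * b"
proof -
  have "pairs 1 = {(0, 0), (0, 1), (1, 0)}" by (auto simp: pairs_def)
  then show ?thesis by (simp add: eval2_sum[OF assms])
qed

lemma linear_nonconstant:
  fixes h :: "int poly poly"
  assumes "deg2 h 1" "\<not> deg2 h 0"
  shows "coeff (coeff h 1) 0 \<noteq> 0 \<or> coeff (coeff h 0) 1 \<noteq> 0"
proof -
  obtain i j where ij: "coeff (coeff h i) j \<noteq> 0" "i + j > 0" using assms(2) by (auto simp: deg2_iff)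
  then have "i + j \<le> 1" using assms(1) by (simp add: deg2_iff)
  then have "(i, j) = (0, 1) \<or> (i, j) = (1, 0)" using ij(2) by auto
  then show ?thesis using ij(1) by auto
qed

definition restrict_to_line :: "int \<Rightarrow> int \<Rightarrow> int \<Rightarrow> int \<Rightarrow> int poly poly \<Rightarrow> int poly" where
  "restrict_to_line y u z v c = poly (map_poly (\<lambda>r. pcompose r [:z, v:]) c) [:y, u:]"

lemma poly_restrict_to_line: "poly (restrict_to_line y u z v c) t = eval2 c (y + t * u) (z + t * v)"
  unfolding restrict_to_line_def by (induction c) (simp_all add: map_poly_pCons eval2_pCons poly_pcompose algebra_simps)

lemma deg1_power: "deg1 (A :: int poly) 1 \<Longrightarrow> deg1 (A ^ i) i"
proof (induction i)
  case (Suc i)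
  then show ?case using F1.D_mult[of A 1 "A ^ i" i] by simp
qed (use F1.D_1 in auto)

lemma degree_restrict_to_line:
  assumes "deg2 c m"
  shows "degree (restrict_to_line y u z v c) \<le> m"
proof -
  have "restrict_to_line y u z v c = (\<Sum>i<Suc (degree c). pcompose (coeff c i) [:z, v:] * [:y, u:] ^ i)"
    unfolding restrict_to_line_def by (rule poly_map_sum) auto
  moreover have "deg1 (\<Sum>i<Suc (degree c). pcompose (coeff c i) [:z, v:] * [:y, u:] ^ i) m"
  proof (rule F1.D_sum)
    fix i
    show "deg1 (pcompose (coeff c i) [:z, v:] * [:y, u:] ^ i) m"
    proof (cases "coeff c i = 0")
      case False
      then have i: "i \<le> m" "deg1 (coeff c i) (m - i)" using assms unfolding lift_deg_def[of deg1] by auto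
      have "degree (pcompose (coeff c i) [:z, v:]) \<le> degree (coeff c i) * 1"
        unfolding degree_pcompose by (intro mult_le_mono2) simp
      then have "deg1 (pcompose (coeff c i) [:z, v:]) (m - i)" using i(2) by (simp add: deg1_iff)
      moreover have "deg1 ([:y, u:] ^ i) i" by (rule deg1_power) (simp add: deg1_iff)
      ultimately show ?thesis using F1.D_mult[of _ "m - i" _ i] i(1) by fastforce
    qed (simp add: F1.D_0)
  qed
  ultimately show ?thesis by (simp add: deg1_iff)
qed

text \<open>With the common factor of \<open>\<alpha>\<close> and \<open>\<beta>\<close> removed,
  the direction \<open>(b, - a)\<close> is primitive, so that every integer point has an integer
  parameter.\<close>

lemma integer_points_of_line:
  fixes \<alpha> \<beta> \<gamma> y0 z0 :: int
  assumes "\<alpha> \<noteq> 0 \<or> \<beta> \<noteq> 0" "\<gamma> + \<alpha> * y0 + \<beta> * z0 = 0"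
  obtains u v where "u \<noteq> 0 \<or> v \<noteq> 0"
    "\<And>y z. \<gamma> + \<alpha> * y + \<beta> * z = 0 \<Longrightarrow> \<exists>t. y = y0 + t * u \<and> z = z0 + t * v"
proof -
  define g where "g = gcd \<alpha> \<beta>"
  have g: "g \<noteq> 0" using assms(1) by (simp add: g_def)
  obtain a b where ab: "\<alpha> = g * a" "\<beta> = g * b" unfolding g_def by (meson dvdE gcd_dvd1 gcd_dvd2)
  have cop: "coprime a b"
  proof -
    have "a = \<alpha> div g" "b = \<beta> div g" using ab g by auto
    then show ?thesis using assms(1) div_gcd_coprime[of \<alpha> \<beta>] by (simp add: g_def)
  qed
  have "\<exists>t. y = y0 + t * b \<and> z = z0 + t * (- a)" if "\<gamma> + \<alpha> * y + \<beta> * z = 0" for y z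
  proof -
    have "g * (a * (y - y0) + b * (z - z0)) = 0" using that assms(2) unfolding ab by (simp add: algebra_simps)
    then have "a * (y - y0) + b * (z - z0) = 0" using g by (simp only: mult_eq_0_iff) simp
    then have eq: "a * (y - y0) = b * (z0 - z)" by (simp add: algebra_simps)
    show ?thesis
    proof (cases "b = 0")
      case True
      then have "a = 1 \<or> a = -1" using cop by auto
      then have "y = y0" "z = z0 + (- a * (z - z0)) * (- a)" using eq True by auto
      then show ?thesis using True by (intro exI[of _ "- a * (z - z0)"]) simp
    next
      case False
      have "b dvd a * (y - y0)" unfolding eq by simp
      then have "b dvd y - y0" using cop by (simp add: coprime_commute coprime_dvd_mult_right_iff)
      then obtain t where t: "y - y0 = b * t" by (rule dvdE)
      then have "b * (a * t) = b * (z0 - z)" using eq by (simp add: algebra_simps)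
      then have "a * t = z0 - z" using False by (metis mult_cancel_left)
      then have "z = z0 + t * (- a)" by (simp add: algebra_simps)
      then show ?thesis using t by (auto intro!: exI[of _ t] simp: algebra_simps)
    qed
  qed
  moreover have "b \<noteq> 0 \<or> - a \<noteq> 0" using assms(1) ab by auto
  ultimately show ?thesis using that by blast
qed

text \<open>Over a curve of degree at least 2 the plane bound applies, and fibres have at most
  \<open>d\<close> points. Over a line, \<open>f\<close> restricts to a plane curve
  \<open>F\<close>. A linear factor of \<open>F\<close> is a line of the surface, so the free points
  lie on the nonlinear factors, and to these the plane bound applies again.\<close>

theorem free_points_over_plane_curve:
  fixes n E d :: nat
  assumes n: "n \<ge> 1"
  shows "\<exists>C\<ge>0. \<forall>f h N. deg3 f d \<longrightarrow> prime_elem h \<longrightarrow> deg2 h E \<longrightarrow> N \<ge> 1 \<longrightarrow>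
    real (card {s \<in> free_points f N. eval2 h (fst (snd s)) (snd (snd s)) = 0}) \<le> C * real N powr ((n + 2) / (2 * n))"
proof -
  define \<beta> where "\<beta> = real (n + 2) / real (2 * n)"
  have \<beta>: "\<beta> > 0" using n by (simp add: \<beta>_def)
  obtain CE where CE: "CE \<ge> 0" "\<And>h N. prime_elem h \<Longrightarrow> deg2 h E \<Longrightarrow> \<not> deg2 h 1 \<Longrightarrow> N \<ge> 1 \<Longrightarrow>
    real (card {(x::int, y). \<bar>x\<bar> \<le> int N \<and> \<bar>y\<bar> \<le> int N \<and> eval2 h x y = 0}) \<le> CE * real N powr \<beta>"
    using plane_curve_points[OF n, of E] unfolding \<beta>_def by blast
  obtain Cd where Cd: "Cd \<ge> 0" "\<And>h N. prime_elem h \<Longrightarrow> deg2 h d \<Longrightarrow> \<not> deg2 h 1 \<Longrightarrow> N \<ge> 1 \<Longrightarrow>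
    real (card {(x::int, y). \<bar>x\<bar> \<le> int N \<and> \<bar>y\<bar> \<le> int N \<and> eval2 h x y = 0}) \<le> Cd * real N powr \<beta>"
    using plane_curve_points[OF n, of d] unfolding \<beta>_def by blast
  define C where "C = CE * d + real ((d + 1) * (d + 1)^2) * (Cd * 2 powr \<beta>)"
  have C0: "C \<ge> 0" using CE(1) Cd(1) by (simp add: C_def)
  have "real (card {s \<in> free_points f N. eval2 h (fst (snd s)) (snd (snd s)) = 0}) \<le> C * real N powr \<beta>"
    if f: "deg3 f d" and h: "prime_elem h" "deg2 h E" and N: "N \<ge> 1" for f h N
  proof -
    define A where "A = {s \<in> free_points f N. eval2 h (fst (snd s)) (snd (snd s)) = 0}"
    have finA: "finite A" unfolding A_def using finite_free_points by simp
    have "real (card A) \<le> CE * d * real N powr \<beta> \<or>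
      real (card A) \<le> real ((d + 1) * (d + 1)^2) * (Cd * 2 powr \<beta>) * real N powr \<beta>"
    proof (cases "deg2 h 1")
      case False
      define Z where "Z = {(x::int, y). \<bar>x\<bar> \<le> int N \<and> \<bar>y\<bar> \<le> int N \<and> eval2 h x y = 0}"
      have "card A \<le> card Z * d"
      proof (rule card_le_fibres[OF finA, of snd Z])
        show "snd ` A \<subseteq> Z" by (auto simp: A_def Z_def free_points_def)
        show "finite Z" unfolding Z_def by (rule finite_box2)
        fix t :: "int \<times> int"
        have "card {x \<in> A. snd x = t} \<le> card {s \<in> free_points f N. snd s = (fst t, snd t)}"
          using finite_free_points by (intro card_mono) (auto simp: A_def)
        also have "\<dots> \<le> d" by (rule card_vertical_fibre[OF f])
        finally show "card {x \<in> A. snd x = t} \<le> d" .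
      qed simp
      then have "real (card A) \<le> real (card Z * d)" by (simp only: of_nat_le_iff)
      also have "\<dots> = real (card Z) * d" by simp
      also have "\<dots> \<le> (CE * real N powr \<beta>) * d"
        using CE(2)[OF h False N] unfolding Z_def by (intro mult_right_mono) auto
      finally show ?thesis by (simp add: mult_ac)
    next
      case True
      show ?thesis
      proof (cases "A = {}")
        case True
        then show ?thesis using CE(1) by simp
      next
        case False
        then obtain x0 y0 z0 where p0: "(x0, y0, z0) \<in> free_points f N" "eval2 h y0 z0 = 0" by (auto simp: A_def)
        note lin = eval2_linear[OF True]
        have "\<not> deg2 h 0"
        proof
          assume "deg2 h 0"
          then have "coeff (coeff h i) j = 0" if "i + j > 0" for i j using that by (auto simp: deg2_iff)
          then have "coeff (coeff h 0) 0 = 0" using lin[of y0 z0] p0(2) by simp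
          with \<open>\<And>j i. i + j > 0 \<Longrightarrow> coeff (coeff h i) j = 0\<close> have "coeff (coeff h i) j = 0" for i j
            by (cases "i + j > 0") auto
          then have "h = 0" by (simp add: poly_eq_iff)
          then show False using h by simp
        qed
        then have ne: "coeff (coeff h 1) 0 \<noteq> 0 \<or> coeff (coeff h 0) 1 \<noteq> 0" using linear_nonconstant[OF True] by simp
        from lin[of y0 z0] p0(2)
        have "coeff (coeff h 0) 0 + coeff (coeff h 1) 0 * y0 + coeff (coeff h 0) 1 * z0 = 0" by simp
        from integer_points_of_line[OF ne this] obtain u v where uv: "u \<noteq> 0 \<or> v \<noteq> 0"
          "\<And>y z. eval2 h y z = 0 \<Longrightarrow> \<exists>t. y = y0 + t * u \<and> z = z0 + t * v"
          unfolding lin by blast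
        define F where "F = map_poly (restrict_to_line y0 u z0 v) f"
        have r0: "restrict_to_line y0 u z0 v 0 = 0" by (simp add: restrict_to_line_def)
        have evF: "eval2 F x t = eval3 f x (y0 + t * u) (z0 + t * v)" for x t
          unfolding F_def eval2_map[of "map_poly _ _"] eval3_map
          by (simp add: map_poly_map_poly r0 o_def poly_restrict_to_line)
        have F0: "F \<noteq> 0"
        proof
          assume "F = 0"
          then have "eval3 f x y0 z0 = 0" for x using evF[of x 0] by simp
          then have "on_integer_line f x0 y0 z0" unfolding on_integer_line_def
            by (intro exI[of _ 1] exI[of _ 0]) auto
          then show False using p0 by (simp add: free_points_def)
        qed
        have dF: "deg2 F d" unfolding lift_deg_def[of deg1]
        proof (intro allI impI)
          fix i assume "coeff F i \<noteq> 0"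
          then have "coeff f i \<noteq> 0" by (auto simp: F_def coeff_map_poly r0)
          then have i: "i \<le> d" "deg2 (coeff f i) (d - i)" using f unfolding lift_deg_def[of deg2] by auto
          then show "i \<le> d \<and> deg1 (coeff F i) (d - i)"
            using degree_restrict_to_line[OF i(2)] by (simp add: F_def coeff_map_poly r0 deg1_iff)
        qed
        define PF where "PF = {h' \<in> plane_factors F. \<not> deg2 h' 1}"
        define Z where "Z h' = {(x::int, t). \<bar>x\<bar> \<le> int (2 * N) \<and> \<bar>t\<bar> \<le> int (2 * N) \<and> eval2 h' x t = 0}" for h'
        have finPF: "finite PF" unfolding PF_def using plane_factors_finite by simp
        have cardPF: "card PF \<le> (d + 1) * (d + 1)^2"
          using card_plane_factors[OF F0 dF] card_mono[OF plane_factors_finite, of PF F] by (auto simp: PF_def)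
        have finZ: "finite (Z h')" for h' unfolding Z_def by (rule finite_box2)
        have cover: "A \<subseteq> (\<lambda>(x, t). (x, y0 + t * u, z0 + t * v)) ` (\<Union>h'\<in>PF. Z h')"
        proof
          fix s assume s: "s \<in> A"
          obtain x y z where xyz: "s = (x, y, z)" by (cases s)
          have fr: "(x, y, z) \<in> free_points f N" "eval2 h y z = 0" using s xyz by (auto simp: A_def)
          obtain t where t: "y = y0 + t * u" "z = z0 + t * v" using uv(2)[OF fr(2)] by blast
          have "eval2 F x t = 0" using fr(1) by (simp add: evF t free_points_def)
          then obtain h' where h': "h' \<in> plane_factors F" "eval2 h' x t = 0" using plane_factor_vanishes[OF F0] by blast
          have "\<not> deg2 h' 1"
          proof
            assume d1: "deg2 h' 1"
            have "\<not> deg2 h' 0" using h'(1) by (simp add: plane_factors_def)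
            then have ne': "coeff (coeff h' 1) 0 \<noteq> 0 \<or> coeff (coeff h' 0) 1 \<noteq> 0" using linear_nonconstant[OF d1] by simp
            define \<mu> \<rho> where "\<mu> = coeff (coeff h' 0) 1" and "\<rho> = coeff (coeff h' 1) 0"
            obtain k where k: "F = h' * k" using plane_factor_prime[OF h'(1)] by (auto elim: dvdE)
            \<comment> \<open>The line \<open>h' = 0\<close> has direction
              \<open>(- \<mu>, \<rho>)\<close> in the coordinates x and t, which becomes an integer
              direction in space.\<close>
            have "eval3 f (x + s * (- \<mu>)) (y + s * (\<rho> * u)) (z + s * (\<rho> * v)) = 0" for s
            proof -
              have "eval2 h' (x + s * (- \<mu>)) (t + s * \<rho>) = eval2 h' x t"
                unfolding eval2_linear[OF d1] by (simp add: \<mu>_def \<rho>_def algebra_simps)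
              then have "eval2 F (x + s * (- \<mu>)) (t + s * \<rho>) = 0" using h'(2) by (simp add: k)
              then show ?thesis unfolding evF by (simp add: t algebra_simps)
            qed
            moreover have "(- \<mu>, \<rho> * u, \<rho> * v) \<noteq> (0, 0, 0)" using ne' uv(1) by (auto simp: \<mu>_def \<rho>_def)
            ultimately have "on_integer_line f x y z" unfolding on_integer_line_def by blast
            then show False using fr by (simp add: free_points_def)
          qed
          \<comment> \<open>A nonzero entry of \<open>(u, v)\<close> times \<open>t\<close> is the
            difference of two coordinates in the box; hence the box of size \<open>2 * N\<close> in
            the definition of \<open>Z\<close>.\<close>
          moreover have "\<bar>t\<bar> \<le> int (2 * N)"
          proof -
            have b: "\<bar>t * u\<bar> \<le> 2 * int N" "\<bar>t * v\<bar> \<le> 2 * int N"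
              using fr(1) p0(1) t by (auto simp: free_points_def)
            have "\<bar>t\<bar> \<le> \<bar>t * w\<bar>" if "w \<noteq> 0" for w :: int
              using that mult_left_mono[of 1 "\<bar>w\<bar>" "\<bar>t\<bar>"] by (simp add: abs_mult)
            then show ?thesis using b uv(1) by (metis of_nat_mult of_nat_numeral order_trans)
          qed
          ultimately have "(x, t) \<in> (\<Union>h'\<in>PF. Z h')"
            using h' fr(1) by (auto simp: PF_def Z_def free_points_def intro!: bexI[of _ h'])
          then show "s \<in> (\<lambda>(x, t). (x, y0 + t * u, z0 + t * v)) ` (\<Union>h'\<in>PF. Z h')"
            using xyz t by (intro image_eqI[of _ _ "(x, t)"]) auto
        qed
        have finU: "finite (\<Union>h'\<in>PF. Z h')" using finPF finZ by blast
        have "card A \<le> card ((\<lambda>(x, t). (x, y0 + t * u, z0 + t * v)) ` (\<Union>h'\<in>PF. Z h'))"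
          using cover finU by (intro card_mono) auto
        also have "\<dots> \<le> card (\<Union>h'\<in>PF. Z h')" by (rule card_image_le[OF finU])
        also have "\<dots> \<le> (\<Sum>h'\<in>PF. card (Z h'))" by (rule card_UN_le[OF finPF])
        finally have "real (card A) \<le> real (\<Sum>h'\<in>PF. card (Z h'))" by (simp only: of_nat_le_iff)
        also have "\<dots> = (\<Sum>h'\<in>PF. real (card (Z h')))" by simp
        also have "\<dots> \<le> (\<Sum>h'\<in>PF. Cd * real (2 * N) powr \<beta>)"
        proof (rule sum_mono)
          fix h' assume h': "h' \<in> PF"
          then have "prime_elem h'" "h' dvd F" "\<not> deg2 h' 1" using plane_factor_prime by (auto simp: PF_def)
          then show "real (card (Z h')) \<le> Cd * real (2 * N) powr \<beta>"
            unfolding Z_def using Cd(2)[of h' "2 * N"] deg2_dvd[OF _ F0 dF] N by simp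
        qed
        also have "\<dots> = real (card PF) * (Cd * real (2 * N) powr \<beta>)" by simp
        also have "\<dots> \<le> real ((d + 1) * (d + 1)^2) * (Cd * real (2 * N) powr \<beta>)"
          using cardPF Cd(1) by (intro mult_right_mono) (simp_all only: of_nat_le_iff, simp)
        also have "real (2 * N) powr \<beta> = 2 powr \<beta> * real N powr \<beta>" by (simp add: powr_mult)
        finally show ?thesis by (simp only: mult.assoc) simp
      qed
    qed
    then show ?thesis
    proof
      assume "real (card A) \<le> CE * d * real N powr \<beta>"
      also have "\<dots> \<le> C * real N powr \<beta>" unfolding C_def using Cd(1) by (intro mult_right_mono) auto
      finally show ?thesis by (simp add: A_def)
    next
      assume "real (card A) \<le> real ((d + 1) * (d + 1)^2) * (Cd * 2 powr \<beta>) * real N powr \<beta>"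
      also have "\<dots> \<le> C * real N powr \<beta>" unfolding C_def using CE(1) by (intro mult_right_mono) auto
      finally show ?thesis by (simp add: A_def)
    qed
  qed
  then show ?thesis using C0 unfolding \<beta>_def by blast
qed

text \<open>Eliminating the first variable puts the intersection over boundedly many plane curves.
  The second surface will be the one from the height argument or the derivative.\<close>

theorem free_points_on_second_surface:
  fixes n d m :: nat
  assumes n: "n \<ge> 1"
  shows "\<exists>C\<ge>0. \<forall>f g N. prime_elem f \<longrightarrow> degree f > 0 \<longrightarrow> deg3 f d \<longrightarrow> deg3 g m \<longrightarrow> \<not> f dvd g \<longrightarrow> N \<ge> 1 \<longrightarrow>
    real (card {(x, y, z) \<in> free_points f N. eval3 g x y z = 0}) \<le> C * real N powr ((n + 2) / (2 * n))"
proof -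
  define \<beta> where "\<beta> = real (n + 2) / real (2 * n)"
  obtain E where E: "\<And>f g :: int poly poly poly. prime_elem f \<Longrightarrow> degree f > 0 \<Longrightarrow> deg3 f d \<Longrightarrow> deg3 g m \<Longrightarrow> \<not> f dvd g \<Longrightarrow>
     (\<exists>r u v. r \<noteq> 0 \<and> deg2 r E \<and> [:r:] = u * f + v * g)"
    using F2.elimination[of d m] by blast
  obtain C where C: "C \<ge> 0" "\<And>f h N. deg3 f d \<Longrightarrow> prime_elem h \<Longrightarrow> deg2 h E \<Longrightarrow> N \<ge> 1 \<Longrightarrow>
    real (card {s \<in> free_points f N. eval2 h (fst (snd s)) (snd (snd s)) = 0}) \<le> C * real N powr \<beta>"
    using free_points_over_plane_curve[OF n, of d E] unfolding \<beta>_def by blast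
  have "real (card {(x, y, z) \<in> free_points f N. eval3 g x y z = 0}) \<le> (real ((E + 1) * (E + 1)^2) * C) * real N powr \<beta>"
    if f: "prime_elem f" "degree f > 0" "deg3 f d" and g: "deg3 g m" "\<not> f dvd g" and N: "N \<ge> 1" for f g N
  proof -
    obtain r u v where r: "r \<noteq> 0" "deg2 r E" "[:r:] = u * f + v * g" using E[OF f g] by blast
    let ?B = "\<lambda>h. {s \<in> free_points f N. eval2 h (fst (snd s)) (snd (snd s)) = 0}"
    have "{(x, y, z) \<in> free_points f N. eval3 g x y z = 0} \<subseteq> (\<Union>h\<in>plane_factors r. ?B h)"
    proof clarify
      fix x y z assume xyz: "(x, y, z) \<in> free_points f N" "eval3 g x y z = 0"
      have "eval3 [:r:] x y z = 0" unfolding r(3) using xyz by (simp add: free_points_def)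
      then have "eval2 r y z = 0" by simp
      then show "(x, y, z) \<in> (\<Union>h\<in>plane_factors r. ?B h)" using plane_factor_vanishes[OF r(1)] xyz(1) by auto
    qed
    then have "card {(x, y, z) \<in> free_points f N. eval3 g x y z = 0} \<le> card (\<Union>h\<in>plane_factors r. ?B h)"
      using plane_factors_finite finite_free_points by (intro card_mono) auto
    also have "\<dots> \<le> (\<Sum>h\<in>plane_factors r. card (?B h))" by (rule card_UN_le[OF plane_factors_finite])
    finally have "real (card {(x, y, z) \<in> free_points f N. eval3 g x y z = 0}) \<le> real (\<Sum>h\<in>plane_factors r. card (?B h))"
      by (simp only: of_nat_le_iff)
    also have "\<dots> = (\<Sum>h\<in>plane_factors r. real (card (?B h)))" by simp
    also have "\<dots> \<le> (\<Sum>h\<in>plane_factors r. C * real N powr \<beta>)"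
    proof (rule sum_mono)
      fix h assume h: "h \<in> plane_factors r"
      then show "real (card (?B h)) \<le> C * real N powr \<beta>"
        using C(2)[OF f(3), of h N] plane_factor_prime[OF h] deg2_dvd[OF _ r(1,2)] N by simp
    qed
    also have "\<dots> = real (card (plane_factors r)) * (C * real N powr \<beta>)" by simp
    also have "\<dots> \<le> real ((E + 1) * (E + 1)^2) * (C * real N powr \<beta>)"
      using card_plane_factors[OF r(1,2)] C(1) by (intro mult_right_mono) (simp_all only: of_nat_le_iff, simp)
    finally show ?thesis by (simp only: mult.assoc)
  qed
  then show ?thesis using C(1) unfolding \<beta>_def by (intro exI[of _ "real ((E + 1) * (E + 1)^2) * C"]) auto
qed

section \<open>Changing the primes\<close>

lemma card_PiE_bound:
  assumes "finite I" "\<And>i. i \<in> I \<Longrightarrow> finite (A i)" "\<And>i. i \<in> I \<Longrightarrow> card (A i) \<le> w"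
  shows "finite (PiE I A) \<and> card (PiE I A) \<le> w ^ card I"
proof -
  have "card (PiE I A) = (\<Prod>i\<in>I. card (A i))" using assms(1) by (rule card_PiE)
  also have "\<dots> \<le> (\<Prod>i\<in>I. w)" using assms(3) by (intro prod_mono) auto
  finally show ?thesis using assms(1,2) by (auto intro: finite_PiE)
qed

lemma card_eq_sum_fibres:
  assumes "finite X"
  shows "card X = (\<Sum>v\<in>f ` X. card {x \<in> X. f x = v})"
proof -
  have "X = (\<Union>v\<in>f ` X. {x \<in> X. f x = v})" by auto
  then have "card X = card (\<Union>v\<in>f ` X. {x \<in> X. f x = v})" by simp
  also have "\<dots> = (\<Sum>v\<in>f ` X. card {x \<in> X. f x = v})"
    using assms by (intro card_UN_disjoint) auto
  finally show ?thesis .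
qed

lemma sum_fibre_squares:
  assumes "finite X"
  shows "(\<Sum>v\<in>f ` X. card {x \<in> X. f x = v} ^ 2) = card {(x, y) \<in> X \<times> X. f x = f y}"
proof -
  let ?P = "{(x, y) \<in> X \<times> X. f x = f y}"
  have fin: "finite ?P" using assms by (auto intro: finite_subset[of _ "X \<times> X"])
  have img: "(\<lambda>p. f (fst p)) ` ?P = f ` X" by force
  have "card ?P = (\<Sum>v\<in>f ` X. card {p \<in> ?P. f (fst p) = v})"
    using card_eq_sum_fibres[OF fin, of "\<lambda>p. f (fst p)"] by (simp only: img)
  also have "\<dots> = (\<Sum>v\<in>f ` X. card {x \<in> X. f x = v} ^ 2)"
  proof (rule sum.cong)
    fix v
    have "{p \<in> ?P. f (fst p) = v} = {x \<in> X. f x = v} \<times> {x \<in> X. f x = v}" by auto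
    then show "card {p \<in> ?P. f (fst p) = v} = card {x \<in> X. f x = v} ^ 2"
      by (simp add: card_cartesian_product power2_eq_square)
  qed simp
  finally show ?thesis ..
qed

text \<open>Points carry labels that are, initially, compatible with a base tuple of primes. Swapping one prime at a
  time, the label of a point either stays compatible up to another tuple or the point is one of few
  exceptional points. Points with a persistent label are then counted with a random tuple, for which points
  with the same label rarely lie in the same class.\<close>

locale label_tracking =
  fixes S :: "'p set" and t :: nat and A :: "nat \<Rightarrow> 'q set" and T0 :: "nat \<Rightarrow> 'q"
    and class_of :: "'q \<Rightarrow> 'p \<Rightarrow> 'k" and good :: "'q \<Rightarrow> 'p \<Rightarrow> bool"
    and H :: "(nat \<Rightarrow> 'q) \<Rightarrow> 'p \<Rightarrow> 'h set" and label :: "'p \<Rightarrow> 'h"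
    and z w h c r r' M :: nat
  assumes finS: "finite S" and t: "t \<ge> 1"
    and A: "\<And>i. i < t \<Longrightarrow> finite (A i)" "\<And>i. i < t \<Longrightarrow> card (A i) = z"
    and good0: "\<And>i x. i < t \<Longrightarrow> x \<in> S \<Longrightarrow> good (T0 i) x"
    and classes: "\<And>i p. i < t \<Longrightarrow> p = T0 i \<or> p \<in> A i \<Longrightarrow>
      finite (class_of p ` {x \<in> S. good p x}) \<and> card (class_of p ` {x \<in> S. good p x}) \<le> w"
    and H_finite: "\<And>T x. finite (H T x)"
    and H_card: "\<And>T x. (\<And>i. i < t \<Longrightarrow> T i = T0 i \<or> T i \<in> A i) \<Longrightarrow> card (H T x) \<le> h"
    and H_class: "\<And>T x y. (\<And>i. i < t \<Longrightarrow> class_of (T i) x = class_of (T i) y) \<Longrightarrow> H T x = H T y"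
    and isolated: "\<And>T T' x l. (\<And>i. i < t \<Longrightarrow> T i = T0 i \<or> T i \<in> A i) \<Longrightarrow> (\<And>i. i < t \<Longrightarrow> T' i = T0 i \<or> T' i \<in> A i) \<Longrightarrow>
      card {y \<in> S. (\<forall>i<t. good (T i) y \<and> good (T' i) y \<and> class_of (T i) y = class_of (T i) x \<and> class_of (T' i) y = class_of (T' i) x)
        \<and> label y = l \<and> l \<in> H T y \<and> l \<notin> H T' y} \<le> c"
    and label0: "\<And>x. x \<in> S \<Longrightarrow> label x \<in> H T0 x"
    and bad: "\<And>x i. x \<in> S \<Longrightarrow> i < t \<Longrightarrow> card {p \<in> A i. \<not> good p x} \<le> r"
    and collisions: "\<And>x y i. x \<in> S \<Longrightarrow> y \<in> S \<Longrightarrow> x \<noteq> y \<Longrightarrow> i < t \<Longrightarrow> card {p \<in> A i. class_of p x = class_of p y} \<le> r'"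
    and mass: "\<And>l. card {x \<in> S. label x = l} \<le> M"
    and z: "z \<ge> 4 * t * r" "z \<ge> 1"
begin

definition tuples where "tuples = PiE {..<t} A"

lemma tuples: "finite tuples" "card tuples = z ^ t"
  unfolding tuples_def using A by (auto simp: card_PiE intro: finite_PiE)

definition swapped where "swapped T i j = (if j < i then T j else T0 j)"

lemma swapped_valid: "T \<in> tuples \<Longrightarrow> j < t \<Longrightarrow> swapped T i j = T0 j \<or> swapped T i j \<in> A j"
  by (auto simp: swapped_def tuples_def)

lemma swapped_0: "swapped T 0 = T0"
  by (simp add: swapped_def fun_eq_iff)

definition all_good where "all_good T = {x \<in> S. \<forall>i<t. good (T i) x}"

definition lost where "lost T = {x \<in> all_good T. label x \<notin> H (swapped T t) x}"

text \<open>A lost label has a first step at which it drops out. The two tuples at this step contain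
  only \<open>t + 1\<close> primes between them. In a joint class modulo these, at most
  \<open>h\<close> labels are possible, and each of them is lost at no more than \<open>c\<close>
  points.\<close>

lemma card_lost:
  assumes T: "T \<in> tuples"
  shows "card (lost T) \<le> t * (w ^ (t + 1) * (h * c))"
proof -
  define L where "L i = {x \<in> all_good T. label x \<in> H (swapped T i) x \<and> label x \<notin> H (swapped T (Suc i)) x}" for i
  have TA: "T j \<in> A j" if "j < t" for j using T that by (auto simp: tuples_def)
  have finL: "finite (L i)" for i using finS by (simp add: L_def all_good_def)
  have cover: "lost T \<subseteq> (\<Union>i<t. L i)"
  proof
    fix x assume x: "x \<in> lost T"
    define P where "P i \<longleftrightarrow> label x \<notin> H (swapped T i) x" for i
    have "P t" using x by (simp add: P_def lost_def)
    then have "\<exists>k\<le>t. (\<forall>i<k. \<not> P i) \<and> P k" by (rule ex_least_nat_le)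
    then obtain k where k: "k \<le> t" "\<forall>i<k. \<not> P i" "P k" by blast
    have "\<not> P 0" using x label0 by (auto simp: P_def swapped_0 lost_def all_good_def)
    then obtain i where i: "k = Suc i" using k(3) by (cases k) auto
    then have "x \<in> L i" using k x by (auto simp: L_def P_def lost_def)
    then show "x \<in> (\<Union>i<t. L i)" using i k(1) by auto
  qed
  have cardL: "card (L i) \<le> w ^ (t + 1) * (h * c)" if i: "i < t" for i
  proof -
    \<comment> \<open>The primes of both tuples in a single list: T 0, ..., T i, followed by T0 i,
      ..., T0 (t - 1), whence the shift by one.\<close>
    define \<pi> where "\<pi> j = (if j \<le> i then T j else T0 (j - 1))" for j
    define f where "f x = restrict (\<lambda>j. class_of (\<pi> j) x) {..t}" for x
    have classes\<pi>: "finite (class_of (\<pi> j) ` {x \<in> S. good (\<pi> j) x}) \<and> card (class_of (\<pi> j) ` {x \<in> S. good (\<pi> j) x}) \<le> w"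
      if "j \<in> {..t}" for j
    proof (cases "j \<le> i")
      case True
      then show ?thesis using classes[of j "T j"] TA[of j] i by (simp add: \<pi>_def)
    next
      case False
      then have "j - 1 < t" using that by auto
      then show ?thesis using classes[of "j - 1" "T0 (j - 1)"] False by (simp add: \<pi>_def)
    qed
    define V where "V = PiE {..t} (\<lambda>j. class_of (\<pi> j) ` {x \<in> S. good (\<pi> j) x})"
    have V: "finite V" "card V \<le> w ^ (t + 1)"
      using card_PiE_bound[of "{..t}" "\<lambda>j. class_of (\<pi> j) ` {x \<in> S. good (\<pi> j) x}" w] classes\<pi> by (simp_all add: V_def)
    have good\<pi>: "good (\<pi> j) x" if "x \<in> L i" "j \<le> t" for x j
    proof (cases "j \<le> i")
      case True
      then show ?thesis using that i by (auto simp: \<pi>_def L_def all_good_def)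
    next
      case False
      then have "j - 1 < t" using that by auto
      then show ?thesis using good0[of "j - 1" x] that False by (auto simp: \<pi>_def L_def all_good_def)
    qed
    show ?thesis
    proof (rule card_le_fibres[OF finL _ V])
      show "f ` L i \<subseteq> V"
        using good\<pi> by (auto simp: f_def V_def L_def all_good_def PiE_iff extensional_def split: if_splits)
      fix v assume "v \<in> f ` L i"
      then obtain x where x: "x \<in> L i" "v = f x" by blast
      have valid: "swapped T k j = T0 j \<or> swapped T k j \<in> A j" if "j < t" for k j
        using swapped_valid[OF T that] .
      define B where "B l = {y \<in> S. (\<forall>j<t. good (swapped T i j) y \<and> good (swapped T (Suc i) j) y
          \<and> class_of (swapped T i j) y = class_of (swapped T i j) x \<and> class_of (swapped T (Suc i) j) y = class_of (swapped T (Suc i) j) x)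
        \<and> label y = l \<and> l \<in> H (swapped T i) y \<and> l \<notin> H (swapped T (Suc i)) y}" for l
      have B: "card (B l) \<le> c" for l unfolding B_def by (rule isolated) (use valid in auto)
      have finB: "finite (B l)" for l unfolding B_def using finS by simp
      have sub: "{y \<in> L i. f y = v} \<subseteq> (\<Union>l\<in>H (swapped T i) x. B l)"
      proof
        fix y assume y: "y \<in> {y \<in> L i. f y = v}"
        have cl: "class_of (\<pi> j) y = class_of (\<pi> j) x" if "j \<le> t" for j
        proof -
          have "f y j = f x j" using y x by simp
          then show ?thesis using that by (simp add: f_def)
        qed
        have sw: "swapped T i j = \<pi> (if j < i then j else Suc j)" "swapped T (Suc i) j = \<pi> (if j \<le> i then j else Suc j)" for j
          by (auto simp: swapped_def \<pi>_def)
        have cls: "class_of (swapped T i j) y = class_of (swapped T i j) x"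
            "class_of (swapped T (Suc i) j) y = class_of (swapped T (Suc i) j) x" if "j < t" for j
          unfolding sw using that by (auto intro!: cl)
        have goods: "good (swapped T i j) y" "good (swapped T (Suc i) j) y" if "j < t" for j
          unfolding sw using that y by (auto intro!: good\<pi>)
        have "H (swapped T i) y = H (swapped T i) x" using cls by (intro H_class) auto
        then have "label y \<in> H (swapped T i) x" using y by (auto simp: L_def)
        moreover have "y \<in> B (label y)" using y cls goods by (auto simp: B_def L_def all_good_def)
        ultimately show "y \<in> (\<Union>l\<in>H (swapped T i) x. B l)" by blast
      qed
      have "card {y \<in> L i. f y = v} \<le> card (\<Union>l\<in>H (swapped T i) x. B l)"
        using sub H_finite finB by (intro card_mono) auto
      also have "\<dots> \<le> (\<Sum>l\<in>H (swapped T i) x. card (B l))" by (rule card_UN_le[OF H_finite])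
      also have "\<dots> \<le> card (H (swapped T i) x) * c"
        using sum_bounded_above[of "H (swapped T i) x" "\<lambda>l. card (B l)" c] B by simp
      also have "\<dots> \<le> h * c" by (intro mult_le_mono1 H_card valid)
      finally show "card {y \<in> L i. f y = v} \<le> h * c" .
    qed
  qed
  have "card (lost T) \<le> card (\<Union>i<t. L i)" using cover finL by (intro card_mono) auto
  also have "\<dots> \<le> (\<Sum>i<t. card (L i))" by (rule card_UN_le) simp
  also have "\<dots> \<le> t * (w ^ (t + 1) * (h * c))"
    using sum_bounded_above[of "{..<t}" "\<lambda>i. card (L i)" "w ^ (t + 1) * (h * c)"] cardL by simp
  finally show ?thesis .
qed

definition colliding where
  "colliding T = {(x, y) \<in> S \<times> S. label x = label y \<and> (\<forall>i<t. class_of (T i) x = class_of (T i) y)}"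

text \<open>Points are grouped by class and label, into at most \<open>w ^ t * h\<close> groups. A
  group of m points is charged to \<open>\<nu>\<close> if it is small and to its m^2 colliding pairs
  otherwise; both cases give m <= \<nu> + m^2 / \<nu>.\<close>

lemma card_kept:
  fixes \<nu> :: real
  assumes T: "T \<in> tuples" and pos: "\<nu> > 0"
  shows "real (card (all_good T - lost T)) \<le> \<nu> * (w ^ t * h) + real (card (colliding T)) / \<nu>"
proof -
  define X where "X = all_good T - lost T"
  have finX: "finite X" using finS by (simp add: X_def all_good_def)
  define \<phi> where "\<phi> x = (restrict (\<lambda>i. class_of (T i) x) {..<t}, label x)" for x
  have TA: "T j \<in> A j" if "j < t" for j using T that by (auto simp: tuples_def)
  define V where "V = PiE {..<t} (\<lambda>j. class_of (T j) ` {x \<in> S. good (T j) x})"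
  have V: "finite V" "card V \<le> w ^ t"
    using card_PiE_bound[of "{..<t}" "\<lambda>j. class_of (T j) ` {x \<in> S. good (T j) x}" w] classes TA by (simp_all add: V_def)
  have image: "card (\<phi> ` X) \<le> w ^ t * h"
  proof (rule card_le_fibres[OF _ _ V, of _ fst])
    show "finite (\<phi> ` X)" using finX by simp
    show "fst ` \<phi> ` X \<subseteq> V" by (auto simp: \<phi>_def V_def X_def all_good_def PiE_iff extensional_def split: if_splits)
    fix v assume "v \<in> fst ` \<phi> ` X"
    then obtain x where x: "x \<in> X" "v = fst (\<phi> x)" by blast
    have "{p \<in> \<phi> ` X. fst p = v} \<subseteq> Pair v ` H (swapped T t) x"
    proof
      fix p assume "p \<in> {p \<in> \<phi> ` X. fst p = v}"
      then obtain y where y: "y \<in> X" "p = \<phi> y" "fst (\<phi> y) = fst (\<phi> x)" using x by auto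
      have "class_of (swapped T t i) y = class_of (swapped T t i) x" if "i < t" for i
        using fun_cong[OF y(3)[unfolded \<phi>_def fst_conv], of i] that by (simp add: swapped_def)
      then have "H (swapped T t) y = H (swapped T t) x" by (rule H_class)
      then have "label y \<in> H (swapped T t) x" using y(1) by (auto simp: X_def lost_def)
      moreover have "p = (v, label y)" using y x by (simp add: \<phi>_def)
      ultimately show "p \<in> Pair v ` H (swapped T t) x" by blast
    qed
    then have "card {p \<in> \<phi> ` X. fst p = v} \<le> card (Pair v ` H (swapped T t) x)"
      using H_finite by (intro card_mono) auto
    also have "\<dots> \<le> card (H (swapped T t) x)" by (rule card_image_le[OF H_finite])
    also have "\<dots> \<le> h" by (rule H_card) (rule swapped_valid[OF T])
    finally show "card {p \<in> \<phi> ` X. fst p = v} \<le> h" .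
  qed
  define N where "N v = card {x \<in> X. \<phi> x = v}" for v
  have "(\<Sum>v\<in>\<phi> ` X. N v ^ 2) = card {(x, y) \<in> X \<times> X. \<phi> x = \<phi> y}"
    unfolding N_def by (rule sum_fibre_squares[OF finX])
  also have "\<dots> \<le> card (colliding T)"
  proof (rule card_mono)
    show "finite (colliding T)" unfolding colliding_def using finS by (auto intro: finite_subset[of _ "S \<times> S"])
    have cl: "class_of (T i) x = class_of (T i) y" if "\<phi> x = \<phi> y" "i < t" for x y i
    proof -
      have "fst (\<phi> x) i = fst (\<phi> y) i" using that(1) by simp
      then show ?thesis using that(2) by (simp add: \<phi>_def)
    qed
    have lab: "label x = label y" if "\<phi> x = \<phi> y" for x y
      using arg_cong[OF that, of snd] by (simp add: \<phi>_def)
    show "{(x, y) \<in> X \<times> X. \<phi> x = \<phi> y} \<subseteq> colliding T"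
    proof clarify
      fix x y assume "x \<in> X" "y \<in> X" and eq: "\<phi> x = \<phi> y"
      then show "(x, y) \<in> colliding T"
        using cl[OF eq] lab[OF eq] by (simp add: colliding_def X_def all_good_def)
    qed
  qed
  finally have sq: "(\<Sum>v\<in>\<phi> ` X. N v ^ 2) \<le> card (colliding T)" .
  have le: "real m \<le> \<nu> + real (m ^ 2) / \<nu>" for m :: nat
  proof (cases "real m \<le> \<nu>")
    case True
    then show ?thesis using pos by (simp add: add_increasing2)
  next
    case False
    then have "real m * \<nu> \<le> real m * real m" by (intro mult_left_mono) auto
    then have "real m \<le> real (m ^ 2) / \<nu>" using pos by (simp add: pos_le_divide_eq power2_eq_square)
    then show ?thesis using pos by linarith
  qed
  have "real (card X) = (\<Sum>v\<in>\<phi> ` X. real (N v))"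
    using card_eq_sum_fibres[OF finX, of \<phi>] by (simp add: N_def)
  also have "\<dots> \<le> (\<Sum>v\<in>\<phi> ` X. \<nu> + real (N v ^ 2) / \<nu>)" by (intro sum_mono le)
  also have "\<dots> = real (card (\<phi> ` X)) * \<nu> + real (\<Sum>v\<in>\<phi> ` X. N v ^ 2) / \<nu>"
    by (simp add: sum.distrib sum_divide_distrib)
  also have "\<dots> \<le> real (w ^ t * h) * \<nu> + real (card (colliding T)) / \<nu>"
    by (intro add_mono mult_right_mono divide_right_mono of_nat_mono image sq less_imp_le[OF pos])
  finally show ?thesis by (simp add: X_def mult.commute)
qed

lemma sum_card_swap:
  assumes "finite B" "finite Q"
  shows "(\<Sum>T\<in>B. card {p \<in> Q. R T p}) = (\<Sum>p\<in>Q. card {T \<in> B. R T p})"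
proof -
  have "(\<Sum>T\<in>B. card {p \<in> Q. R T p}) = (\<Sum>T\<in>B. \<Sum>p\<in>Q. if R T p then 1 else 0)"
    using assms by (simp add: sum.If_cases Int_def)
  also have "\<dots> = (\<Sum>p\<in>Q. \<Sum>T\<in>B. if R T p then 1 else 0)" by (rule sum.swap)
  also have "\<dots> = (\<Sum>p\<in>Q. card {T \<in> B. R T p})" using assms by (simp add: sum.If_cases Int_def)
  finally show ?thesis .
qed

text \<open>A point collides with itself for every tuple. Two different points are identified by at
  most \<open>r'\<close> primes in each place, so by at most \<open>r' ^ t\<close> tuples, and a
  point has at most \<open>M\<close> partners with its label.\<close>

lemma sum_colliding: "(\<Sum>T\<in>tuples. card (colliding T)) \<le> card S * (z ^ t + M * r' ^ t)"
proof -
  define Q where "Q = (SIGMA x:S. {y \<in> S. label y = label x})"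
  define R where "R T p \<longleftrightarrow> (\<forall>i<t. class_of (T i) (fst p) = class_of (T i) (snd p))" for T p
  have finQ: "finite Q" unfolding Q_def using finS by (intro finite_SigmaI) auto
  have "colliding T = {p \<in> Q. R T p}" for T by (auto simp: colliding_def Q_def R_def)
  then have "(\<Sum>T\<in>tuples. card (colliding T)) = (\<Sum>p\<in>Q. card {T \<in> tuples. R T p})"
    using sum_card_swap[OF tuples(1) finQ, of R] by simp
  also have "\<dots> \<le> (\<Sum>p\<in>Q. (if fst p = snd p then z ^ t else 0) + r' ^ t)"
  proof (rule sum_mono)
    fix p assume "p \<in> Q"
    then have p: "fst p \<in> S" "snd p \<in> S" by (auto simp: Q_def)
    show "card {T \<in> tuples. R T p} \<le> (if fst p = snd p then z ^ t else 0) + r' ^ t"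
    proof (cases "fst p = snd p")
      case True
      have "card {T \<in> tuples. R T p} \<le> card tuples" using tuples(1) by (intro card_mono) auto
      then show ?thesis using True tuples(2) by simp
    next
      case False
      let ?W = "PiE {..<t} (\<lambda>i. {q \<in> A i. class_of q (fst p) = class_of q (snd p)})"
      have W: "finite ?W \<and> card ?W \<le> r' ^ card {..<t}"
        using A(1) collisions[OF p False] by (intro card_PiE_bound) auto
      have "{T \<in> tuples. R T p} \<subseteq> ?W" by (auto simp: tuples_def R_def PiE_iff extensional_def)
      then have "card {T \<in> tuples. R T p} \<le> card ?W" using W by (intro card_mono) auto
      then show ?thesis using W False by simp
    qed
  qed
  also have "\<dots> = (\<Sum>x\<in>S. \<Sum>y\<in>{y \<in> S. label y = label x}. (if x = y then z ^ t else 0) + r' ^ t)"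
    unfolding Q_def using finS by (subst sum.Sigma) (auto simp: case_prod_unfold)
  also have "\<dots> \<le> (\<Sum>x\<in>S. z ^ t + M * r' ^ t)"
  proof (rule sum_mono)
    fix x assume "x \<in> S"
    then have "(\<Sum>y\<in>{y \<in> S. label y = label x}. (if x = y then z ^ t else 0) + r' ^ t)
        = z ^ t + card {y \<in> S. label y = label x} * r' ^ t"
      using finS by (simp add: sum.distrib)
    also have "\<dots> \<le> z ^ t + M * r' ^ t" using mass by (intro add_left_mono mult_le_mono1)
    finally show "(\<Sum>y\<in>{y \<in> S. label y = label x}. (if x = y then z ^ t else 0) + r' ^ t) \<le> z ^ t + M * r' ^ t" .
  qed
  finally show ?thesis by simp
qed

text \<open>A union bound over the places; by \<open>z \<ge> 4 * t * r\<close>, a tuple is bad at no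
  more than a quarter of \<open>S\<close> on average.\<close>

lemma sum_not_good: "4 * (\<Sum>T\<in>tuples. card (S - all_good T)) \<le> card S * z ^ t"
proof -
  have "(\<Sum>T\<in>tuples. card (S - all_good T)) = (\<Sum>T\<in>tuples. card {x \<in> S. \<exists>i<t. \<not> good (T i) x})"
    by (intro sum.cong arg_cong[of _ _ card]) (auto simp: all_good_def)
  also have "\<dots> = (\<Sum>x\<in>S. card {T \<in> tuples. \<exists>i<t. \<not> good (T i) x})"
    by (rule sum_card_swap[OF tuples(1) finS])
  also have "\<dots> \<le> (\<Sum>x\<in>S. t * (r * z ^ (t - 1)))"
  proof (rule sum_mono)
    fix x assume x: "x \<in> S"
    let ?D = "\<lambda>i. {T \<in> tuples. \<not> good (T i) x}"
    have D: "card (?D i) \<le> r * z ^ (t - 1)" if i: "i < t" for i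
    proof -
      \<comment> \<open>The tuples that are bad in place \<open>i\<close> form a product in which
        one factor is cut down to the bad primes.\<close>
      define A' where "A' j = (if j = i then {p \<in> A i. \<not> good p x} else A j)" for j
      have "?D i \<subseteq> PiE {..<t} A'" using i by (auto simp: tuples_def A'_def PiE_iff extensional_def)
      moreover have "finite (PiE {..<t} A')" using A(1) i by (intro finite_PiE) (auto simp: A'_def)
      ultimately have "card (?D i) \<le> card (PiE {..<t} A')" by (rule card_mono[rotated])
      also have "\<dots> = (\<Prod>j<t. card (A' j))" by (simp add: card_PiE)
      also have "\<dots> = card (A' i) * (\<Prod>j\<in>{..<t} - {i}. card (A' j))" using i by (subst prod.remove[of _ i]) auto
      also have "(\<Prod>j\<in>{..<t} - {i}. card (A' j)) = (\<Prod>j\<in>{..<t} - {i}. z)"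
        using A(2) by (intro prod.cong) (auto simp: A'_def)
      also have "\<dots> = z ^ (t - 1)" using i by simp
      also have "card (A' i) * z ^ (t - 1) \<le> r * z ^ (t - 1)" using bad[OF x i] by (simp add: A'_def)
      finally show ?thesis .
    qed
    have "card {T \<in> tuples. \<exists>i<t. \<not> good (T i) x} = card (\<Union>i<t. ?D i)" by (rule arg_cong[of _ _ card]) auto
    also have "\<dots> \<le> (\<Sum>i<t. card (?D i))" by (rule card_UN_le) simp
    also have "\<dots> \<le> t * (r * z ^ (t - 1))"
      using sum_bounded_above[of "{..<t}" "\<lambda>i. card (?D i)" "r * z ^ (t - 1)"] D by simp
    finally show "card {T \<in> tuples. \<exists>i<t. \<not> good (T i) x} \<le> t * (r * z ^ (t - 1))" .
  qed
  also have "\<dots> = card S * (t * (r * z ^ (t - 1)))" by simp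
  finally have "4 * (\<Sum>T\<in>tuples. card (S - all_good T)) \<le> card S * ((4 * t * r) * z ^ (t - 1))" by (simp add: mult_ac)
  also have "\<dots> \<le> card S * (z * z ^ (t - 1))" using z(1) by (intro mult_le_mono2 mult_le_mono1)
  also have "z * z ^ (t - 1) = z ^ t" using t by (cases t) auto
  finally show ?thesis .
qed

text \<open>An average over all tuples. Bad points and collisions account for at most a quarter of
  \<open>S\<close> each; moving this half to the left gives the factor 2.\<close>

theorem card_bound:
  "real (card S) \<le> 2 * real (t * (w ^ (t + 1) * (h * c))) + 8 * (1 + real (M * r' ^ t) / real (z ^ t)) * real (w ^ t * h)"
proof -
  \<comment> \<open>Chosen such that \<open>card (colliding T) / \<kappa>\<close> is on average at
    most a quarter of \<open>card S\<close>.\<close>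
  define \<kappa> where "\<kappa> = 4 * (1 + real (M * r' ^ t) / real (z ^ t))"
  have zt: "real (z ^ t) > 0" using z(2) by simp
  have \<kappa>: "\<kappa> > 0" unfolding \<kappa>_def using zt by (intro mult_pos_pos add_pos_nonneg) auto
  define a where "a = real (t * (w ^ (t + 1) * (h * c)))"
  define b where "b = real (w ^ t * h)"
  have each: "real (card S) \<le> real (card (S - all_good T)) + (a + (\<kappa> * b + real (card (colliding T)) / \<kappa>))" if T: "T \<in> tuples" for T
  proof -
    have "S = (S - all_good T) \<union> (lost T \<union> (all_good T - lost T))" by (auto simp: all_good_def lost_def)
    then have "card S \<le> card (S - all_good T) + card (lost T \<union> (all_good T - lost T))" by (metis card_Un_le)
    also have "card (lost T \<union> (all_good T - lost T)) \<le> card (lost T) + card (all_good T - lost T)" by (rule card_Un_le)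
    finally have "real (card S) \<le> real (card (S - all_good T)) + (real (card (lost T)) + real (card (all_good T - lost T)))" by linarith
    moreover have "real (card (lost T)) \<le> a" unfolding a_def using card_lost[OF T] by (simp only: of_nat_le_iff)
    moreover have "real (card (all_good T - lost T)) \<le> \<kappa> * b + real (card (colliding T)) / \<kappa>"
      using card_kept[OF T \<kappa>] by (simp add: b_def)
    ultimately show ?thesis by linarith
  qed
  have "real (z ^ t) * real (card S) = (\<Sum>T\<in>tuples. real (card S))" by (simp add: tuples(2))
  also have "\<dots> \<le> (\<Sum>T\<in>tuples. real (card (S - all_good T)) + (a + (\<kappa> * b + real (card (colliding T)) / \<kappa>)))"
    by (intro sum_mono each)
  also have "\<dots> = real (\<Sum>T\<in>tuples. card (S - all_good T)) + (real (z ^ t) * a + (real (z ^ t) * (\<kappa> * b)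
      + real (\<Sum>T\<in>tuples. card (colliding T)) / \<kappa>))"
    by (simp add: sum.distrib tuples(2) sum_divide_distrib)
  finally have main: "real (z ^ t) * real (card S) \<le> real (\<Sum>T\<in>tuples. card (S - all_good T)) + (real (z ^ t) * a
      + (real (z ^ t) * (\<kappa> * b) + real (\<Sum>T\<in>tuples. card (colliding T)) / \<kappa>))" .
  have "real (4 * (\<Sum>T\<in>tuples. card (S - all_good T))) \<le> real (card S * z ^ t)"
    using sum_not_good by (simp only: of_nat_le_iff)
  then have 1: "4 * real (\<Sum>T\<in>tuples. card (S - all_good T)) \<le> real (card S) * real (z ^ t)" by simp
  have "real (\<Sum>T\<in>tuples. card (colliding T)) \<le> real (card S * (z ^ t + M * r' ^ t))"
    using sum_colliding by (simp only: of_nat_le_iff)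
  also have "\<dots> = real (card S) * (real (z ^ t) * (\<kappa> / 4))"
    using zt by (simp add: \<kappa>_def field_simps)
  finally have 2: "real (\<Sum>T\<in>tuples. card (colliding T)) / \<kappa> \<le> real (card S) * real (z ^ t) / 4"
    using \<kappa> by (simp add: field_simps)
  have "real (z ^ t) * real (card S) \<le> real (z ^ t) * (2 * a + 2 * (\<kappa> * b))"
    using main 1 2 by (simp add: algebra_simps)
  then have "real (card S) \<le> 2 * a + 2 * (\<kappa> * b)" using zt by (simp only: mult_le_cancel_left_pos)
  then show ?thesis by (simp add: a_def b_def \<kappa>_def algebra_simps)
qed

end

section \<open>Uniform bounds for finite algebraic families\<close>

interpretation rat_vs: vector_space "\<lambda>(q::rat) (x::complex). of_rat q * x"
  by unfold_locales (auto simp: algebra_simps of_rat_add of_rat_mult)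

text \<open>A ring of finite dimension over the rationals, in which all the algebraic numbers of an
  argument can be placed at once.\<close>

definition finite_rat_ring :: "complex set \<Rightarrow> bool" where
  "finite_rat_ring R \<longleftrightarrow> (\<forall>q. of_rat q \<in> R) \<and> (\<forall>x\<in>R. \<forall>y\<in>R. x + y \<in> R \<and> x * y \<in> R) \<and> (\<exists>B. finite B \<and> R \<subseteq> rat_vs.span B)"

lemma finite_rat_ring_rat: "finite_rat_ring R \<Longrightarrow> of_rat q \<in> R"
  and finite_rat_ring_add: "finite_rat_ring R \<Longrightarrow> x \<in> R \<Longrightarrow> y \<in> R \<Longrightarrow> x + y \<in> R"
  and finite_rat_ring_mult: "finite_rat_ring R \<Longrightarrow> x \<in> R \<Longrightarrow> y \<in> R \<Longrightarrow> x * y \<in> R"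
  by (auto simp: finite_rat_ring_def)

lemma finite_rat_ring_01: "finite_rat_ring R \<Longrightarrow> 0 \<in> R" "finite_rat_ring R \<Longrightarrow> 1 \<in> R"
  using finite_rat_ring_rat[of R 0] finite_rat_ring_rat[of R 1] by auto

lemma finite_rat_ring_uminus: "finite_rat_ring R \<Longrightarrow> x \<in> R \<Longrightarrow> - x \<in> R"
  using finite_rat_ring_mult[of R "of_rat (-1)" x] finite_rat_ring_rat[of R "-1"] by (simp add: of_rat_minus)

lemma finite_rat_ring_power: "finite_rat_ring R \<Longrightarrow> x \<in> R \<Longrightarrow> x ^ i \<in> R"
  by (induction i) (auto intro: finite_rat_ring_01 finite_rat_ring_mult)

text \<open>More powers of \<open>x\<close> than the dimension allows are linearly dependent over
  the rationals, unless two of them coincide, which is an equation for \<open>x\<close> as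
  well.\<close>

lemma algebraic_if_in_finite_rat_ring:
  assumes R: "finite_rat_ring R" and x: "x \<in> R"
  shows "algebraic x"
proof -
  obtain B where B: "finite B" "R \<subseteq> rat_vs.span B" using R by (auto simp: finite_rat_ring_def)
  define n where "n = card B"
  show ?thesis
  proof (cases "inj_on (\<lambda>i. x ^ i) {..n}")
    case False
    then obtain i j where ij: "i \<noteq> j" "x ^ i = x ^ j" by (auto simp: inj_on_def)
    define p :: "complex poly" where "p = monom 1 i - monom 1 j"
    have "coeff p i \<noteq> 0" using ij by (simp add: p_def)
    then have "p \<noteq> 0" by auto
    moreover have "coeff p k \<in> \<int>" for k by (simp add: p_def)
    moreover have "poly p x = 0" using ij by (simp add: p_def poly_monom)
    ultimately show ?thesis by (intro algebraicI[of p]) auto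
  next
    case True
    define S where "S = (\<lambda>i. x ^ i) ` {..n}"
    have "card S = Suc n" unfolding S_def using card_image[OF True] by simp
    moreover have "S \<subseteq> rat_vs.span B" using B(2) finite_rat_ring_power[OF R x] by (auto simp: S_def)
    ultimately have "rat_vs.dependent S" using rat_vs.independent_span_bound[OF B(1), of S] by (auto simp: n_def)
    then obtain u v0 where u: "v0 \<in> S" "u v0 \<noteq> 0" "(\<Sum>v\<in>S. of_rat (u v) * v) = 0"
      using rat_vs.dependent_finite[of S] by (auto simp: S_def)
    obtain i0 where i0: "i0 \<le> n" "v0 = x ^ i0" using u(1) by (auto simp: S_def)
    define p :: "complex poly" where "p = (\<Sum>i\<le>n. monom (of_rat (u (x ^ i))) i)"
    have coef: "coeff p k = (if k \<le> n then of_rat (u (x ^ k)) else 0)" for k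
      by (simp add: p_def coeff_sum)
    have "coeff p i0 \<noteq> 0" using i0 u(2) by (simp add: coef)
    then have "p \<noteq> 0" by auto
    moreover have "poly p x = 0"
      using u(3) unfolding S_def by (simp add: p_def poly_sum poly_monom sum.reindex[OF True])
    ultimately show ?thesis by (intro algebraicI'[of p]) (auto simp: coef)
  qed
qed

text \<open>The combinations of 1, x, ..., x^(n-1) over \<open>R\<close> are closed under
  multiplication by \<open>x\<close> because of the monic relation, hence they form a ring. The
  products of these powers with a spanning set of \<open>R\<close> span it.\<close>

lemma adjoin_integral:
  assumes R: "finite_rat_ring R" and n: "n \<ge> 1" and s: "\<And>i. s i \<in> R" and x: "x ^ n = (\<Sum>i<n. s i * x ^ i)"
  obtains R' where "finite_rat_ring R'" "R \<subseteq> R'" "x \<in> R'"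
proof -
  define R' where "R' = {\<Sum>i<n. r i * x ^ i | r. \<forall>i. r i \<in> R}"
  note RI = finite_rat_ring_01[OF R] finite_rat_ring_add[OF R] finite_rat_ring_mult[OF R]
  have add: "v + w \<in> R'" if vw: "v \<in> R'" "w \<in> R'" for v w
  proof -
    obtain r r' where r: "v = (\<Sum>i<n. r i * x ^ i)" "w = (\<Sum>i<n. r' i * x ^ i)" "\<forall>i. r i \<in> R" "\<forall>i. r' i \<in> R"
      using vw by (auto simp: R'_def)
    have "v + w = (\<Sum>i<n. (r i + r' i) * x ^ i)" by (simp add: r distrib_right sum.distrib)
    then show ?thesis unfolding R'_def using r(3,4) RI by (auto intro!: exI[of _ "\<lambda>i. r i + r' i"])
  qed
  have smul: "a * w \<in> R'" if aw: "a \<in> R" "w \<in> R'" for a w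
  proof -
    obtain r where r: "w = (\<Sum>i<n. r i * x ^ i)" "\<forall>i. r i \<in> R" using aw by (auto simp: R'_def)
    have "a * w = (\<Sum>i<n. (a * r i) * x ^ i)" by (simp add: r sum_distrib_left mult_ac)
    then show ?thesis unfolding R'_def using r(2) RI aw(1) by (auto intro!: exI[of _ "\<lambda>i. a * r i"])
  qed
  have sum: "(\<Sum>i\<in>I. g i) \<in> R'" if "\<And>i. i \<in> I \<Longrightarrow> g i \<in> R'" for g and I :: "nat set"
  proof -
    have "0 \<in> R'" unfolding R'_def using RI by (auto intro!: exI[of _ "\<lambda>_. 0"])
    then show ?thesis using that by (induction I rule: infinite_finite_induct) (auto intro: add)
  qed
  have pow: "x ^ i \<in> R'" if i: "i < n" for i
  proof -
    have "x ^ i = (\<Sum>j<n. (if j = i then 1 else 0) * x ^ j)"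
      using i by (simp add: if_distrib[of "\<lambda>c. c * _"] cong: if_cong)
    then show ?thesis unfolding R'_def using RI by (auto intro!: exI[of _ "\<lambda>j. if j = i then 1 else 0"])
  qed
  have xn: "x ^ n \<in> R'" unfolding R'_def using s x by (auto intro!: exI[of _ s])
  have xmul: "x * w \<in> R'" if w: "w \<in> R'" for w
  proof -
    obtain r where r: "w = (\<Sum>i<n. r i * x ^ i)" "\<forall>i. r i \<in> R" using w by (auto simp: R'_def)
    have "x * w = (\<Sum>i<n. r i * x ^ Suc i)" by (simp add: r sum_distrib_left mult_ac)
    moreover have "x ^ Suc i \<in> R'" if "i < n" for i
      using pow[of "Suc i"] xn that by (cases "Suc i = n") auto
    ultimately show ?thesis using r(2) smul by (auto intro!: sum simp del: power_Suc)
  qed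
  have mult: "v * w \<in> R'" if vw: "v \<in> R'" "w \<in> R'" for v w
  proof -
    obtain r where r: "v = (\<Sum>i<n. r i * x ^ i)" "\<forall>i. r i \<in> R" using vw by (auto simp: R'_def)
    have "x ^ i * w \<in> R'" for i using vw(2) by (induction i) (auto simp: mult.assoc intro: xmul)
    then have "r i * (x ^ i * w) \<in> R'" for i using r(2) smul by blast
    moreover have "v * w = (\<Sum>i<n. r i * (x ^ i * w))" by (simp add: r sum_distrib_right mult.assoc)
    ultimately show ?thesis by (auto intro: sum)
  qed
  have one: "1 \<in> R'" using pow[of 0] n by simp
  have sub: "a \<in> R'" if "a \<in> R" for a using smul[OF that one] by simp
  obtain B where B: "finite B" "R \<subseteq> rat_vs.span B" using R by (auto simp: finite_rat_ring_def)
  define B' where "B' = (\<lambda>(b, i). b * x ^ i) ` (B \<times> {..<n})"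
  have "R' \<subseteq> rat_vs.span B'"
  proof
    fix w assume "w \<in> R'"
    then obtain r where r: "w = (\<Sum>i<n. r i * x ^ i)" "\<forall>i. r i \<in> R" by (auto simp: R'_def)
    have "a * x ^ i \<in> rat_vs.span B'" if "a \<in> rat_vs.span B" "i < n" for a i
      using that(1)
    proof (induction rule: rat_vs.span_induct_alt)
      case base
      then show ?case by (simp add: rat_vs.span_zero)
    next
      case (step c b v)
      have "b * x ^ i \<in> B'" using step(1) that(2) by (auto simp: B'_def)
      then have "of_rat c * (b * x ^ i) \<in> rat_vs.span B'" by (intro rat_vs.span_scale rat_vs.span_base)
      then have "of_rat c * (b * x ^ i) + v * x ^ i \<in> rat_vs.span B'" using step(2) by (rule rat_vs.span_add)
      moreover have "(of_rat c * b + v) * x ^ i = of_rat c * (b * x ^ i) + v * x ^ i" by (simp only: distrib_right mult.assoc)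
      ultimately show ?case by (simp only:)
    qed
    then show "w \<in> rat_vs.span B'" unfolding r using r(2) B(2) by (intro rat_vs.span_sum) auto
  qed
  moreover have "finite B'" using B(1) by (simp add: B'_def)
  ultimately have "finite_rat_ring R'"
    unfolding finite_rat_ring_def using add mult sub finite_rat_ring_rat[OF R] by blast
  moreover have "x \<in> R'" using xmul[OF one] by simp
  ultimately show ?thesis using that sub by blast
qed

lemma monic_relation:
  fixes x :: "'a::field"
  assumes "poly p x = 0" "p \<noteq> 0"
  shows "degree p \<ge> 1" "x ^ degree p = (\<Sum>i<degree p. (- inverse (lead_coeff p) * coeff p i) * x ^ i)"
proof -
  show "degree p \<ge> 1"
  proof (rule ccontr)
    assume "\<not> degree p \<ge> 1"
    then obtain c where "p = [:c:]" by (metis degree_eq_zeroE less_one not_le)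
    then show False using assms by simp
  qed
  have "(\<Sum>i<degree p. coeff p i * x ^ i) + lead_coeff p * x ^ degree p = 0"
    using assms(1) unfolding poly_altdef by (simp add: lessThan_Suc_atMost[symmetric])
  then have "lead_coeff p * x ^ degree p = - (\<Sum>i<degree p. coeff p i * x ^ i)"
    by (metis add.commute eq_neg_iff_add_eq_0)
  then have "inverse (lead_coeff p) * (lead_coeff p * x ^ degree p) = - inverse (lead_coeff p) * (\<Sum>i<degree p. coeff p i * x ^ i)"
    by simp
  moreover have "inverse (lead_coeff p) * (lead_coeff p * x ^ degree p) = x ^ degree p"
    using assms(2) by (simp add: field_simps)
  ultimately show "x ^ degree p = (\<Sum>i<degree p. (- inverse (lead_coeff p) * coeff p i) * x ^ i)"
    by (simp add: sum_distrib_left mult.assoc)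
qed

lemma finite_rat_ring_of_algebraics:
  assumes "finite A" "\<And>a. a \<in> A \<Longrightarrow> algebraic a"
  shows "\<exists>R. finite_rat_ring R \<and> A \<subseteq> R"
  using assms
proof (induction A rule: finite_induct)
  case empty
  have "finite_rat_ring (range of_rat)" unfolding finite_rat_ring_def
  proof (intro conjI ballI exI[of _ "{1}"])
    show "range of_rat \<subseteq> rat_vs.span {1}"
    proof clarify
      fix q :: rat
      have "of_rat q * 1 \<in> rat_vs.span {1}" by (intro rat_vs.span_scale rat_vs.span_base) simp
      then show "of_rat q \<in> rat_vs.span {1}" by simp
    qed
  qed (auto simp flip: of_rat_add of_rat_mult)
  then show ?case by auto
next
  case (insert a A)
  then obtain R where R: "finite_rat_ring R" "A \<subseteq> R" by auto
  obtain p where p: "\<And>i. coeff p i \<in> \<rat>" "p \<noteq> 0" "poly p a = 0"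
    using insert.prems[of a] unfolding algebraic_altdef by auto
  note rel = monic_relation[OF p(3,2)]
  have "- inverse (lead_coeff p) * coeff p i \<in> \<rat>" for i using p(1) by (intro Rats_mult Rats_inverse) (simp_all add: Rats_minus_iff)
  then have "- inverse (lead_coeff p) * coeff p i \<in> R" for i using finite_rat_ring_rat[OF R(1)] by (metis Rats_cases)
  from adjoin_integral[OF R(1) rel(1) this rel(2)] obtain R' where "finite_rat_ring R'" "R \<subseteq> R'" "a \<in> R'" by blast
  then show ?case using R(2) by auto
qed

text \<open>The coefficients and the inverse of the leading one lie in a common ring of finite
  dimension, over which \<open>x\<close> satisfies a monic equation.\<close>

lemma algebraic_root_of_algebraic_poly:
  fixes p :: "complex poly"
  assumes "\<And>i. algebraic (coeff p i)" "p \<noteq> 0" "poly p x = 0"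
  shows "algebraic x"
proof -
  define A where "A = insert (inverse (lead_coeff p)) (coeff p ` {..degree p})"
  have "algebraic a" if "a \<in> A" for a using that assms(1) by (auto simp: A_def)
  then obtain R where R: "finite_rat_ring R" "A \<subseteq> R" using finite_rat_ring_of_algebraics[of A] by (auto simp: A_def)
  note rel = monic_relation[OF assms(3,2)]
  have "- inverse (lead_coeff p) * coeff p i \<in> R" for i
  proof -
    have "coeff p i \<in> R" using R(2) finite_rat_ring_01[OF R(1)] by (cases "i \<le> degree p") (auto simp: A_def coeff_eq_0)
    moreover have "inverse (lead_coeff p) \<in> R" using R(2) by (simp add: A_def)
    ultimately show ?thesis by (intro finite_rat_ring_mult finite_rat_ring_uminus R(1))
  qed
  from adjoin_integral[OF R(1) rel(1) this rel(2)] obtain R' where "finite_rat_ring R'" "x \<in> R'" by blast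
  then show ?thesis by (rule algebraic_if_in_finite_rat_ring)
qed

lemma algebraic_add: "algebraic x \<Longrightarrow> algebraic y \<Longrightarrow> algebraic (x + y)"
  and algebraic_mult: "algebraic x \<Longrightarrow> algebraic y \<Longrightarrow> algebraic (x * y)" for x y :: complex
  using finite_rat_ring_of_algebraics[of "{x, y}"]
  by (auto intro: algebraic_if_in_finite_rat_ring finite_rat_ring_add finite_rat_ring_mult)

text \<open>Lines are counted by quantifier elimination over the algebraic numbers: a finite fibre of a constructible
  family has uniformly bounded size, because sections are finite or cofinite.\<close>

inductive_set polyfuns :: "((nat \<Rightarrow> complex) \<Rightarrow> complex) set" where
  proj: "(\<lambda>v. v i) \<in> polyfuns"
| const: "algebraic c \<Longrightarrow> (\<lambda>_. c) \<in> polyfuns"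
| add: "P \<in> polyfuns \<Longrightarrow> Q \<in> polyfuns \<Longrightarrow> (\<lambda>v. P v + Q v) \<in> polyfuns"
| mult: "P \<in> polyfuns \<Longrightarrow> Q \<in> polyfuns \<Longrightarrow> (\<lambda>v. P v * Q v) \<in> polyfuns"

definition algpts :: "(nat \<Rightarrow> complex) set" where
  "algpts = {v. \<forall>i. algebraic (v i)}"

lemma polyfuns_algebraic: "P \<in> polyfuns \<Longrightarrow> v \<in> algpts \<Longrightarrow> algebraic (P v)"
  by (induction P rule: polyfuns.induct) (auto simp: algpts_def intro: algebraic_add algebraic_mult)

lemma polyfuns_uminus: "P \<in> polyfuns \<Longrightarrow> (\<lambda>v. - P v) \<in> polyfuns"
  using polyfuns.mult[OF polyfuns.const[of "-1"], of P] by simp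

lemma polyfuns_diff: "P \<in> polyfuns \<Longrightarrow> Q \<in> polyfuns \<Longrightarrow> (\<lambda>v. P v - Q v) \<in> polyfuns"
  using polyfuns.add[OF _ polyfuns_uminus] by simp

lemma polyfuns_sum: "(\<And>i. i \<in> I \<Longrightarrow> P i \<in> polyfuns) \<Longrightarrow> (\<lambda>v. \<Sum>i\<in>I. P i v) \<in> polyfuns"
proof (induction I rule: infinite_finite_induct)
  case (insert i I)
  then show ?case using polyfuns.add[of "P i" "\<lambda>v. \<Sum>i\<in>I. P i v"] by simp
qed (auto intro: polyfuns.const)

lemma polyfuns_power: "P \<in> polyfuns \<Longrightarrow> (\<lambda>v. P v ^ n) \<in> polyfuns"
  by (induction n) (auto intro: polyfuns.const polyfuns.mult)

text \<open>A polynomial in one variable with parameters. The bound \<open>n\<close> is formal, as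
  leading coefficients may vanish for special parameters; it exceeds the degree, so that
  \<open>family 0\<close> is left to the zero polynomial.\<close>

definition family :: "nat \<Rightarrow> ((nat \<Rightarrow> complex) \<Rightarrow> complex poly) \<Rightarrow> bool" where
  "family n P \<longleftrightarrow> (\<forall>j. (\<lambda>v. coeff (P v) j) \<in> polyfuns) \<and> (\<forall>v. \<forall>j\<ge>n. coeff (P v) j = 0)"

lemma family_add: "family m P \<Longrightarrow> family n Q \<Longrightarrow> family (max m n) (\<lambda>v. P v + Q v)"
  by (auto simp: family_def intro: polyfuns.add)

lemma family_mult:
  assumes "family m P" "family n Q"
  shows "family (m + n) (\<lambda>v. P v * Q v)"
proof -
  have "coeff (P v * Q v) j = 0" if "j \<ge> m + n" for v j
    unfolding coeff_mult
  proof (rule sum.neutral, rule ballI)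
    fix i assume "i \<in> {..j}"
    then have "i \<ge> m \<or> j - i \<ge> n" using that by auto
    then show "coeff (P v) i * coeff (Q v) (j - i) = 0" using assms by (auto simp: family_def)
  qed
  then show ?thesis using assms by (auto simp: family_def coeff_mult intro!: polyfuns_sum polyfuns.mult)
qed

lemma family_power: "family m P \<Longrightarrow> \<exists>n. family n (\<lambda>v. P v ^ k)"
proof (induction k)
  case 0
  show ?case by (intro exI[of _ 1]) (auto simp: family_def coeff_1 intro: polyfuns.const)
next
  case (Suc k)
  then obtain n where "family n (\<lambda>v. P v ^ k)" by blast
  then show ?case using family_mult[OF Suc.prems] by auto
qed

text \<open>Singling out one coordinate turns a polynomial function into a polynomial in that
  coordinate, with a formal degree that is the same for all parameters.\<close>

lemma family_of_polyfun:
  assumes "P \<in> polyfuns"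
  shows "\<exists>n Q. family n Q \<and> (\<forall>v x. P (v(i := x)) = poly (Q v) x)"
  using assms
proof (induction P rule: polyfuns.induct)
  case (proj j)
  show ?case
  proof (cases "j = i")
    case True
    have "family 2 (\<lambda>_. [:0, 1:])"
      unfolding family_def by (auto simp: coeff_pCons intro: polyfuns.const split: nat.splits)
    then show ?thesis using True by (intro exI[of _ 2] exI[of _ "\<lambda>_. [:0, 1:]"]) auto
  next
    case False
    have "(\<lambda>v. coeff [:v j:] k) \<in> polyfuns" for k
      by (cases k) (auto intro: polyfuns.proj polyfuns.const)
    then have "family 1 (\<lambda>v. [:v j:])" unfolding family_def by (auto simp: coeff_pCons split: nat.splits)
    then show ?thesis using False by (intro exI[of _ 1] exI[of _ "\<lambda>v. [:v j:]"]) auto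
  qed
next
  case (const c)
  have "(\<lambda>v. coeff [:c:] k) \<in> polyfuns" for k
    using const by (cases k) (auto intro: polyfuns.const)
  then have "family 1 (\<lambda>v. [:c:])" unfolding family_def by (auto simp: coeff_pCons split: nat.splits)
  then show ?case by (intro exI[of _ 1] exI[of _ "\<lambda>v. [:c:]"]) auto
next
  case (add P Q)
  then obtain m P' n Q' where "family m P'" "\<forall>v x. P (v(i := x)) = poly (P' v) x"
    "family n Q'" "\<forall>v x. Q (v(i := x)) = poly (Q' v) x" by blast
  then show ?case using family_add[of m P' n Q']
    by (intro exI[of _ "max m n"] exI[of _ "\<lambda>v. P' v + Q' v"] conjI allI) (simp_all del: fun_upd_apply)
next
  case (mult P Q)
  then obtain m P' n Q' where "family m P'" "\<forall>v x. P (v(i := x)) = poly (P' v) x"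
    "family n Q'" "\<forall>v x. Q (v(i := x)) = poly (Q' v) x" by blast
  then show ?case using family_mult[of m P' n Q']
    by (intro exI[of _ "m + n"] exI[of _ "\<lambda>v. P' v * Q' v"] conjI allI) (simp_all del: fun_upd_apply)
qed

inductive_set constructible :: "(nat \<Rightarrow> complex) set set" where
  zero: "P \<in> polyfuns \<Longrightarrow> {v. P v = 0} \<in> constructible"
| compl: "Z \<in> constructible \<Longrightarrow> - Z \<in> constructible"
| inter: "Z \<in> constructible \<Longrightarrow> Z' \<in> constructible \<Longrightarrow> Z \<inter> Z' \<in> constructible"

lemma constructible_UNIV: "UNIV \<in> constructible"
  using constructible.zero[OF polyfuns.const[of 0]] by simp

lemma constructible_un: "Z \<in> constructible \<Longrightarrow> Z' \<in> constructible \<Longrightarrow> Z \<union> Z' \<in> constructible"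
  using constructible.compl[OF constructible.inter[OF constructible.compl constructible.compl]] by simp

lemma constructible_INT: "finite I \<Longrightarrow> (\<And>i. i \<in> I \<Longrightarrow> Z i \<in> constructible) \<Longrightarrow> (\<Inter>i\<in>I. Z i) \<in> constructible"
  by (induction I rule: finite_induct) (auto intro: constructible_UNIV constructible.inter)

lemma constructible_UN: "finite I \<Longrightarrow> (\<And>i. i \<in> I \<Longrightarrow> Z i \<in> constructible) \<Longrightarrow> (\<Union>i\<in>I. Z i) \<in> constructible"
proof (induction I rule: finite_induct)
  case empty
  then show ?case using constructible.compl[OF constructible_UNIV] by simp
qed (auto intro: constructible_un)

lemma constructible_zero_poly:
  assumes "family n Q"
  shows "{v. Q v = 0} \<in> constructible"
proof -
  have "Q v = 0 \<longleftrightarrow> (\<forall>j<n. coeff (Q v) j = 0)" for v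
  proof
    assume *: "\<forall>j<n. coeff (Q v) j = 0"
    have "coeff (Q v) j = 0" for j using * assms by (cases "j < n") (auto simp: family_def)
    then show "Q v = 0" by (simp add: poly_eq_iff)
  qed simp
  then have "{v. Q v = 0} = (\<Inter>j\<in>{..<n}. {v. coeff (Q v) j = 0})" by auto
  moreover have "(\<Inter>j\<in>{..<n}. {v. coeff (Q v) j = 0}) \<in> constructible"
    using assms by (intro constructible_INT constructible.zero) (auto simp: family_def)
  ultimately show ?thesis by (simp only:)
qed

text \<open>Pseudo-division with parameters: where the leading coefficient of \<open>P v\<close> is
  nonzero, multiplying \<open>Q v\<close> by it does not affect divisibility.\<close>

lemma constructible_dvd:
  assumes P: "family (Suc m) P"
  shows "family n Q \<Longrightarrow> \<exists>D\<in>constructible. \<forall>v. coeff (P v) m \<noteq> 0 \<longrightarrow> (v \<in> D \<longleftrightarrow> P v dvd Q v)"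
proof (induction n arbitrary: Q)
  case 0
  then have "Q v = 0" for v by (auto simp: family_def poly_eq_iff)
  then show ?case by (intro bexI[OF _ constructible_UNIV]) auto
next
  case (Suc n)
  have degP: "degree (P v) = m" if "coeff (P v) m \<noteq> 0" for v
    using P that by (intro antisym degree_le le_degree) (auto simp: family_def)
  show ?case
  proof (cases "n < m")
    case True
    have "P v dvd Q v \<longleftrightarrow> Q v = 0" if "coeff (P v) m \<noteq> 0" for v
    proof -
      have "degree (Q v) \<le> n" using Suc.prems by (intro degree_le) (auto simp: family_def)
      then have "degree (Q v) < degree (P v)" using True degP[OF that] by simp
      then show ?thesis using dvd_imp_degree_le[of "P v" "Q v"] by auto
    qed
    then show ?thesis by (intro bexI[OF _ constructible_zero_poly[OF Suc.prems]]) auto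
  next
    case False
    define Q' where "Q' v = smult (coeff (P v) m) (Q v) - monom (coeff (Q v) n) (n - m) * P v" for v
    have PF: "(\<lambda>v. coeff (P v) j) \<in> polyfuns" "(\<lambda>v. coeff (Q v) j) \<in> polyfuns" for j
      using P Suc.prems by (auto simp: family_def)
    have "family n Q'" unfolding family_def
    proof (intro conjI allI impI)
      show "(\<lambda>v. coeff (Q' v) j) \<in> polyfuns" for j
        unfolding Q'_def by (cases "j < n - m") (auto simp: coeff_monom_mult intro!: polyfuns_diff polyfuns.mult PF polyfuns.const)
      show "coeff (Q' v) j = 0" if "j \<ge> n" for v j
      proof (cases "j = n")
        case True
        then show ?thesis using False by (simp add: Q'_def coeff_monom_mult)
      next
        case jn: False
        then have "coeff (Q v) j = 0" "coeff (P v) (j - (n - m)) = 0"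
          using that False P Suc.prems by (auto simp: family_def)
        then show ?thesis by (simp add: Q'_def coeff_monom_mult)
      qed
    qed
    then obtain D where D: "D \<in> constructible" "\<forall>v. coeff (P v) m \<noteq> 0 \<longrightarrow> (v \<in> D \<longleftrightarrow> P v dvd Q' v)"
      using Suc.IH by blast
    have "P v dvd Q' v \<longleftrightarrow> P v dvd Q v" if "coeff (P v) m \<noteq> 0" for v
    proof -
      have "P v dvd Q' v \<longleftrightarrow> P v dvd smult (coeff (P v) m) (Q v)"
        unfolding Q'_def by (rule dvd_diff_left_iff) simp
      then show ?thesis using that by (simp add: dvd_smult_iff)
    qed
    then show ?thesis using D by blast
  qed
qed

lemma infinite_algebraic: "infinite {x::complex. algebraic x}"
proof
  assume "finite {x::complex. algebraic x}"
  moreover have "range (of_nat :: nat \<Rightarrow> complex) \<subseteq> {x. algebraic x}" by auto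
  ultimately have "finite (range (of_nat :: nat \<Rightarrow> complex))" by (rule finite_subset[rotated])
  then show False using range_inj_infinite[OF inj_of_nat] by blast
qed

lemma exists_algebraic_nonroot:
  assumes "q \<noteq> (0 :: complex poly)"
  shows "\<exists>x. algebraic x \<and> poly q x \<noteq> 0"
proof (rule ccontr)
  assume "\<not> ?thesis"
  then have "{x. algebraic x} \<subseteq> {x. poly q x = 0}" by auto
  then show False using poly_roots_finite[OF assms] infinite_algebraic finite_subset by blast
qed

text \<open>The pseudo-Euclidean algorithm, splitting into cases according to the vanishing of leading coefficients,
  reduces a system of equations to at most one equation.\<close>

lemma constructible_common_root:
  assumes q: "family nq q"
  shows "(\<And>m P. (m, P) \<in> set Ps \<Longrightarrow> family m P) \<Longrightarrow> \<exists>Z\<in>constructible. \<forall>v\<in>algpts.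
    v \<in> Z \<longleftrightarrow> (\<exists>x. algebraic x \<and> (\<forall>(m, P)\<in>set Ps. poly (P v) x = 0) \<and> poly (q v) x \<noteq> 0)"
proof (induction "sum_list (map (\<lambda>(m, P). Suc m) Ps)" arbitrary: Ps rule: less_induct)
  case less
  define sol where "sol Ps v \<longleftrightarrow> (\<exists>x. algebraic x \<and> (\<forall>(m, P)\<in>set Ps. poly (P v) x = 0) \<and> poly (q v) x \<noteq> 0)"
    for Ps :: "(nat \<times> ((nat \<Rightarrow> complex) \<Rightarrow> complex poly)) list" and v
  define size where "size Ps = sum_list (map (\<lambda>(m, P). Suc m) Ps)" for Ps :: "(nat \<times> ((nat \<Rightarrow> complex) \<Rightarrow> complex poly)) list"
  have IH: "\<exists>Z\<in>constructible. \<forall>v\<in>algpts. v \<in> Z \<longleftrightarrow> sol Qs v" if "size Qs < size Ps" "\<And>m P. (m, P) \<in> set Qs \<Longrightarrow> family m P" for Qs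
    using less.hyps[of Qs] that unfolding sol_def size_def by blast
  have truncate: "family m (\<lambda>v. P v - monom (coeff (P v) m) m)" if "family (Suc m) P" for m P
  proof -
    have "(\<lambda>v. coeff (P v - monom (coeff (P v) m) m) j) \<in> polyfuns" for j
      using that by (cases "j = m") (auto simp: family_def intro: polyfuns.const)
    moreover have "coeff (P v - monom (coeff (P v) m) m) j = 0" if "j \<ge> m" for v j
      using that \<open>family (Suc m) P\<close> by (cases "j = m") (auto simp: family_def)
    ultimately show ?thesis unfolding family_def by blast
  qed
  have split: "\<exists>Z\<in>constructible. \<forall>v\<in>algpts. v \<in> Z \<longleftrightarrow> sol Ps v"
    if "Z1 \<in> constructible" "Z2 \<in> constructible" "c \<in> polyfuns"
      "\<And>v. v \<in> algpts \<Longrightarrow> c v = 0 \<Longrightarrow> v \<in> Z1 \<longleftrightarrow> sol Ps v"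
      "\<And>v. v \<in> algpts \<Longrightarrow> c v \<noteq> 0 \<Longrightarrow> v \<in> Z2 \<longleftrightarrow> sol Ps v" for Z1 Z2 c
  proof (rule bexI)
    show "({v. c v = 0} \<inter> Z1) \<union> (- {v. c v = 0} \<inter> Z2) \<in> constructible"
      using that by (intro constructible_un constructible.inter constructible.compl constructible.zero)
    show "\<forall>v\<in>algpts. v \<in> ({v. c v = 0} \<inter> Z1) \<union> (- {v. c v = 0} \<inter> Z2) \<longleftrightarrow> sol Ps v"
      using that(4,5) by auto
  qed
  \<comment> \<open>Of two equations, the shorter is truncated where its formal leading coefficient
    \<open>c\<close> vanishes, and elsewhere it cancels the leading term of the longer. Either way
    the sum of the formal degrees falls.\<close>
  have two: "\<exists>Z\<in>constructible. \<forall>v\<in>algpts. v \<in> Z \<longleftrightarrow> sol Ps v"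
    if set: "set Ps = insert (m1, P1) (insert (Suc m2, P2) (set Rs))" and sz: "size Ps = Suc m1 + (Suc (Suc m2) + size Rs)"
      and le: "Suc m2 \<le> m1" for m1 P1 m2 P2 Rs
  proof -
    have fam: "family m1 P1" "family (Suc m2) P2" "\<And>m P. (m, P) \<in> set Rs \<Longrightarrow> family m P" using less.prems set by auto
    define c where "c v = coeff (P2 v) m2" for v
    have c: "c \<in> polyfuns" unfolding c_def using fam(2) by (simp add: family_def)
    define P2' where "P2' v = P2 v - monom (c v) m2" for v
    define n where "n = m1 - 1"
    have m1: "m1 = Suc n" "m2 \<le> n" using le by (simp_all add: n_def)
    define P1' where "P1' v = smult (c v) (P1 v) - monom (coeff (P1 v) n) (n - m2) * P2 v" for v
    have P2': "family m2 P2'" unfolding P2'_def c_def by (rule truncate[OF fam(2)])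
    have PF: "(\<lambda>v. coeff (P1 v) j) \<in> polyfuns" "(\<lambda>v. coeff (P2 v) j) \<in> polyfuns" for j
      using fam by (auto simp: family_def)
    have P1': "family n P1'" unfolding family_def
    proof (intro conjI allI impI)
      show "(\<lambda>v. coeff (P1' v) j) \<in> polyfuns" for j
        unfolding P1'_def by (cases "j < n - m2") (auto simp: coeff_monom_mult intro!: polyfuns_diff polyfuns.mult PF c polyfuns.const)
      show "coeff (P1' v) j = 0" if "j \<ge> n" for v j
      proof (cases "j = n")
        case True
        then show ?thesis using m1 by (simp add: P1'_def coeff_monom_mult c_def)
      next
        case False
        then have "coeff (P1 v) j = 0" "coeff (P2 v) (j - (n - m2)) = 0"
          using that fam m1 by (auto simp: family_def)
        then show ?thesis by (simp add: P1'_def coeff_monom_mult)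
      qed
    qed
    define Q1 where "Q1 = (m1, P1) # (m2, P2') # Rs"
    define Q2 where "Q2 = (n, P1') # (Suc m2, P2) # Rs"
    have "size Q1 < size Ps" "size Q2 < size Ps" unfolding sz by (simp_all add: size_def Q1_def Q2_def m1)
    moreover have "family m P" if "(m, P) \<in> set Q1" for m P using that fam P2' by (auto simp: Q1_def)
    moreover have "family m P" if "(m, P) \<in> set Q2" for m P using that fam P1' by (auto simp: Q2_def)
    ultimately obtain Z1 Z2 where Z: "Z1 \<in> constructible" "\<forall>v\<in>algpts. v \<in> Z1 \<longleftrightarrow> sol Q1 v"
      "Z2 \<in> constructible" "\<forall>v\<in>algpts. v \<in> Z2 \<longleftrightarrow> sol Q2 v" using IH by metis
    show ?thesis
    proof (rule split[OF Z(1,3) c])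
      fix v assume v: "v \<in> algpts"
      show "v \<in> Z1 \<longleftrightarrow> sol Ps v" if "c v = 0"
      proof -
        have "P2' v = P2 v" using that by (simp add: P2'_def)
        then have "sol Q1 v \<longleftrightarrow> sol Ps v" unfolding sol_def set Q1_def by simp
        then show ?thesis using Z(2) v by simp
      qed
      show "v \<in> Z2 \<longleftrightarrow> sol Ps v" if "c v \<noteq> 0"
      proof -
        have "poly (P1' v) x = 0 \<longleftrightarrow> poly (P1 v) x = 0" if "poly (P2 v) x = 0" for x
          using that \<open>c v \<noteq> 0\<close> by (simp add: P1'_def)
        then have "sol Q2 v \<longleftrightarrow> sol Ps v" unfolding sol_def set Q2_def by auto
        then show ?thesis using Z(4) v by simp
      qed
    qed
  qed
  show ?case unfolding sol_def[symmetric]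
  proof (cases "\<exists>P. (0, P) \<in> set Ps")
    case True
    then obtain P where P: "(0, P) \<in> set Ps" by blast
    define Qs where "Qs = remove1 (0, P) Ps"
    have P0: "P v = 0" for v using less.prems[OF P] by (auto simp: family_def poly_eq_iff)
    have set: "insert (0, P) (set Qs) = set Ps"
    proof -
      have "set Ps \<subseteq> insert (0, P) (set Qs)"
      proof
        fix s assume "s \<in> set Ps"
        then show "s \<in> insert (0, P) (set Qs)" by (cases "s = (0, P)") (simp_all add: Qs_def in_set_remove1)
      qed
      then show ?thesis using P set_remove1_subset[of "(0, P)" Ps] by (auto simp: Qs_def)
    qed
    have "size Qs < size Ps" unfolding size_def Qs_def using P
      by (induction Ps) auto
    then obtain Z where "Z \<in> constructible" "\<forall>v\<in>algpts. v \<in> Z \<longleftrightarrow> sol Qs v" using IH[of Qs] less.prems set by (metis insertCI)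
    moreover have "sol Qs v \<longleftrightarrow> sol Ps v" for v unfolding sol_def set[symmetric] by (simp add: P0)
    ultimately show "\<exists>Z\<in>constructible. \<forall>v\<in>algpts. v \<in> Z \<longleftrightarrow> sol Ps v" by auto
  next
    case False
    show "\<exists>Z\<in>constructible. \<forall>v\<in>algpts. v \<in> Z \<longleftrightarrow> sol Ps v"
    proof (cases Ps)
      case Nil
      have "sol Ps v \<longleftrightarrow> v \<in> - {v. q v = 0}" for v
        using exists_algebraic_nonroot[of "q v"] by (auto simp: sol_def Nil)
      then show ?thesis using constructible.compl[OF constructible_zero_poly[OF q]] by blast
    next
      case (Cons a Rs)
      obtain m1 P1 where a: "a = (Suc m1, P1)" using False Cons by (metis list.set_intros(1) nat.exhaust surj_pair)
      show ?thesis
      proof (cases Rs)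
        case Nil
        have fam: "family (Suc m1) P1" using less.prems Cons a by auto
        define c where "c v = coeff (P1 v) m1" for v
        have c: "c \<in> polyfuns" unfolding c_def using fam by (simp add: family_def)
        define P1' where "P1' v = P1 v - monom (c v) m1" for v
        have P1': "family m1 P1'" unfolding P1'_def c_def by (rule truncate[OF fam])
        have "size [(m1, P1')] < size Ps" by (simp add: size_def Cons a Nil)
        then obtain Z1 where Z1: "Z1 \<in> constructible" "\<forall>v\<in>algpts. v \<in> Z1 \<longleftrightarrow> sol [(m1, P1')] v" using IH[of "[(m1, P1')]"] P1' by auto
        obtain n where "family n (\<lambda>v. q v ^ m1)" using family_power[OF q] by blast
        then obtain D where D: "D \<in> constructible" "\<forall>v. coeff (P1 v) m1 \<noteq> 0 \<longrightarrow> (v \<in> D \<longleftrightarrow> P1 v dvd q v ^ m1)"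
          using constructible_dvd[OF fam] by blast
        show ?thesis
        proof (rule split[OF Z1(1) constructible.compl[OF D(1)] c])
          fix v assume v: "v \<in> algpts"
          show "v \<in> Z1 \<longleftrightarrow> sol Ps v" if "c v = 0"
            using Z1(2) v that by (simp add: sol_def Cons a Nil P1'_def)
          show "v \<in> - D \<longleftrightarrow> sol Ps v" if cv: "c v \<noteq> 0"
          proof -
            have deg: "degree (P1 v) = m1"
              using fam cv by (intro antisym degree_le le_degree) (auto simp: family_def c_def)
            have P0: "P1 v \<noteq> 0" using cv by (auto simp: c_def)
            have "v \<in> - D \<longleftrightarrow> \<not> P1 v dvd q v ^ m1" using D(2) cv by (simp add: c_def)
            \<comment> \<open>The univariate Nullstellensatz: all roots of \<open>P1 v\<close> are
              roots of \<open>q v\<close> exactly if \<open>P1 v\<close> divides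
              \<open>q v ^ m1\<close>. The roots are complex numbers, and algebraic because the
              coefficients are.\<close>
            also have "\<dots> \<longleftrightarrow> (\<exists>x. poly (P1 v) x = 0 \<and> poly (q v) x \<noteq> 0)"
              using nullstellensatz_univariate[of "P1 v" "q v"] P0 deg by auto
            also have "\<dots> \<longleftrightarrow> sol Ps v"
            proof -
              have "algebraic x" if "poly (P1 v) x = 0" for x
              proof (rule algebraic_root_of_algebraic_poly[OF _ P0 that])
                show "algebraic (coeff (P1 v) i)" for i
                  using polyfuns_algebraic[OF _ v] fam by (auto simp: family_def)
              qed
              then show ?thesis by (auto simp: sol_def Cons a Nil)
            qed
            finally show ?thesis .
          qed
        qed
      next
        case (Cons b Rs')
        obtain m2 P2 where b: "b = (Suc m2, P2)"
          using False \<open>Ps = a # Rs\<close> Cons by (metis list.set_intros(1,2) nat.exhaust surj_pair)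
        have Ps: "Ps = (Suc m1, P1) # (Suc m2, P2) # Rs'" using \<open>Ps = a # Rs\<close> Cons a b by simp
        show ?thesis
        proof (cases "m2 \<le> m1")
          case True
          then show ?thesis by (intro two[of "Suc m1" P1 m2 P2 Rs']) (auto simp: Ps size_def)
        next
          case False
          then show ?thesis by (intro two[of "Suc m2" P2 m1 P1 Rs']) (auto simp: Ps size_def)
        qed
      qed
    qed
  qed
qed

text \<open>Membership depends only on which of finitely many polynomial functions vanish, so a
  constructible set is a finite union of cells given by equations and inequations.\<close>

lemma constructible_determined:
  assumes "Z \<in> constructible"
  shows "\<exists>\<P>. finite \<P> \<and> \<P> \<subseteq> polyfuns \<and> (\<forall>v v'. (\<forall>P\<in>\<P>. P v = 0 \<longleftrightarrow> P v' = 0) \<longrightarrow> (v \<in> Z \<longleftrightarrow> v' \<in> Z))"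
  using assms
proof (induction Z rule: constructible.induct)
  case (zero P)
  then show ?case by (intro exI[of _ "{P}"]) auto
next
  case (compl Z)
  then show ?case by auto
next
  case (inter Z Z')
  then obtain A B where "finite A" "A \<subseteq> polyfuns" "\<forall>v v'. (\<forall>P\<in>A. P v = 0 \<longleftrightarrow> P v' = 0) \<longrightarrow> (v \<in> Z \<longleftrightarrow> v' \<in> Z)"
    "finite B" "B \<subseteq> polyfuns" "\<forall>v v'. (\<forall>P\<in>B. P v = 0 \<longleftrightarrow> P v' = 0) \<longrightarrow> (v \<in> Z' \<longleftrightarrow> v' \<in> Z')"
    by blast
  then show ?case by (intro exI[of _ "A \<union> B"]) (auto, (blast+)?)
qed

lemma family_prod: "finite I \<Longrightarrow> (\<And>i. i \<in> I \<Longrightarrow> \<exists>n. family n (Q i)) \<Longrightarrow> \<exists>n. family n (\<lambda>v. \<Prod>i\<in>I. Q i v)"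
proof (induction I rule: finite_induct)
  case empty
  show ?case by (intro exI[of _ 1]) (auto simp: family_def coeff_1 intro: polyfuns.const)
next
  case (insert i I)
  then obtain m n where "family m (Q i)" "family n (\<lambda>v. \<Prod>i\<in>I. Q i v)" by blast
  from family_mult[OF this] show ?case using insert.hyps by auto
qed

text \<open>Chevalley's theorem for algebraic points. The inequations of a cell are joined into one
  by taking a product, and \<open>constructible_common_root\<close> then eliminates the
  variable.\<close>

lemma constructible_projection:
  assumes Z: "Z \<in> constructible"
  shows "\<exists>Z'\<in>constructible. \<forall>v\<in>algpts. v \<in> Z' \<longleftrightarrow> (\<exists>x. algebraic x \<and> v(i := x) \<in> Z)"
proof -
  obtain \<P> where \<P>: "finite \<P>" "\<P> \<subseteq> polyfuns"
    and det: "\<And>v v'. (\<forall>P\<in>\<P>. P v = 0 \<longleftrightarrow> P v' = 0) \<Longrightarrow> v \<in> Z \<longleftrightarrow> v' \<in> Z"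
    using constructible_determined[OF Z] by blast
  define cell where "cell \<sigma> = {v. \<forall>P\<in>\<P>. P v = 0 \<longleftrightarrow> P \<in> \<sigma>}" for \<sigma>
  define good where "good = {\<sigma> \<in> Pow \<P>. cell \<sigma> \<subseteq> Z}"
  have fin: "finite good" using \<P>(1) by (simp add: good_def)
  have Zcells: "v \<in> Z \<longleftrightarrow> (\<exists>\<sigma>\<in>good. v \<in> cell \<sigma>)" for v
  proof
    assume v: "v \<in> Z"
    define \<sigma> where "\<sigma> = {P \<in> \<P>. P v = 0}"
    have "v \<in> cell \<sigma>" by (auto simp: cell_def \<sigma>_def)
    moreover have "cell \<sigma> \<subseteq> Z"
    proof
      fix u assume "u \<in> cell \<sigma>"
      then have "\<forall>P\<in>\<P>. P v = 0 \<longleftrightarrow> P u = 0" by (auto simp: cell_def \<sigma>_def)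
      then show "u \<in> Z" using det v by blast
    qed
    moreover have "\<sigma> \<subseteq> \<P>" by (auto simp: \<sigma>_def)
    ultimately show "\<exists>\<sigma>\<in>good. v \<in> cell \<sigma>" unfolding good_def by blast
  qed (auto simp: good_def)
  define rep where "rep P nQ \<longleftrightarrow> family (fst nQ) (snd nQ) \<and> (\<forall>v x. P (v(i := x)) = poly (snd nQ v) x)" for P nQ
  have "\<exists>nQ. rep P nQ" if "P \<in> \<P>" for P
    using family_of_polyfun[of P i] \<P>(2) that by (auto simp: rep_def)
  then obtain R where R: "\<And>P. P \<in> \<P> \<Longrightarrow> rep P (R P)" by metis
  have "\<exists>W\<in>constructible. \<forall>v\<in>algpts. v \<in> W \<longleftrightarrow> (\<exists>x. algebraic x \<and> v(i := x) \<in> cell \<sigma>)" if \<sigma>: "\<sigma> \<in> good" for \<sigma>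
  proof -
    have sub: "\<sigma> \<subseteq> \<P>" using \<sigma> by (auto simp: good_def)
    obtain ls where ls: "set ls = \<sigma>" using finite_list finite_subset[OF sub \<P>(1)] by blast
    define Ps where "Ps = map R ls"
    have "\<exists>n. family n (snd (R P))" if "P \<in> \<P> - \<sigma>" for P using R[of P] that by (auto simp: rep_def)
    then obtain n where n: "family n (\<lambda>v. \<Prod>P\<in>\<P> - \<sigma>. snd (R P) v)" using family_prod[of "\<P> - \<sigma>" "\<lambda>P. snd (R P)"] \<P>(1) by auto
    have "family m P" if mem: "(m, P) \<in> set Ps" for m P
    proof -
      obtain Q where "Q \<in> \<sigma>" "R Q = (m, P)" using mem ls by (auto simp: Ps_def)
      then show ?thesis using R[of Q] sub by (auto simp: rep_def)
    qed
    from constructible_common_root[OF n this] obtain W where W: "W \<in> constructible"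
      "\<forall>v\<in>algpts. v \<in> W \<longleftrightarrow> (\<exists>x. algebraic x \<and> (\<forall>(m, P)\<in>set Ps. poly (P v) x = 0) \<and> poly (\<Prod>P\<in>\<P> - \<sigma>. snd (R P) v) x \<noteq> 0)"
      by blast
    have "(\<forall>(m, P)\<in>set Ps. poly (P v) x = 0) \<and> poly (\<Prod>P\<in>\<P> - \<sigma>. snd (R P) v) x \<noteq> 0 \<longleftrightarrow> v(i := x) \<in> cell \<sigma>" for v x
    proof -
      have ev: "poly (snd (R P) v) x = P (v(i := x))" if "P \<in> \<P>" for P using R[OF that] by (simp add: rep_def)
      have "(\<forall>(m, P)\<in>set Ps. poly (P v) x = 0) \<longleftrightarrow> (\<forall>P\<in>\<sigma>. P (v(i := x)) = 0)"
      proof -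
        have "(\<forall>(m, P)\<in>set Ps. poly (P v) x = 0) \<longleftrightarrow> (\<forall>P\<in>\<sigma>. poly (snd (R P) v) x = 0)"
          by (simp add: Ps_def ls case_prod_unfold)
        also have "\<dots> \<longleftrightarrow> (\<forall>P\<in>\<sigma>. P (v(i := x)) = 0)"
          using ev sub by (intro ball_cong) auto
        finally show ?thesis .
      qed
      moreover have "poly (\<Prod>P\<in>\<P> - \<sigma>. snd (R P) v) x \<noteq> 0 \<longleftrightarrow> (\<forall>P\<in>\<P> - \<sigma>. P (v(i := x)) \<noteq> 0)"
      proof -
        have "poly (\<Prod>P\<in>\<P> - \<sigma>. snd (R P) v) x \<noteq> 0 \<longleftrightarrow> (\<forall>P\<in>\<P> - \<sigma>. poly (snd (R P) v) x \<noteq> 0)"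
          using \<P>(1) by (simp add: poly_prod)
        also have "\<dots> \<longleftrightarrow> (\<forall>P\<in>\<P> - \<sigma>. P (v(i := x)) \<noteq> 0)"
          using ev by (intro ball_cong) auto
        finally show ?thesis .
      qed
      ultimately show ?thesis using sub unfolding cell_def mem_Collect_eq by blast
    qed
    from W(2)[unfolded this] show ?thesis using W(1) by (rule bexI)
  qed
  then obtain W where W: "\<And>\<sigma>. \<sigma> \<in> good \<Longrightarrow> W \<sigma> \<in> constructible"
    "\<And>\<sigma> v. \<sigma> \<in> good \<Longrightarrow> v \<in> algpts \<Longrightarrow> v \<in> W \<sigma> \<longleftrightarrow> (\<exists>x. algebraic x \<and> v(i := x) \<in> cell \<sigma>)" by metis
  show ?thesis
  proof (rule bexI)
    show "(\<Union>\<sigma>\<in>good. W \<sigma>) \<in> constructible" using fin W(1) by (rule constructible_UN)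
    show "\<forall>v\<in>algpts. v \<in> (\<Union>\<sigma>\<in>good. W \<sigma>) \<longleftrightarrow> (\<exists>x. algebraic x \<and> v(i := x) \<in> Z)"
    proof
      fix v assume "v \<in> algpts"
      then have "v \<in> (\<Union>\<sigma>\<in>good. W \<sigma>) \<longleftrightarrow> (\<exists>\<sigma>\<in>good. \<exists>x. algebraic x \<and> v(i := x) \<in> cell \<sigma>)" using W(2) by blast
      also have "\<dots> \<longleftrightarrow> (\<exists>x. algebraic x \<and> v(i := x) \<in> Z)" unfolding Zcells by blast
      finally show "v \<in> (\<Union>\<sigma>\<in>good. W \<sigma>) \<longleftrightarrow> (\<exists>x. algebraic x \<and> v(i := x) \<in> Z)" .
    qed
  qed
qed

text \<open>An equation in one variable has boundedly many solutions or holds identically. The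
  alternative of few points or few missing points survives complements and intersections.\<close>

lemma constructible_section_bound:
  assumes "Z \<in> constructible"
  shows "\<exists>n. \<forall>v. let F = {x. algebraic x \<and> v(i := x) \<in> Z}; G = {x. algebraic x \<and> v(i := x) \<notin> Z} in
    finite F \<and> card F \<le> n \<or> finite G \<and> card G \<le> n"
  using assms
proof (induction Z rule: constructible.induct)
  case (zero P)
  then obtain n Q where Q: "family n Q" "\<And>v x. P (v(i := x)) = poly (Q v) x" using family_of_polyfun by blast
  show ?case
  proof (rule exI[of _ n], rule allI, unfold Let_def)
    fix v
    show "finite {x. algebraic x \<and> v(i := x) \<in> {v. P v = 0}} \<and> card {x. algebraic x \<and> v(i := x) \<in> {v. P v = 0}} \<le> n \<or>
        finite {x. algebraic x \<and> v(i := x) \<notin> {v. P v = 0}} \<and> card {x. algebraic x \<and> v(i := x) \<notin> {v. P v = 0}} \<le> n"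
    proof (cases "Q v = 0")
      case False
      have "degree (Q v) \<le> n" using Q(1) by (intro degree_le) (auto simp: family_def)
      then have "finite {x. poly (Q v) x = 0}" "card {x. poly (Q v) x = 0} \<le> n" using card_roots_le[OF False] by auto
      moreover have "{x. algebraic x \<and> v(i := x) \<in> {v. P v = 0}} \<subseteq> {x. poly (Q v) x = 0}" by (auto simp: Q(2))
      ultimately show ?thesis by (meson card_mono finite_subset le_trans)
    qed (simp add: Q(2))
  qed
next
  case (compl Z)
  then obtain n where n: "\<forall>v. let F = {x. algebraic x \<and> v(i := x) \<in> Z}; G = {x. algebraic x \<and> v(i := x) \<notin> Z} in
    finite F \<and> card F \<le> n \<or> finite G \<and> card G \<le> n" by blast
  show ?case
  proof (rule exI[of _ n], rule allI)
    fix v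
    show "let F = {x. algebraic x \<and> v(i := x) \<in> - Z}; G = {x. algebraic x \<and> v(i := x) \<notin> - Z} in
      finite F \<and> card F \<le> n \<or> finite G \<and> card G \<le> n"
      using spec[OF n, of v] by (simp add: Let_def disj_commute del: fun_upd_apply)
  qed
next
  case (inter Z Z')
  then obtain m n where mn: "\<And>v. let F = {x. algebraic x \<and> v(i := x) \<in> Z}; G = {x. algebraic x \<and> v(i := x) \<notin> Z} in
    finite F \<and> card F \<le> m \<or> finite G \<and> card G \<le> m"
    "\<And>v. let F = {x. algebraic x \<and> v(i := x) \<in> Z'}; G = {x. algebraic x \<and> v(i := x) \<notin> Z'} in
    finite F \<and> card F \<le> n \<or> finite G \<and> card G \<le> n" by blast
  show ?case
  proof (rule exI[of _ "m + n"], rule allI, unfold Let_def)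
    fix v
    define F G F' G' where "F = {x. algebraic x \<and> v(i := x) \<in> Z}" and "G = {x. algebraic x \<and> v(i := x) \<notin> Z}"
      and "F' = {x. algebraic x \<and> v(i := x) \<in> Z'}" and "G' = {x. algebraic x \<and> v(i := x) \<notin> Z'}"
    have eq: "{x. algebraic x \<and> v(i := x) \<in> Z \<inter> Z'} = F \<inter> F'" "{x. algebraic x \<and> v(i := x) \<notin> Z \<inter> Z'} = G \<union> G'"
      by (auto simp: F_def G_def F'_def G'_def)
    have 1: "finite F \<and> card F \<le> m \<or> finite G \<and> card G \<le> m" using mn(1)[of v] by (simp add: Let_def F_def G_def)
    have 2: "finite F' \<and> card F' \<le> n \<or> finite G' \<and> card G' \<le> n" using mn(2)[of v] by (simp add: Let_def F'_def G'_def)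
    have "finite (F \<inter> F') \<and> card (F \<inter> F') \<le> m + n \<or> finite (G \<union> G') \<and> card (G \<union> G') \<le> m + n"
    proof -
      consider "finite F" "card F \<le> m" | "finite F'" "card F' \<le> n" | "finite G" "card G \<le> m" "finite G'" "card G' \<le> n"
        using 1 2 by blast
      then show ?thesis
      proof cases
        case 1
        then have "card (F \<inter> F') \<le> card F" by (intro card_mono) auto
        then show ?thesis using 1 by auto
      next
        case 2
        then have "card (F \<inter> F') \<le> card F'" by (intro card_mono) auto
        then show ?thesis using 2 by auto
      next
        case 3
        then show ?thesis using card_Un_le[of G G'] by auto
      qed
    qed
    then show "finite {x. algebraic x \<and> v(i := x) \<in> Z \<inter> Z'} \<and> card {x. algebraic x \<and> v(i := x) \<in> Z \<inter> Z'} \<le> m + n \<or>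
       finite {x. algebraic x \<and> v(i := x) \<notin> Z \<inter> Z'} \<and> card {x. algebraic x \<and> v(i := x) \<notin> Z \<inter> Z'} \<le> m + n"
      unfolding eq .
  qed
qed

text \<open>The coordinates below \<open>m\<close> vary and those from \<open>m\<close> on are
  parameters. Only algebraic points count, because the projections are described for these
  alone.\<close>

definition fibre :: "nat \<Rightarrow> (nat \<Rightarrow> complex) set \<Rightarrow> (nat \<Rightarrow> complex) \<Rightarrow> (nat \<Rightarrow> complex) set" where
  "fibre m Z v = {w \<in> algpts \<inter> Z. \<forall>i\<ge>m. w i = v i}"

text \<open>Forgetting one free coordinate leaves a finite fibre of the projection. The sections
  over its points are finite, and since there are infinitely many algebraic numbers they are not
  cofinite, so \<open>constructible_section_bound\<close> limits their size.\<close>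

theorem finite_fibres_bounded:
  "Z \<in> constructible \<Longrightarrow> \<exists>n. \<forall>v\<in>algpts. finite (fibre m Z v) \<longrightarrow> card (fibre m Z v) \<le> n"
proof (induction m arbitrary: Z)
  case 0
  have "card (fibre 0 Z v) \<le> 1" for v
  proof -
    have "fibre 0 Z v \<subseteq> {v}" by (auto simp: fibre_def)
    then show ?thesis using card_mono[of "{v}" "fibre 0 Z v"] by simp
  qed
  then show ?case by blast
next
  case (Suc m)
  obtain Z' where Z': "Z' \<in> constructible" "\<And>v. v \<in> algpts \<Longrightarrow> v \<in> Z' \<longleftrightarrow> (\<exists>x. algebraic x \<and> v(m := x) \<in> Z)"
    using constructible_projection[OF Suc.prems, of m] by blast
  obtain n1 where n1: "\<And>v. v \<in> algpts \<Longrightarrow> finite (fibre m Z' v) \<Longrightarrow> card (fibre m Z' v) \<le> n1"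
    using Suc.IH[OF Z'(1)] by blast
  obtain n2 where n2: "\<And>v. let F = {x. algebraic x \<and> v(m := x) \<in> Z}; G = {x. algebraic x \<and> v(m := x) \<notin> Z} in
    finite F \<and> card F \<le> n2 \<or> finite G \<and> card G \<le> n2"
    using constructible_section_bound[OF Suc.prems, of m] by blast
  have "card (fibre (Suc m) Z v) \<le> n1 * n2" if v: "v \<in> algpts" and fin: "finite (fibre (Suc m) Z v)" for v
  proof -
    \<comment> \<open>Coordinate \<open>m\<close> is reset to its value in \<open>v\<close>, so that
      the image is a fibre over the same parameter.\<close>
    define f where "f w = w(m := v m)" for w :: "nat \<Rightarrow> complex"
    have upd: "u(m := x) \<in> algpts" if "u \<in> algpts" "algebraic x" for u x using that by (auto simp: algpts_def)
    have vm: "algebraic (w m)" if "w \<in> algpts" for w using that by (simp add: algpts_def)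
    have image: "f ` fibre (Suc m) Z v = fibre m Z' v"
    proof (intro equalityI subsetI)
      fix u assume "u \<in> f ` fibre (Suc m) Z v"
      then obtain w where w: "w \<in> fibre (Suc m) Z v" "u = f w" by blast
      have "u \<in> algpts" using w upd vm[OF v] by (auto simp: f_def fibre_def)
      moreover have "u(m := w m) = w" by (simp add: w f_def)
      then have "\<exists>x. algebraic x \<and> u(m := x) \<in> Z" using w vm[of w] by (auto simp: fibre_def)
      moreover have "u i = v i" if "i \<ge> m" for i using w that by (cases "i = m") (auto simp: f_def fibre_def)
      ultimately show "u \<in> fibre m Z' v" using Z'(2) by (auto simp: fibre_def)
    next
      fix u assume u: "u \<in> fibre m Z' v"
      then obtain x where x: "algebraic x" "u(m := x) \<in> Z" using Z'(2) by (auto simp: fibre_def)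
      have "u(m := x) \<in> fibre (Suc m) Z v" using u x upd by (auto simp: fibre_def)
      moreover have "f (u(m := x)) = u" using u by (auto simp: f_def fibre_def fun_eq_iff)
      ultimately show "u \<in> f ` fibre (Suc m) Z v" by (metis image_eqI)
    qed
    have finU: "finite (fibre m Z' v)" using fin image by (metis finite_imageI)
    show ?thesis
    proof (rule card_le_fibres[OF fin, of f "fibre m Z' v"])
      show "f ` fibre (Suc m) Z v \<subseteq> fibre m Z' v" using image by simp
      show "card (fibre m Z' v) \<le> n1" using n1[OF v finU] .
      fix u assume "u \<in> f ` fibre (Suc m) Z v"
      then have u: "u \<in> fibre m Z' v" using image by simp
      define F G where "F = {x. algebraic x \<and> u(m := x) \<in> Z}" and "G = {x. algebraic x \<and> u(m := x) \<notin> Z}"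
      have sub: "(\<lambda>x. u(m := x)) ` F \<subseteq> fibre (Suc m) Z v" using u upd by (auto simp: F_def fibre_def)
      have "inj_on (\<lambda>x. u(m := x)) F" by (rule inj_onI) (metis fun_upd_same)
      then have finF: "finite F" using finite_subset[OF sub fin] finite_imageD by blast
      have "\<not> finite G"
      proof
        assume "finite G"
        moreover have "{x. algebraic x} = F \<union> G" by (auto simp: F_def G_def)
        ultimately show False using finF infinite_algebraic by simp
      qed
      then have cardF: "card F \<le> n2" using n2[of u] by (simp add: Let_def F_def G_def)
      have "{w \<in> fibre (Suc m) Z v. f w = u} \<subseteq> (\<lambda>x. u(m := x)) ` F"
      proof
        fix w assume w: "w \<in> {w \<in> fibre (Suc m) Z v. f w = u}"
        have "u(m := w m) = w" using w by (auto simp: f_def)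
        then show "w \<in> (\<lambda>x. u(m := x)) ` F" using w vm[of w] by (intro image_eqI[of _ _ "w m"]) (auto simp: F_def fibre_def)
      qed
      then have "card {w \<in> fibre (Suc m) Z v. f w = u} \<le> card ((\<lambda>x. u(m := x)) ` F)" using finF by (intro card_mono) auto
      also have "\<dots> \<le> card F" by (rule card_image_le[OF finF])
      finally show "card {w \<in> fibre (Suc m) Z v. f w = u} \<le> n2" using cardF by simp
    qed (fact finU)
  qed
  then show ?case by blast
qed

section \<open>Lines on the surface\<close>

text \<open>A line whose direction has a nonzero s-th coordinate has exactly one description by a
  point with s-th coordinate 0 and a direction with s-th coordinate 1. In this normal form, finitely
  many lines mean a finite fibre over the coefficients of \<open>f\<close>.\<close>

lemma card_lines_bounded:
  "\<exists>K. \<forall>f :: int poly poly poly. deg3 f d \<longrightarrow> finite (lines_on_surface f) \<longrightarrow> card (lines_on_surface f) \<le> K"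
proof -
  \<comment> \<open>Coordinates 0 to 2 hold a point, 3 to 5 a direction, 6 the parameter on the
    line, and the coefficients of \<open>f\<close> start at 7.\<close>
  define enc where "enc i j k = 7 + prod_encode (i, prod_encode (j, k))" for i j k
  define P :: "(nat \<Rightarrow> complex) \<Rightarrow> complex" where "P = (\<lambda>v. \<Sum>(i, j, k)\<in>triples d. v (enc i j k) *
    ((v 0 + v 6 * v 3) ^ i * (v 1 + v 6 * v 4) ^ j * (v 2 + v 6 * v 5) ^ k))"
  have "P \<in> polyfuns" unfolding P_def case_prod_unfold
    by (intro polyfuns_sum polyfuns.mult polyfuns_power polyfuns.add polyfuns.proj)
  then obtain W where W: "W \<in> constructible" "\<forall>v\<in>algpts. v \<in> W \<longleftrightarrow> (\<exists>x. algebraic x \<and> v(6 := x) \<in> - {v. P v = 0})"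
    using constructible_projection[of "- {v. P v = 0}" 6] constructible.compl constructible.zero by blast
  \<comment> \<open>Outside \<open>W\<close> every algebraic parameter gives a point of the surface;
    the two equations are the normal form.\<close>
  define Z where "Z s = - W \<inter> {v. v s = 0} \<inter> {v. v (3 + s) - 1 = 0}" for s :: nat
  have "Z s \<in> constructible" for s unfolding Z_def
    by (intro constructible.inter constructible.compl W(1) constructible.zero polyfuns_diff polyfuns.proj polyfuns.const) simp
  from finite_fibres_bounded[OF this] have "\<exists>n. \<forall>v\<in>algpts. finite (fibre 6 (Z s) v) \<longrightarrow> card (fibre 6 (Z s) v) \<le> n" for s .
  then obtain n where n: "\<And>s v. v \<in> algpts \<Longrightarrow> finite (fibre 6 (Z s) v) \<Longrightarrow> card (fibre 6 (Z s) v) \<le> n s" by metis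
  have three: "i = 0 \<or> i = 1 \<or> i = 2" if "i < 3" for i :: nat using that by auto
  have "card (lines_on_surface f) \<le> (\<Sum>s<3. n s)"
    if deg: "deg3 f d" and fin: "finite (lines_on_surface f)" for f :: "int poly poly poly"
  proof -
    define F :: "complex poly poly poly" where "F = map_poly3 of_int f"
    define v :: "nat \<Rightarrow> complex" where "v i = (if i < 7 then 0 else
      of_int (coeff3 f (fst (prod_decode (i - 7))) (fst (prod_decode (snd (prod_decode (i - 7))))) (snd (prod_decode (snd (prod_decode (i - 7)))))))" for i
    have v: "v \<in> algpts" by (simp add: algpts_def v_def)
    have cF: "coeff3 F i j k = of_int (coeff3 f i j k)" for i j k by (simp add: F_def coeff3_map_poly3)
    have degF: "deg3 F d" using deg unfolding deg3_iff cF by simp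
    have Pv: "P (w(6 := x)) = eval3 F (w 0 + x * w 3) (w 1 + x * w 4) (w 2 + x * w 5)" if w: "\<forall>i\<ge>6. w i = v i" for w x
    proof -
      have "(w(6 := x)) (enc i j k) = coeff3 F i j k" for i j k
        using w by (simp add: cF enc_def v_def)
      then show ?thesis unfolding eval3_sum[OF degF] P_def by simp
    qed
    define line where "line w = {(w 0 + t * w 3, w 1 + t * w 4, w 2 + t * w 5) | t. True}" for w :: "nat \<Rightarrow> complex"
    have sound: "line w \<in> lines_on_surface f" if w: "w \<in> fibre 6 (Z s) v" and s: "s < 3" for w s
    proof -
      have alg: "algebraic (w i)" for i using w by (simp add: fibre_def algpts_def)
      have "w (3 + s) = 1" using w by (simp add: fibre_def Z_def)
      then have "(w 3, w 4, w 5) \<noteq> (0, 0, 0)" using three[OF s] by auto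
      moreover have "eval3 F (w 0 + t * w 3) (w 1 + t * w 4) (w 2 + t * w 5) = 0" if t: "algebraic t" for t
      proof -
        have "w \<in> algpts" "w \<notin> W" using w by (auto simp: fibre_def Z_def)
        then have "P (w(6 := t)) = 0" using W(2) t by blast
        then show ?thesis using Pv[of w t] w by (simp add: fibre_def)
      qed
      ultimately show ?thesis unfolding lines_on_surface_def mem_Collect_eq F_def
        by - (rule exI[of _ "w 0"], rule exI[of _ "w 1"], rule exI[of _ "w 2"], rule exI[of _ "w 3"], rule exI[of _ "w 4"],
          rule exI[of _ "w 5"], intro conjI alg, assumption, simp add: line_def, simp)
    qed
    have inj: "inj_on line (fibre 6 (Z s) v)" if s: "s < 3" for s
    proof (rule inj_onI)
      fix w w' assume w: "w \<in> fibre 6 (Z s) v" "w' \<in> fibre 6 (Z s) v" and eq: "line w = line w'"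
      have ws: "w s = 0" "w' s = 0" "w (3 + s) = 1" "w' (3 + s) = 1" using w by (simp_all add: fibre_def Z_def)
      have pt: "\<exists>u. \<forall>i<3. w i + t * w (3 + i) = w' i + u * w' (3 + i)" for t
      proof -
        have "(w 0 + t * w 3, w 1 + t * w 4, w 2 + t * w 5) \<in> line w'" unfolding eq[symmetric] by (auto simp: line_def)
        then obtain u where "w 0 + t * w 3 = w' 0 + u * w' 3" "w 1 + t * w 4 = w' 1 + u * w' 4" "w 2 + t * w 5 = w' 2 + u * w' 5"
          by (auto simp: line_def)
        then show ?thesis by (intro exI[of _ u] allI impI) (use three in fastforce)
      qed
      have same: "w i + t * w (3 + i) = w' i + t * w' (3 + i)" if i: "i < 3" for i t
      proof -
        obtain u where u: "\<forall>i<3. w i + t * w (3 + i) = w' i + u * w' (3 + i)" using pt by blast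
        then have "u = t" using s ws by force
        then show ?thesis using u i by simp
      qed
      have low: "w i = w' i" "w (3 + i) = w' (3 + i)" if i: "i < 3" for i
        using same[OF i, of 0] same[OF i, of 1] by auto
      show "w = w'"
      proof
        fix i :: nat
        consider "i < 3" | "3 \<le> i" "i - 3 < 3" | "i \<ge> 6" by linarith
        then show "w i = w' i"
        proof cases
          case 2
          then show ?thesis using low(2)[of "i - 3"] by simp
        qed (use low(1) w in \<open>auto simp: fibre_def\<close>)
      qed
    qed
    have complete: "\<exists>s<3. L \<in> line ` fibre 6 (Z s) v" if L: "L \<in> lines_on_surface f" for L
    proof -
      obtain a1 a2 a3 b1 b2 b3 where ab: "algebraic a1" "algebraic a2" "algebraic a3" "algebraic b1" "algebraic b2" "algebraic b3"
        "(b1, b2, b3) \<noteq> (0, 0, 0)" and L_eq: "L = {(a1 + t * b1, a2 + t * b2, a3 + t * b3) | t. True}"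
        and zero: "\<And>t. algebraic t \<Longrightarrow> eval3 F (a1 + t * b1) (a2 + t * b2) (a3 + t * b3) = 0"
      proof -
        define Q where "Q a1 a2 a3 b1 b2 b3 \<longleftrightarrow> algebraic a1 \<and> algebraic a2 \<and> algebraic a3 \<and> algebraic b1 \<and> algebraic b2 \<and> algebraic b3 \<and>
          (b1, b2, b3) \<noteq> (0, 0, 0) \<and> L = {(a1 + t * b1, a2 + t * b2, a3 + t * b3) | t. True} \<and>
          (\<forall>t. algebraic t \<longrightarrow> eval3 F (a1 + t * b1) (a2 + t * b2) (a3 + t * b3) = 0)" for a1 a2 a3 b1 b2 b3
        have "\<exists>a1 a2 a3 b1 b2 b3. Q a1 a2 a3 b1 b2 b3"
          using L unfolding lines_on_surface_def mem_Collect_eq Q_def F_def .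
        then obtain a1 a2 a3 b1 b2 b3 where "Q a1 a2 a3 b1 b2 b3" by blast
        then show ?thesis
          unfolding Q_def by (elim conjE) (rule that[of a1 a2 a3 b1 b2 b3], (assumption | (erule allE, erule mp, assumption))+)
      qed
      define a where "a i = (if i = 0 then a1 else if i = 1 then a2 else a3)" for i :: nat
      define b where "b i = (if i = 0 then b1 else if i = 1 then b2 else b3)" for i :: nat
      have alg: "algebraic (a i)" "algebraic (b i)" for i using ab by (auto simp: a_def b_def)
      have "b 0 \<noteq> 0 \<or> b 1 \<noteq> 0 \<or> b 2 \<noteq> 0" using ab(7) by (auto simp: b_def)
      then obtain s where s: "s < 3" "b s \<noteq> 0" using that[of 0] that[of 1] that[of 2] by auto
      \<comment> \<open>The parameter at which coordinate \<open>s\<close> of the line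
        vanishes.\<close>
      define c where "c = - (a s * inverse (b s))"
      have algc: "algebraic c" "algebraic (inverse (b s))"
        using alg algebraic_mult[of "-1" "a s * inverse (b s)"] by (auto simp: c_def intro!: algebraic_mult)
      define w where "w i = (if i < 3 then a i + c * b i else if i < 6 then inverse (b s) * b (i - 3) else v i)" for i
      have pt: "w i + t * w (3 + i) = a i + (c + t * inverse (b s)) * b i" if "i < 3" for i t
        using that by (simp add: w_def algebra_simps)
      have pts: "(w 0 + t * w 3, w 1 + t * w 4, w 2 + t * w 5) =
        (a1 + (c + t * inverse (b s)) * b1, a2 + (c + t * inverse (b s)) * b2, a3 + (c + t * inverse (b s)) * b3)" for t
        using pt[of 0 t] pt[of 1 t] pt[of 2 t] by (simp add: a_def b_def)
      have walg: "w \<in> algpts" unfolding algpts_def w_def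
        using v by (auto simp: algpts_def intro!: algebraic_add algebraic_mult alg algc)
      have "line w = L"
      proof (intro equalityI subsetI)
        fix p assume "p \<in> line w"
        then show "p \<in> L" unfolding line_def pts L_eq by blast
      next
        fix p assume "p \<in> L"
        then obtain t where p: "p = (a1 + t * b1, a2 + t * b2, a3 + t * b3)" unfolding L_eq by blast
        have "c + (b s * (t - c)) * inverse (b s) = t" using s(2) by (simp add: field_simps)
        then show "p \<in> line w" unfolding line_def pts p by (intro CollectI exI[of _ "b s * (t - c)"]) simp
      qed
      moreover have "w \<in> fibre 6 (Z s) v"
      proof -
        have hi: "\<forall>i\<ge>6. w i = v i" by (simp add: w_def)
        have "P (w(6 := x)) = 0" if "algebraic x" for x
        proof -
          have "algebraic (c + x * inverse (b s))" using that algc by (intro algebraic_add algebraic_mult)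
          then show ?thesis unfolding Pv[OF hi] using zero pts[of x] by (simp only: prod.inject)
        qed
        then have "w \<notin> W" using W(2) walg by blast
        moreover have "w s = 0" "w (3 + s) = 1" using s by (simp_all add: w_def c_def)
        ultimately show ?thesis using walg hi by (simp add: fibre_def Z_def)
      qed
      ultimately show ?thesis using s(1) by blast
    qed
    have sub: "line ` fibre 6 (Z s) v \<subseteq> lines_on_surface f" if "s < 3" for s using sound that by blast
    have cardf: "card (line ` fibre 6 (Z s) v) \<le> n s" if s: "s < 3" for s
    proof -
      have "finite (fibre 6 (Z s) v)" using finite_subset[OF sub[OF s] fin] inj[OF s] by (rule finite_imageD)
      then show ?thesis using n[OF v] card_image[OF inj[OF s]] by simp
    qed
    have "lines_on_surface f = (\<Union>s\<in>{..<3}. line ` fibre 6 (Z s) v)" using complete sub by blast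
    then have "card (lines_on_surface f) \<le> (\<Sum>s<3. card (line ` fibre 6 (Z s) v))"
      using card_UN_le[of "{..<3::nat}" "\<lambda>s. line ` fibre 6 (Z s) v"] by simp
    also have "\<dots> \<le> (\<Sum>s<3. n s)" using cardf by (intro sum_mono) auto
    finally show ?thesis .
  qed
  then show ?thesis by blast
qed

section \<open>Counting points\<close>

lemma derivative_bound3:
  fixes f :: "int poly poly poly"
  assumes f: "deg3 f d" "\<And>i j k. \<bar>coeff3 f i j k\<bar> \<le> int N ^ c" and N: "N \<ge> card (triples d) * (d + 1)" "N \<ge> 1"
    and box: "\<bar>x\<bar> \<le> int N" "\<bar>y\<bar> \<le> int N" "\<bar>z\<bar> \<le> int N"
  shows "\<bar>eval3 (pderiv f) x y z\<bar> \<le> int N ^ (c + d + 1)"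
proof -
  have coef: "coeff3 (pderiv f) i j k = of_nat (Suc i) * coeff3 f (Suc i) j k" for i j k
    by (simp add: coeff3_def coeff_pderiv coeff_of_nat_mult del: of_nat_Suc)
  have deg: "deg3 (pderiv f) d" unfolding deg3_iff
  proof (intro allI impI)
    fix i j k assume "coeff3 (pderiv f) i j k \<noteq> 0"
    then have "coeff3 f (Suc i) j k \<noteq> 0" by (simp add: coef)
    then have "Suc i + j + k \<le> d" using f(1) unfolding deg3_iff by blast
    then show "i + j + k \<le> d" by simp
  qed
  have "\<bar>eval3 (pderiv f) x y z\<bar> \<le> (\<Sum>(i, j, k)\<in>triples d. \<bar>coeff3 (pderiv f) i j k * (x ^ i * y ^ j * z ^ k)\<bar>)"
    unfolding eval3_sum[OF deg] case_prod_unfold by (rule sum_abs)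
  also have "\<dots> \<le> (\<Sum>(i, j, k)\<in>triples d. (int d + 1) * int N ^ c * int N ^ d)"
  proof (rule sum_mono, clarify)
    fix i j k assume ijk: "(i, j, k) \<in> triples d"
    have 1: "\<bar>coeff3 (pderiv f) i j k\<bar> \<le> (int d + 1) * int N ^ c"
      unfolding coef abs_mult using f(2) ijk by (intro mult_mono) (auto simp: triples_def)
    have "\<bar>x\<bar> ^ i * \<bar>y\<bar> ^ j * \<bar>z\<bar> ^ k \<le> int N ^ i * int N ^ j * int N ^ k" using box by (intro mult_mono power_mono) auto
    also have "\<dots> \<le> int N ^ d" unfolding power_add[symmetric] using ijk N by (intro power_increasing) (auto simp: triples_def)
    finally have 2: "\<bar>x ^ i * y ^ j * z ^ k\<bar> \<le> int N ^ d" by (simp add: abs_mult power_abs)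
    show "\<bar>coeff3 (pderiv f) i j k * (x ^ i * y ^ j * z ^ k)\<bar> \<le> (int d + 1) * int N ^ c * int N ^ d"
      unfolding abs_mult[of "coeff3 _ _ _ _"] using 1 2 by (intro mult_mono) auto
  qed
  also have "\<dots> = int (card (triples d) * (d + 1)) * (int N ^ c * int N ^ d)" by (simp add: algebra_simps)
  also have "\<dots> \<le> int N * (int N ^ c * int N ^ d)" using N by (intro mult_right_mono) (auto simp only: of_nat_le_iff, auto)
  also have "\<dots> = int N ^ (c + d + 1)" by (simp add: power_add)
  finally show ?thesis .
qed

definition residues3 :: "nat \<Rightarrow> int \<times> int \<times> int \<Rightarrow> int \<times> int \<times> int" where
  "residues3 p s = (fst s mod int p, fst (snd s) mod int p, snd (snd s) mod int p)"

lemma residues3_eq_iff: "residues3 p (x, y, z) = residues3 p (x', y', z') \<longleftrightarrow>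
    [x = x'] (mod int p) \<and> [y = y'] (mod int p) \<and> [z = z'] (mod int p)"
  by (simp add: residues3_def cong_def)

text \<open>Over each of the \<open>p ^ 2\<close> residues of the last two coordinates there are at
  most \<open>d\<close> simple roots.\<close>

lemma card_simple_zeros3_mod_prime:
  fixes f :: "int poly poly poly" and p :: nat
  assumes "prime p" "deg3 f d"
    and A: "\<And>x y z. (x, y, z) \<in> A \<Longrightarrow> int p dvd eval3 f x y z \<and> \<not> int p dvd eval3 (pderiv f) x y z"
  shows "finite (residues3 p ` A) \<and> card (residues3 p ` A) \<le> p ^ 2 * d"
proof -
  define F where "F b c = map_poly (\<lambda>r. eval2 r b c) f" for b c
  define R where "R b c = {a \<in> {0..<int p}. int p dvd poly (F b c) a \<and> \<not> int p dvd poly (pderiv (F b c)) a}" for b c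
  have R: "finite (R b c)" "card (R b c) \<le> d" for b c
  proof -
    show "finite (R b c)" unfolding R_def by (rule finite_subset[of _ "{0..<int p}"]) auto
    have "degree (F b c) \<le> d"
      unfolding F_def using map_poly_degree_leq F2.lift_deg_degree[OF assms(2)] by (rule le_trans)
    then show "card (R b c) \<le> d" unfolding R_def using assms(1) by (intro card_simple_roots_mod_prime) auto
  qed
  define B where "B = {0..<int p} \<times> {0..<int p}"
  define T where "T = (\<lambda>(bc, a). (a, bc)) ` (SIGMA bc:B. R (fst bc) (snd bc))"
  have finB: "finite B" by (simp add: B_def)
  have fin: "finite T" unfolding T_def using R finB by (intro finite_imageI finite_SigmaI) auto
  have "card T \<le> card (SIGMA bc:B. R (fst bc) (snd bc))" unfolding T_def using R finB by (intro card_image_le finite_SigmaI) auto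
  also have "\<dots> = (\<Sum>bc\<in>B. card (R (fst bc) (snd bc)))" using R finB by (intro card_SigmaI) auto
  also have "\<dots> \<le> (\<Sum>bc\<in>B. d)" using R by (intro sum_mono)
  also have "\<dots> = p ^ 2 * d" by (simp add: B_def card_cartesian_product power2_eq_square)
  finally have cardT: "card T \<le> p ^ 2 * d" .
  have "residues3 p s \<in> T" if "s \<in> A" for s
  proof -
    obtain x y z where s: "s = (x, y, z)" by (cases s)
    let ?x = "x mod int p" and ?y = "y mod int p" and ?z = "z mod int p"
    have p: "int p > 0" using assms(1) by (simp add: prime_gt_0_nat)
    have "[eval3 g ?x ?y ?z = eval3 g x y z] (mod int p)" for g by (intro cong_eval3) (auto simp: cong_def)
    then have "int p dvd eval3 g ?x ?y ?z \<longleftrightarrow> int p dvd eval3 g x y z" for g by (simp add: cong_dvd_iff)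
    then have "int p dvd eval3 f ?x ?y ?z" "\<not> int p dvd eval3 (pderiv f) ?x ?y ?z" using A[of x y z] that s by auto
    then have "?x \<in> R ?y ?z" using p by (simp add: R_def F_def flip: eval3_map eval3_pderiv)
    then have "((?y, ?z), ?x) \<in> (SIGMA bc:B. R (fst bc) (snd bc))" using p by (simp add: B_def)
    from imageI[OF this, of "\<lambda>(bc, a). (a, bc)"] show ?thesis unfolding T_def residues3_def s by simp
  qed
  then have "residues3 p ` A \<subseteq> T" by auto
  then show ?thesis using fin cardT card_mono finite_subset le_trans by metis
qed

text \<open>The surface contains the line of direction (1, 0, 0) through each of its points.\<close>

lemma free_points_of_cylinder:
  assumes "degree f = 0"
  shows "free_points f N = {}"
proof -
  obtain h where "f = [:h:]" using assms by (meson degree_eq_zeroE)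
  then have "on_integer_line f x y z" if "eval3 f x y z = 0" for x y z
    using that unfolding on_integer_line_def by (intro exI[of _ 1] exI[of _ 0]) (auto simp: eval3_simps)
  then show ?thesis by (auto simp: free_points_def)
qed

text \<open>The first variable is eliminated from \<open>f\<close> and the auxiliary polynomial of
  the class. The prime factors of \<open>R\<close> will be the possible labels of the points in the
  class.\<close>

lemma projected_class_curve:
  fixes n d :: nat
  assumes n: "n \<ge> 1" and d: "d \<ge> 4"
  shows "\<exists>N0 E. \<forall>N q f S. N \<ge> N0 \<longrightarrow> N ^ (n + 1) \<le> q ^ (2 * n) \<longrightarrow> q ^ (2 * n) \<le> N ^ (n + 2) \<longrightarrow>
    prime_elem f \<longrightarrow> degree f > 0 \<longrightarrow> deg3 f d \<longrightarrow> (\<exists>i j k. i + j + k = d \<and> coeff3 f i j k \<noteq> 0) \<longrightarrow>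
    (\<forall>(x, y, z)\<in>S. \<bar>x\<bar> \<le> int N \<and> \<bar>y\<bar> \<le> int N \<and> \<bar>z\<bar> \<le> int N \<and> eval3 f x y z = 0
      \<and> coprime (eval3 (pderiv f) x y z) (int q)) \<longrightarrow>
    (\<forall>s\<in>S. \<forall>s'\<in>S. residues3 q s = residues3 q s') \<longrightarrow>
    (\<exists>R. R \<noteq> 0 \<and> deg2 R E \<and> (\<forall>(x, y, z)\<in>S. eval2 R y z = 0))"
proof -
  obtain N0 D where aux: "\<And>N q f d i0 j0 k0 S. N \<ge> N0 \<Longrightarrow> N ^ (n + 1) \<le> q ^ (2 * n) \<Longrightarrow> q ^ (2 * n) \<le> N ^ (n + 2) \<Longrightarrow>
    deg3 f d \<Longrightarrow> i0 + j0 + k0 = d \<Longrightarrow> coeff3 f i0 j0 k0 \<noteq> 0 \<Longrightarrow> d \<ge> 4 \<Longrightarrow>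
    (\<And>x y z. (x, y, z) \<in> S \<Longrightarrow> \<bar>x\<bar> \<le> int N \<and> \<bar>y\<bar> \<le> int N \<and> \<bar>z\<bar> \<le> int N \<and> eval3 f x y z = 0
      \<and> coprime (eval3 (pderiv f) x y z) (int q)) \<Longrightarrow>
    (\<And>x y z x' y' z'. (x, y, z) \<in> S \<Longrightarrow> (x', y', z') \<in> S \<Longrightarrow>
      [x = x'] (mod int q) \<and> [y = y'] (mod int q) \<and> [z = z'] (mod int q)) \<Longrightarrow>
    \<exists>g. g \<noteq> 0 \<and> deg3 g D \<and> \<not> f dvd g \<and> (\<forall>(x, y, z)\<in>S. eval3 g x y z = 0)"
  proof (rule surface_class_auxiliary[OF n], goal_cases)
    case (1 N0 D)
    show ?case by (rule 1(1), rule 1(2))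
  qed
  obtain E where E: "\<And>f g :: int poly poly poly. prime_elem f \<Longrightarrow> degree f > 0 \<Longrightarrow> deg3 f d \<Longrightarrow> deg3 g D \<Longrightarrow> \<not> f dvd g \<Longrightarrow>
     (\<exists>r u v. r \<noteq> 0 \<and> deg2 r E \<and> [:r:] = u * f + v * g)"
    using F2.elimination[of d D] by blast
  show ?thesis
  proof (rule exI[of _ N0], rule exI[of _ E], intro allI impI)
    fix N q :: nat and f :: "int poly poly poly" and S
    assume N: "N \<ge> N0" and q: "N ^ (n + 1) \<le> q ^ (2 * n)" "q ^ (2 * n) \<le> N ^ (n + 2)"
      and f: "prime_elem f" "degree f > 0" "deg3 f d" "\<exists>i j k. i + j + k = d \<and> coeff3 f i j k \<noteq> 0"
      and S: "\<forall>(x, y, z)\<in>S. \<bar>x\<bar> \<le> int N \<and> \<bar>y\<bar> \<le> int N \<and> \<bar>z\<bar> \<le> int N \<and> eval3 f x y z = 0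
        \<and> coprime (eval3 (pderiv f) x y z) (int q)" "\<forall>s\<in>S. \<forall>s'\<in>S. residues3 q s = residues3 q s'"
    obtain i0 j0 k0 where ijk: "i0 + j0 + k0 = d" "coeff3 f i0 j0 k0 \<noteq> 0" using f(4) by blast
    have S1: "\<bar>x\<bar> \<le> int N \<and> \<bar>y\<bar> \<le> int N \<and> \<bar>z\<bar> \<le> int N \<and> eval3 f x y z = 0
      \<and> coprime (eval3 (pderiv f) x y z) (int q)" if "(x, y, z) \<in> S" for x y z
      using S(1) that by auto
    have S2: "[x = x'] (mod int q) \<and> [y = y'] (mod int q) \<and> [z = z'] (mod int q)"
      if "(x, y, z) \<in> S" "(x', y', z') \<in> S" for x y z x' y' z'
      using bspec[OF bspec[OF S(2) that(1)] that(2)] by (simp only: residues3_eq_iff)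
    have "\<exists>g. g \<noteq> 0 \<and> deg3 g D \<and> \<not> f dvd g \<and> (\<forall>(x, y, z)\<in>S. eval3 g x y z = 0)"
      by (rule aux[OF N q f(3) ijk d]) (erule S1, erule S2)
    then obtain g where g: "deg3 g D" "\<not> f dvd g" "\<forall>(x, y, z)\<in>S. eval3 g x y z = 0" by blast
    obtain r u v where r: "r \<noteq> 0" "deg2 r E" "[:r:] = u * f + v * g" using E[OF f(1-3) g(1,2)] by blast
    have "eval2 r y z = 0" if s: "(x, y, z) \<in> S" for x y z
    proof -
      have "eval2 r y z = eval3 [:r:] x y z" by (simp add: eval3_simps)
      also have "\<dots> = 0" unfolding r(3) using S1[OF s] g(3) s by (auto simp: eval3_simps)
      finally show ?thesis .
    qed
    then show "\<exists>R. R \<noteq> 0 \<and> deg2 R E \<and> (\<forall>(x, y, z)\<in>S. eval2 R y z = 0)" using r by blast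
  qed
qed

text \<open>The label argument, with all it takes from the surface isolated in the hypotheses.
  \<open>F1\<close> stands for the derivative, a tuple of primes stands for their product as
  modulus, and a label is a component of the plane curve of a class.\<close>

lemma tracked_points_bound:
  fixes S :: "(int \<times> int \<times> int) set" and F1 :: "int \<times> int \<times> int \<Rightarrow> int" and A :: "nat \<Rightarrow> nat set"
  assumes n: "n \<ge> 1" and N: "N \<ge> 2" and fin: "finite S"
    and box: "\<And>x y z. (x, y, z) \<in> S \<Longrightarrow> \<bar>x\<bar> \<le> int N \<and> \<bar>y\<bar> \<le> int N \<and> \<bar>z\<bar> \<le> int N"
    and F1: "\<And>s. s \<in> S \<Longrightarrow> F1 s \<noteq> 0 \<and> \<bar>F1 s\<bar> \<le> int N ^ e"
    and curve: "\<And>q G. N ^ (n + 1) \<le> q ^ (2 * n) \<Longrightarrow> q ^ (2 * n) \<le> N ^ (n + 2) \<Longrightarrow> G \<subseteq> S \<Longrightarrow> (\<And>s. s \<in> G \<Longrightarrow> coprime (F1 s) (int q)) \<Longrightarrow>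
      (\<And>s s'. s \<in> G \<Longrightarrow> s' \<in> G \<Longrightarrow> residues3 q s = residues3 q s') \<Longrightarrow> \<exists>R. R \<noteq> 0 \<and> deg2 R E \<and> (\<forall>(x, y, z)\<in>G. eval2 R y z = 0)"
    and classes: "\<And>p. prime p \<Longrightarrow> card (residues3 p ` {s \<in> S. \<not> int p dvd F1 s}) \<le> p ^ 2 * d"
    and vertical: "\<And>y z. card {s \<in> S. snd s = (y, z)} \<le> d"
    and mass: "\<And>h. prime_elem h \<Longrightarrow> deg2 h E \<Longrightarrow> card {s \<in> S. eval2 h (fst (snd s)) (snd (snd s)) = 0} \<le> M"
    and bezout: "\<And>h R. prime_elem h \<Longrightarrow> deg2 h E \<Longrightarrow> deg2 R E \<Longrightarrow> \<not> h dvd R \<Longrightarrow>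
      finite {(a::int, b). eval2 h a b = 0 \<and> eval2 R a b = 0} \<and> card {(a, b). eval2 h a b = 0 \<and> eval2 R a b = 0} \<le> Cb"
    and primes: "\<And>i p. i < n \<Longrightarrow> p = T0 i \<or> p \<in> A i \<Longrightarrow> prime p \<and> real N powr (real (n + 1) / real (2 * n) / n) \<le> p \<and>
      p \<le> real N powr (real (n + 2) / real (2 * n) / n) \<and> p \<le> L"
    and disjoint: "\<And>i j p. i < n \<Longrightarrow> j < n \<Longrightarrow> p = T0 i \<or> p \<in> A i \<Longrightarrow> p = T0 j \<or> p \<in> A j \<Longrightarrow> i = j"
    and A: "\<And>i. i < n \<Longrightarrow> finite (A i)" "\<And>i. i < n \<Longrightarrow> card (A i) = z"
    and good0: "\<And>i s. i < n \<Longrightarrow> s \<in> S \<Longrightarrow> \<not> int (T0 i) dvd F1 s"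
    and z: "z \<ge> 4 * n * (2 * n * e)" "z \<ge> 1"
  shows "real (card S) \<le> 2 * real (n * ((L ^ 2 * d) ^ (n + 1) * ((E + 1) * (E + 1) ^ 2 * (Cb * d)))) +
    8 * (1 + real (M * (2 * n * 2) ^ n) / real (z ^ n)) * real ((L ^ 2 * d) ^ n * ((E + 1) * (E + 1) ^ 2))"
proof -
  define good where "good p s \<longleftrightarrow> \<not> int p dvd F1 s" for p s
  define G where "G T s = {s' \<in> S. \<forall>i<n. good (T i) s' \<and> residues3 (T i) s' = residues3 (T i) s}" for T :: "nat \<Rightarrow> nat" and s
  define pr where "pr R X \<longleftrightarrow> R \<noteq> 0 \<and> deg2 R E \<and> (\<forall>(x, y, z)\<in>X. eval2 R y z = 0)"
    for R :: "int poly poly" and X :: "(int \<times> int \<times> int) set"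
  \<comment> \<open>The choice depends on the class \<open>G T s\<close> alone, so the points of a
    class share one curve. The default 1 has no components and keeps the degree bound for arbitrary
    tuples.\<close>
  define Rc where "Rc T s = (if \<exists>R. pr R (G T s) then SOME R. pr R (G T s) else 1)" for T s
  define H where "H T s = plane_factors (Rc T s)" for T s
  define valid where "valid T \<longleftrightarrow> (\<forall>i<n. T i = T0 i \<or> T i \<in> A i)" for T
  have valid: "pr (Rc T s) (G T s)" if T: "valid T" for T s
  proof -
    define q where "q = (\<Prod>i<n. T i)"
    have p: "prime (T i)" "real N powr (real (n + 1) / real (2 * n) / n) \<le> T i"
      "T i \<le> real N powr (real (n + 2) / real (2 * n) / n)" if "i < n" for i
      using primes[OF that, of "T i"] T that by (auto simp: valid_def)
    \<comment> \<open>The primes lie between the n-th roots of the bounds for the modulus, so their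
      product lies in the admissible window.\<close>
    have root: "(real N powr (a / n)) ^ n = real N powr a" for a
    proof -
      have "(real N powr (a / n)) ^ n = (real N powr (a / n)) powr n" using N by (subst powr_realpow) auto
      then show ?thesis using n by (simp add: powr_powr)
    qed
    have "real N powr (real (n + 1) / real (2 * n)) = (\<Prod>i<n. real N powr (real (n + 1) / real (2 * n) / n))"
      by (simp only: prod_constant card_lessThan root)
    also have "\<dots> \<le> (\<Prod>i<n. real (T i))" using p by (intro prod_mono) auto
    finally have q1: "N ^ (n + 1) \<le> q ^ (2 * n)" using n N by (intro admissible_powr) (auto simp: q_def)
    have "(\<Prod>i<n. real (T i)) \<le> (\<Prod>i<n. real N powr (real (n + 2) / real (2 * n) / n))"
      using p by (intro prod_mono) auto
    also have "\<dots> = real N powr (real (n + 2) / real (2 * n))"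
      by (simp only: prod_constant card_lessThan root)
    finally have q2: "q ^ (2 * n) \<le> N ^ (n + 2)" using n N by (intro admissible_powr) (auto simp: q_def)
    have iq: "int q = (\<Prod>i\<in>{..<n}. int (T i))" by (simp add: q_def)
    have "\<exists>R. R \<noteq> 0 \<and> deg2 R E \<and> (\<forall>(x, y, z)\<in>G T s. eval2 R y z = 0)"
    proof (rule curve[OF q1 q2])
      show "G T s \<subseteq> S" by (auto simp: G_def)
      show "coprime (F1 s') (int q)" if s': "s' \<in> G T s" for s'
        unfolding iq
      proof (rule prod_coprime_right)
        fix i assume "i \<in> {..<n}"
        then have "\<not> int (T i) dvd F1 s'" "prime (int (T i))" using s' p(1)[of i] by (auto simp: G_def good_def)
        then show "coprime (F1 s') (int (T i))" using prime_imp_coprime coprime_commute by blast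
      qed
      show "residues3 q s' = residues3 q s''" if s': "s' \<in> G T s" "s'' \<in> G T s" for s' s''
      proof -
        \<comment> \<open>The Chinese remainder theorem; primes in different places are distinct by
          \<open>disjoint\<close>.\<close>
        have *: "[a = b] (mod int q)" if "\<And>i. i < n \<Longrightarrow> [a = b] (mod int (T i))" for a b
          unfolding iq
        proof (rule cong_cong_prod_coprime)
          show "\<forall>i\<in>{..<n}. [a = b] (mod int (T i))" using that by simp
          show "\<forall>i\<in>{..<n}. \<forall>j\<in>{..<n}. i \<noteq> j \<longrightarrow> coprime (int (T i)) (int (T j))"
          proof (intro ballI impI)
            fix i j assume ij: "i \<in> {..<n}" "j \<in> {..<n}" "i \<noteq> j"
            then have "T i \<noteq> T j" using disjoint[of i j "T i"] T by (auto simp: valid_def)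
            then show "coprime (int (T i)) (int (T j))" using p(1) ij by (simp add: primes_coprime)
          qed
        qed
        obtain x y z x' y' z' where xyz: "s' = (x, y, z)" "s'' = (x', y', z')" by (cases s', cases s'')
        have "residues3 (T i) s' = residues3 (T i) s''" if "i < n" for i using s' that by (simp add: G_def)
        then show ?thesis unfolding xyz residues3_eq_iff using * by blast
      qed
    qed
    then have ex: "\<exists>R. pr R (G T s)" unfolding pr_def .
    show ?thesis unfolding Rc_def using someI_ex[OF ex] ex by simp
  qed
  have Rc: "Rc T s \<noteq> 0" "deg2 (Rc T s) E" for T s
  proof -
    have "Rc T s \<noteq> 0 \<and> deg2 (Rc T s) E"
    proof (cases "\<exists>R. pr R (G T s)")
      case True
      then show ?thesis using someI_ex[OF True] by (simp add: Rc_def pr_def)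
    next
      case False
      moreover have "deg2 (1 :: int poly poly) E" using F2.D_1 by (rule F2.D_mono) simp
      ultimately show ?thesis by (simp add: Rc_def)
    qed
    then show "Rc T s \<noteq> 0" "deg2 (Rc T s) E" by auto
  qed
  \<comment> \<open>The label is fixed once and for all by the base tuple \<open>T0\<close>, as a
    component through the projected point.\<close>
  define label where "label s = (SOME h. h \<in> H T0 s \<and> eval2 h (fst (snd s)) (snd (snd s)) = 0)" for s
  have label: "label s \<in> H T0 s \<and> eval2 (label s) (fst (snd s)) (snd (snd s)) = 0" if s: "s \<in> S" for s
  proof -
    have "s \<in> G T0 s" using s good0 by (simp add: G_def good_def)
    moreover have "pr (Rc T0 s) (G T0 s)" by (rule valid) (simp add: valid_def)
    ultimately have "eval2 (Rc T0 s) (fst (snd s)) (snd (snd s)) = 0" by (auto simp: pr_def case_prod_unfold)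
    then have "\<exists>h. h \<in> H T0 s \<and> eval2 h (fst (snd s)) (snd (snd s)) = 0"
      unfolding H_def using plane_factor_vanishes[OF Rc(1)] by blast
    then show ?thesis unfolding label_def by (rule someI_ex)
  qed
  have factor: "prime_elem h" "deg2 h E" if "h \<in> H T s" for h T s
    using plane_factor_prime[of h "Rc T s"] that deg2_dvd[OF _ Rc(1) Rc(2), of h T s] by (auto simp: H_def)
  have Hcong: "H T x = H T y" if "\<And>i. i < n \<Longrightarrow> residues3 (T i) x = residues3 (T i) y" for T x y
  proof -
    have "G T x = G T y" using that by (simp add: G_def cong: conj_cong)
    then show ?thesis by (simp add: H_def Rc_def)
  qed
  \<comment> \<open>A prime is at least N^((n + 1) / (2 n^2)), so its power with exponent 2n is at
    least N^((n + 1) / n).\<close>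
  have prime_big: "N \<le> p ^ (2 * n)" if "i < n" "p = T0 i \<or> p \<in> A i" for i p
  proof -
    have "(real n + 1) / n = real (n + 1) / real (2 * n) / n * real (2 * n)" using n by (simp add: field_simps)
    then have "real N powr ((real n + 1) / n) = (real N powr (real (n + 1) / real (2 * n) / n)) powr (2 * n)"
      by (simp only: powr_powr)
    also have "\<dots> = (real N powr (real (n + 1) / real (2 * n) / n)) ^ (2 * n)"
      using N by (subst powr_realpow[symmetric]) auto
    also have "\<dots> \<le> real p ^ (2 * n)" using primes[OF that] by (intro power_mono) auto
    finally have *: "real N powr ((real n + 1) / n) \<le> real (p ^ (2 * n))" by simp
    have "real N = real N powr 1" using N by simp
    also have "\<dots> \<le> real N powr ((real n + 1) / n)" using n N by (intro powr_mono) (auto simp: field_simps)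
    also note *
    finally show ?thesis by (simp only: of_nat_le_iff)
  qed
  interpret label_tracking S n A T0 residues3 good H label z "L ^ 2 * d" "(E + 1) * (E + 1) ^ 2" "Cb * d" "2 * n * e" "2 * n * 2" M
  proof
    show "finite S" "n \<ge> 1" by (fact fin n)+
    show "finite (A i)" "card (A i) = z" if "i < n" for i using A that by auto
    show "good (T0 i) s" if "i < n" "s \<in> S" for i s using good0 that by (simp add: good_def)
    show "finite (residues3 p ` {x \<in> S. good p x}) \<and> card (residues3 p ` {x \<in> S. good p x}) \<le> L ^ 2 * d"
      if "i < n" "p = T0 i \<or> p \<in> A i" for i p
    proof -
      have p: "prime p" "p \<le> L" using primes[OF that] by auto
      have "card (residues3 p ` {x \<in> S. good p x}) \<le> p ^ 2 * d" using classes[OF p(1)] by (simp add: good_def)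
      also have "\<dots> \<le> L ^ 2 * d" using p(2) by (intro mult_le_mono1 power_mono) auto
      finally show ?thesis using fin by simp
    qed
    show "finite (H T x)" for T x by (simp add: H_def plane_factors_finite)
    show "card (H T x) \<le> (E + 1) * (E + 1) ^ 2" for T x unfolding H_def using Rc by (rule card_plane_factors)
    show "H T x = H T y" if "\<And>i. i < n \<Longrightarrow> residues3 (T i) x = residues3 (T i) y" for T x y using Hcong that by blast
    show "label x \<in> H T0 x" if "x \<in> S" for x using label that by blast
    show "z \<ge> 4 * n * (2 * n * e)" "z \<ge> 1" by (fact z)+
    show "card {p \<in> A i. \<not> good p x} \<le> 2 * n * e" if x: "x \<in> S" and i: "i < n" for x i
    proof (rule card_prime_divisors)
      show "F1 x \<noteq> 0" "\<bar>F1 x\<bar> \<le> int N ^ e" using F1 x by auto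
    qed (use A i N primes prime_big in \<open>auto simp: good_def\<close>)
    show "card {p \<in> A i. residues3 p x = residues3 p y} \<le> 2 * n * 2" if xy: "x \<in> S" "y \<in> S" "x \<noteq> y" and i: "i < n" for x y i
    proof -
      have small: "\<bar>a - b\<bar> \<le> int N ^ 2" if "\<bar>a\<bar> \<le> int N" "\<bar>b\<bar> \<le> int N" for a b
      proof -
        have "\<bar>a - b\<bar> \<le> 2 * int N" using that by linarith
        also have "\<dots> \<le> int N * int N" using N by (intro mult_right_mono) auto
        finally show ?thesis by (simp add: power2_eq_square)
      qed
      obtain x1 x2 x3 y1 y2 y3 where xy': "x = (x1, x2, x3)" "y = (y1, y2, y3)" by (cases x, cases y)
      have bx: "\<bar>x1\<bar> \<le> int N" "\<bar>x2\<bar> \<le> int N" "\<bar>x3\<bar> \<le> int N" "\<bar>y1\<bar> \<le> int N" "\<bar>y2\<bar> \<le> int N" "\<bar>y3\<bar> \<le> int N"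
        using box xy xy' by auto
      have "\<exists>u. u \<noteq> 0 \<and> \<bar>u\<bar> \<le> int N ^ 2 \<and> (\<forall>p. residues3 p x = residues3 p y \<longrightarrow> int p dvd u)"
      proof -
        consider "x1 \<noteq> y1" | "x2 \<noteq> y2" | "x3 \<noteq> y3" using xy(3) xy' by auto
        then show ?thesis
        proof cases
          case 1
          then show ?thesis using small bx by (intro exI[of _ "x1 - y1"]) (auto simp: xy' residues3_eq_iff cong_iff_dvd_diff)
        next
          case 2
          then show ?thesis using small bx by (intro exI[of _ "x2 - y2"]) (auto simp: xy' residues3_eq_iff cong_iff_dvd_diff)
        next
          case 3
          then show ?thesis using small bx by (intro exI[of _ "x3 - y3"]) (auto simp: xy' residues3_eq_iff cong_iff_dvd_diff)
        qed
      qed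
      then obtain u where u: "u \<noteq> 0" "\<bar>u\<bar> \<le> int N ^ 2" "\<And>p. residues3 p x = residues3 p y \<Longrightarrow> int p dvd u" by blast
      show ?thesis
      proof (rule card_prime_divisors)
        show "u \<noteq> 0" "\<bar>u\<bar> \<le> int N ^ 2" by (fact u)+
      qed (use A i N primes prime_big u(3) in auto)
    qed
    show "card {x \<in> S. label x = l} \<le> M" for l
    proof (cases "\<exists>s\<in>S. label s = l")
      case True
      then obtain s where "s \<in> S" "label s = l" by blast
      then have l: "prime_elem l" "deg2 l E" using factor label by blast+
      have "card {x \<in> S. label x = l} \<le> card {s \<in> S. eval2 l (fst (snd s)) (snd (snd s)) = 0}"
        using label fin by (intro card_mono) auto
      then show ?thesis using mass[OF l] by linarith
    next
      case False
      then have "{x \<in> S. label x = l} = {}" by blast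
      then show ?thesis by (simp only: card.empty)
    qed
    show "card {y \<in> S. (\<forall>i<n. good (T i) y \<and> good (T' i) y \<and> residues3 (T i) y = residues3 (T i) x \<and> residues3 (T' i) y = residues3 (T' i) x)
        \<and> label y = l \<and> l \<in> H T y \<and> l \<notin> H T' y} \<le> Cb * d" (is "card ?X \<le> _")
      if T: "\<And>i. i < n \<Longrightarrow> T i = T0 i \<or> T i \<in> A i" and T': "\<And>i. i < n \<Longrightarrow> T' i = T0 i \<or> T' i \<in> A i" for T T' x l
    proof (cases "?X = {}")
      case True
      then show ?thesis by (simp only: card.empty)
    next
      case False
      then obtain y where y: "y \<in> ?X" by blast
      have HT: "H T y = H T x" "H T' y = H T' x" using y by (auto intro!: Hcong)
      have l: "prime_elem l" "deg2 l E" using factor[of l T y] y by auto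
      \<comment> \<open>\<open>l\<close> is a component of the curve of \<open>T\<close> but not of
        that of \<open>T'\<close>, so the points in question lie over the few intersections of
        \<open>l\<close> with the latter.\<close>
      have "l \<in> plane_factors (Rc T x)" "l \<notin> plane_factors (Rc T' x)" using y HT by (auto simp: H_def)
      then have nd: "\<not> l dvd Rc T' x" using Rc(1)[of T' x] by (auto simp: plane_factors_def in_prime_factors_iff)
      let ?Z = "{(a::int, b). eval2 l a b = 0 \<and> eval2 (Rc T' x) a b = 0}"
      have Z: "finite ?Z" "card ?Z \<le> Cb" using bezout[OF l Rc(2) nd] by auto
      have prx: "pr (Rc T' x) (G T' x)" using T' by (intro valid) (simp add: valid_def)
      show ?thesis
      proof (rule card_le_fibres[of ?X snd ?Z])
        show "finite ?X" using fin by simp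
        show "snd ` ?X \<subseteq> ?Z"
        proof
          fix v assume "v \<in> snd ` ?X"
          then obtain s where s: "s \<in> ?X" "v = snd s" by blast
          have "s \<in> G T' x" using s by (simp add: G_def)
          then have "eval2 (Rc T' x) (fst v) (snd v) = 0" using prx s(2) by (auto simp: pr_def case_prod_unfold)
          moreover have "eval2 l (fst v) (snd v) = 0" using label[of s] s by auto
          ultimately show "v \<in> ?Z" by (simp add: case_prod_unfold)
        qed
        show "finite ?Z" "card ?Z \<le> Cb" by (fact Z)+
        show "card {s \<in> ?X. snd s = v} \<le> d" for v
        proof -
          obtain a b where v: "v = (a, b)" by (cases v)
          have "card {s \<in> ?X. snd s = v} \<le> card {s \<in> S. snd s = (a, b)}" using fin v by (intro card_mono) auto
          then show ?thesis using vertical[of a b] by linarith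
        qed
      qed
    qed
  qed
  show ?thesis by (rule card_bound)
qed

lemma power_powr: "x > 0 \<Longrightarrow> (x powr u) ^ k = x powr (u * real k)" for x u :: real
  by (simp add: powr_realpow[symmetric] powr_powr)

text \<open>Bookkeeping of exponents. In the first term the joint classes contribute (n + 1)(n + 2)
  / n^2, which is at most 1 + 5/n. In the second term the ratio of \<open>M\<close> to
  \<open>z ^ n\<close> contributes at most 1 / (2n), and the classes contribute 1 + 2/n.\<close>

lemma tracked_estimate:
  fixes n N L z M d h k :: nat and Cm :: real
  assumes n: "n \<ge> 1" and N: "N \<ge> 1" and L: "real L \<le> real N powr (real (n + 2) / real (2 * n) / n)"
    and z: "real N powr (real (n + 1) / real (2 * n) / n) \<le> real z"
    and M: "real M \<le> Cm * real N powr (real (n + 2) / real (2 * n))" and Cm: "Cm \<ge> 0"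
  shows "2 * real (n * ((L ^ 2 * d) ^ (n + 1) * (h * k))) + 8 * (1 + real (M * (2 * n * 2) ^ n) / real (z ^ n)) * real ((L ^ 2 * d) ^ n * h)
    \<le> (real (2 * n * d ^ (n + 1) * (h * k)) + 8 * (1 + Cm * real ((2 * n * 2) ^ n)) * real (d ^ n * h)) * real N powr (1 + 5 / n)"
proof -
  define X where "X = real N"
  define \<gamma> where "\<gamma> = 1 + 5 / real n"
  have X: "X \<ge> 1" "X > 0" using N by (auto simp: X_def)
  have rn: "real n \<ge> 1" using n by simp
  have Lpow: "real L ^ (2 * j) \<le> X powr (real (n + 2) / real (2 * n) / n * real (2 * j))" for j
  proof -
    have "real L ^ (2 * j) \<le> (X powr (real (n + 2) / real (2 * n) / n)) ^ (2 * j)" using L by (intro power_mono) (auto simp: X_def)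
    then show ?thesis by (simp only: power_powr[OF X(2)])
  qed
  have L1: "real L ^ (2 * (n + 1)) \<le> X powr \<gamma>"
  proof -
    have "real (n + 2) / real (2 * n) / n * real (2 * (n + 1)) = (real n ^ 2 + 3 * real n + 2) / real n ^ 2"
      using rn by (simp add: field_simps power2_eq_square)
    also have "\<dots> \<le> (real n ^ 2 + 5 * real n) / real n ^ 2" using rn by (intro divide_right_mono) auto
    also have "\<dots> = \<gamma>" using rn by (simp add: \<gamma>_def field_simps power2_eq_square)
    finally show ?thesis using Lpow[of "n + 1"] powr_mono[OF _ X(1)] by (meson order_trans)
  qed
  have L2: "real L ^ (2 * n) \<le> X powr (1 + 2 / n)"
  proof -
    have "real (n + 2) / real (2 * n) / n * real (2 * n) = 1 + 2 / n" using rn by (simp add: field_simps)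
    then show ?thesis using Lpow[of n] by (simp only:)
  qed
  have zpow: "X powr (real (n + 1) / real (2 * n)) \<le> real (z ^ n)"
  proof -
    have "X powr (real (n + 1) / real (2 * n)) = (X powr (real (n + 1) / real (2 * n) / n)) ^ n"
      using rn by (simp add: power_powr[OF X(2)])
    also have "\<dots> \<le> real z ^ n" using z by (intro power_mono) (auto simp: X_def)
    finally show ?thesis by simp
  qed
  have ratio: "real (M * (2 * n * 2) ^ n) / real (z ^ n) \<le> Cm * real ((2 * n * 2) ^ n) * X powr (1 / (2 * real n))"
  proof -
    have "real (M * (2 * n * 2) ^ n) / real (z ^ n) \<le>
      (Cm * X powr (real (n + 2) / real (2 * n)) * real ((2 * n * 2) ^ n)) / X powr (real (n + 1) / real (2 * n))"
      using M zpow X Cm unfolding of_nat_mult X_def by (intro frac_le mult_mono) (auto simp flip: X_def)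
    also have "\<dots> = Cm * real ((2 * n * 2) ^ n) * (X powr (real (n + 2) / real (2 * n)) / X powr (real (n + 1) / real (2 * n)))" by simp
    also have "X powr (real (n + 2) / real (2 * n)) / X powr (real (n + 1) / real (2 * n)) = X powr (1 / (2 * real n))"
      by (simp add: powr_diff[symmetric] diff_divide_distrib[symmetric])
    finally show ?thesis .
  qed
  have one: "1 \<le> X powr (1 / (2 * real n))" using X by (intro ge_one_powr_ge_zero) auto
  have "1 + real (M * (2 * n * 2) ^ n) / real (z ^ n) \<le> X powr (1 / (2 * real n)) + Cm * real ((2 * n * 2) ^ n) * X powr (1 / (2 * real n))"
    using one ratio by linarith
  also have "\<dots> = (1 + Cm * real ((2 * n * 2) ^ n)) * X powr (1 / (2 * real n))" by (simp add: algebra_simps)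
  finally have sum: "1 + real (M * (2 * n * 2) ^ n) / real (z ^ n) \<le> (1 + Cm * real ((2 * n * 2) ^ n)) * X powr (1 / (2 * real n))" .
  have prod: "X powr (1 / (2 * real n)) * real L ^ (2 * n) \<le> X powr \<gamma>"
  proof -
    have "X powr (1 / (2 * real n)) * real L ^ (2 * n) \<le> X powr (1 / (2 * real n)) * X powr (1 + 2 / n)"
      using L2 by (intro mult_left_mono) auto
    also have "\<dots> = X powr (1 / (2 * real n) + (1 + 2 / n))" by (simp only: powr_add)
    also have "\<dots> \<le> X powr \<gamma>" using X(1) rn by (intro powr_mono) (auto simp: \<gamma>_def field_simps)
    finally show ?thesis .
  qed
  have "2 * real (n * ((L ^ 2 * d) ^ (n + 1) * (h * k))) = real (2 * n * d ^ (n + 1) * (h * k)) * real L ^ (2 * (n + 1))"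
    by (simp only: power_mult_distrib of_nat_mult of_nat_power power_mult[symmetric] of_nat_numeral ac_simps)
  also have "\<dots> \<le> real (2 * n * d ^ (n + 1) * (h * k)) * X powr \<gamma>" using L1 by (intro mult_left_mono) auto
  finally have t1: "2 * real (n * ((L ^ 2 * d) ^ (n + 1) * (h * k))) \<le> real (2 * n * d ^ (n + 1) * (h * k)) * X powr \<gamma>" .
  have Ld: "real ((L ^ 2 * d) ^ n * h) = real L ^ (2 * n) * real (d ^ n * h)"
    by (simp only: power_mult_distrib of_nat_mult of_nat_power power_mult[symmetric] ac_simps)
  have "(1 + real (M * (2 * n * 2) ^ n) / real (z ^ n)) * real ((L ^ 2 * d) ^ n * h) \<le>
    ((1 + Cm * real ((2 * n * 2) ^ n)) * X powr (1 / (2 * real n))) * (real L ^ (2 * n) * real (d ^ n * h))"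
    unfolding Ld using sum by (intro mult_right_mono) auto
  also have "\<dots> = ((1 + Cm * real ((2 * n * 2) ^ n)) * real (d ^ n * h)) * (X powr (1 / (2 * real n)) * real L ^ (2 * n))"
    by (simp only: ac_simps)
  also have "\<dots> \<le> ((1 + Cm * real ((2 * n * 2) ^ n)) * real (d ^ n * h)) * X powr \<gamma>"
    using prod Cm by (intro mult_left_mono mult_nonneg_nonneg add_nonneg_nonneg) auto
  finally have t2: "(1 + real (M * (2 * n * 2) ^ n) / real (z ^ n)) * real ((L ^ 2 * d) ^ n * h) \<le>
    ((1 + Cm * real ((2 * n * 2) ^ n)) * real (d ^ n * h)) * X powr \<gamma>" .
  define u v where "u = (1 + real (M * (2 * n * 2) ^ n) / real (z ^ n)) * real ((L ^ 2 * d) ^ n * h)"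
    and "v = (1 + Cm * real ((2 * n * 2) ^ n)) * real (d ^ n * h)"
  have "8 * (1 + real (M * (2 * n * 2) ^ n) / real (z ^ n)) * real ((L ^ 2 * d) ^ n * h) = 8 * u" by (simp only: u_def mult.assoc)
  moreover have "8 * (1 + Cm * real ((2 * n * 2) ^ n)) * real (d ^ n * h) = 8 * v" by (simp only: v_def mult.assoc)
  ultimately show ?thesis using t1 t2[folded u_def v_def] unfolding \<gamma>_def X_def by (simp only: distrib_right mult.assoc)
qed

text \<open>An enumeration of \<open>P\<close> is cut into \<open>n\<close> blocks of length
  \<open>z\<close>, from which the new primes are drawn, followed by \<open>K\<close> base tuples of
  length \<open>n\<close>.\<close>

lemma disjoint_blocks:
  fixes P :: "'a set" and n z K :: nat
  assumes P: "finite P" "n * z + K * n \<le> card P"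
  obtains A T where "\<And>i. i < n \<Longrightarrow> finite (A i) \<and> card (A i) = z \<and> A i \<subseteq> P" "\<And>j i. j < K \<Longrightarrow> i < n \<Longrightarrow> T j i \<in> P"
    "\<And>j i i' p. j < K \<Longrightarrow> i < n \<Longrightarrow> i' < n \<Longrightarrow> p = T j i \<or> p \<in> A i \<Longrightarrow> p = T j i' \<or> p \<in> A i' \<Longrightarrow> i = i'"
    "\<And>j j' i i'. j < K \<Longrightarrow> j' < K \<Longrightarrow> i < n \<Longrightarrow> i' < n \<Longrightarrow> T j i = T j' i' \<Longrightarrow> j = j'"
proof -
  obtain e where e: "bij_betw e {0..<card P} P" using ex_bij_betw_nat_finite[OF P(1)] by blast
  define A where "A i = e ` {i * z..<i * z + z}" for i
  define T where "T j i = e (n * z + j * n + i)" for j i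
  have b1: "i * z + z \<le> n * z" if "i < n" for i using mult_le_mono1[of "Suc i" n z] that by simp
  have b2: "j * n + i < K * n" if "j < K" "i < n" for j i using mult_le_mono1[of "Suc j" K n] that by simp
  have inj: "inj_on e {0..<card P}" and img: "e ` {0..<card P} = P" using e by (auto simp: bij_betw_def)
  have sub: "{i * z..<i * z + z} \<subseteq> {0..<card P}" if "i < n" for i using b1[OF that] P(2) by auto
  have mem: "n * z + j * n + i \<in> {0..<card P}" if "j < K" "i < n" for j i using b2[OF that] P(2) by auto
  show ?thesis
  proof (rule that[of A T])
    show "finite (A i) \<and> card (A i) = z \<and> A i \<subseteq> P" if "i < n" for i
      using sub[OF that] card_image[OF inj_on_subset[OF inj sub[OF that]]] img by (auto simp: A_def)
    show "T j i \<in> P" if "j < K" "i < n" for j i using mem[OF that] img by (auto simp: T_def)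
    show "i = i'" if j: "j < K" and i: "i < n" "i' < n" and p: "p = T j i \<or> p \<in> A i" "p = T j i' \<or> p \<in> A i'" for j i i' p
    proof -
      define I where "I i = insert (n * z + j * n + i) {i * z..<i * z + z}" for i
      have I: "I i \<subseteq> {0..<card P}" if "i < n" for i unfolding I_def using mem[OF j that] sub[OF that] by blast
      have "p \<in> e ` I i" "p \<in> e ` I i'" using p by (auto simp: I_def T_def A_def)
      then obtain u u' where u: "u \<in> I i" "u' \<in> I i'" "p = e u" "p = e u'" by blast
      then have "u = u'" using inj_onD[OF inj, of u u'] I[OF i(1)] I[OF i(2)] by blast
      have dv: "v div z = l" if "l * z \<le> v" "v < l * z + z" for v l
        using that by (intro div_nat_eqI) (auto simp: algebra_simps)
      have "u \<ge> n * z \<or> u < n * z \<and> u div z = i"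
        using u(1) b1[OF i(1)] dv[of i u] by (auto simp: I_def)
      moreover have "u \<ge> n * z \<or> u < n * z \<and> u div z = i'"
        using u(2) \<open>u = u'\<close> b1[OF i(2)] dv[of i' u] by (auto simp: I_def)
      moreover have "u = n * z + j * n + i" if "u \<ge> n * z" using u(1) that b1[OF i(1)] by (auto simp: I_def)
      moreover have "u = n * z + j * n + i'" if "u \<ge> n * z" using u(2) \<open>u = u'\<close> that b1[OF i(2)] by (auto simp: I_def)
      ultimately show ?thesis by linarith
    qed
    show "j = j'" if j: "j < K" "j' < K" and i: "i < n" "i' < n" and eq: "T j i = T j' i'" for j j' i i'
    proof -
      have "j * n + i = j' * n + i'" using inj_onD[OF inj eq[unfolded T_def]] mem j i by simp
      moreover have "(j * n + i) div n = j" "(j' * n + i') div n = j'" using i by auto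
      ultimately show ?thesis by simp
    qed
  qed
qed

lemma card_box3: "card (free_points f N) \<le> (2 * N + 1) ^ 3"
proof -
  have "card (free_points f N) \<le> card ({-int N..int N} \<times> {-int N..int N} \<times> {-int N..int N})"
    by (intro card_mono) (auto simp: free_points_def)
  moreover have "card {-int N..int N} = 2 * N + 1" by (subst card_atLeastAtMost_int) arith
  ultimately show ?thesis by (simp only: card_cartesian_product power3_eq_cube mult.assoc)
qed

lemma not_dvd_pderiv:
  fixes f :: "int poly poly poly"
  assumes "degree f > 0"
  shows "\<not> f dvd pderiv f"
proof
  assume dvd: "f dvd pderiv f"
  have "coeff (pderiv f) (degree f - 1) = of_nat (degree f) * lead_coeff f"
    using assms by (simp add: coeff_pderiv)
  moreover have "of_nat (degree f) * lead_coeff f \<noteq> 0" using assms by auto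
  ultimately have "pderiv f \<noteq> 0" by (metis coeff_0)
  then have "degree f \<le> degree (pderiv f)" using dvd by (intro dvd_imp_degree_le)
  moreover have "degree (pderiv f) \<le> degree f - 1" by (intro degree_le) (auto simp: coeff_pderiv coeff_eq_0)
  ultimately show False using assms by linarith
qed

text \<open>A single base tuple need not be good at all points. With more disjoint base tuples than
  there are primes dividing a derivative value, each point with nonzero derivative has one that is
  good for it, and the label argument is applied to each base tuple separately. Where the derivative
  vanishes, it serves as the second surface.\<close>

theorem free_points_bound:
  fixes n d :: nat
  assumes n: "n \<ge> 1" and d: "d \<ge> 4"
  shows "\<exists>C\<ge>0. \<forall>f N. prime_elem f \<longrightarrow> deg3 f d \<longrightarrow> (\<exists>i j k. i + j + k = d \<and> coeff3 f i j k \<noteq> 0) \<longrightarrow> N \<ge> 1 \<longrightarrow>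
    real (card (free_points f N)) \<le> C * real N powr (1 + 5 / n)"
proof -
  define \<beta> where "\<beta> = real (n + 2) / real (2 * n)"
  define \<gamma> where "\<gamma> = 1 + 5 / real n"
  define a where "a = real (n + 1) / real (2 * n) / n"
  define b where "b = real (n + 2) / real (2 * n) / n"
  have rn: "real n \<ge> 1" using n by simp
  have ab: "0 < a" "a < b" using rn by (auto simp: a_def b_def divide_strict_right_mono)
  have \<beta>\<gamma>: "\<beta> \<le> \<gamma>" "\<gamma> > 0" using rn by (auto simp: \<beta>_def \<gamma>_def field_simps)
  obtain N1 E where curve: "\<forall>N q f S. N \<ge> N1 \<longrightarrow> N ^ (n + 1) \<le> q ^ (2 * n) \<longrightarrow> q ^ (2 * n) \<le> N ^ (n + 2) \<longrightarrow>
    prime_elem f \<longrightarrow> degree f > 0 \<longrightarrow> deg3 f d \<longrightarrow> (\<exists>i j k. i + j + k = d \<and> coeff3 f i j k \<noteq> 0) \<longrightarrow>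
    (\<forall>(x, y, z)\<in>S. \<bar>x\<bar> \<le> int N \<and> \<bar>y\<bar> \<le> int N \<and> \<bar>z\<bar> \<le> int N \<and> eval3 f x y z = 0
      \<and> coprime (eval3 (pderiv f) x y z) (int q)) \<longrightarrow>
    (\<forall>s\<in>S. \<forall>s'\<in>S. residues3 q s = residues3 q s') \<longrightarrow>
    (\<exists>R. R \<noteq> 0 \<and> deg2 R E \<and> (\<forall>(x, y, z)\<in>S. eval2 R y z = 0))"
    using projected_class_curve[OF n d] by blast
  obtain Cg where Cg: "Cg \<ge> 0" "\<And>f g N. prime_elem f \<Longrightarrow> degree f > 0 \<Longrightarrow> deg3 f d \<Longrightarrow> deg3 g d \<Longrightarrow> \<not> f dvd g \<Longrightarrow> N \<ge> 1 \<Longrightarrow>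
    real (card {(x, y, z) \<in> free_points f N. eval3 g x y z = 0}) \<le> Cg * real N powr \<beta>"
    using free_points_on_second_surface[OF n, of d d] unfolding \<beta>_def by blast
  obtain Cm where Cm: "Cm \<ge> 0" "\<And>f h N. deg3 f d \<Longrightarrow> prime_elem h \<Longrightarrow> deg2 h E \<Longrightarrow> N \<ge> 1 \<Longrightarrow>
    real (card {s \<in> free_points f N. eval2 h (fst (snd s)) (snd (snd s)) = 0}) \<le> Cm * real N powr \<beta>"
    using free_points_over_plane_curve[OF n, of d E] unfolding \<beta>_def by blast
  obtain Cb where Cb: "\<And>h R. prime_elem h \<Longrightarrow> deg2 h E \<Longrightarrow> deg2 R E \<Longrightarrow> \<not> h dvd R \<Longrightarrow>
     finite {(a::int, b). eval2 h a b = 0 \<and> eval2 R a b = 0} \<and> card {(a, b). eval2 h a b = 0 \<and> eval2 R a b = 0} \<le> Cb"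
    using plane_bezout[of E E] by blast
  define dich where "dich c \<longleftrightarrow> (\<forall>f N S. N \<ge> 2 \<longrightarrow> (\<forall>i j k. coeff3 f i j k \<noteq> 0 \<longrightarrow> (i, j, k) \<in> triples d) \<longrightarrow>
    (\<exists>i j k. i + j + k = d \<and> coeff3 f i j k \<noteq> 0) \<longrightarrow>
    (\<forall>(x, y, z)\<in>S. \<bar>x\<bar> \<le> int N \<and> \<bar>y\<bar> \<le> int N \<and> \<bar>z\<bar> \<le> int N \<and> eval3 f x y z = 0) \<longrightarrow>
    (\<exists>g. g \<noteq> 0 \<and> (\<forall>i j k. coeff3 g i j k \<noteq> 0 \<longrightarrow> (i, j, k) \<in> triples d) \<and> \<not> f dvd g \<and> (\<forall>(x, y, z)\<in>S. eval3 g x y z = 0)) \<or>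
    (\<forall>i j k. \<bar>coeff3 f i j k\<bar> \<le> int N ^ c))" for c
  have "\<exists>c. dich c" unfolding dich_def by (rule height_dichotomy) auto
  then obtain c where "dich c" by blast
  note c = this[unfolded dich_def]
  define e where "e = c + d + 1"
  \<comment> \<open>A bound for the number of primes \<open>p\<close> with
    \<open>N \<le> p ^ (2 * n)\<close> that divide a nonzero derivative value.\<close>
  define r where "r = 2 * n * e"
  define K where "K = r + 1"
  \<comment> \<open>Room for \<open>n\<close> blocks of \<open>z\<close> primes and
    \<open>K * n\<close> base primes, in units of N^a.\<close>
  define m where "m = 2 * n * (4 * n * r + 1) + K * n"
  obtain N2 where N2: "\<And>N::nat. N \<ge> N2 \<Longrightarrow>
    real m * real N powr a \<le> card {p::nat. prime p \<and> real N powr a \<le> p \<and> p \<le> real N powr b}"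
    using primes_between[OF ab, of m] by blast
  define N0 where "N0 = N1 + N2 + 2 + card (triples d) * (d + 1)"
  define h where "h = (E + 1) * (E + 1) ^ 2"
  define CT where "CT = real (2 * n * d ^ (n + 1) * (h * (Cb * d))) + 8 * (1 + Cm * real ((2 * n * 2) ^ n)) * real (d ^ n * h)"
  define C where "C = real ((2 * N0 + 1) ^ 3) + Cg + real K * CT"
  have CT: "CT \<ge> 0" unfolding CT_def using Cm(1) by (intro add_nonneg_nonneg mult_nonneg_nonneg) auto
  have C: "C \<ge> real ((2 * N0 + 1) ^ 3)" "C \<ge> Cg" "C \<ge> Cg + real K * CT" "C \<ge> 0"
    unfolding C_def using CT Cg(1) by (auto intro!: add_nonneg_nonneg)
  have main: "real (card (free_points f N)) \<le> C * real N powr \<gamma>"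
    if f: "prime_elem f" "deg3 f d" "\<exists>i j k. i + j + k = d \<and> coeff3 f i j k \<noteq> 0" and N: "N \<ge> 1" for f N
  proof (cases "degree f = 0 \<or> N < N0")
    case True
    have "card (free_points f N) \<le> (2 * N0 + 1) ^ 3"
    proof (cases "degree f = 0")
      case True
      then show ?thesis by (simp add: free_points_of_cylinder)
    next
      case False
      then have "(2 * N + 1) ^ 3 \<le> (2 * N0 + 1) ^ 3" using True by (intro power_mono) auto
      then show ?thesis using card_box3[of f N] by linarith
    qed
    then have "real (card (free_points f N)) \<le> real ((2 * N0 + 1) ^ 3)" by (simp only: of_nat_le_iff)
    also have "\<dots> \<le> C" by (fact C(1))
    also have "\<dots> \<le> C * real N powr \<gamma>" using mult_left_mono[OF ge_one_powr_ge_zero[of "real N" \<gamma>] C(4)] N \<beta>\<gamma> by simp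
    finally show ?thesis .
  next
    case False
    then have deg: "degree f > 0" and N': "N \<ge> N1" "N \<ge> N2" "N \<ge> 2" "N \<ge> card (triples d) * (d + 1)" by (simp_all add: N0_def)
    define FP where "FP = free_points f N"
    have FP: "\<bar>x\<bar> \<le> int N" "\<bar>y\<bar> \<le> int N" "\<bar>z\<bar> \<le> int N" "eval3 f x y z = 0" if "(x, y, z) \<in> FP" for x y z
      using that by (auto simp: FP_def free_points_def)
    have finFP: "finite FP" by (simp add: FP_def finite_free_points)
    have mono: "Cg * real N powr \<beta> \<le> Cg * real N powr \<gamma>" using \<beta>\<gamma> N Cg(1) by (intro mult_left_mono powr_mono) auto
    have supp: "\<forall>i j k. coeff3 f i j k \<noteq> 0 \<longrightarrow> (i, j, k) \<in> triples d" using f(2) by (simp add: deg3_iff triples_def)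
    have boxFP: "\<forall>(x, y, z)\<in>FP. \<bar>x\<bar> \<le> int N \<and> \<bar>y\<bar> \<le> int N \<and> \<bar>z\<bar> \<le> int N \<and> eval3 f x y z = 0" using FP by blast
    have second: "real (card {(x, y, z) \<in> FP. eval3 g x y z = 0}) \<le> Cg * real N powr \<gamma>" if "deg3 g d" "\<not> f dvd g" for g
      using Cg(2)[OF f(1) deg f(2) that N] mono by (simp add: FP_def)
    from c[rule_format, OF N'(3) supp[rule_format] f(3) boxFP[rule_format]]
    consider g where "\<forall>i j k. coeff3 g i j k \<noteq> 0 \<longrightarrow> (i, j, k) \<in> triples d" "\<not> f dvd g" "\<forall>(x, y, z)\<in>FP. eval3 g x y z = 0"
      | "\<forall>i j k. \<bar>coeff3 f i j k\<bar> \<le> int N ^ c" by blast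
    then show ?thesis
    proof cases
      case (1 g)
      have "deg3 g d" using 1(1) by (simp add: deg3_iff triples_def)
      moreover have "{(x, y, z) \<in> FP. eval3 g x y z = 0} = FP" using 1(3) by auto
      ultimately have "real (card FP) \<le> Cg * real N powr \<gamma>" using second[of g] 1(2) by simp
      also have "\<dots> \<le> C * real N powr \<gamma>" using C(2) by (intro mult_right_mono) auto
      finally show ?thesis by (simp add: FP_def)
    next
      case 2
      define F1 where "F1 s = eval3 (pderiv f) (fst s) (fst (snd s)) (snd (snd s))" for s
      have F1_bound: "\<bar>F1 s\<bar> \<le> int N ^ e" if "s \<in> FP" for s
        unfolding F1_def e_def using 2 FP[of "fst s" "fst (snd s)" "snd (snd s)"] that
        by (intro derivative_bound3 f(2) N'(4) N) auto
      have degpd: "deg3 (pderiv f) d" unfolding deg3_iff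
      proof (intro allI impI)
        fix i j k assume "coeff3 (pderiv f) i j k \<noteq> 0"
        then have "coeff3 f (Suc i) j k \<noteq> 0"
          by (auto simp: coeff3_def coeff_pderiv coeff_of_nat_mult simp del: of_nat_Suc)
        then have "Suc i + j + k \<le> d" using f(2) unfolding deg3_iff by blast
        then show "i + j + k \<le> d" by simp
      qed
      define P where "P = {p::nat. prime p \<and> real N powr a \<le> p \<and> p \<le> real N powr b}"
      define L where "L = nat \<lfloor>real N powr b\<rfloor>"
      have PL: "p \<le> L" if "p \<in> P" for p using that by (auto simp: P_def L_def le_nat_floor)
      then have finP: "finite P" by (meson finite_nat_set_iff_bounded_le)
      have L: "real L \<le> real N powr b" by (simp add: L_def)
      define Y where "Y = nat \<lceil>real N powr a\<rceil>"
      have Na: "real N powr a \<ge> 1" using N ab by (intro ge_one_powr_ge_zero) auto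
      have Y: "real N powr a \<le> real Y" "real Y \<le> 2 * real N powr a" "Y \<ge> 1" using Na unfolding Y_def by linarith+
      \<comment> \<open>At least \<open>4 * n * r\<close>, for the union bound over bad primes, and
        at least N^a, so that there are at least N^((n + 1) / (2n)) tuples.\<close>
      define z where "z = (4 * n * r + 1) * Y"
      have "4 * n * r + 1 \<le> z" "Y \<le> z"
        using mult_le_mono2[OF Y(3), of "4 * n * r + 1"] mult_le_mono1[of 1 "4 * n * r + 1" Y] by (simp_all add: z_def)
      then have z: "z \<ge> 4 * n * (2 * n * e)" "z \<ge> 1" "Y \<le> z" unfolding r_def[symmetric] by linarith+
      have "real (n * z + K * n) = real (n * (4 * n * r + 1)) * real Y + real (K * n)" by (simp add: z_def algebra_simps)
      also have "\<dots> \<le> real (n * (4 * n * r + 1)) * (2 * real N powr a) + real (K * n) * real N powr a"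
        using Y(2) mult_left_mono[OF Na, of "real (K * n)"] by (intro add_mono mult_left_mono) auto
      also have "\<dots> = real m * real N powr a" by (simp add: m_def algebra_simps)
      also have "\<dots> \<le> real (card P)" unfolding P_def using N2[OF N'(2)] by simp
      finally have "n * z + K * n \<le> card P" by (simp only: of_nat_le_iff)
      then obtain A T where AT: "\<And>i. i < n \<Longrightarrow> finite (A i) \<and> card (A i) = z \<and> A i \<subseteq> P" "\<And>j i. j < K \<Longrightarrow> i < n \<Longrightarrow> T j i \<in> P"
        "\<And>j i i' p. j < K \<Longrightarrow> i < n \<Longrightarrow> i' < n \<Longrightarrow> p = T j i \<or> p \<in> A i \<Longrightarrow> p = T j i' \<or> p \<in> A i' \<Longrightarrow> i = i'"
        "\<And>j j' i i'. j < K \<Longrightarrow> j' < K \<Longrightarrow> i < n \<Longrightarrow> i' < n \<Longrightarrow> T j i = T j' i' \<Longrightarrow> j = j'"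
      proof (rule disjoint_blocks[OF finP], goal_cases)
        case (1 A T)
        show ?case by (rule 1(1), rule 1(2), assumption, rule 1(3), assumption+, rule 1(4), assumption+, rule 1(5), assumption+)
      qed
      define Z0 where "Z0 = {s \<in> FP. F1 s = 0}"
      define S where "S j = {s \<in> FP. F1 s \<noteq> 0 \<and> (\<forall>i<n. \<not> int (T j i) dvd F1 s)}" for j
      have big: "N \<le> p ^ (2 * n)" if "p \<in> P" for p
      proof -
        have "a * real (2 * n) = (real n + 1) / n" using rn by (simp add: a_def field_simps)
        then have "real N powr ((real n + 1) / n) = (real N powr a) ^ (2 * n)" using N by (simp only: power_powr)
        also have "\<dots> \<le> real p ^ (2 * n)" using that by (intro power_mono) (auto simp: P_def)
        finally have *: "real N powr ((real n + 1) / n) \<le> real (p ^ (2 * n))" by simp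
        have "real N = real N powr 1" using N by simp
        also have "\<dots> \<le> real N powr ((real n + 1) / n)" using n N by (intro powr_mono) (auto simp: field_simps)
        also note *
        finally show ?thesis by (simp only: of_nat_le_iff)
      qed
      \<comment> \<open>A point outside \<open>Z0\<close> and all \<open>S j\<close> would have a
        bad prime in each of the \<open>K\<close> base tuples. These are distinct divisors of its
        derivative value, one too many.\<close>
      have cover: "FP \<subseteq> Z0 \<union> (\<Union>j<K. S j)"
      proof
        fix s assume s: "s \<in> FP"
        show "s \<in> Z0 \<union> (\<Union>j<K. S j)"
        proof (rule ccontr)
          assume no: "\<not> ?thesis"
          then have F10: "F1 s \<noteq> 0" using s by (auto simp: Z0_def)
          have "\<exists>i<n. int (T j i) dvd F1 s" if "j < K" for j using no that s F10 by (auto simp: S_def)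
          then obtain i where i: "\<And>j. j < K \<Longrightarrow> i j < n \<and> int (T j (i j)) dvd F1 s" by metis
          have "inj_on (\<lambda>j. T j (i j)) {..<K}"
          proof (rule inj_onI)
            fix j j' assume j: "j \<in> {..<K}" "j' \<in> {..<K}" "T j (i j) = T j' (i j')"
            then show "j = j'" using AT(4)[of j j' "i j" "i j'"] i[of j] i[of j'] by simp
          qed
          then have "K = card ((\<lambda>j. T j (i j)) ` {..<K})" by (simp add: card_image)
          also have "\<dots> \<le> card {p \<in> P. int p dvd F1 s}" using i AT(2) finP by (intro card_mono) auto
          also have "\<dots> \<le> 2 * n * e"
          proof (rule card_prime_divisors)
            show "F1 s \<noteq> 0" "\<bar>F1 s\<bar> \<le> int N ^ e" "N \<ge> 2" using F10 F1_bound[OF s] N' by auto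
            show "finite {p \<in> P. int p dvd F1 s}" using finP by simp
            show "prime p \<and> int p dvd F1 s \<and> N \<le> p ^ (2 * n)" if "p \<in> {p \<in> P. int p dvd F1 s}" for p
              using that big[of p] by (simp add: P_def)
          qed
          finally show False by (simp add: K_def r_def)
        qed
      qed
      \<comment> \<open>The number of points with a given label: free points over a single plane
        curve.\<close>
      define M where "M = nat \<lfloor>Cm * real N powr \<beta>\<rfloor>"
      have M: "real M \<le> Cm * real N powr \<beta>" using Cm(1) by (simp add: M_def)
      have cardS: "real (card (S j)) \<le> CT * real N powr \<gamma>" if j: "j < K" for j
      proof -
        have sub: "S j \<subseteq> FP" by (auto simp: S_def)
        have "real (card (S j)) \<le> 2 * real (n * ((L ^ 2 * d) ^ (n + 1) * ((E + 1) * (E + 1) ^ 2 * (Cb * d)))) +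
          8 * (1 + real (M * (2 * n * 2) ^ n) / real (z ^ n)) * real ((L ^ 2 * d) ^ n * ((E + 1) * (E + 1) ^ 2))"
        proof (rule tracked_points_bound[where N = N and ?F1.0 = F1 and e = e and ?T0.0 = "T j" and A = A])
          show "n \<ge> 1" "N \<ge> 2" "finite (S j)" using n N' finite_subset[OF sub finFP] by auto
          show "\<bar>x\<bar> \<le> int N \<and> \<bar>y\<bar> \<le> int N \<and> \<bar>z\<bar> \<le> int N" if "(x, y, z) \<in> S j" for x y z
            using FP sub that by blast
          show "F1 s \<noteq> 0 \<and> \<bar>F1 s\<bar> \<le> int N ^ e" if "s \<in> S j" for s using that F1_bound by (auto simp: S_def)
          show "\<exists>R. R \<noteq> 0 \<and> deg2 R E \<and> (\<forall>(x, y, z)\<in>G. eval2 R y z = 0)"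
            if q: "N ^ (n + 1) \<le> q ^ (2 * n)" "q ^ (2 * n) \<le> N ^ (n + 2)" and G: "G \<subseteq> S j"
              "\<And>s. s \<in> G \<Longrightarrow> coprime (F1 s) (int q)" "\<And>s s'. s \<in> G \<Longrightarrow> s' \<in> G \<Longrightarrow> residues3 q s = residues3 q s'" for q G
          proof -
            have "\<forall>(x, y, z)\<in>G. \<bar>x\<bar> \<le> int N \<and> \<bar>y\<bar> \<le> int N \<and> \<bar>z\<bar> \<le> int N \<and> eval3 f x y z = 0
              \<and> coprime (eval3 (pderiv f) x y z) (int q)"
              using boxFP sub G(1) G(2)[unfolded F1_def] by fastforce
            moreover have "\<forall>s\<in>G. \<forall>s'\<in>G. residues3 q s = residues3 q s'" using G(3) by blast
            ultimately show ?thesis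
              using curve[THEN spec, THEN spec, THEN spec, THEN spec, THEN mp, OF N'(1), THEN mp, OF q(1), THEN mp, OF q(2),
                THEN mp, OF f(1), THEN mp, OF deg, THEN mp, OF f(2), THEN mp, OF f(3)] by blast
          qed
          show "card (residues3 p ` {s \<in> S j. \<not> int p dvd F1 s}) \<le> p ^ 2 * d" if p: "prime p" for p
          proof -
            have "int p dvd eval3 f x y z \<and> \<not> int p dvd eval3 (pderiv f) x y z"
              if "(x, y, z) \<in> {s \<in> S j. \<not> int p dvd F1 s}" for x y z
              using that sub FP(4)[of x y z] by (auto simp: F1_def)
            from card_simple_zeros3_mod_prime[OF p f(2) this] show ?thesis by blast
          qed
          show "card {s \<in> S j. snd s = (y, z)} \<le> d" for y z
          proof -
            have "card {s \<in> S j. snd s = (y, z)} \<le> card {s \<in> FP. snd s = (y, z)}"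
              using sub finFP by (intro card_mono) auto
            then show ?thesis using card_vertical_fibre[OF f(2), of N y z] by (simp add: FP_def)
          qed
          show "card {s \<in> S j. eval2 h (fst (snd s)) (snd (snd s)) = 0} \<le> M" if h: "prime_elem h" "deg2 h E" for h
          proof -
            have "card {s \<in> S j. eval2 h (fst (snd s)) (snd (snd s)) = 0} \<le> card {s \<in> FP. eval2 h (fst (snd s)) (snd (snd s)) = 0}"
              using sub finFP by (intro card_mono) auto
            then have "real (card {s \<in> S j. eval2 h (fst (snd s)) (snd (snd s)) = 0}) \<le> Cm * real N powr \<beta>"
              using Cm(2)[OF f(2) h N] unfolding FP_def by linarith
            then show ?thesis unfolding M_def by (rule le_nat_floor)
          qed
          show "finite {(a::int, b). eval2 h a b = 0 \<and> eval2 R a b = 0} \<and> card {(a, b). eval2 h a b = 0 \<and> eval2 R a b = 0} \<le> Cb"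
            if "prime_elem h" "deg2 h E" "deg2 R E" "\<not> h dvd R" for h R using that by (rule Cb)
          show "prime p \<and> real N powr (real (n + 1) / real (2 * n) / n) \<le> p \<and> p \<le> real N powr (real (n + 2) / real (2 * n) / n) \<and> p \<le> L"
            if i: "i < n" and p: "p = T j i \<or> p \<in> A i" for i p
          proof -
            have "p \<in> P" using AT(1)[OF i] AT(2)[OF j i] p by blast
            then show ?thesis using PL by (simp add: P_def a_def b_def)
          qed
          show "i = i'" if "i < n" "i' < n" "p = T j i \<or> p \<in> A i" "p = T j i' \<or> p \<in> A i'" for i i' p
            using j that by (rule AT(3))
          show "finite (A i)" "card (A i) = z" if "i < n" for i using AT(1)[OF that] by auto
          show "\<not> int (T j i) dvd F1 s" if "i < n" "s \<in> S j" for i s using that by (simp add: S_def)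
          show "z \<ge> 4 * n * (2 * n * e)" "z \<ge> 1" by (fact z)+
        qed
        also have "\<dots> \<le> CT * real N powr \<gamma>" unfolding h_def[symmetric] CT_def \<gamma>_def
        proof (rule tracked_estimate[OF n N])
          show "real L \<le> real N powr (real (n + 2) / real (2 * n) / n)" using L by (simp add: b_def)
          have "real Y \<le> real z" using z(3) by (simp only: of_nat_le_iff)
          then show "real N powr (real (n + 1) / real (2 * n) / n) \<le> real z" using Y(1) unfolding a_def by linarith
          show "real M \<le> Cm * real N powr (real (n + 2) / real (2 * n))" using M by (simp only: \<beta>_def)
        qed (fact Cm(1))
        finally show ?thesis .
      qed
      have "Z0 = {(x, y, z) \<in> FP. eval3 (pderiv f) x y z = 0}" by (auto simp: Z0_def F1_def)
      then have cardZ0: "real (card Z0) \<le> Cg * real N powr \<gamma>" using second[OF degpd not_dvd_pderiv[OF deg]] by simp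
      have finU: "finite (Z0 \<union> (\<Union>j<K. S j))" by (rule finite_subset[OF _ finFP]) (auto simp: Z0_def S_def)
      have "card FP \<le> card Z0 + card (\<Union>j<K. S j)"
        using card_mono[OF finU cover] card_Un_le[of Z0 "\<Union>j<K. S j"] by linarith
      also have "\<dots> \<le> card Z0 + (\<Sum>j<K. card (S j))" using card_UN_le[of "{..<K}" S] by simp
      finally have "real (card FP) \<le> real (card Z0 + (\<Sum>j<K. card (S j)))" by (simp only: of_nat_le_iff)
      also have "\<dots> = real (card Z0) + (\<Sum>j<K. real (card (S j)))" by simp
      also have "\<dots> \<le> Cg * real N powr \<gamma> + (\<Sum>j<K. CT * real N powr \<gamma>)"
        using cardZ0 cardS by (intro add_mono sum_mono) auto
      also have "\<dots> = (Cg + real K * CT) * real N powr \<gamma>" by (simp add: algebra_simps)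
      also have "\<dots> \<le> C * real N powr \<gamma>" using C(3) by (intro mult_right_mono) auto
      finally show ?thesis by (simp add: FP_def)
    qed
  qed
  show ?thesis using C(4) main unfolding \<gamma>_def by blast
qed

section \<open>From free points to all points: the lines of the surface\<close>

definition embed3 :: "int \<times> int \<times> int \<Rightarrow> complex \<times> complex \<times> complex" where
  "embed3 = (\<lambda>(x, y, z). (of_int x, of_int y, of_int z))"

text \<open>Along the line \<open>f\<close> is a polynomial in one variable with infinitely many
  integer zeros, so it vanishes at all complex parameters, in particular at the algebraic
  ones.\<close>

lemma integer_line_on_surface:
  assumes "on_integer_line f x y z"
  shows "\<exists>L\<in>lines_on_surface f. embed3 (x, y, z) \<in> L"
proof -
  obtain a b c where abc: "(a, b, c) \<noteq> (0, 0, 0)" "\<And>t. eval3 f (x + t * a) (y + t * b) (z + t * c) = 0"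
    using assms by (auto simp: on_integer_line_def)
  obtain d where d: "deg3 f d" using deg3_exists by blast
  define F :: "complex poly poly poly" where "F = map_poly3 of_int f"
  have cF: "coeff3 F i j k = of_int (coeff3 f i j k)" for i j k by (simp add: F_def coeff3_map_poly3)
  have degF: "deg3 F d" using d unfolding deg3_iff cF by simp
  define X Y Z A B C where "X = (of_int x :: complex)" and "Y = (of_int y :: complex)" and "Z = (of_int z :: complex)"
    and "A = (of_int a :: complex)" and "B = (of_int b :: complex)" and "C = (of_int c :: complex)"
  define g :: "complex poly" where "g = (\<Sum>(i, j, k)\<in>triples d. smult (coeff3 F i j k) ([:X, A:] ^ i * [:Y, B:] ^ j * [:Z, C:] ^ k))"
  have g: "poly g t = eval3 F (X + t * A) (Y + t * B) (Z + t * C)" for t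
    by (simp add: g_def eval3_sum[OF degF] poly_sum case_prod_unfold poly_power)
  have "poly g (of_int t) = of_int (eval3 f (x + t * a) (y + t * b) (z + t * c))" for t
    unfolding g eval3_sum[OF degF] eval3_sum[OF d] X_def Y_def Z_def A_def B_def C_def cF
    by (simp add: case_prod_unfold)
  then have "range of_int \<subseteq> {t. poly g t = 0}" using abc(2) by auto
  moreover have "infinite (range (of_int :: int \<Rightarrow> complex))" by (simp add: finite_image_iff inj_on_def infinite_UNIV_int)
  ultimately have "infinite {t. poly g t = 0}" using finite_subset by blast
  then have "g = 0" using poly_roots_finite by blast
  then have zero: "eval3 F (X + t * A) (Y + t * B) (Z + t * C) = 0" for t using g[of t] by simp
  define L where "L = {(X + t * A, Y + t * B, Z + t * C) | t. True}"
  have "L \<in> lines_on_surface f" unfolding lines_on_surface_def mem_Collect_eq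
  proof (rule exI[of _ X], rule exI[of _ Y], rule exI[of _ Z], rule exI[of _ A], rule exI[of _ B], rule exI[of _ C], intro conjI)
    show "(A, B, C) \<noteq> (0, 0, 0)" using abc(1) by (simp add: A_def B_def C_def)
    show "\<forall>t. algebraic t \<longrightarrow> eval3 (map_poly3 of_int f) (X + t * A) (Y + t * B) (Z + t * C) = 0"
      using zero by (simp add: F_def)
  qed (simp_all add: X_def Y_def Z_def A_def B_def C_def L_def)
  moreover have "embed3 (x, y, z) \<in> L"
    unfolding L_def embed3_def by (auto simp: X_def Y_def Z_def intro!: exI[of _ 0])
  ultimately show ?thesis by blast
qed

text \<open>A coordinate in which the direction is nonzero determines the point of the line, and it
  takes at most \<open>2 * N + 1\<close> integer values in the box.\<close>

lemma card_integer_points_on_line: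
  assumes "L \<in> lines_on_surface f"
  shows "card {(x, y, z). \<bar>x\<bar> \<le> int N \<and> \<bar>y\<bar> \<le> int N \<and> \<bar>z\<bar> \<le> int N \<and> embed3 (x, y, z) \<in> L} \<le> 2 * N + 1"
    (is "card ?S \<le> _")
proof -
  define pt where "pt a1 a2 a3 b1 b2 b3 t = (a1 + t * b1, a2 + t * b2, a3 + t * b3)" for a1 a2 a3 b1 b2 b3 t :: complex
  define Q where "Q a1 a2 a3 b1 b2 b3 \<longleftrightarrow> (b1, b2, b3) \<noteq> (0, 0, 0) \<and> L = range (pt a1 a2 a3 b1 b2 b3)" for a1 a2 a3 b1 b2 b3
  have "\<exists>a1 a2 a3 b1 b2 b3. Q a1 a2 a3 b1 b2 b3"
    using assms unfolding lines_on_surface_def mem_Collect_eq Q_def pt_def full_SetCompr_eq[symmetric]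
    by (elim exE conjE) (intro exI conjI, assumption, simp add: full_SetCompr_eq)
  then obtain a1 a2 a3 b1 b2 b3 where "Q a1 a2 a3 b1 b2 b3" by blast
  then have b: "(b1, b2, b3) \<noteq> (0, 0, 0)" and L: "L = range (pt a1 a2 a3 b1 b2 b3)" by (auto simp: Q_def)
  have bound: "card ?S \<le> 2 * N + 1" if b: "b \<noteq> 0" and pr: "pr ` ?S \<subseteq> {-int N..int N}"
      "\<And>s t. embed3 s = pt a1 a2 a3 b1 b2 b3 t \<Longrightarrow> of_int (pr s) = a + t * b" for pr a and b :: complex
  proof -
    have "inj_on pr ?S"
    proof (rule inj_onI)
      fix s s' assume s: "s \<in> ?S" "s' \<in> ?S" "pr s = pr s'"
      obtain t t' where t: "embed3 s = pt a1 a2 a3 b1 b2 b3 t" "embed3 s' = pt a1 a2 a3 b1 b2 b3 t'" using s L by auto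
      have "a + t * b = a + t' * b" unfolding pr(2)[OF t(1), symmetric] pr(2)[OF t(2), symmetric] s(3) ..
      then have "embed3 s = embed3 s'" using b t by simp
      then show "s = s'" by (cases s, cases s') (simp add: embed3_def)
    qed
    then have "card ?S = card (pr ` ?S)" by (simp add: card_image)
    also have "\<dots> \<le> card {-int N..int N}" using pr(1) by (intro card_mono) auto
    also have "card {-int N..int N} = 2 * N + 1" by (subst card_atLeastAtMost_int) arith
    finally show ?thesis .
  qed
  consider "b1 \<noteq> 0" | "b2 \<noteq> 0" | "b3 \<noteq> 0" using b by auto
  then show ?thesis
  proof cases
    case 1
    then show ?thesis by (rule bound[where pr = fst and a = a1]) (auto simp: embed3_def pt_def)
  next
    case 2
    then show ?thesis by (rule bound[where pr = "\<lambda>s. fst (snd s)" and a = a2]) (auto simp: embed3_def pt_def)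
  next
    case 3
    then show ?thesis by (rule bound[where pr = "\<lambda>s. snd (snd s)" and a = a3]) (auto simp: embed3_def pt_def)
  qed
qed

lemma total_degree3_exact:
  fixes f :: "int poly poly poly"
  assumes "total_degree3 f = d" "d > 0"
  shows "deg3 f d" "\<exists>i j k. i + j + k = d \<and> coeff3 f i j k \<noteq> 0"
proof -
  define D where "D = {i + j + k | i j k. coeff3 f i j k \<noteq> 0}"
  obtain m where "deg3 f m" using deg3_exists by blast
  then have fin: "finite (insert 0 D)" by (intro finite.insertI finite_subset[of D "{..m}"]) (auto simp: D_def deg3_iff)
  have d: "d = Max (insert 0 D)" using assms(1) by (simp add: total_degree3_def D_def)
  have "i + j + k \<le> d" if "coeff3 f i j k \<noteq> 0" for i j k
    unfolding d using that by (intro Max_ge[OF fin]) (auto simp: D_def)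
  then show "deg3 f d" by (simp add: deg3_iff)
  have "d \<in> insert 0 D" unfolding d by (intro Max_in[OF fin]) auto
  then show "\<exists>i j k. i + j + k = d \<and> coeff3 f i j k \<noteq> 0" using assms(2) by (auto simp: D_def)
qed

theorem theorem6p4:
  fixes d :: nat and \<epsilon> :: real
  assumes "d \<ge> 4" and "\<epsilon> > 0"
  shows "\<exists>C::real. \<forall>f :: int poly poly poly.
           total_degree3 f = d \<longrightarrow>
           irreducible (map_poly3 (of_int :: int \<Rightarrow> complex) f) \<longrightarrow>
           finite (lines_on_surface f) \<longrightarrow>
           (\<forall>B::real. B \<ge> 1 \<longrightarrow> real (count_points f B) \<le> C * B powr (1 + \<epsilon>))"
proof -
  \<comment> \<open>Makes the exponent \<open>1 + 5 / n\<close> at most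
    \<open>1 + \<epsilon>\<close>.\<close>
  define n where "n = nat \<lceil>5 / \<epsilon>\<rceil> + 1"
  have n: "n \<ge> 1" by (simp add: n_def)
  have "5 / \<epsilon> \<le> real n" unfolding n_def by linarith
  then have n\<epsilon>: "5 / real n \<le> \<epsilon>" using assms(2) n by (simp add: field_simps)
  obtain Cf where Cf: "Cf \<ge> 0" "\<And>f N. prime_elem f \<Longrightarrow> deg3 f d \<Longrightarrow> \<exists>i j k. i + j + k = d \<and> coeff3 f i j k \<noteq> 0 \<Longrightarrow> N \<ge> 1 \<Longrightarrow>
    real (card (free_points f N)) \<le> Cf * real N powr (1 + 5 / n)"
    using free_points_bound[OF n assms(1)] by blast
  obtain K where K: "\<And>f. deg3 f d \<Longrightarrow> finite (lines_on_surface f) \<Longrightarrow> card (lines_on_surface f) \<le> K"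
    using card_lines_bounded[of d] by blast
  have "real (count_points f B) \<le> (Cf + 3 * real K) * B powr (1 + \<epsilon>)"
    if f: "total_degree3 f = d" "irreducible (map_poly3 (of_int :: int \<Rightarrow> complex) f)" "finite (lines_on_surface f)"
      and B: "B \<ge> 1" for f B
  proof -
    \<comment> \<open>\<open>f\<close> and its prime part \<open>p\<close> have the same zeros, and
      \<open>p\<close> has the same total degree, so the constants for \<open>p\<close> still depend
      on \<open>d\<close> only.\<close>
    obtain c p where cp: "f = [:[:[:c:]:]:] * p" "c \<noteq> 0" "prime_elem p" using irreducible_over_int[OF f(2)] by metis
    have eval: "eval3 f x y z = c * eval3 p x y z" for x y z
    proof -
      have "eval3 f x y z = eval3 [:[:[:c:]:]:] x y z * eval3 p x y z" unfolding cp(1) by (simp only: eval3_simps)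
      then show ?thesis by (simp add: eval3_def)
    qed
    have coef: "coeff3 f i j k = c * coeff3 p i j k" for i j k by (simp add: cp(1) coeff3_def)
    have "d > 0" using assms(1) by simp
    note fd = total_degree3_exact[OF f(1) this]
    have pd: "deg3 p d" "\<exists>i j k. i + j + k = d \<and> coeff3 p i j k \<noteq> 0"
      using fd cp(2) unfolding deg3_iff coef by auto
    define N where "N = nat \<lfloor>B\<rfloor>"
    have N: "N \<ge> 1" "real N \<le> B" using B by (auto simp: N_def le_nat_floor)
    have box: "\<bar>real_of_int y\<bar> \<le> B \<longleftrightarrow> \<bar>y\<bar> \<le> int N" for y
    proof -
      have "\<bar>real_of_int y\<bar> \<le> B \<longleftrightarrow> real_of_int \<bar>y\<bar> \<le> B" by simp
      also have "\<dots> \<longleftrightarrow> \<bar>y\<bar> \<le> \<lfloor>B\<rfloor>" by (rule le_floor_iff[symmetric])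
      finally show ?thesis using B by (simp add: N_def)
    qed
    define on where "on L = {(x, y, z). \<bar>x\<bar> \<le> int N \<and> \<bar>y\<bar> \<le> int N \<and> \<bar>z\<bar> \<le> int N \<and> embed3 (x, y, z) \<in> L}" for L
    have finon: "finite (on L)" for L
      by (rule finite_subset[of _ "{-int N..int N} \<times> {-int N..int N} \<times> {-int N..int N}"]) (auto simp: on_def)
    define X where "X = {(x, y, z). \<bar>x\<bar> \<le> int N \<and> \<bar>y\<bar> \<le> int N \<and> \<bar>z\<bar> \<le> int N \<and> eval3 f x y z = 0}"
    have "X \<subseteq> free_points p N \<union> (\<Union>L\<in>lines_on_surface f. on L)"
    proof
      fix s assume "s \<in> X"
      then obtain x y z where s: "s = (x, y, z)" "\<bar>x\<bar> \<le> int N" "\<bar>y\<bar> \<le> int N" "\<bar>z\<bar> \<le> int N" "eval3 f x y z = 0"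
        by (auto simp: X_def)
      show "s \<in> free_points p N \<union> (\<Union>L\<in>lines_on_surface f. on L)"
      proof (cases "on_integer_line f x y z")
        case True
        then show ?thesis using integer_line_on_surface[OF True] s by (auto simp: on_def)
      next
        case False
        then have "\<not> on_integer_line p x y z" using cp(2) by (simp add: on_integer_line_def eval)
        then show ?thesis using s cp(2) eval by (simp add: free_points_def)
      qed
    qed
    then have "card X \<le> card (free_points p N \<union> (\<Union>L\<in>lines_on_surface f. on L))"
      using f(3) finon by (intro card_mono) (auto simp: finite_free_points)
    also have "\<dots> \<le> card (free_points p N) + card (\<Union>L\<in>lines_on_surface f. on L)" by (rule card_Un_le)
    also have "card (\<Union>L\<in>lines_on_surface f. on L) \<le> (\<Sum>L\<in>lines_on_surface f. card (on L))" by (rule card_UN_le[OF f(3)])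
    also have "\<dots> \<le> (\<Sum>L\<in>lines_on_surface f. 2 * N + 1)"
      unfolding on_def by (intro sum_mono card_integer_points_on_line)
    also have "\<dots> = card (lines_on_surface f) * (2 * N + 1)" by simp
    also have "\<dots> \<le> K * (3 * N)" using K[OF fd(1) f(3)] N(1) by (intro mult_le_mono) auto
    finally have "card X \<le> card (free_points p N) + K * (3 * N)" by simp
    then have "real (card X) \<le> real (card (free_points p N) + K * (3 * N))" by (simp only: of_nat_le_iff)
    also have "\<dots> = real (card (free_points p N)) + 3 * real K * real N" by simp
    also have "\<dots> \<le> Cf * B powr (1 + \<epsilon>) + 3 * real K * B powr (1 + \<epsilon>)"
    proof (intro add_mono mult_left_mono)
      have "real (card (free_points p N)) \<le> Cf * real N powr (1 + 5 / n)" using Cf(2)[OF cp(3) pd N(1)] .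
      also have "\<dots> \<le> Cf * B powr (1 + 5 / n)" using N Cf(1) by (intro mult_left_mono powr_mono2) auto
      also have "\<dots> \<le> Cf * B powr (1 + \<epsilon>)" using B n\<epsilon> Cf(1) by (intro mult_left_mono powr_mono) auto
      finally show "real (card (free_points p N)) \<le> Cf * B powr (1 + \<epsilon>)" .
      have "real N \<le> B powr 1" using N B by simp
      also have "\<dots> \<le> B powr (1 + \<epsilon>)" using B assms(2) by (intro powr_mono) auto
      finally show "real N \<le> B powr (1 + \<epsilon>)" .
    qed simp
    finally have "real (card X) \<le> (Cf + 3 * real K) * B powr (1 + \<epsilon>)" by (simp add: algebra_simps)
    then show ?thesis by (simp add: count_points_def box X_def)
  qed
  then show ?thesis by blast
qed

end
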